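(* Let $K$ be an algebraically closed field of characteristic $3$. Consider $H(S_3,M^1)=\bigoplus_{m\ge0}H^m(S_3,M^1)$ as a right module over the cohomology ring $H(S_3,K)$ via the Yoneda product, with the $\mathrm{SL}(2,\mathbb Z)$-action induced from $M^1=M^1(O_1)\oplus M^1(O_2)\oplus M^1(O_3)$. Then: (1) $H(S_3,M^1(O_1))$ is free of rank $1$ over $H(S_3,K)$. The module action induces an $\mathrm{SL}(2,\mathbb Z)$-equivariant isomorphism $H^0(S_3,M^1(O_1))\otimes_K H(S_3,K)\to H(S_3,M^1(O_1))$. (2) $H(S_3,M^1(O_2))=H^0(S_3,M^1(O_2))\cong K[\mathbb P^1_2]$ (as an $\mathrm{SL}(2,\mathbb Z)$-module) is a trivial $H(S_3,K)$-module. (3) $H(S_3,M^1(O_3))$ is the direct sum of a free module of rank $4$ and $H(S_3,K_\varepsilon)^4$. We have $$H(S_3,M^1(O_3))\cong H(S_3,K)\otimes_K K_{\chi_1}[\mathbb P^1_3]\ \oplus\ H(S_3,K_\varepsilon)\otimes_K K_{\chi_2}[\mathbb P^1_3]$$ as modules over both $H(S_3,K)$ and $\mathrm{SL}(2,\mathbb Z)$.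
   Context: For a $K[S_3]$-module $M$, $H^m(S_3,M)=\mathrm{Ext}^m_{K[S_3]}(K,M)$ and $H(S_3,M)=\bigoplus_{m\ge0}H^m(S_3,M)$; the latter is a graded right module over the graded algebra $H(S_3,K)=\mathrm{Ext}_{K[S_3]}(K,K)$ via the Yoneda product. A module over $H(S_3,K)$ is called trivial if $H(S_3,K)$ acts through the augmentation, i.e. the projection $H(S_3,K)\to H^0(S_3,K)=K$. $M^1$ is the vector space with basis $\Omega^1=\{(a,b)\in S_3\times S_3\mid ab=ba\}$ (identified with the set of homomorphisms from $\pi_1$ of the torus, free abelian with basis $\alpha_1,\beta_1$, to $S_3$, via the values at $\alpha_1$ and $\beta_1$). $S_3$ acts by $c.(a,b)=(cac^{-1},cbc^{-1})$. A matrix $A\in\mathrm{SL}(2,\mathbb Z)$ acts by $v\mapsto(A^T)^{-1}v$, where a matrix $\begin{pmatrix} p & q \\ r & s \end{pmatrix}$ sends a commuting pair $(a,b)$ to $(a^pb^q,a^rb^s)$. This commutes with $S_3$ and induces an $\mathrm{SL}(2,\mathbb Z)$-action on $H(S_3,M^1)$. $M^1(O_1)$, $M^1(O_2)$, $M^1(O_3)$ are the subspaces spanned by the pairs $(a,b)$ that generate the trivial subgroup, a subgroup of order $2$, and the alternating group $A_3$, respectively; they are invariant under both actions. $\mathrm{SL}(2,\mathbb Z)$ acts on $H^0\otimes H(S_3,K)$ in (1) via the first factor; in (3), on the right-hand side it acts via the second tensor factors and $H(S_3,K)$ acts on the first tensor factors. $K_\varepsilon$ is the sign representation of $S_3$.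 For a prime $n$, $\mathbb P^1_n$ is the set of one-dimensional subspaces of $\mathbb Z_n^2$, and $K[\mathbb P^1_n]$ the corresponding permutation module of $\mathrm{SL}(2,\mathbb Z)$ (acting through its natural action on $\mathbb Z_n^2$). Let $\Omega^{1,3}=\mathbb Z_3^2\setminus\{0\}$, with $\mathrm{SL}(2,\mathbb Z)$ and $\mathbb Z_3^\times=\{\bar1,-\bar1\}$ permuting the basis of $K[\Omega^{1,3}]$. For a character $\chi\colon\mathbb Z_3^\times\to K^\times$, $K_\chi[\mathbb P^1_3]=\{v\in K[\Omega^{1,3}]\mid\bar kv=\chi(\bar k)v\ \text{for all}\ \bar k\in\mathbb Z_3^\times\}$; $\chi_1$ is the trivial character and $\chi_2(-\bar1)=-1$. *)

theory Defs
  imports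
    "HOL-Analysis.Determinants"
    "HOL-Computational_Algebra.Polynomial"
    "HOL-Library.Poly_Mapping"
    "HOL-Library.Numeral_Type"
    "HOL-Combinatorics.Permutations"
    "HOL-Algebra.Module"
    "HOL-Algebra.AbelCoset"
    "HOL-Algebra.Sym_Groups"
begin

section \<open>Vector spaces and modules\<close>

text \<open>
  The scalars form a field type \<open>'k\<close>; a vector space is a record of type \<open>('k, 'v) module\<close>,
  whose ring fields \<open>mult\<close> and \<open>one\<close> are not used. A module over a group algebra (or over the
  group \<open>SL(2,\<int>)\<close>) is a vector space with a linear action \<open>gact\<close> of the group.
  The third record adds a right action \<open>ract\<close> of a graded algebra with
  elements of type \<open>'r\<close>, and the homogeneous components \<open>hcomp\<close>.
\<close>

record ('k, 'v, 'g) gmodule = "('k, 'v) module" +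
  gact :: "'g \<Rightarrow> 'v \<Rightarrow> 'v"

record ('k, 'v, 'g, 'r) hmodule = "('k, 'v, 'g) gmodule" +
  ract :: "'v \<Rightarrow> 'r \<Rightarrow> 'v"
  hcomp :: "nat \<Rightarrow> 'v set"

definition lin_iso ::
  "('k, 'v, 'x) module_scheme \<Rightarrow> ('k, 'w, 'y) module_scheme \<Rightarrow> ('v \<Rightarrow> 'w) \<Rightarrow> bool" where
  "lin_iso V W \<phi> \<longleftrightarrow>
     bij_betw \<phi> (carrier V) (carrier W) \<and>
     (\<forall>u\<in>carrier V. \<forall>v\<in>carrier V. \<phi> (u \<oplus>\<^bsub>V\<^esub> v) = \<phi> u \<oplus>\<^bsub>W\<^esub> \<phi> v) \<and>
     (\<forall>c. \<forall>v\<in>carrier V. \<phi> (c \<odot>\<^bsub>V\<^esub> v) = c \<odot>\<^bsub>W\<^esub> \<phi> v)"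

definition equivariant ::
  "'g set \<Rightarrow> ('k, 'v, 'g, 'x) gmodule_scheme \<Rightarrow> ('k, 'w, 'g, 'y) gmodule_scheme
    \<Rightarrow> ('v \<Rightarrow> 'w) \<Rightarrow> bool" where
  "equivariant S V W \<phi> \<longleftrightarrow>
     (\<forall>g\<in>S. \<forall>v\<in>carrier V. \<phi> (gact V g v) = gact W g (\<phi> v))"

definition right_linear ::
  "'r set \<Rightarrow> ('k, 'v, 'g, 'r, 'x) hmodule_scheme \<Rightarrow> ('k, 'w, 'h, 'r, 'y) hmodule_scheme
    \<Rightarrow> ('v \<Rightarrow> 'w) \<Rightarrow> bool" where
  "right_linear R V W \<phi> \<longleftrightarrow>
     (\<forall>b\<in>R. \<forall>v\<in>carrier V. \<phi> (ract V v b) = ract W (\<phi> v) b)"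

definition degree_preserving ::
  "('k, 'v, 'g, 'r, 'x) hmodule_scheme \<Rightarrow> ('k, 'w, 'h, 'r, 'y) hmodule_scheme
    \<Rightarrow> ('v \<Rightarrow> 'w) \<Rightarrow> bool" where
  "degree_preserving V W \<phi> \<longleftrightarrow> (\<forall>n. \<phi> ` hcomp V n = hcomp W n)"

definition add_gact ::
  "('g \<Rightarrow> 'v \<Rightarrow> 'v) \<Rightarrow> ('k, 'v) module \<Rightarrow> ('k, 'v, 'g) gmodule" where
  "add_gact \<gamma> V = Module.module.extend V (gmodule.fields \<gamma>)"

definition quot_mod ::
  "('k, 'v, 'x) module_scheme \<Rightarrow> 'v set \<Rightarrow> ('k, 'v set) module" where
  "quot_mod V B =
     \<lparr> carrier = a_rcosets\<^bsub>V\<^esub> B, mult = undefined, one = undefined,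
       zero = B, add = (<+>\<^bsub>V\<^esub>), smult = (\<lambda>c X. B <+>\<^bsub>V\<^esub> ((\<lambda>v. c \<odot>\<^bsub>V\<^esub> v) ` X)) \<rparr>"

definition dir_sum ::
  "('k, 'v, 'g, 'r) hmodule \<Rightarrow> ('k, 'w, 'g, 'r) hmodule \<Rightarrow> ('k, 'v \<times> 'w, 'g, 'r) hmodule" where
  "dir_sum V W =
     \<lparr> carrier = carrier V \<times> carrier W, mult = undefined, one = undefined,
       zero = (\<zero>\<^bsub>V\<^esub>, \<zero>\<^bsub>W\<^esub>),
       add = (\<lambda>x y. (fst x \<oplus>\<^bsub>V\<^esub> fst y, snd x \<oplus>\<^bsub>W\<^esub> snd y)),
       smult = (\<lambda>c. map_prod (\<lambda>v. c \<odot>\<^bsub>V\<^esub> v) (\<lambda>w. c \<odot>\<^bsub>W\<^esub> w)),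
       gact = (\<lambda>g. map_prod (gact V g) (gact W g)),
       ract = (\<lambda>x b. (ract V (fst x) b, ract W (snd x) b)),
       hcomp = (\<lambda>n. hcomp V n \<times> hcomp W n) \<rparr>"

definition dpower :: "('k, 'v, 'g, 'r) hmodule \<Rightarrow> nat \<Rightarrow> ('k, nat \<Rightarrow> 'v, 'g, 'r) hmodule" where
  "dpower V k =
     \<lparr> carrier = {..<k} \<rightarrow>\<^sub>E carrier V, mult = undefined, one = undefined,
       zero = (\<lambda>i\<in>{..<k}. \<zero>\<^bsub>V\<^esub>),
       add = (\<lambda>x y. \<lambda>i\<in>{..<k}. x i \<oplus>\<^bsub>V\<^esub> y i),
       smult = (\<lambda>c x. \<lambda>i\<in>{..<k}. c \<odot>\<^bsub>V\<^esub> x i),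
       gact = (\<lambda>g x. \<lambda>i\<in>{..<k}. gact V g (x i)),
       ract = (\<lambda>x b. \<lambda>i\<in>{..<k}. ract V (x i) b),
       hcomp = (\<lambda>n. {..<k} \<rightarrow>\<^sub>E hcomp V n) \<rparr>"

text \<open>\<open>R\<close> is an algebra, given as the right regular module over itself.\<close>

definition free_of_rank ::
  "('k, 'r, 'g, 'r) hmodule \<Rightarrow> nat \<Rightarrow> ('k, 'v, 'h, 'r) hmodule \<Rightarrow> bool" where
  "free_of_rank R k V \<longleftrightarrow>
     (\<exists>\<phi>. lin_iso (dpower R k) V \<phi> \<and> right_linear (carrier R) (dpower R k) V \<phi>)"


section \<open>Free vector spaces and tensor products\<close>

definition pm_scale :: "'k::field \<Rightarrow> ('a \<Rightarrow>\<^sub>0 'k) \<Rightarrow> ('a \<Rightarrow>\<^sub>0 'k)" where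
  "pm_scale c = Poly_Mapping.map (\<lambda>x. c * x)"

definition lin_ext :: "('a \<Rightarrow> ('b \<Rightarrow>\<^sub>0 'k::field)) \<Rightarrow> ('a \<Rightarrow>\<^sub>0 'k) \<Rightarrow> ('b \<Rightarrow>\<^sub>0 'k)" where
  "lin_ext f v = (\<Sum>x\<in>Poly_Mapping.keys v. pm_scale (Poly_Mapping.lookup v x) (f x))"

definition basis_map :: "('a \<Rightarrow> 'b) \<Rightarrow> ('a \<Rightarrow>\<^sub>0 'k::field) \<Rightarrow> ('b \<Rightarrow>\<^sub>0 'k)" where
  "basis_map \<sigma> = lin_ext (\<lambda>x. Poly_Mapping.single (\<sigma> x) 1)"

definition free_mod :: "'a set \<Rightarrow> ('k::field, 'a \<Rightarrow>\<^sub>0 'k) module" where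
  "free_mod X =
     \<lparr> carrier = {v. Poly_Mapping.keys v \<subseteq> X}, mult = undefined, one = undefined,
       zero = 0, add = (+), smult = pm_scale \<rparr>"

definition perm_mod ::
  "'a set \<Rightarrow> ('g \<Rightarrow> 'a \<Rightarrow> 'a) \<Rightarrow> ('k::field, 'a \<Rightarrow>\<^sub>0 'k, 'g) gmodule" where
  "perm_mod X \<alpha> = add_gact (\<lambda>g. basis_map (\<alpha> g)) (free_mod X)"

text \<open>
  The tensor product over \<open>'k\<close> is the free vector space on pairs modulo the bilinearity
  relations; its elements are cosets.
\<close>

definition tensor_rel ::
  "('k::field, 'v, 'x) module_scheme \<Rightarrow> ('k, 'w, 'y) module_scheme \<Rightarrow> ('v \<times> 'w \<Rightarrow>\<^sub>0 'k) set" where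
  "tensor_rel V W = Modules.module.span pm_scale
     ({Poly_Mapping.single (v \<oplus>\<^bsub>V\<^esub> v', w) 1 - Poly_Mapping.single (v, w) 1
         - Poly_Mapping.single (v', w) 1
         | v v' w. v \<in> carrier V \<and> v' \<in> carrier V \<and> w \<in> carrier W} \<union>
      {Poly_Mapping.single (v, w \<oplus>\<^bsub>W\<^esub> w') 1 - Poly_Mapping.single (v, w) 1
         - Poly_Mapping.single (v, w') 1
         | v w w'. v \<in> carrier V \<and> w \<in> carrier W \<and> w' \<in> carrier W} \<union>
      {Poly_Mapping.single (c \<odot>\<^bsub>V\<^esub> v, w) 1 - Poly_Mapping.single (v, w) c
         | c v w. v \<in> carrier V \<and> w \<in> carrier W} \<union>
      {Poly_Mapping.single (v, c \<odot>\<^bsub>W\<^esub> w) 1 - Poly_Mapping.single (v, w) c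
         | c v w. v \<in> carrier V \<and> w \<in> carrier W})"

definition tensor ::
  "('k::field, 'v, 'x) module_scheme \<Rightarrow> ('k, 'w, 'y) module_scheme
    \<Rightarrow> ('k, ('v \<times> 'w \<Rightarrow>\<^sub>0 'k) set) module" where
  "tensor V W = quot_mod (free_mod (carrier V \<times> carrier W)) (tensor_rel V W)"

definition elem_tensor ::
  "('k::field, 'v, 'x) module_scheme \<Rightarrow> ('k, 'w, 'y) module_scheme \<Rightarrow> 'v \<Rightarrow> 'w
    \<Rightarrow> ('v \<times> 'w \<Rightarrow>\<^sub>0 'k) set" where
  "elem_tensor V W v w =
     tensor_rel V W +>\<^bsub>free_mod (carrier V \<times> carrier W)\<^esub> Poly_Mapping.single (v, w) 1"

text \<open>
  \<open>tensor_map V W f h\<close> is \<open>f \<otimes> h\<close> for linear endomorphisms \<open>f\<close> of \<open>V\<close> and \<open>h\<close> of \<open>W\<close>.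
\<close>

definition tensor_map ::
  "('k::field, 'v, 'x) module_scheme \<Rightarrow> ('k, 'w, 'y) module_scheme
    \<Rightarrow> ('v \<Rightarrow> 'v) \<Rightarrow> ('w \<Rightarrow> 'w) \<Rightarrow> ('v \<times> 'w \<Rightarrow>\<^sub>0 'k) set \<Rightarrow> ('v \<times> 'w \<Rightarrow>\<^sub>0 'k) set" where
  "tensor_map V W f h T =
     tensor_rel V W <+>\<^bsub>free_mod (carrier V \<times> carrier W)\<^esub> (basis_map (map_prod f h) ` T)"

definition tensor_fst ::
  "('k::field, 'v, 'g, 'x) gmodule_scheme \<Rightarrow> ('k, 'w, 'y) module_scheme
    \<Rightarrow> ('k, ('v \<times> 'w \<Rightarrow>\<^sub>0 'k) set, 'g) gmodule" where
  "tensor_fst V W = add_gact (\<lambda>g. tensor_map V W (gact V g) id) (tensor V W)"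

text \<open>The algebra acts on the first factor, which also carries the grading, the group on the second.\<close>

definition tensor_snd ::
  "('k::field, 'v, 'h, 'r) hmodule \<Rightarrow> ('k, 'w, 'g) gmodule
    \<Rightarrow> ('k, ('v \<times> 'w \<Rightarrow>\<^sub>0 'k) set, 'g, 'r) hmodule" where
  "tensor_snd V W =
     gmodule.extend (add_gact (\<lambda>g. tensor_map V W id (gact W g)) (tensor V W))
       (hmodule.fields
         (\<lambda>T b. tensor_map V W (\<lambda>v. ract V v b) id T)
         (\<lambda>n. {T \<in> carrier (tensor V W).
                 \<exists>t\<in>T. Poly_Mapping.keys t \<subseteq> hcomp V n \<times> carrier W}))"


section \<open>Ext and the Yoneda product\<close>

definition KG_hom ::
  "('g, 'z) monoid_scheme \<Rightarrow> ('k, 'v, 'g, 'x) gmodule_scheme \<Rightarrow> ('k, 'w, 'g, 'y) gmodule_scheme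
    \<Rightarrow> ('v \<Rightarrow> 'w) set" where
  "KG_hom G V W =
     {f \<in> carrier V \<rightarrow>\<^sub>E carrier W.
        (\<forall>u\<in>carrier V. \<forall>v\<in>carrier V. f (u \<oplus>\<^bsub>V\<^esub> v) = f u \<oplus>\<^bsub>W\<^esub> f v) \<and>
        (\<forall>c. \<forall>v\<in>carrier V. f (c \<odot>\<^bsub>V\<^esub> v) = c \<odot>\<^bsub>W\<^esub> f v) \<and>
        equivariant (carrier G) V W f}"

definition triv_mod :: "'k::field itself \<Rightarrow> ('k, 'k, 'g) gmodule" where
  "triv_mod _ =
     \<lparr> carrier = UNIV, mult = undefined, one = undefined, zero = 0, add = (+), smult = (*),
       gact = (\<lambda>g v. v) \<rparr>"

text \<open>
  \<open>Ext\<^sub>K\<^sub>[\<^sub>G\<^sub>](K, M)\<close> is computed from the standard free resolution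
  \<open>\<dots> \<rightarrow> K[G\<^sup>2] \<rightarrow> K[G] \<rightarrow> K\<close> with diagonal \<open>G\<close>-action; its degree \<open>m\<close> term has as basis the
  lists of length \<open>m + 1\<close> of elements of \<open>G\<close>.
\<close>

definition std_res ::
  "('g, 'z) monoid_scheme \<Rightarrow> nat \<Rightarrow> ('k::field, 'g list \<Rightarrow>\<^sub>0 'k, 'g) gmodule" where
  "std_res G m =
     perm_mod {xs. length xs = Suc m \<and> set xs \<subseteq> carrier G} (\<lambda>g. map (\<lambda>h. g \<otimes>\<^bsub>G\<^esub> h))"

definition std_diff :: "('g list \<Rightarrow>\<^sub>0 'k::field) \<Rightarrow> ('g list \<Rightarrow>\<^sub>0 'k)" where
  "std_diff = lin_ext
     (\<lambda>xs. \<Sum>i<length xs. Poly_Mapping.single (take i xs @ drop (Suc i) xs) ((-1) ^ i))"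

definition std_aug :: "('g list \<Rightarrow>\<^sub>0 'k::field) \<Rightarrow> 'k" where
  "std_aug v = (\<Sum>x\<in>Poly_Mapping.keys v. Poly_Mapping.lookup v x)"

definition cochains ::
  "('g, 'z) monoid_scheme \<Rightarrow> ('k::field, 'v, 'g) gmodule \<Rightarrow> nat
    \<Rightarrow> ('k, ('g list \<Rightarrow>\<^sub>0 'k) \<Rightarrow> 'v) module" where
  "cochains G M m =
     \<lparr> carrier = KG_hom G (std_res G m) M, mult = undefined, one = undefined,
       zero = (\<lambda>x\<in>carrier (std_res G m). \<zero>\<^bsub>M\<^esub>),
       add = (\<lambda>f h. \<lambda>x\<in>carrier (std_res G m). f x \<oplus>\<^bsub>M\<^esub> h x),
       smult = (\<lambda>c f. \<lambda>x\<in>carrier (std_res G m). c \<odot>\<^bsub>M\<^esub> f x) \<rparr>"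

definition cocycles ::
  "('g, 'z) monoid_scheme \<Rightarrow> ('k::field, 'v, 'g) gmodule \<Rightarrow> nat
    \<Rightarrow> (('g list \<Rightarrow>\<^sub>0 'k) \<Rightarrow> 'v) set" where
  "cocycles G M m =
     {f \<in> carrier (cochains G M m). \<forall>x\<in>carrier (std_res G (Suc m)). f (std_diff x) = \<zero>\<^bsub>M\<^esub>}"

fun coboundaries ::
  "('g, 'z) monoid_scheme \<Rightarrow> ('k::field, 'v, 'g) gmodule \<Rightarrow> nat
    \<Rightarrow> (('g list \<Rightarrow>\<^sub>0 'k) \<Rightarrow> 'v) set" where
  "coboundaries G M 0 = {\<zero>\<^bsub>cochains G M 0\<^esub>}"
| "coboundaries G M (Suc m) =
     (\<lambda>f. compose (carrier (std_res G (Suc m))) f std_diff) ` carrier (cochains G M m)"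

definition Ext ::
  "('g, 'z) monoid_scheme \<Rightarrow> ('k::field, 'v, 'g) gmodule \<Rightarrow> nat
    \<Rightarrow> ('k, (('g list \<Rightarrow>\<^sub>0 'k) \<Rightarrow> 'v) set) module" where
  "Ext G M m =
     quot_mod ((cochains G M m)\<lparr>carrier := cocycles G M m\<rparr>) (coboundaries G M m)"

definition ext_class ::
  "('g, 'z) monoid_scheme \<Rightarrow> ('k::field, 'v, 'g) gmodule \<Rightarrow> nat \<Rightarrow> (('g list \<Rightarrow>\<^sub>0 'k) \<Rightarrow> 'v)
    \<Rightarrow> (('g list \<Rightarrow>\<^sub>0 'k) \<Rightarrow> 'v) set" where
  "ext_class G M m f = coboundaries G M m +>\<^bsub>cochains G M m\<^esub> f"

text \<open>The map on \<open>Ext\<^sup>m\<close> induced by an endomorphism \<open>\<theta>\<close> of \<open>M\<close>.\<close>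

definition ext_map ::
  "('g, 'z) monoid_scheme \<Rightarrow> ('k::field, 'v, 'g) gmodule \<Rightarrow> nat \<Rightarrow> ('v \<Rightarrow> 'v)
    \<Rightarrow> (('g list \<Rightarrow>\<^sub>0 'k) \<Rightarrow> 'v) set \<Rightarrow> (('g list \<Rightarrow>\<^sub>0 'k) \<Rightarrow> 'v) set" where
  "ext_map G M m \<theta> X =
     coboundaries G M m <+>\<^bsub>cochains G M m\<^esub> ((\<lambda>f. compose (carrier (std_res G m)) \<theta> f) ` X)"

text \<open>
  \<open>\<psi>\<close> lifts the cocycle \<open>h\<close> of degree \<open>j\<close> with values in \<open>K\<close> to a chain map of degree \<open>-j\<close> from
  the resolution to itself. The Yoneda product of the classes of \<open>f\<close> (degree \<open>i\<close>)
  and \<open>h\<close> is the class of \<open>f \<circ> \<psi> i\<close>; it depends neither on the representatives nor on the lift.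
\<close>

definition is_lift ::
  "('g, 'z) monoid_scheme \<Rightarrow> nat \<Rightarrow> (('g list \<Rightarrow>\<^sub>0 'k::field) \<Rightarrow> 'k)
    \<Rightarrow> (nat \<Rightarrow> ('g list \<Rightarrow>\<^sub>0 'k) \<Rightarrow> ('g list \<Rightarrow>\<^sub>0 'k)) \<Rightarrow> bool" where
  "is_lift G j h \<psi> \<longleftrightarrow>
     (\<forall>n. \<psi> n \<in> KG_hom G (std_res G (n + j)) (std_res G n)) \<and>
     (\<forall>n. \<forall>x\<in>carrier (std_res G (Suc n + j)). std_diff (\<psi> (Suc n) x) = \<psi> n (std_diff x)) \<and>
     (\<forall>x\<in>carrier (std_res G j). std_aug (\<psi> 0 x) = h x)"

definition yoneda ::
  "('g, 'z) monoid_scheme \<Rightarrow> ('k::field, 'v, 'g) gmodule \<Rightarrow> nat \<Rightarrow> nat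
    \<Rightarrow> (('g list \<Rightarrow>\<^sub>0 'k) \<Rightarrow> 'v) set \<Rightarrow> (('g list \<Rightarrow>\<^sub>0 'k) \<Rightarrow> 'k) set
    \<Rightarrow> (('g list \<Rightarrow>\<^sub>0 'k) \<Rightarrow> 'v) set" where
  "yoneda G M i j X Y =
     (THE Z. \<exists>f\<in>X. \<exists>h\<in>Y. \<exists>\<psi>. is_lift G j h \<psi> \<and>
        Z = ext_class G M (i + j) (compose (carrier (std_res G (i + j))) f (\<psi> i)))"

text \<open>
  The total cohomology \<open>H(G, M) = \<Oplus>\<^sub>m Ext\<^sup>m(K, M)\<close> as a graded right module over \<open>H(G, K)\<close>.
  The family \<open>\<Phi>\<close> is an action by \<open>K[G]\<close>-endomorphisms of a further group on \<open>M\<close>, and \<open>gact\<close> is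
  the induced action on cohomology. For \<open>M = K\<close> the right action is the multiplication of
  the algebra \<open>H(G, K)\<close>.
\<close>

definition total_ext_carrier ::
  "('g, 'z) monoid_scheme \<Rightarrow> ('k::field, 'v, 'g) gmodule
    \<Rightarrow> (nat \<Rightarrow> (('g list \<Rightarrow>\<^sub>0 'k) \<Rightarrow> 'v) set) set" where
  "total_ext_carrier G M =
     {x. (\<forall>m. x m \<in> carrier (Ext G M m)) \<and> finite {m. x m \<noteq> \<zero>\<^bsub>Ext G M m\<^esub>}}"

definition total_ext ::
  "('g, 'z) monoid_scheme \<Rightarrow> ('h \<Rightarrow> 'v \<Rightarrow> 'v) \<Rightarrow> ('k::field, 'v, 'g) gmodule
    \<Rightarrow> ('k, nat \<Rightarrow> (('g list \<Rightarrow>\<^sub>0 'k) \<Rightarrow> 'v) set, 'h, nat \<Rightarrow> (('g list \<Rightarrow>\<^sub>0 'k) \<Rightarrow> 'k) set) hmodule" where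
  "total_ext G \<Phi> M =
     \<lparr> carrier = total_ext_carrier G M, mult = undefined, one = undefined,
       zero = (\<lambda>m. \<zero>\<^bsub>Ext G M m\<^esub>),
       add = (\<lambda>x y m. x m \<oplus>\<^bsub>Ext G M m\<^esub> y m),
       smult = (\<lambda>c x m. c \<odot>\<^bsub>Ext G M m\<^esub> x m),
       gact = (\<lambda>h x m. ext_map G M m (\<Phi> h) (x m)),
       ract = (\<lambda>x b n. \<Oplus>\<^bsub>Ext G M n\<^esub>i\<in>{..n}. yoneda G M i (n - i) (x i) (b (n - i))),
       hcomp = (\<lambda>n. {x \<in> total_ext_carrier G M. \<forall>m. m \<noteq> n \<longrightarrow> x m = \<zero>\<^bsub>Ext G M m\<^esub>}) \<rparr>"

definition ext_gmod ::
  "('g, 'z) monoid_scheme \<Rightarrow> ('h \<Rightarrow> 'v \<Rightarrow> 'v) \<Rightarrow> ('k::field, 'v, 'g) gmodule \<Rightarrow> nat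
    \<Rightarrow> ('k, (('g list \<Rightarrow>\<^sub>0 'k) \<Rightarrow> 'v) set, 'h) gmodule" where
  "ext_gmod G \<Phi> M m = add_gact (\<lambda>h. ext_map G M m (\<Phi> h)) (Ext G M m)"

definition in_degree ::
  "('g, 'z) monoid_scheme \<Rightarrow> ('k::field, 'v, 'g) gmodule \<Rightarrow> nat
    \<Rightarrow> (('g list \<Rightarrow>\<^sub>0 'k) \<Rightarrow> 'v) set \<Rightarrow> (nat \<Rightarrow> (('g list \<Rightarrow>\<^sub>0 'k) \<Rightarrow> 'v) set)" where
  "in_degree G M n X = (\<lambda>m. if m = n then X else \<zero>\<^bsub>Ext G M m\<^esub>)"

text \<open>
  The identification \<open>H\<^sup>0(G, K) = K\<close> sends the class of the augmentation of the resolution to \<open>1\<close>.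
\<close>

definition coh_augmentation ::
  "('g, 'z) monoid_scheme \<Rightarrow> (nat \<Rightarrow> (('g list \<Rightarrow>\<^sub>0 'k::field) \<Rightarrow> 'k) set) \<Rightarrow> 'k" where
  "coh_augmentation G b =
     (THE c. b 0 = c \<odot>\<^bsub>Ext G (triv_mod TYPE('k)) 0\<^esub>
        ext_class G (triv_mod TYPE('k)) 0 (\<lambda>x\<in>carrier (std_res G 0). std_aug x))"

definition trivial_coh_module ::
  "('g, 'z) monoid_scheme
    \<Rightarrow> ('k::field, 'v, 'h, nat \<Rightarrow> (('g list \<Rightarrow>\<^sub>0 'k) \<Rightarrow> 'k) set) hmodule \<Rightarrow> bool" where
  "trivial_coh_module G V \<longleftrightarrow>
     (\<forall>b\<in>total_ext_carrier G (triv_mod TYPE('k)). \<forall>x\<in>carrier V.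
        ract V x b = coh_augmentation G b \<odot>\<^bsub>V\<^esub> x)"


section \<open>The modules for the torus and \<open>S\<^sub>3\<close>\<close>

type_synonym perm3 = "nat \<Rightarrow> nat"

abbreviation S3 :: "perm3 monoid" where
  "S3 \<equiv> sym_group 3"

definition sign_mod :: "'k::field itself \<Rightarrow> ('k, 'k, perm3) gmodule" where
  "sign_mod _ = (triv_mod TYPE('k))\<lparr>gact := (\<lambda>p v. of_int (sign p) * v)\<rparr>"

definition SL2Z :: "(int^2^2) set" where
  "SL2Z = {A. det A = 1}"

definition Omega1 :: "(perm3 \<times> perm3) set" where
  "Omega1 = {(a, b). a \<in> carrier S3 \<and> b \<in> carrier S3 \<and> a \<otimes>\<^bsub>S3\<^esub> b = b \<otimes>\<^bsub>S3\<^esub> a}"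

definition O1 :: "(perm3 \<times> perm3) set" where
  "O1 = {(a, b) \<in> Omega1. generate S3 {a, b} = {\<one>\<^bsub>S3\<^esub>}}"

definition O2 :: "(perm3 \<times> perm3) set" where
  "O2 = {(a, b) \<in> Omega1. card (generate S3 {a, b}) = 2}"

definition O3 :: "(perm3 \<times> perm3) set" where
  "O3 = {(a, b) \<in> Omega1. generate S3 {a, b} = carrier (alt_group 3)}"

definition mat_act :: "int^2^2 \<Rightarrow> perm3 \<times> perm3 \<Rightarrow> perm3 \<times> perm3" where
  "mat_act B = (\<lambda>(a, b).
     (a [^]\<^bsub>S3\<^esub> (B$1$1) \<otimes>\<^bsub>S3\<^esub> b [^]\<^bsub>S3\<^esub> (B$1$2),
      a [^]\<^bsub>S3\<^esub> (B$2$1) \<otimes>\<^bsub>S3\<^esub> b [^]\<^bsub>S3\<^esub> (B$2$2)))"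

definition sl_act :: "int^2^2 \<Rightarrow> (perm3 \<times> perm3 \<Rightarrow>\<^sub>0 'k::field) \<Rightarrow> (perm3 \<times> perm3 \<Rightarrow>\<^sub>0 'k)" where
  "sl_act A = basis_map (mat_act (matrix_inv (transpose A)))"

text \<open>\<open>M1 TYPE('k) Omega1\<close> is \<open>M\<^sup>1\<close>, and \<open>M1 TYPE('k) O1\<close> is \<open>M\<^sup>1(O\<^sub>1)\<close>, etc.\<close>

definition M1 ::
  "'k::field itself \<Rightarrow> (perm3 \<times> perm3) set \<Rightarrow> ('k, perm3 \<times> perm3 \<Rightarrow>\<^sub>0 'k, perm3) gmodule" where
  "M1 _ X = perm_mod X (\<lambda>c (a, b).
     (c \<otimes>\<^bsub>S3\<^esub> a \<otimes>\<^bsub>S3\<^esub> inv\<^bsub>S3\<^esub> c, c \<otimes>\<^bsub>S3\<^esub> b \<otimes>\<^bsub>S3\<^esub> inv\<^bsub>S3\<^esub> c))"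

definition H_M1 where
  "H_M1 (k :: 'k::field itself) X = total_ext S3 (sl_act :: int^2^2 \<Rightarrow> _) (M1 k X)"

definition H0_M1 where
  "H0_M1 (k :: 'k::field itself) X = ext_gmod S3 (sl_act :: int^2^2 \<Rightarrow> _) (M1 k X) 0"

text \<open>\<open>SL(2,\<int>)\<close> acts trivially on \<open>H(S\<^sub>3, K)\<close> and \<open>H(S\<^sub>3, K\<^sub>\<epsilon>)\<close>.\<close>

definition H_K where
  "H_K (k :: 'k::field itself) = total_ext S3 (\<lambda>A :: int^2^2. id) (triv_mod k)"

definition H_sgn where
  "H_sgn (k :: 'k::field itself) = total_ext S3 (\<lambda>A :: int^2^2. id) (sign_mod k)"


section \<open>Permutation modules over \<open>\<int>\<^sub>n\<^sup>2\<close>\<close>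

text \<open>
  \<open>\<int>\<^sub>n\<close> is the numeral type \<open>n\<close>. For prime \<open>n\<close> it is a field and \<open>proj_line\<close> is the set of
  one-dimensional subspaces of \<open>\<int>\<^sub>n\<^sup>2\<close>.
\<close>

definition proj_line :: "('r::comm_ring_1 ^ 2) set set" where
  "proj_line = {range (\<lambda>c. c *s v) | v. v \<noteq> 0}"

definition vec_act :: "int^2^2 \<Rightarrow> 'r::comm_ring_1 ^ 2 \<Rightarrow> 'r ^ 2" where
  "vec_act A v = map_matrix of_int A *v v"

definition K_P1_2 :: "('k::field, (2^2) set \<Rightarrow>\<^sub>0 'k, int^2^2) gmodule" where
  "K_P1_2 = perm_mod proj_line (\<lambda>A. image (vec_act A))"

definition units3 :: "3 set" where
  "units3 = {1, -1}"

definition chi1 :: "3 \<Rightarrow> 'k::field" where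
  "chi1 k = 1"

definition chi2 :: "3 \<Rightarrow> 'k::field" where
  "chi2 k = (if k = -1 then -1 else 1)"

definition K_chi :: "(3 \<Rightarrow> 'k::field) \<Rightarrow> ('k, 3^2 \<Rightarrow>\<^sub>0 'k, int^2^2) gmodule" where
  "K_chi \<eta> = (perm_mod (UNIV - {0}) vec_act)
     \<lparr>carrier := {v. Poly_Mapping.keys v \<subseteq> UNIV - {0} \<and>
        (\<forall>k\<in>units3. basis_map (\<lambda>x. k *s x) v = pm_scale (\<eta> k) v)}\<rparr>"

end

theory Submission
  imports Defs
begin

text \<open>
  Cohomology is computed from the standard resolution, augmented by the tuples of length \<open>0\<close>.
  Prepending the first entry of a tuple to the value of a map lifts cycles equivariantly through
  the differential, and this one device gives both the existence of the chain maps
  that define the Yoneda product and the homotopies that make it independent of all choices. So the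
  product is bilinear and natural in the coefficient module \<open>M\<close>.

  A decomposition of \<open>M\<close> by inclusions and projections therefore decomposes \<open>H(G, M)\<close> as a module
  over \<open>H(G, K)\<close>. If moreover \<open>M\<close> is assembled from copies of a module \<open>N\<close> indexed by a vector
  space \<open>W\<close>, then \<open>x \<otimes> w\<close> goes to the image of \<open>x\<close> under the map of coefficients that belongs to
  \<open>w\<close>. A basis of \<open>W\<close> turns this map on the tensor product into the decomposition already known;
  as every tensor is a combination of basis vectors, it is bijective, and it respects every action
  that \<open>W\<close> carries.

  The three summands are then easy. The group fixes the only element of \<open>O1\<close>, and \<open>M\<^sup>1(O\<^sub>1)\<close> is the trivial
  module. The pairs in \<open>O2\<close> have stabilisers of order \<open>2\<close>, which is invertible in \<open>K\<close>: averaging over them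
  contracts the cochain complex in positive degrees, and the degree \<open>0\<close> part is the space of
  functions on the three orbits, which correspond to the points of the projective line over \<open>\<int>\<^sub>2\<close>. On \<open>O3\<close>,
  identified with the nonzero vectors of \<open>\<int>\<^sub>3\<^sup>2\<close>, the group acts through the sign by \<open>x \<mapsto> - x\<close>,
  and symmetric and antisymmetric functions give the trivial and the sign representation
  four times each.

  An integral matrix of determinant \<open>1\<close> acts on pairs by its inverse transpose; the coordinates
  \<open>u \<mapsto> (u\<^sub>2, - u\<^sub>1)\<close> conjugate this into the natural action.
\<close>

section \<open>Vector spaces given by records\<close>

locale vspace = abelian_group V for V :: "('k::field, 'v, 'x) module_scheme" (structure) +
  assumes smult_closed [simp, intro]: "v \<in> carrier V \<Longrightarrow> c \<odot> v \<in> carrier V"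
    and smult_r_distr: "\<lbrakk>u \<in> carrier V; v \<in> carrier V\<rbrakk> \<Longrightarrow> c \<odot> (u \<oplus> v) = c \<odot> u \<oplus> c \<odot> v"
    and smult_l_distr: "v \<in> carrier V \<Longrightarrow> (a + b) \<odot> v = a \<odot> v \<oplus> b \<odot> v"
    and smult_assoc: "v \<in> carrier V \<Longrightarrow> (a * b) \<odot> v = a \<odot> (b \<odot> v)"
    and smult_one [simp]: "v \<in> carrier V \<Longrightarrow> 1 \<odot> v = v"
begin

lemma smult_zero_l [simp]: "v \<in> carrier V \<Longrightarrow> 0 \<odot> v = \<zero>"
  using smult_l_distr[of v 0 0] by (simp add: add.l_cancel_one')

lemma smult_zero_r [simp]: "c \<odot> \<zero> = \<zero>"
  using smult_r_distr[of \<zero> \<zero> c] by (simp add: add.l_cancel_one')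

lemma smult_minus_one: "v \<in> carrier V \<Longrightarrow> (-1) \<odot> v = \<ominus> v"
  using smult_l_distr[of v 1 "-1"] minus_equality[of "(-1) \<odot> v" v]
  by (simp add: a_comm)

lemma minus_eq_smult: "\<lbrakk>u \<in> carrier V; v \<in> carrier V\<rbrakk> \<Longrightarrow> u \<ominus> v = u \<oplus> (-1) \<odot> v"
  by (simp add: smult_minus_one minus_eq)

end

lemma vspaceI:
  fixes V :: "('k::field, 'v, 'x) module_scheme" (structure)
  assumes "\<And>u v. \<lbrakk>u \<in> carrier V; v \<in> carrier V\<rbrakk> \<Longrightarrow> u \<oplus> v \<in> carrier V"
    and "\<zero> \<in> carrier V"
    and "\<And>u v w. \<lbrakk>u \<in> carrier V; v \<in> carrier V; w \<in> carrier V\<rbrakk> \<Longrightarrow> (u \<oplus> v) \<oplus> w = u \<oplus> (v \<oplus> w)"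
    and "\<And>u v. \<lbrakk>u \<in> carrier V; v \<in> carrier V\<rbrakk> \<Longrightarrow> u \<oplus> v = v \<oplus> u"
    and "\<And>v. v \<in> carrier V \<Longrightarrow> \<zero> \<oplus> v = v"
    and "\<And>v. v \<in> carrier V \<Longrightarrow> 0 \<odot> v = \<zero>"
    and "\<And>c v. v \<in> carrier V \<Longrightarrow> c \<odot> v \<in> carrier V"
    and "\<And>c u v. \<lbrakk>u \<in> carrier V; v \<in> carrier V\<rbrakk> \<Longrightarrow> c \<odot> (u \<oplus> v) = c \<odot> u \<oplus> c \<odot> v"
    and "\<And>a b v. v \<in> carrier V \<Longrightarrow> (a + b) \<odot> v = a \<odot> v \<oplus> b \<odot> v"
    and "\<And>a b v. v \<in> carrier V \<Longrightarrow> (a * b) \<odot> v = a \<odot> (b \<odot> v)"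
    and "\<And>v. v \<in> carrier V \<Longrightarrow> 1 \<odot> v = v"
  shows "vspace V"
proof -
  have "\<exists>y\<in>carrier V. y \<oplus> v = \<zero>" if "v \<in> carrier V" for v
    using assms(6,7)[OF that] assms(9)[OF that, of "-1" 1] assms(11)[OF that] by force
  then have "abelian_group V"
    using assms(1-5) by (intro abelian_groupI) auto
  then show ?thesis
    using assms by (simp add: vspace_def vspace_axioms_def)
qed

definition vlin ::
  "('k::field, 'v, 'x) module_scheme \<Rightarrow> ('k, 'w, 'y) module_scheme \<Rightarrow> ('v \<Rightarrow> 'w) \<Rightarrow> bool" where
  "vlin V W f \<longleftrightarrow> f \<in> carrier V \<rightarrow> carrier W \<and>
     (\<forall>u\<in>carrier V. \<forall>v\<in>carrier V. f (u \<oplus>\<^bsub>V\<^esub> v) = f u \<oplus>\<^bsub>W\<^esub> f v) \<and>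
     (\<forall>c. \<forall>v\<in>carrier V. f (c \<odot>\<^bsub>V\<^esub> v) = c \<odot>\<^bsub>W\<^esub> f v)"

lemma vlinI:
  assumes "\<And>v. v \<in> carrier V \<Longrightarrow> f v \<in> carrier W"
    and "\<And>u v. \<lbrakk>u \<in> carrier V; v \<in> carrier V\<rbrakk> \<Longrightarrow> f (u \<oplus>\<^bsub>V\<^esub> v) = f u \<oplus>\<^bsub>W\<^esub> f v"
    and "\<And>c v. v \<in> carrier V \<Longrightarrow> f (c \<odot>\<^bsub>V\<^esub> v) = c \<odot>\<^bsub>W\<^esub> f v"
  shows "vlin V W f"
  using assms by (simp add: vlin_def)

lemma (in vspace) scale_lin: "vlin V V (\<lambda>v. c \<odot> v)"
proof (rule vlinI)
  show "c \<odot> (a \<odot> v) = a \<odot> (c \<odot> v)" if "v \<in> carrier V" for a v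
    using smult_assoc[OF that, of c a] smult_assoc[OF that, of a c] by (simp add: mult.commute)
qed (auto simp: smult_r_distr)

lemma vlin_closed: "\<lbrakk>vlin V W f; v \<in> carrier V\<rbrakk> \<Longrightarrow> f v \<in> carrier W"
  by (auto simp: vlin_def)

lemma vlin_add:
  "\<lbrakk>vlin V W f; u \<in> carrier V; v \<in> carrier V\<rbrakk> \<Longrightarrow> f (u \<oplus>\<^bsub>V\<^esub> v) = f u \<oplus>\<^bsub>W\<^esub> f v"
  by (simp add: vlin_def)

lemma vlin_smult: "\<lbrakk>vlin V W f; v \<in> carrier V\<rbrakk> \<Longrightarrow> f (c \<odot>\<^bsub>V\<^esub> v) = c \<odot>\<^bsub>W\<^esub> f v"
  by (simp add: vlin_def)

lemma vlin_zero:
  assumes "vspace V" "vspace W" "vlin V W f" shows "f \<zero>\<^bsub>V\<^esub> = \<zero>\<^bsub>W\<^esub>"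
proof -
  interpret V: vspace V by fact
  interpret W: vspace W by fact
  have "f (0 \<odot>\<^bsub>V\<^esub> \<zero>\<^bsub>V\<^esub>) = 0 \<odot>\<^bsub>W\<^esub> f \<zero>\<^bsub>V\<^esub>"
    by (rule vlin_smult[OF assms(3)]) simp
  then show ?thesis
    using vlin_closed[OF assms(3), of "\<zero>\<^bsub>V\<^esub>"] by simp
qed

lemma vlin_minus:
  assumes "vspace V" "vspace W" "vlin V W f" "u \<in> carrier V" "v \<in> carrier V"
  shows "f (u \<ominus>\<^bsub>V\<^esub> v) = f u \<ominus>\<^bsub>W\<^esub> f v"
proof -
  interpret V: vspace V by fact
  interpret W: vspace W by fact
  show ?thesis
    using assms(3-5)
    by (simp add: V.minus_eq_smult W.minus_eq_smult vlin_closed vlin_add vlin_smult)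
qed

lemma vlin_finsum:
  assumes "vspace V" "vspace W" "vlin V W f" "finite I" "\<And>i. i \<in> I \<Longrightarrow> v i \<in> carrier V"
  shows "f (\<Oplus>\<^bsub>V\<^esub>i\<in>I. v i) = (\<Oplus>\<^bsub>W\<^esub>i\<in>I. f (v i))"
proof -
  interpret V: vspace V by fact
  interpret W: vspace W by fact
  from assms(4,5) show ?thesis
  proof (induction I rule: finite_induct)
    case empty
    then show ?case using vlin_zero[OF assms(1-3)] by simp
  next
    case (insert i I)
    then show ?case
      using assms(3) by (simp add: vlin_add vlin_closed Pi_def)
  qed
qed

lemma vlin_compose: "\<lbrakk>vlin U V f; vlin V W g\<rbrakk> \<Longrightarrow> vlin U W (\<lambda>x. g (f x))"
  by (auto simp: vlin_def Pi_def)

lemma vlin_cong: "\<lbrakk>vlin V W f; \<And>v. v \<in> carrier V \<Longrightarrow> g v = f v; vspace V\<rbrakk> \<Longrightarrow> vlin V W g"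
  by (auto simp: vlin_def vspace_def abelian_group_def abelian_monoid.a_closed vspace.smult_closed)

lemma lin_iso_alt: "lin_iso V W f \<longleftrightarrow> vlin V W f \<and> bij_betw f (carrier V) (carrier W)"
  by (auto simp: lin_iso_def vlin_def bij_betw_def)

context
  fixes V :: "('k::field, 'v, 'x) module_scheme" and W :: "('k, 'w, 'y) module_scheme" and f
  assumes V: "vspace V" and f: "lin_iso V W f"
begin

lemma lin_iso_inv: "lin_iso W V (inv_into (carrier V) f)"
proof -
  interpret V: vspace V by (rule V)
  let ?g = "inv_into (carrier V) f"
  from f have bij: "bij_betw f (carrier V) (carrier W)" by (simp add: lin_iso_alt)
  have g: "?g w \<in> carrier V" "f (?g w) = w" if "w \<in> carrier W" for w
    using bij that by (auto simp: bij_betw_def inv_into_into f_inv_into_f)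
  have gf: "?g (f v) = v" if "v \<in> carrier V" for v
    using bij that by (auto simp: bij_betw_def)
  have "?g (u \<oplus>\<^bsub>W\<^esub> v) = ?g u \<oplus>\<^bsub>V\<^esub> ?g v" if "u \<in> carrier W" "v \<in> carrier W" for u v
  proof -
    have "f (?g u \<oplus>\<^bsub>V\<^esub> ?g v) = u \<oplus>\<^bsub>W\<^esub> v"
      using f g that by (simp add: lin_iso_def)
    then show ?thesis using gf g that by (metis V.a_closed)
  qed
  moreover have "?g (c \<odot>\<^bsub>W\<^esub> v) = c \<odot>\<^bsub>V\<^esub> ?g v" if "v \<in> carrier W" for c v
  proof -
    have "f (c \<odot>\<^bsub>V\<^esub> ?g v) = c \<odot>\<^bsub>W\<^esub> v"
      using f g that by (simp add: lin_iso_def)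
    then show ?thesis using gf g that by (metis V.smult_closed)
  qed
  ultimately show ?thesis
    using bij_betw_inv_into[OF bij] by (simp add: lin_iso_def)
qed

end

lemma inverse_intertwines:
  assumes bij: "bij_betw f A B" and closed: "\<And>a. a \<in> A \<Longrightarrow> p a \<in> A"
    and f: "\<And>a. a \<in> A \<Longrightarrow> f (p a) = q (f a)" and b: "b \<in> B"
  shows "inv_into A f (q b) = p (inv_into A f b)"
proof -
  obtain a where a: "a \<in> A" "b = f a" using bij b by (auto simp: bij_betw_def)
  have "inv_into A f (f (p a)) = p a" "inv_into A f (f a) = a"
    using bij a closed by (auto simp: bij_betw_def inv_into_f_f)
  then show ?thesis using f[of a] a by simp
qed

subsection \<open>Subspaces and quotients\<close>

definition subsp :: "('k::field, 'v, 'x) module_scheme \<Rightarrow> 'v set \<Rightarrow> bool" where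
  "subsp V B \<longleftrightarrow> B \<subseteq> carrier V \<and> \<zero>\<^bsub>V\<^esub> \<in> B \<and> (\<forall>u\<in>B. \<forall>v\<in>B. u \<oplus>\<^bsub>V\<^esub> v \<in> B) \<and>
     (\<forall>c. \<forall>v\<in>B. c \<odot>\<^bsub>V\<^esub> v \<in> B)"

lemma subsp_abelian_subgroup:
  assumes "vspace V" "subsp V B" shows "abelian_subgroup B V"
proof -
  interpret V: vspace V by fact
  have "\<ominus>\<^bsub>V\<^esub> v \<in> B" if "v \<in> B" for v
    using assms(2) that V.smult_minus_one[of v] unfolding subsp_def by (metis subsetD)
  then have "subgroup B (add_monoid V)"
    using assms(2) by (intro V.add.subgroupI) (auto simp: subsp_def a_inv_def)
  then show ?thesis
    by (intro abelian_subgroupI3 additive_subgroupI V.abelian_group_axioms)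
qed

lemma vspace_subsp:
  assumes "vspace V" "subsp V B" shows "vspace (V\<lparr>carrier := B\<rparr>)"
proof -
  interpret V: vspace V by fact
  have B: "v \<in> carrier V" if "v \<in> B" for v using assms(2) that by (auto simp: subsp_def)
  show ?thesis
    using assms(2)
    by (intro vspaceI)
       (auto simp: subsp_def B V.a_ac V.smult_r_distr V.smult_l_distr V.smult_assoc)
qed

locale quotient_space = vspace V for V :: "('k::field, 'v, 'x) module_scheme" (structure) +
  fixes B :: "'v set"
  assumes subsp: "subsp V B"
begin

sublocale abelian_subgroup B V
  using subsp_abelian_subgroup[OF vspace_axioms subsp] .

lemma coset_eqI: "\<lbrakk>u \<in> carrier V; v \<in> carrier V; b \<in> B; u = b \<oplus> v\<rbrakk> \<Longrightarrow> B +> u = B +> v"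
  using a_repr_independence'[of u v] by (auto simp: a_r_coset_def')

lemma coset_zero: "B +> \<zero> = B"
  using subsp by (simp add: subsp_def a_rcos_const)

lemma coset_eq_zero_iff: "v \<in> carrier V \<Longrightarrow> B +> v = B \<longleftrightarrow> v \<in> B"
  using a_rcos_self[of v] a_rcos_const[of v] by auto

lemma quot_mod_simps:
  "carrier (quot_mod V B) = (\<lambda>v. B +> v) ` carrier V"
  "zero (quot_mod V B) = B"
  by (auto simp: quot_mod_def A_RCOSETS_def')

lemma quot_add:
  "\<lbrakk>u \<in> carrier V; v \<in> carrier V\<rbrakk> \<Longrightarrow> (B +> u) \<oplus>\<^bsub>quot_mod V B\<^esub> (B +> v) = B +> (u \<oplus> v)"
  by (simp add: quot_mod_def a_rcos_sum)

end

lemma set_add_image_coset: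
  assumes V: "quotient_space V B" and W: "quotient_space W C"
    and f: "vlin V W f" and BC: "f ` B \<subseteq> C" and u: "u \<in> carrier V"
  shows "C <+>\<^bsub>W\<^esub> (f ` (B +>\<^bsub>V\<^esub> u)) = C +>\<^bsub>W\<^esub> f u"
proof -
  interpret V: quotient_space V B by fact
  interpret W: quotient_space W C by fact
  have B: "b \<in> carrier V" if "b \<in> B" for b using that V.a_subset by auto
  have C: "c \<in> carrier W" if "c \<in> C" for c using that W.a_subset by auto
  have fu: "f u \<in> carrier W" using f u by (rule vlin_closed)
  show ?thesis
  proof (intro equalityI subsetI)
    fix y assume "y \<in> C <+>\<^bsub>W\<^esub> (f ` (B +>\<^bsub>V\<^esub> u))"
    then obtain c b where cb: "c \<in> C" "b \<in> B" "y = c \<oplus>\<^bsub>W\<^esub> f (b \<oplus>\<^bsub>V\<^esub> u)"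
      by (auto simp: set_add_def' a_r_coset_def')
    have fb: "f b \<in> C" using BC cb by auto
    have "y = (c \<oplus>\<^bsub>W\<^esub> f b) \<oplus>\<^bsub>W\<^esub> f u"
      using cb B C fu u f fb by (simp add: vlin_add W.a_assoc)
    then show "y \<in> C +>\<^bsub>W\<^esub> f u"
      using cb fb by (auto simp: a_r_coset_def')
  next
    fix y assume "y \<in> C +>\<^bsub>W\<^esub> f u"
    then obtain c where c: "c \<in> C" "y = c \<oplus>\<^bsub>W\<^esub> f u"
      by (auto simp: a_r_coset_def')
    moreover have "u \<in> B +>\<^bsub>V\<^esub> u" using V.a_rcos_self u by simp
    ultimately show "y \<in> C <+>\<^bsub>W\<^esub> (f ` (B +>\<^bsub>V\<^esub> u))"
      by (auto simp: set_add_def')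
  qed
qed

context quotient_space
begin

lemma quot_smult:
  assumes "v \<in> carrier V"
  shows "c \<odot>\<^bsub>quot_mod V B\<^esub> (B +> v) = B +> (c \<odot> v)"
proof -
  have "(\<lambda>v. c \<odot> v) ` B \<subseteq> B" using subsp by (auto simp: subsp_def)
  from set_add_image_coset[OF quotient_space_axioms quotient_space_axioms scale_lin this assms]
  show ?thesis by (simp add: quot_mod_def)
qed

lemma vspace_quot: "vspace (quot_mod V B)"
proof (rule vspaceI, goal_cases)
  case (1 u v) then show ?case by (auto simp: quot_mod_simps(1) quot_add)
next
  case 2 then show ?case using coset_zero by (auto simp: quot_mod_simps)
next
  case (3 u v w) then show ?case by (auto simp: quot_mod_simps(1) quot_add a_assoc)
next
  case (4 u v) then show ?case by (auto simp: quot_mod_simps(1) quot_add a_comm)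
next
  case (5 v) then show ?case using quot_add[of \<zero>] by (auto simp: quot_mod_simps coset_zero)
next
  case (6 v) then show ?case by (auto simp: quot_mod_simps quot_smult coset_zero)
next
  case (7 c v) then show ?case by (auto simp: quot_mod_simps(1) quot_smult)
next
  case (8 c u v) then show ?case by (auto simp: quot_mod_simps(1) quot_smult quot_add smult_r_distr)
next
  case (9 a b v) then show ?case by (auto simp: quot_mod_simps(1) quot_smult quot_add smult_l_distr)
next
  case (10 a b v) then show ?case by (auto simp: quot_mod_simps(1) quot_smult smult_assoc)
next
  case (11 v) then show ?case by (auto simp: quot_mod_simps(1) quot_smult)
qed

lemma vlin_coset: "vlin V (quot_mod V B) (\<lambda>v. B +> v)"
  by (intro vlinI) (auto simp: quot_mod_simps(1) quot_add quot_smult)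

end

section \<open>Free vector spaces\<close>

lemma lookup_pm_scale [simp]: "Poly_Mapping.lookup (pm_scale c v) x = c * Poly_Mapping.lookup v x"
  by (simp add: pm_scale_def Poly_Mapping.map.rep_eq when_def)

lemma keys_pm_scale: "Poly_Mapping.keys (pm_scale c v) \<subseteq> Poly_Mapping.keys v"
  by (auto simp: in_keys_iff)

lemma pm_scale_simps [simp]:
  "pm_scale c (u + v) = pm_scale c u + pm_scale c v"
  "pm_scale c (u - v) = pm_scale c u - pm_scale c v"
  "pm_scale c (- v) = - pm_scale c v"
  "pm_scale c 0 = 0" "pm_scale 0 v = 0" "pm_scale 1 v = v"
  "pm_scale a (pm_scale b v) = pm_scale (a * b) v"
  "pm_scale c (Poly_Mapping.single x a) = Poly_Mapping.single x (c * a)"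
  by (rule poly_mapping_eqI; simp add: lookup_add lookup_minus lookup_single when_def algebra_simps)+

lemma pm_scale_add_left: "pm_scale (a + b) v = pm_scale a v + pm_scale b v"
  by (rule poly_mapping_eqI; simp add: lookup_add algebra_simps)

lemma pm_scale_sum: "pm_scale c (\<Sum>i\<in>I. v i) = (\<Sum>i\<in>I. pm_scale c (v i))"
  by (induction I rule: infinite_finite_induct) auto

lemma pm_module: "Modules.module pm_scale"
  by unfold_locales (auto simp: pm_scale_add_left)

lemma vspace_free_mod: "vspace (free_mod X)"
proof (rule vspaceI, goal_cases)
  case (1 u v)
  then show ?case using keys_add[of u v] by (auto simp: free_mod_def)
next
  case (7 c v)
  then show ?case using keys_pm_scale[of c v] by (auto simp: free_mod_def)
qed (simp_all add: free_mod_def pm_scale_add_left add_ac)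

lemma free_mod_simps [simp]:
  "carrier (free_mod X) = {v. Poly_Mapping.keys v \<subseteq> X}"
  "add (free_mod X) = (+)" "zero (free_mod X) = 0" "smult (free_mod X) = pm_scale"
  by (simp_all add: free_mod_def)

lemma lin_ext_superset:
  assumes "finite S" "Poly_Mapping.keys v \<subseteq> S"
  shows "lin_ext f v = (\<Sum>x\<in>S. pm_scale (Poly_Mapping.lookup v x) (f x))"
  unfolding lin_ext_def using assms
  by (intro sum.mono_neutral_left) (auto simp: in_keys_iff)

lemma lin_ext_add [simp]: "lin_ext f (u + v) = lin_ext f u + lin_ext f v"
proof -
  let ?S = "Poly_Mapping.keys u \<union> Poly_Mapping.keys v"
  have "finite ?S" "Poly_Mapping.keys (u + v) \<subseteq> ?S" by (auto simp: keys_add)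
  then show ?thesis
    by (simp add: lin_ext_superset[of ?S] lookup_add pm_scale_add_left sum.distrib)
qed

lemma lin_ext_scale [simp]: "lin_ext f (pm_scale c v) = pm_scale c (lin_ext f v)"
  by (simp add: lin_ext_superset[of "Poly_Mapping.keys v"] keys_pm_scale pm_scale_sum)

lemma lin_ext_zero [simp]: "lin_ext f 0 = 0"
  by (simp add: lin_ext_def)

lemma lin_ext_single [simp]: "lin_ext f (Poly_Mapping.single x c) = pm_scale c (f x)"
  by (simp add: lin_ext_superset[of "{x}"])

lemma lin_ext_uminus [simp]: "lin_ext f (- v) = - lin_ext f v"
  using lin_ext_scale[of f "-1" v] pm_scale_add_left[of "-1" 1]
  by (metis add.inverse_unique add.right_inverse lin_ext_add lin_ext_zero)

lemma lin_ext_diff [simp]: "lin_ext f (u - v) = lin_ext f u - lin_ext f v"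
  using lin_ext_add[of f u "- v"] by simp

lemma lin_ext_sum: "lin_ext f (\<Sum>i\<in>I. v i) = (\<Sum>i\<in>I. lin_ext f (v i))"
  by (induction I rule: infinite_finite_induct) auto

lemma free_induct [consumes 1, case_names zero step]:
  fixes v :: "'a \<Rightarrow>\<^sub>0 'k::field"
  assumes "Poly_Mapping.keys v \<subseteq> X" and "P 0"
    and "\<And>x c v. \<lbrakk>x \<in> X; Poly_Mapping.keys v \<subseteq> X; P v\<rbrakk> \<Longrightarrow> P (Poly_Mapping.single x c + v)"
  shows "P v"
proof -
  have "Poly_Mapping.keys v \<subseteq> X \<longrightarrow> P v" if "finite S" "Poly_Mapping.keys v \<subseteq> S" for S v
    using that
  proof (induction S arbitrary: v rule: finite_induct)
    case empty
    then show ?case using assms(2) by simp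
  next
    case (insert s S)
    define u where "u = v - Poly_Mapping.single s (Poly_Mapping.lookup v s)"
    have u: "Poly_Mapping.keys u \<subseteq> S" "Poly_Mapping.keys u \<subseteq> Poly_Mapping.keys v"
      using insert.prems
      by (auto simp: u_def in_keys_iff lookup_minus lookup_single when_def split: if_splits)
    have v: "v = Poly_Mapping.single s (Poly_Mapping.lookup v s) + u"
      by (simp add: u_def)
    show ?case
    proof
      assume X: "Poly_Mapping.keys v \<subseteq> X"
      with u insert.IH have "P u" by blast
      show "P v"
      proof (cases "s \<in> Poly_Mapping.keys v")
        case True
        then show ?thesis using X u(2) \<open>P u\<close> assms(3)[of s u] v by (metis subset_trans subsetD)
      next
        case False
        then show ?thesis using \<open>P u\<close> v by (simp add: in_keys_iff)
      qed
    qed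
  qed
  from this[of "Poly_Mapping.keys v" v] assms(1) show ?thesis by simp
qed

lemma lin_ext_cong:
  assumes "\<And>x. x \<in> Poly_Mapping.keys v \<Longrightarrow> f x = g x"
  shows "lin_ext f v = lin_ext g v"
  unfolding lin_ext_def using assms by (intro sum.cong) auto

lemma lin_ext_keys:
  assumes "Poly_Mapping.keys v \<subseteq> X" "\<And>x. x \<in> X \<Longrightarrow> Poly_Mapping.keys (f x) \<subseteq> Y"
  shows "Poly_Mapping.keys (lin_ext f v) \<subseteq> Y"
  using assms(1)
proof (induction v rule: free_induct)
  case (step x c v)
  then show ?case
    using keys_add[of "pm_scale c (f x)" "lin_ext f v"] keys_pm_scale[of c "f x"] assms(2)[of x]
    by (simp; blast)
qed simp

lemma lin_ext_lin_ext: "lin_ext f (lin_ext g v) = lin_ext (\<lambda>x. lin_ext f (g x)) v"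
proof -
  have "Poly_Mapping.keys v \<subseteq> UNIV" by simp
  then show ?thesis by (induction v rule: free_induct) auto
qed

lemma lin_ext_id [simp]: "lin_ext (\<lambda>x. Poly_Mapping.single x 1) v = v"
proof -
  have "Poly_Mapping.keys v \<subseteq> UNIV" by simp
  then show ?thesis by (induction v rule: free_induct) auto
qed

lemma basis_map_simps [simp]:
  "basis_map \<sigma> (u + v) = basis_map \<sigma> u + basis_map \<sigma> v"
  "basis_map \<sigma> (u - v) = basis_map \<sigma> u - basis_map \<sigma> v"
  "basis_map \<sigma> (pm_scale c v) = pm_scale c (basis_map \<sigma> v)"
  "basis_map \<sigma> 0 = 0"
  "basis_map \<sigma> (Poly_Mapping.single x c) = Poly_Mapping.single (\<sigma> x) c"
  by (simp_all add: basis_map_def)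

lemma basis_map_comp: "basis_map \<sigma> (basis_map \<tau> v) = basis_map (\<lambda>x. \<sigma> (\<tau> x)) v"
  by (simp add: basis_map_def lin_ext_lin_ext)

lemma basis_map_keys:
  "\<lbrakk>Poly_Mapping.keys v \<subseteq> X; \<sigma> \<in> X \<rightarrow> Y\<rbrakk> \<Longrightarrow> Poly_Mapping.keys (basis_map \<sigma> v) \<subseteq> Y"
  unfolding basis_map_def by (rule lin_ext_keys) auto

lemma basis_map_cong:
  "(\<And>x. x \<in> Poly_Mapping.keys v \<Longrightarrow> \<sigma> x = \<tau> x) \<Longrightarrow> basis_map \<sigma> v = basis_map \<tau> v"
  unfolding basis_map_def by (rule lin_ext_cong) auto

lemma basis_map_ident: "(\<And>x. x \<in> Poly_Mapping.keys v \<Longrightarrow> \<sigma> x = x) \<Longrightarrow> basis_map \<sigma> v = v"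
  using basis_map_cong[of v \<sigma> "\<lambda>x. x"] by (simp add: basis_map_def)

lemma vlin_eq_on_basis:
  assumes V: "vspace W" and f: "vlin (free_mod X) W f" and g: "vlin (free_mod X) W g"
    and eq: "\<And>x. x \<in> X \<Longrightarrow> f (Poly_Mapping.single x 1) = g (Poly_Mapping.single x 1)"
    and v: "Poly_Mapping.keys v \<subseteq> X"
  shows "f v = g v"
  using v
proof (induction v rule: free_induct)
  case zero
  then show ?case
    using vlin_zero[OF vspace_free_mod V f] vlin_zero[OF vspace_free_mod V g] by simp
next
  case (step x c v)
  have x: "Poly_Mapping.single x c \<in> carrier (free_mod X)"
      "Poly_Mapping.single x 1 \<in> carrier (free_mod X)"
    using step by auto
  have "f (Poly_Mapping.single x c) = g (Poly_Mapping.single x c)"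
    using vlin_smult[OF f x(2), of c] vlin_smult[OF g x(2), of c] eq[of x] step by simp
  then show ?case
    using vlin_add[OF f x(1), of v] vlin_add[OF g x(1), of v] step by simp
qed

lemma vlin_lin_ext:
  assumes "\<And>x. x \<in> X \<Longrightarrow> Poly_Mapping.keys (f x) \<subseteq> Y"
  shows "vlin (free_mod X) (free_mod Y) (lin_ext f)"
  using lin_ext_keys[of _ X f Y] assms by (intro vlinI) auto

section \<open>Representations\<close>

locale gmod = vspace M + grp: group G
  for G :: "('g, 'z) monoid_scheme" and M :: "('k::field, 'v, 'g, 'x) gmodule_scheme" +
  assumes gact_closed [simp, intro]:
      "\<lbrakk>g \<in> carrier G; v \<in> carrier M\<rbrakk> \<Longrightarrow> gact M g v \<in> carrier M"
    and gact_add: "\<lbrakk>g \<in> carrier G; u \<in> carrier M; v \<in> carrier M\<rbrakk> \<Longrightarrow>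
      gact M g (u \<oplus>\<^bsub>M\<^esub> v) = gact M g u \<oplus>\<^bsub>M\<^esub> gact M g v"
    and gact_smult: "\<lbrakk>g \<in> carrier G; v \<in> carrier M\<rbrakk> \<Longrightarrow>
      gact M g (c \<odot>\<^bsub>M\<^esub> v) = c \<odot>\<^bsub>M\<^esub> gact M g v"
    and gact_one: "v \<in> carrier M \<Longrightarrow> gact M \<one>\<^bsub>G\<^esub> v = v"
    and gact_mult: "\<lbrakk>g \<in> carrier G; h \<in> carrier G; v \<in> carrier M\<rbrakk> \<Longrightarrow>
      gact M (g \<otimes>\<^bsub>G\<^esub> h) v = gact M g (gact M h v)"

definition gmap ::
  "('g, 'z) monoid_scheme \<Rightarrow> ('k::field, 'v, 'g, 'x) gmodule_scheme \<Rightarrow> ('k, 'w, 'g, 'y) gmodule_scheme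
    \<Rightarrow> ('v \<Rightarrow> 'w) \<Rightarrow> bool" where
  "gmap G V W f \<longleftrightarrow> vlin V W f \<and> equivariant (carrier G) V W f"

lemma KG_hom_iff: "f \<in> KG_hom G V W \<longleftrightarrow> f \<in> extensional (carrier V) \<and> gmap G V W f"
  by (auto simp: KG_hom_def gmap_def vlin_def PiE_def)

lemma gmap_closed: "\<lbrakk>gmap G V W f; v \<in> carrier V\<rbrakk> \<Longrightarrow> f v \<in> carrier W"
  by (auto simp: gmap_def vlin_def)

lemma gmap_add: "\<lbrakk>gmap G V W f; u \<in> carrier V; v \<in> carrier V\<rbrakk> \<Longrightarrow>
    f (u \<oplus>\<^bsub>V\<^esub> v) = f u \<oplus>\<^bsub>W\<^esub> f v"
  by (simp add: gmap_def vlin_add)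

lemma gmap_smult: "\<lbrakk>gmap G V W f; v \<in> carrier V\<rbrakk> \<Longrightarrow> f (c \<odot>\<^bsub>V\<^esub> v) = c \<odot>\<^bsub>W\<^esub> f v"
  by (simp add: gmap_def vlin_smult)

lemma gmap_gact: "\<lbrakk>gmap G V W f; g \<in> carrier G; v \<in> carrier V\<rbrakk> \<Longrightarrow>
    f (gact V g v) = gact W g (f v)"
  by (simp add: gmap_def equivariant_def)

lemma gmap_zero: "\<lbrakk>gmap G V W f; vspace V; vspace W\<rbrakk> \<Longrightarrow> f \<zero>\<^bsub>V\<^esub> = \<zero>\<^bsub>W\<^esub>"
  by (simp add: gmap_def vlin_zero)

lemma gmap_cong:
  assumes "gmap G V W f" "\<And>v. v \<in> carrier V \<Longrightarrow> g v = f v" "gmod G V"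
  shows "gmap G V W g"
  using assms vlin_cong[of V W f g]
  by (simp add: gmap_def equivariant_def gmod_def gmod_axioms_def)

lemma gmap_restrict:
  assumes "gmod G V" "gmap G V W f" shows "gmap G V W (restrict f (carrier V))"
  by (rule gmap_cong[OF assms(2) _ assms(1)]) simp

lemma gmap_comp: "\<lbrakk>gmap G U V f; gmap G V W h\<rbrakk> \<Longrightarrow> gmap G U W (\<lambda>x. h (f x))"
  using vlin_compose[of U V f W h]
  by (auto simp: gmap_def equivariant_def vlin_closed)

lemma gmap_plus:
  assumes "gmod G W" "gmap G V W f" "gmap G V W h"
  shows "gmap G V W (\<lambda>x. f x \<oplus>\<^bsub>W\<^esub> h x)"
proof -
  interpret W: gmod G W by fact
  show ?thesis
    using assms(2,3)
    by (auto simp: gmap_def equivariant_def vlin_closed vlin_add vlin_smult W.a_ac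
        W.smult_r_distr W.gact_add intro!: vlinI)
qed

lemma gmap_scale:
  assumes "gmod G W" "gmap G V W f"
  shows "gmap G V W (\<lambda>x. c \<odot>\<^bsub>W\<^esub> f x)"
proof -
  interpret W: gmod G W by fact
  have "c \<odot>\<^bsub>W\<^esub> (a \<odot>\<^bsub>W\<^esub> w) = a \<odot>\<^bsub>W\<^esub> (c \<odot>\<^bsub>W\<^esub> w)" if "w \<in> carrier W" for a w
    using that by (metis W.smult_assoc mult.commute)
  with assms(2) show ?thesis
    by (auto simp: gmap_def equivariant_def vlin_closed vlin_add vlin_smult
        W.smult_r_distr W.gact_smult intro!: vlinI)
qed

lemma gmap_const_zero:
  assumes "gmod G W" shows "gmap G V W (\<lambda>x. \<zero>\<^bsub>W\<^esub>)"
proof -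
  interpret W: gmod G W by fact
  have "gact W g \<zero>\<^bsub>W\<^esub> = \<zero>\<^bsub>W\<^esub>" if "g \<in> carrier G" for g
    using W.gact_smult[OF that, of "\<zero>\<^bsub>W\<^esub>" 0] W.gact_closed[OF that, of "\<zero>\<^bsub>W\<^esub>"] by simp
  then show ?thesis
    by (auto simp: gmap_def equivariant_def intro!: vlinI)
qed

lemma perm_mod_simps [simp]:
  "carrier (perm_mod X \<alpha>) = {v. Poly_Mapping.keys v \<subseteq> X}"
  "add (perm_mod X \<alpha>) = (+)" "zero (perm_mod X \<alpha>) = 0" "smult (perm_mod X \<alpha>) = pm_scale"
  "gact (perm_mod X \<alpha>) = (\<lambda>g. basis_map (\<alpha> g))"
  by (simp_all add: perm_mod_def add_gact_def module.defs gmodule.defs)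

lemma vspace_perm_mod: "vspace (perm_mod X \<alpha>)"
proof -
  interpret vspace "free_mod X" by (rule vspace_free_mod)
  show ?thesis
    using a_closed smult_closed by (intro vspaceI) (simp_all add: add_ac pm_scale_add_left)
qed

lemma gmod_perm_mod:
  fixes G :: "('g, 'z) monoid_scheme" and \<alpha> :: "'g \<Rightarrow> 'a \<Rightarrow> 'a"
  assumes "group G"
    and closed: "\<And>g x. \<lbrakk>g \<in> carrier G; x \<in> X\<rbrakk> \<Longrightarrow> \<alpha> g x \<in> X"
    and one: "\<And>x. x \<in> X \<Longrightarrow> \<alpha> \<one>\<^bsub>G\<^esub> x = x"
    and mult: "\<And>g h x. \<lbrakk>g \<in> carrier G; h \<in> carrier G; x \<in> X\<rbrakk> \<Longrightarrow> \<alpha> (g \<otimes>\<^bsub>G\<^esub> h) x = \<alpha> g (\<alpha> h x)"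
  shows "gmod G (perm_mod X \<alpha> :: ('k::field, _, _) gmodule)"
proof -
  have "Poly_Mapping.keys (basis_map (\<alpha> g) v) \<subseteq> X"
    if "g \<in> carrier G" "Poly_Mapping.keys v \<subseteq> X" for g and v :: "'a \<Rightarrow>\<^sub>0 'k"
    using that closed by (intro basis_map_keys[of v X]) auto
  moreover have "basis_map (\<alpha> \<one>\<^bsub>G\<^esub>) v = v"
    if "Poly_Mapping.keys v \<subseteq> X" for v :: "'a \<Rightarrow>\<^sub>0 'k"
    using that one by (intro basis_map_ident) auto
  moreover have "basis_map (\<alpha> (g \<otimes>\<^bsub>G\<^esub> h)) v = basis_map (\<alpha> g) (basis_map (\<alpha> h) v)"
    if "g \<in> carrier G" "h \<in> carrier G" "Poly_Mapping.keys v \<subseteq> X" for g h and v :: "'a \<Rightarrow>\<^sub>0 'k"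
    using that mult unfolding basis_map_comp by (intro basis_map_cong) auto
  ultimately show ?thesis
    using assms(1) vspace_perm_mod by (simp add: gmod_def gmod_axioms_def)
qed

lemma gmap_lin_ext:
  assumes keys: "\<And>x. x \<in> X \<Longrightarrow> Poly_Mapping.keys (F x) \<subseteq> Y"
    and equiv: "\<And>g x. \<lbrakk>g \<in> carrier G; x \<in> X\<rbrakk> \<Longrightarrow> F (\<alpha> g x) = basis_map (\<beta> g) (F x)"
  shows "gmap G (perm_mod X \<alpha>) (perm_mod Y \<beta>) (lin_ext F)"
proof -
  have "lin_ext F (basis_map (\<alpha> g) v) = basis_map (\<beta> g) (lin_ext F v)"
    if "g \<in> carrier G" "Poly_Mapping.keys v \<subseteq> X" for g v
    using that(2) by (induction v rule: free_induct) (simp_all add: equiv that(1))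
  moreover have "vlin (perm_mod X \<alpha>) (perm_mod Y \<beta>) (lin_ext F)"
    using vlin_lin_ext[of X F Y] keys by (auto simp: vlin_def)
  ultimately show ?thesis
    by (simp add: gmap_def equivariant_def)
qed

section \<open>The standard resolution\<close>

text \<open>
  Lists of length \<open>0\<close> are admitted, so that the augmentation becomes the
  differential from degree \<open>1\<close> to degree \<open>0\<close>.
\<close>

definition tuples :: "('g, 'z) monoid_scheme \<Rightarrow> nat \<Rightarrow> 'g list set" where
  "tuples G n = {xs. length xs = n \<and> set xs \<subseteq> carrier G}"

definition tuple_mod ::
  "('g, 'z) monoid_scheme \<Rightarrow> nat \<Rightarrow> ('k::field, 'g list \<Rightarrow>\<^sub>0 'k, 'g) gmodule" where
  "tuple_mod G n = perm_mod (tuples G n) (\<lambda>g. map (\<lambda>h. g \<otimes>\<^bsub>G\<^esub> h))"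

lemma std_res_eq: "std_res G m = tuple_mod G (Suc m)"
  by (simp add: std_res_def tuple_mod_def tuples_def)

lemma tuple_mod_simps [simp]:
  "carrier (tuple_mod G n) = {v. Poly_Mapping.keys v \<subseteq> tuples G n}"
  "add (tuple_mod G n) = (+)" "zero (tuple_mod G n) = 0" "smult (tuple_mod G n) = pm_scale"
  "gact (tuple_mod G n) = (\<lambda>g. basis_map (map (\<lambda>h. g \<otimes>\<^bsub>G\<^esub> h)))"
  by (simp_all add: tuple_mod_def)

lemma (in group) gmod_tuple_mod: "gmod G (tuple_mod G n)"
  unfolding tuple_mod_def
  by (rule gmod_perm_mod) (auto simp: tuples_def m_assoc subset_iff intro: map_idI)

lemma (in group) gmod_std_res: "gmod G (std_res G m)"
  by (simp add: std_res_eq gmod_tuple_mod)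

lemma std_diff_simps [simp]:
  "std_diff (u + v) = std_diff u + std_diff v"
  "std_diff (u - v) = std_diff u - std_diff v"
  "std_diff (- v) = - std_diff v"
  "std_diff (pm_scale c v) = pm_scale c (std_diff v)"
  "std_diff 0 = 0"
  by (simp_all add: std_diff_def)

lemma std_diff_Nil [simp]: "std_diff (Poly_Mapping.single [] c) = 0"
  by (simp add: std_diff_def)

lemma basis_map_sum: "basis_map \<sigma> (\<Sum>i\<in>I. v i) = (\<Sum>i\<in>I. basis_map \<sigma> (v i))"
  by (simp add: basis_map_def lin_ext_sum)

lemma std_diff_Cons:
  fixes v :: "'g list \<Rightarrow>\<^sub>0 'k::field"
  shows "std_diff (basis_map (Cons g) v) = v - basis_map (Cons g) (std_diff v)"
proof -
  have "Poly_Mapping.keys v \<subseteq> UNIV" by simp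
  then show ?thesis
  proof (induction v rule: free_induct)
    case (step xs c v)
    have "std_diff (Poly_Mapping.single (g # xs) (1::'k))
        = Poly_Mapping.single xs 1 - basis_map (Cons g) (std_diff (Poly_Mapping.single xs 1))"
      unfolding std_diff_def lin_ext_single
      by (simp add: sum.lessThan_Suc_shift basis_map_sum single_uminus sum_negf del: sum.lessThan_Suc)
    then have "std_diff (pm_scale c (Poly_Mapping.single (g # xs) 1))
        = pm_scale c (Poly_Mapping.single xs 1 - basis_map (Cons g) (std_diff (Poly_Mapping.single xs 1)))"
      by (simp only: std_diff_simps)
    then have "std_diff (Poly_Mapping.single (g # xs) c)
        = Poly_Mapping.single xs c - basis_map (Cons g) (std_diff (Poly_Mapping.single xs c))"
      using std_diff_simps(4)[of c "Poly_Mapping.single xs 1", symmetric] by (simp del: std_diff_simps(4) flip: basis_map_simps(3))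
    then show ?case using step by simp
  qed simp
qed

lemma std_diff_single_Cons:
  "std_diff (Poly_Mapping.single (g # xs) c)
    = Poly_Mapping.single xs c - basis_map (Cons g) (std_diff (Poly_Mapping.single xs c))"
  using std_diff_Cons[of g "Poly_Mapping.single xs c"] by simp

lemma std_diff_std_diff [simp]: "std_diff (std_diff v) = 0"
proof -
  have *: "std_diff (std_diff (Poly_Mapping.single xs c)) = 0" for xs c
    by (induction xs) (simp_all add: std_diff_single_Cons std_diff_Cons)
  have "Poly_Mapping.keys v \<subseteq> UNIV" by simp
  then show ?thesis
    by (induction v rule: free_induct) (simp_all add: *)
qed

lemma std_diff_map: "std_diff (basis_map (map \<sigma>) v) = basis_map (map \<sigma>) (std_diff v)"
proof -
  have *: "std_diff (Poly_Mapping.single (map \<sigma> xs) c)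
      = basis_map (map \<sigma>) (std_diff (Poly_Mapping.single xs c))" for xs c
    by (induction xs) (simp_all add: std_diff_single_Cons basis_map_comp)
  have "Poly_Mapping.keys v \<subseteq> UNIV" by simp
  then show ?thesis
    by (induction v rule: free_induct) (simp_all add: *)
qed

lemma gmap_std_diff:
  "gmap G (tuple_mod G (Suc n)) (tuple_mod G n) (std_diff :: ('g list \<Rightarrow>\<^sub>0 'k::field) \<Rightarrow> _)"
  unfolding std_diff_def tuple_mod_def
proof (rule gmap_lin_ext)
  fix xs assume xs: "xs \<in> tuples G (Suc n)"
  have "take i xs @ drop (Suc i) xs \<in> tuples G n" if "i < length xs" for i
    using xs that by (auto simp: tuples_def dest: in_set_takeD in_set_dropD)
  then show "Poly_Mapping.keys (\<Sum>i<length xs. Poly_Mapping.single (take i xs @ drop (Suc i) xs)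
      ((- 1) ^ i :: 'k)) \<subseteq> tuples G n"
    using keys_sum[of "\<lambda>i. Poly_Mapping.single (take i xs @ drop (Suc i) xs) ((- 1) ^ i :: 'k)" "{..<length xs}"]
    by (force split: if_splits)
qed (simp add: basis_map_sum take_map drop_map)

lemma std_aug_superset:
  assumes "finite S" "Poly_Mapping.keys v \<subseteq> S"
  shows "std_aug v = (\<Sum>x\<in>S. Poly_Mapping.lookup v x)"
  unfolding std_aug_def using assms
  by (intro sum.mono_neutral_left) (auto simp: in_keys_iff)

lemma std_aug_simps [simp]:
  fixes u v :: "'a list \<Rightarrow>\<^sub>0 'b::field"
  shows
  "std_aug (u + v) = std_aug u + std_aug v"
  "std_aug (pm_scale c v) = c * std_aug v"
  "std_aug (0 :: 'a list \<Rightarrow>\<^sub>0 'b) = 0"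
  "std_aug (Poly_Mapping.single xs c :: 'a list \<Rightarrow>\<^sub>0 'b) = c"
proof -
  let ?S = "Poly_Mapping.keys u \<union> Poly_Mapping.keys v"
  have "finite ?S" "Poly_Mapping.keys (u + v) \<subseteq> ?S" by (auto simp: keys_add)
  then show "std_aug (u + v) = std_aug u + std_aug v"
    by (simp add: std_aug_superset[of ?S] lookup_add sum.distrib)
  show "std_aug (pm_scale c v) = c * std_aug v"
    by (simp add: std_aug_superset[of "Poly_Mapping.keys v"] keys_pm_scale sum_distrib_left)
  show "std_aug (0 :: 'a list \<Rightarrow>\<^sub>0 'b) = 0" by (simp add: std_aug_def)
  show "std_aug (Poly_Mapping.single xs c :: 'a list \<Rightarrow>\<^sub>0 'b) = c"
    by (simp add: std_aug_superset[of "{xs}"])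
qed

lemma std_diff_eq_std_aug:
  assumes "Poly_Mapping.keys v \<subseteq> tuples G 1"
  shows "std_diff v = Poly_Mapping.single [] (std_aug v)"
  using assms
proof (induction v rule: free_induct)
  case (step xs c v)
  then obtain g where "xs = [g]" by (auto simp: tuples_def length_Suc_conv)
  with step show ?case by (simp add: std_diff_single_Cons single_add)
qed simp

lemma std_aug_eq_iff:
  assumes "Poly_Mapping.keys u \<subseteq> tuples G 1" "Poly_Mapping.keys v \<subseteq> tuples G 1"
  shows "std_aug u = std_aug v \<longleftrightarrow> std_diff u = std_diff v"
  using assms by (auto simp: std_diff_eq_std_aug) (metis lookup_single_eq)

text \<open>
  Prepending a fixed group element contracts the augmented resolution, but not equivariantly;
  prepending the first entry of the argument is equivariant.
\<close>

definition prism :: "(('g list \<Rightarrow>\<^sub>0 'k::field) \<Rightarrow> ('g list \<Rightarrow>\<^sub>0 'k)) \<Rightarrow> ('g list \<Rightarrow>\<^sub>0 'k) \<Rightarrow> ('g list \<Rightarrow>\<^sub>0 'k)" where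
  "prism \<phi> = lin_ext (\<lambda>xs. basis_map (Cons (hd xs)) (\<phi> (Poly_Mapping.single xs 1)))"

lemma gmap_prism:
  assumes \<phi>: "gmap G (tuple_mod G (Suc m)) (tuple_mod G n) (\<phi> :: _ \<Rightarrow> 'g list \<Rightarrow>\<^sub>0 'k::field)"
  shows "gmap G (tuple_mod G (Suc m)) (tuple_mod G (Suc n)) (prism \<phi>)"
  unfolding prism_def tuple_mod_def
proof (rule gmap_lin_ext)
  fix xs assume xs: "xs \<in> tuples G (Suc m)"
  then have hd: "hd xs \<in> carrier G" by (cases xs) (auto simp: tuples_def)
  have s: "Poly_Mapping.single xs (1::'k) \<in> carrier (tuple_mod G (Suc m))" using xs by simp
  show "Poly_Mapping.keys (basis_map (Cons (hd xs)) (\<phi> (Poly_Mapping.single xs 1))) \<subseteq> tuples G (Suc n)"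
    using gmap_closed[OF \<phi> s] hd by (intro basis_map_keys) (auto simp: tuples_def)
  fix g assume g: "g \<in> carrier G"
  have "hd (map ((\<otimes>\<^bsub>G\<^esub>) g) xs) = g \<otimes>\<^bsub>G\<^esub> hd xs" using xs by (cases xs) (auto simp: tuples_def)
  then show "basis_map (Cons (hd (map ((\<otimes>\<^bsub>G\<^esub>) g) xs))) (\<phi> (Poly_Mapping.single (map ((\<otimes>\<^bsub>G\<^esub>) g) xs) 1)) =
       basis_map (map ((\<otimes>\<^bsub>G\<^esub>) g)) (basis_map (Cons (hd xs)) (\<phi> (Poly_Mapping.single xs 1)))"
    using gmap_gact[OF \<phi> g s] by (simp add: basis_map_comp)
qed

text \<open>
  Prepending satisfies \<open>d (g # y) = y - g # d y\<close>, and the correction vanishes because the values of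
  \<open>\<phi>\<close> are cycles.
\<close>

lemma std_diff_prism:
  assumes \<phi>: "gmap G (tuple_mod G (Suc m)) (tuple_mod G n) \<phi>"
    and "\<And>x. Poly_Mapping.keys x \<subseteq> tuples G (Suc m) \<Longrightarrow> std_diff (\<phi> x) = 0"
    and x: "Poly_Mapping.keys x \<subseteq> tuples G (Suc m)"
  shows "std_diff (prism \<phi> x) = \<phi> x"
proof (rule vlin_eq_on_basis[OF vspace_perm_mod _ _ _ x])
  show "vlin (free_mod (tuples G (Suc m))) (perm_mod (tuples G n) (\<lambda>g. map ((\<otimes>\<^bsub>G\<^esub>) g))) (\<lambda>x. std_diff (prism \<phi> x))"
    using gmap_comp[OF gmap_prism[OF \<phi>] gmap_std_diff] by (simp add: gmap_def vlin_def)
  show "vlin (free_mod (tuples G (Suc m))) (perm_mod (tuples G n) (\<lambda>g. map ((\<otimes>\<^bsub>G\<^esub>) g))) \<phi>"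
    using \<phi> by (simp add: gmap_def vlin_def)
  show "std_diff (prism \<phi> (Poly_Mapping.single xs 1)) = \<phi> (Poly_Mapping.single xs 1)"
    if "xs \<in> tuples G (Suc m)" for xs
    using that assms(2) by (simp add: prism_def std_diff_Cons)
qed

section \<open>Lifting cocycles to chain maps\<close>

lemma triv_mod_simps [simp]:
  "carrier (triv_mod T) = UNIV" "add (triv_mod T) = (+)" "zero (triv_mod T) = 0"
  "smult (triv_mod T) = (*)" "gact (triv_mod T) g v = v"
  by (simp_all add: triv_mod_def)

lemma (in group) gmod_triv_mod: "gmod G (triv_mod T)"
  by (auto simp: gmod_def gmod_axioms_def group_axioms algebra_simps intro!: vspaceI)

definition base_lift :: "(('g list \<Rightarrow>\<^sub>0 'k::field) \<Rightarrow> 'k) \<Rightarrow> ('g list \<Rightarrow>\<^sub>0 'k) \<Rightarrow> ('g list \<Rightarrow>\<^sub>0 'k)" where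
  "base_lift h = lin_ext (\<lambda>xs. Poly_Mapping.single [hd xs] (h (Poly_Mapping.single xs 1)))"

lemma gmap_base_lift:
  fixes h :: "('g list \<Rightarrow>\<^sub>0 'k::field) \<Rightarrow> 'k"
  assumes h: "gmap G (tuple_mod G (Suc m)) (triv_mod TYPE('k)) h"
  shows "gmap G (tuple_mod G (Suc m)) (tuple_mod G 1) (base_lift h)"
  unfolding base_lift_def tuple_mod_def
proof (rule gmap_lin_ext)
  fix xs assume xs: "xs \<in> tuples G (Suc m)"
  then show "Poly_Mapping.keys (Poly_Mapping.single [hd xs] (h (Poly_Mapping.single xs 1))) \<subseteq> tuples G 1"
    by (cases xs) (auto simp: tuples_def)
  have s: "Poly_Mapping.single xs (1::'k) \<in> carrier (tuple_mod G (Suc m))" using xs by simp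
  show "Poly_Mapping.single [hd (map ((\<otimes>\<^bsub>G\<^esub>) g) xs)] (h (Poly_Mapping.single (map ((\<otimes>\<^bsub>G\<^esub>) g) xs) 1)) =
      basis_map (map ((\<otimes>\<^bsub>G\<^esub>) g)) (Poly_Mapping.single [hd xs] (h (Poly_Mapping.single xs 1)))"
    if "g \<in> carrier G" for g
    using gmap_gact[OF h that s] xs by (cases xs) (auto simp: tuples_def)
qed

lemma std_aug_base_lift:
  fixes h :: "('g list \<Rightarrow>\<^sub>0 'k::field) \<Rightarrow> 'k"
  assumes h: "gmap G (tuple_mod G (Suc m)) (triv_mod TYPE('k)) h"
    and x: "Poly_Mapping.keys x \<subseteq> tuples G (Suc m)"
  shows "std_aug (base_lift h x) = h x"
  using x
proof (induction x rule: free_induct)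
  case zero
  show ?case using gmap_smult[OF h, of 0 0] by (simp add: base_lift_def)
next
  case (step xs c x)
  have "h (Poly_Mapping.single xs c + x) = c * h (Poly_Mapping.single xs 1) + h x"
    using gmap_add[OF h, of "Poly_Mapping.single xs c" x]
      gmap_smult[OF h, of "Poly_Mapping.single xs 1" c] step by simp
  then show ?case using step by (simp add: base_lift_def)
qed

fun lift :: "(('g list \<Rightarrow>\<^sub>0 'k::field) \<Rightarrow> 'k) \<Rightarrow> nat \<Rightarrow> ('g list \<Rightarrow>\<^sub>0 'k) \<Rightarrow> ('g list \<Rightarrow>\<^sub>0 'k)" where
  "lift h 0 = base_lift h"
| "lift h (Suc n) = prism (\<lambda>x. lift h n (std_diff x))"

lemma gmap_lift:
  assumes "gmap G (tuple_mod G (Suc j)) (triv_mod TYPE('k::field)) h"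
  shows "gmap G (tuple_mod G (Suc (n + j))) (tuple_mod G (Suc n)) (lift h n)"
proof (induction n)
  case 0
  then show ?case using gmap_base_lift[OF assms] by simp
next
  case (Suc n)
  show ?case
    using gmap_prism[OF gmap_comp[OF gmap_std_diff Suc]] by simp
qed

lemma std_diff_lift:
  fixes h :: "('g list \<Rightarrow>\<^sub>0 'k::field) \<Rightarrow> 'k"
  assumes h: "gmap G (tuple_mod G (Suc j)) (triv_mod TYPE('k)) h"
    and cocycle: "\<And>x. Poly_Mapping.keys x \<subseteq> tuples G (Suc (Suc j)) \<Longrightarrow> h (std_diff x) = 0"
    and "Poly_Mapping.keys x \<subseteq> tuples G (Suc (Suc (n + j)))"
  shows "std_diff (lift h (Suc n) x) = lift h n (std_diff x)"
  using assms(3)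
proof (induction n arbitrary: x)
  case 0
  have d: "Poly_Mapping.keys (std_diff x) \<subseteq> tuples G (Suc j)"
    if "Poly_Mapping.keys x \<subseteq> tuples G (Suc (Suc j))" for x :: "'g list \<Rightarrow>\<^sub>0 'k"
    using that gmap_closed[OF gmap_std_diff, of x G "Suc j"] by simp
  have "std_diff (base_lift h (std_diff x)) = 0"
    if "Poly_Mapping.keys x \<subseteq> tuples G (Suc (Suc j))" for x
    using std_diff_eq_std_aug[of "base_lift h (std_diff x)" G] gmap_closed[OF gmap_base_lift[OF h]]
      std_aug_base_lift[OF h d[OF that]] cocycle[OF that] d[OF that] by simp
  then show ?case
    using std_diff_prism[OF gmap_comp[OF gmap_std_diff gmap_lift[OF h, of 0, simplified]]] 0
    by simp
next
  case (Suc n)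
  have d: "Poly_Mapping.keys (std_diff x) \<subseteq> tuples G (Suc (Suc (n + j)))"
    if "Poly_Mapping.keys x \<subseteq> tuples G (Suc (Suc (Suc n + j)))" for x :: "'g list \<Rightarrow>\<^sub>0 'k"
    using that gmap_closed[OF gmap_std_diff, of x G "Suc (Suc (n + j))"] by simp
  have "gmap G (tuple_mod G (Suc (Suc (Suc n + j)))) (tuple_mod G (Suc (Suc n))) (\<lambda>x. lift h (Suc n) (std_diff x))"
    using gmap_comp[OF gmap_std_diff gmap_lift[OF h, of "Suc n"]] by simp
  note prism = std_diff_prism[OF this]
  have "std_diff (lift h (Suc n) (std_diff y)) = 0"
    if "Poly_Mapping.keys y \<subseteq> tuples G (Suc (Suc (Suc n + j)))" for y
    using Suc.IH[OF d[OF that]] gmap_smult[OF gmap_lift[OF h, of n], of 0 0]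
    by (simp del: lift.simps)
  from prism[OF this Suc.prems] show ?case
    by (simp only: lift.simps(2))
qed

section \<open>Cohomology of a group\<close>

locale coeff = gmod G M for G :: "('g, 'z) monoid_scheme" and M :: "('k::field, 'v, 'g) gmodule"
begin

lemma cochains_simps:
  "zero (cochains G M m) = (\<lambda>x\<in>carrier (std_res G m). \<zero>\<^bsub>M\<^esub>)"
  "f \<oplus>\<^bsub>cochains G M m\<^esub> h = (\<lambda>x\<in>carrier (std_res G m). f x \<oplus>\<^bsub>M\<^esub> h x)"
  "c \<odot>\<^bsub>cochains G M m\<^esub> f = (\<lambda>x\<in>carrier (std_res G m). c \<odot>\<^bsub>M\<^esub> f x)"
  by (simp_all add: cochains_def)

lemma cochain_iff:
  "f \<in> carrier (cochains G M m) \<longleftrightarrow>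
     f \<in> extensional (carrier (std_res G m)) \<and> gmap G (std_res G m) M f"
  by (simp add: cochains_def KG_hom_iff)

lemma restrict_cochain:
  "gmap G (std_res G m) M f \<Longrightarrow> restrict f (carrier (std_res G m)) \<in> carrier (cochains G M m)"
  by (simp add: cochain_iff) (rule gmap_restrict[OF grp.gmod_std_res])

lemma cochain_closed:
  "\<lbrakk>f \<in> carrier (cochains G M m); x \<in> carrier (std_res G m)\<rbrakk> \<Longrightarrow> f x \<in> carrier M"
  by (auto simp: cochain_iff gmap_closed)

lemma cochain_eqI:
  assumes "f \<in> carrier (cochains G M m)" "h \<in> carrier (cochains G M m)"
    and "\<And>x. x \<in> carrier (std_res G m) \<Longrightarrow> f x = h x"
  shows "f = h"
  using assms by (auto simp: cochain_iff intro: extensionalityI)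

lemma vspace_cochains: "vspace (cochains G M m)"
proof -
  note gm = gmod_axioms
  have add: "f \<oplus>\<^bsub>cochains G M m\<^esub> h \<in> carrier (cochains G M m)"
    if "f \<in> carrier (cochains G M m)" "h \<in> carrier (cochains G M m)" for f h
    using that by (simp only: cochains_simps) (intro restrict_cochain gmap_plus gm; simp add: cochain_iff)
  have sm: "c \<odot>\<^bsub>cochains G M m\<^esub> f \<in> carrier (cochains G M m)"
    if "f \<in> carrier (cochains G M m)" for f c
    using that by (simp only: cochains_simps) (intro restrict_cochain gmap_scale gm; simp add: cochain_iff)
  have zero: "\<zero>\<^bsub>cochains G M m\<^esub> \<in> carrier (cochains G M m)"
    by (simp only: cochains_simps) (intro restrict_cochain gmap_const_zero gm)
  note eq = cochain_eqI[where m = m] and [simp] = cochain_closed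
  show ?thesis
  proof (rule vspaceI, goal_cases)
    case (3 u v w) then show ?case by (intro eq add) (auto simp: cochains_simps a_assoc)
  next
    case (4 u v) then show ?case by (intro eq add) (auto simp: cochains_simps a_comm)
  next
    case (5 v) then show ?case by (intro eq add zero) (auto simp: cochains_simps)
  next
    case (6 v) then show ?case by (intro eq sm zero) (auto simp: cochains_simps)
  next
    case (8 c u v) then show ?case by (intro eq add sm) (auto simp: cochains_simps smult_r_distr)
  next
    case (9 a b v) then show ?case by (intro eq add sm) (auto simp: cochains_simps smult_l_distr)
  next
    case (10 a b v) then show ?case by (intro eq sm) (auto simp: cochains_simps smult_assoc)
  next
    case (11 v) then show ?case by (intro eq sm) (auto simp: cochains_simps)
  qed (intro add sm zero; assumption)+
qed

lemma cochain_zero: "f \<in> carrier (cochains G M m) \<Longrightarrow> f 0 = \<zero>\<^bsub>M\<^esub>"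
  using gmap_zero[of G "std_res G m" M f] vspace_axioms gmod.axioms(1)[OF grp.gmod_std_res]
  by (auto simp: cochain_iff std_res_eq)

lemma std_diff_closed:
  "x \<in> carrier (std_res G (Suc m)) \<Longrightarrow> std_diff x \<in> carrier (std_res G m)"
  unfolding std_res_eq by (rule gmap_closed[OF gmap_std_diff])

lemma subsp_cocycles: "subsp (cochains G M m) (cocycles G M m)"
proof -
  interpret C: vspace "cochains G M m" by (rule vspace_cochains)
  show ?thesis
    using C.a_closed C.zero_closed C.smult_closed
    by (auto simp: subsp_def cocycles_def cochains_simps std_diff_closed)
qed

lemma coboundary_SucE:
  assumes "f \<in> coboundaries G M (Suc m)"
  obtains e where "e \<in> carrier (cochains G M m)" "f = (\<lambda>x\<in>carrier (std_res G (Suc m)). e (std_diff x))"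
  using assms by (auto simp: compose_def)

lemma coboundary_SucI:
  assumes "gmap G (std_res G m) M e"
    and "\<And>x. x \<in> carrier (std_res G (Suc m)) \<Longrightarrow> f x = e (std_diff x)"
    and "f \<in> extensional (carrier (std_res G (Suc m)))"
  shows "f \<in> coboundaries G M (Suc m)"
proof -
  have "f = compose (carrier (std_res G (Suc m))) (restrict e (carrier (std_res G m))) std_diff"
    using assms(2,3) by (intro extensionalityI[OF assms(3)]) (auto simp: compose_def std_diff_closed)
  with restrict_cochain[OF assms(1)] show ?thesis by auto
qed

lemma coboundaries_cocycles: "coboundaries G M m \<subseteq> cocycles G M m"
proof (cases m)
  case 0
  then show ?thesis using subsp_cocycles[of m] by (simp add: subsp_def)
next
  case (Suc n)
  show ?thesis
  proof
    fix f assume "f \<in> coboundaries G M m"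
    then obtain e where e: "e \<in> carrier (cochains G M n)"
      and f: "f = (\<lambda>x\<in>carrier (std_res G m). e (std_diff x))"
      using Suc coboundary_SucE by blast
    have "gmap G (std_res G m) M (\<lambda>x. e (std_diff x))"
      using e gmap_comp[OF gmap_std_diff, of G "Suc n" M e] by (simp add: Suc std_res_eq cochain_iff)
    then show "f \<in> cocycles G M m"
      using e cochain_zero[OF e] restrict_cochain[of m "\<lambda>x. e (std_diff x)"]
      by (auto simp: f cocycles_def Suc std_diff_closed)
  qed
qed

lemma subsp_coboundaries: "subsp (cochains G M m) (coboundaries G M m)"
proof -
  interpret C: vspace "cochains G M m" by (rule vspace_cochains)
  have sub: "coboundaries G M m \<subseteq> carrier (cochains G M m)"
    using coboundaries_cocycles[of m] by (auto simp: cocycles_def)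
  show ?thesis
  proof (cases m)
    case 0
    interpret C0: vspace "cochains G M 0" by (rule vspace_cochains)
    show ?thesis using 0 by (auto simp: subsp_def)
  next
    case (Suc n)
    have "\<zero>\<^bsub>cochains G M m\<^esub> \<in> coboundaries G M m"
      unfolding Suc cochains_simps
      by (rule coboundary_SucI[OF gmap_const_zero[OF gmod_axioms]]) auto
    moreover have "f \<oplus>\<^bsub>cochains G M m\<^esub> f' \<in> coboundaries G M m"
      if "f \<in> coboundaries G M m" "f' \<in> coboundaries G M m" for f f'
    proof -
      from that obtain e e' where e: "e \<in> carrier (cochains G M n)" "e' \<in> carrier (cochains G M n)"
        "f = (\<lambda>x\<in>carrier (std_res G m). e (std_diff x))" "f' = (\<lambda>x\<in>carrier (std_res G m). e' (std_diff x))"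
        unfolding Suc by (metis coboundary_SucE)
      then show ?thesis
        unfolding Suc cochains_simps
        by (intro coboundary_SucI[of n "\<lambda>x. e x \<oplus>\<^bsub>M\<^esub> e' x"] gmap_plus[OF gmod_axioms])
          (auto simp: cochain_iff)
    qed
    moreover have "c \<odot>\<^bsub>cochains G M m\<^esub> f \<in> coboundaries G M m"
      if "f \<in> coboundaries G M m" for f c
    proof -
      from that obtain e where e: "e \<in> carrier (cochains G M n)"
        "f = (\<lambda>x\<in>carrier (std_res G m). e (std_diff x))"
        unfolding Suc by (metis coboundary_SucE)
      then show ?thesis
        unfolding Suc cochains_simps
        by (intro coboundary_SucI[of n "\<lambda>x. c \<odot>\<^bsub>M\<^esub> e x"] gmap_scale[OF gmod_axioms])
          (auto simp: cochain_iff)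
    qed
    ultimately show ?thesis using sub by (auto simp: subsp_def)
  qed
qed

definition Z :: "nat \<Rightarrow> ('k, ('g list \<Rightarrow>\<^sub>0 'k) \<Rightarrow> 'v) module" where
  "Z m = (cochains G M m)\<lparr>carrier := cocycles G M m\<rparr>"

lemma Z_simps [simp]:
  "carrier (Z m) = cocycles G M m" "add (Z m) = add (cochains G M m)"
  "zero (Z m) = zero (cochains G M m)" "smult (Z m) = smult (cochains G M m)"
  by (simp_all add: Z_def)

lemma quotient_Z: "quotient_space (Z m) (coboundaries G M m)"
proof (intro quotient_space.intro quotient_space_axioms.intro)
  show "vspace (Z m)"
    unfolding Z_def by (rule vspace_subsp[OF vspace_cochains subsp_cocycles])
  show "subsp (Z m) (coboundaries G M m)"
    using subsp_coboundaries[of m] coboundaries_cocycles[of m] by (simp add: subsp_def)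
qed

lemma Ext_eq: "Ext G M m = quot_mod (Z m) (coboundaries G M m)"
  by (simp add: Ext_def Z_def)

lemma ext_class_eq: "ext_class G M m f = coboundaries G M m +>\<^bsub>Z m\<^esub> f"
  by (simp add: ext_class_def a_r_coset_def')

lemma vspace_Ext: "vspace (Ext G M m)"
  unfolding Ext_eq by (rule quotient_space.vspace_quot[OF quotient_Z])

lemma Ext_carrier: "carrier (Ext G M m) = ext_class G M m ` cocycles G M m"
  unfolding Ext_eq ext_class_eq quotient_space.quot_mod_simps[OF quotient_Z] by simp

lemma ExtE:
  assumes "X \<in> carrier (Ext G M m)"
  obtains f where "f \<in> cocycles G M m" "X = ext_class G M m f"
  using assms by (auto simp: Ext_carrier)

lemma ext_class_closed: "f \<in> cocycles G M m \<Longrightarrow> ext_class G M m f \<in> carrier (Ext G M m)"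
  by (simp add: Ext_carrier)

lemma ext_class_lin: "vlin (Z m) (Ext G M m) (ext_class G M m)"
  using quotient_space.vlin_coset[OF quotient_Z] by (simp add: Ext_eq ext_class_eq[abs_def])

lemma Ext_zero: "\<zero>\<^bsub>Ext G M m\<^esub> = coboundaries G M m"
  by (simp add: Ext_eq quotient_space.quot_mod_simps[OF quotient_Z])

lemma ext_class_eq_zero_iff:
  "f \<in> cocycles G M m \<Longrightarrow> ext_class G M m f = \<zero>\<^bsub>Ext G M m\<^esub> \<longleftrightarrow> f \<in> coboundaries G M m"
  using quotient_space.coset_eq_zero_iff[OF quotient_Z, of f m] by (simp add: Ext_zero ext_class_eq)

lemma cochain_coset_memD:
  assumes "f \<in> ext_class G M m f0" "f0 \<in> cocycles G M m"
  obtains b where "b \<in> coboundaries G M m" "f = (\<lambda>x\<in>carrier (std_res G m). b x \<oplus>\<^bsub>M\<^esub> f0 x)"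
    "f \<in> cocycles G M m"
proof -
  obtain b where b: "b \<in> coboundaries G M m" "f = b \<oplus>\<^bsub>cochains G M m\<^esub> f0"
    using assms(1) by (auto simp: ext_class_def a_r_coset_def')
  have "f \<in> cocycles G M m"
    using subsp_cocycles[of m] b assms(2) coboundaries_cocycles[of m] by (auto simp: subsp_def)
  with b that show thesis by (auto simp: cochains_simps)
qed

lemma ext_class_self: "f \<in> cocycles G M m \<Longrightarrow> f \<in> ext_class G M m f"
  using quotient_space.axioms(1)[OF quotient_Z] abelian_subgroup.a_rcos_self[OF
    quotient_space.axioms(1)[OF quotient_Z, THEN subsp_abelian_subgroup, OF quotient_space.subsp[OF quotient_Z]], of f m]
  by (simp add: ext_class_eq)

lemma ext_class_eqI:
  assumes "f \<in> cocycles G M m" "f' \<in> cocycles G M m" "b \<in> coboundaries G M m"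
    and "\<And>x. x \<in> carrier (std_res G m) \<Longrightarrow> f x = b x \<oplus>\<^bsub>M\<^esub> f' x"
  shows "ext_class G M m f = ext_class G M m f'"
proof -
  have "b \<oplus>\<^bsub>cochains G M m\<^esub> f' \<in> cocycles G M m"
    using subsp_cocycles[of m] assms(2,3) coboundaries_cocycles[of m] by (auto simp: subsp_def)
  then have "f = b \<oplus>\<^bsub>cochains G M m\<^esub> f'"
    using assms by (intro cochain_eqI[of f m]) (auto simp: cocycles_def cochains_simps)
  then show ?thesis
    using quotient_space.coset_eqI[OF quotient_Z, of f m f' b] assms(1-3) by (simp add: ext_class_eq)
qed

end

section \<open>The Yoneda product\<close>

lemma (in group) coeff_triv: "coeff G (triv_mod T)"
  by (simp add: coeff_def gmod_triv_mod)

lemma pm_scale_minus_one: "pm_scale (-1) v = - v"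
  using pm_scale_simps(3)[of 1 v] by (intro poly_mapping_eqI) simp

lemma is_liftI:
  fixes h :: "('g list \<Rightarrow>\<^sub>0 'k::field) \<Rightarrow> 'k"
  assumes "group G"
    and "\<And>n. gmap G (std_res G (n + j)) (std_res G n) (\<psi> n)"
    and "\<And>n x. x \<in> carrier (std_res G (Suc n + j)) \<Longrightarrow> std_diff (\<psi> (Suc n) x) = \<psi> n (std_diff x)"
    and "\<And>x. x \<in> carrier (std_res G j) \<Longrightarrow> std_aug (\<psi> 0 x) = h x"
  shows "is_lift G j h (\<lambda>n. restrict (\<psi> n) (carrier (std_res G (n + j))))"
proof -
  interpret group G by fact
  have "std_diff x \<in> carrier (std_res G (n + j))" if "x \<in> carrier (std_res G (Suc n + j))"
    for n and x :: "'g list \<Rightarrow>\<^sub>0 'k"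
    using that gmap_closed[OF gmap_std_diff, of x G "Suc (n + j)"] by (simp add: std_res_eq)
  moreover have "gmap G (std_res G (n + j)) (std_res G n) (restrict (\<psi> n) (carrier (std_res G (n + j))))" for n
    by (rule gmap_restrict[OF gmod_std_res assms(2)])
  ultimately show ?thesis
    using assms(3,4) by (auto simp: is_lift_def KG_hom_iff)
qed

lemma is_liftD:
  assumes "is_lift G j h \<psi>"
  shows "gmap G (std_res G (n + j)) (std_res G n) (\<psi> n)"
    and "x \<in> carrier (std_res G (Suc n + j)) \<Longrightarrow> std_diff (\<psi> (Suc n) x) = \<psi> n (std_diff x)"
    and "x \<in> carrier (std_res G j) \<Longrightarrow> std_aug (\<psi> 0 x) = h x"
  using assms by (auto simp: is_lift_def KG_hom_iff)

lemma lift_exists: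
  fixes h :: "('g list \<Rightarrow>\<^sub>0 'k::field) \<Rightarrow> 'k"
  assumes "group G" and h: "h \<in> cocycles G (triv_mod TYPE('k)) j"
  obtains \<psi> where "is_lift G j h \<psi>"
proof -
  interpret group G by fact
  interpret K: coeff G "triv_mod TYPE('k)" by (rule coeff_triv)
  have gh: "gmap G (tuple_mod G (Suc j)) (triv_mod TYPE('k)) h"
    and cocycle: "\<And>x. Poly_Mapping.keys x \<subseteq> tuples G (Suc (Suc j)) \<Longrightarrow> h (std_diff x) = 0"
    using h by (auto simp: cocycles_def K.cochain_iff std_res_eq)
  show thesis
  proof (rule that, rule is_liftI)
    show "std_diff (lift h (Suc n) x) = lift h n (std_diff x)"
      if "x \<in> carrier (std_res G (Suc n + j))" for n x
      by (rule std_diff_lift[OF gh cocycle]) (use that in \<open>auto simp: std_res_eq\<close>)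
  qed (use gmap_lift[OF gh] std_aug_base_lift[OF gh] in \<open>auto simp: std_res_eq group_axioms\<close>)
qed

context coeff
begin

text \<open>
  A chain map that lifts a coboundary is null homotopic in the sense that \<open>d (T n (d x)) = d (\<xi> n x)\<close>.
  In degree \<open>0\<close> the map \<open>T 0\<close> lifts a cochain bounding \<open>c\<close>; for \<open>j = 0\<close> there is no such cochain,
  then \<open>c = 0\<close> and \<open>T 0 = 0\<close>. The later maps arise by prepending, as \<open>\<xi> n x - T n (d x)\<close> is a cycle.
  Since that cycle is also \<open>d (T (n + 1) x)\<close> and the cocycle \<open>f\<close> kills boundaries,
  \<open>f (\<xi> i x) = f (T i (d x))\<close>.
\<close>

lemma lift_of_coboundary:
  fixes c :: "('g list \<Rightarrow>\<^sub>0 'k) \<Rightarrow> 'k"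
  assumes \<xi>: "\<And>n. gmap G (std_res G (n + j)) (std_res G n) (\<xi> n)"
    and chain: "\<And>n x. x \<in> carrier (std_res G (Suc n + j)) \<Longrightarrow> std_diff (\<xi> (Suc n) x) = \<xi> n (std_diff x)"
    and aug: "\<And>x. x \<in> carrier (std_res G j) \<Longrightarrow> std_aug (\<xi> 0 x) = c x"
    and c: "c \<in> coboundaries G (triv_mod TYPE('k)) j"
    and f: "f \<in> cocycles G M i"
  shows "(\<lambda>x\<in>carrier (std_res G (i + j)). f (\<xi> i x)) \<in> coboundaries G M (i + j)"
proof -
  interpret K: coeff G "triv_mod TYPE('k)" by (rule grp.coeff_triv)
  have d: "Poly_Mapping.keys (std_diff x) \<subseteq> tuples G n"
    if "Poly_Mapping.keys x \<subseteq> tuples G (Suc n)" for n and x :: "'g list \<Rightarrow>\<^sub>0 'k"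
    using that gmap_closed[OF gmap_std_diff, of x G n] by simp
  have \<xi>': "gmap G (tuple_mod G (Suc (n + j))) (tuple_mod G (Suc n)) (\<xi> n)" for n
    using \<xi>[of n] by (simp add: std_res_eq)
  obtain T0 where T0: "gmap G (tuple_mod G j) (tuple_mod G 1) T0"
    "\<And>x. Poly_Mapping.keys x \<subseteq> tuples G (Suc j) \<Longrightarrow> std_diff (T0 (std_diff x)) = std_diff (\<xi> 0 x)"
    "j = 0 \<Longrightarrow> T0 = (\<lambda>x. 0)"
  proof (cases j)
    case 0
    have "std_diff (\<xi> 0 x) = 0" if "Poly_Mapping.keys x \<subseteq> tuples G (Suc j)" for x
      using aug[of x] c that gmap_closed[OF \<xi>'[of 0], of x]
      by (simp add: 0 std_res_eq std_diff_eq_std_aug[of _ G] K.cochains_simps)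
    with that[of "\<lambda>x. 0"] gmap_const_zero[OF grp.gmod_tuple_mod, of "tuple_mod G j" 1] show thesis
      by simp
  next
    case (Suc p)
    with c obtain e where e: "e \<in> carrier (cochains G (triv_mod TYPE('k)) p)"
      "c = (\<lambda>x\<in>carrier (std_res G j). e (std_diff x))"
      using K.coboundary_SucE by metis
    then have ge: "gmap G (tuple_mod G (Suc p)) (triv_mod TYPE('k)) e"
      by (simp add: K.cochain_iff std_res_eq)
    have "std_diff (base_lift e (std_diff x)) = std_diff (\<xi> 0 x)"
      if x: "Poly_Mapping.keys x \<subseteq> tuples G (Suc j)" for x
    proof (subst std_aug_eq_iff[symmetric])
      show "Poly_Mapping.keys (base_lift e (std_diff x)) \<subseteq> tuples G 1"
        using gmap_closed[OF gmap_base_lift[OF ge], of "std_diff x"] d[OF x] Suc by simp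
      show "Poly_Mapping.keys (\<xi> 0 x) \<subseteq> tuples G 1"
        using gmap_closed[OF \<xi>'[of 0], of x] x by simp
      show "std_aug (base_lift e (std_diff x)) = std_aug (\<xi> 0 x)"
        using aug[of x] std_aug_base_lift[OF ge, of "std_diff x"] d[OF x] x
        by (simp add: e Suc std_res_eq)
    qed
    with that gmap_base_lift[OF ge] Suc show thesis by blast
  qed
  define T where "T = rec_nat T0 (\<lambda>n Tn. prism (\<lambda>x. \<xi> n x + pm_scale (-1) (Tn (std_diff x))))"
  have T_Suc: "T (Suc n) = prism (\<lambda>x. \<xi> n x + pm_scale (-1) (T n (std_diff x)))" for n
    by (simp add: T_def)
  have \<phi>: "gmap G (tuple_mod G (Suc (n + j))) (tuple_mod G (Suc n))
      (\<lambda>x. \<xi> n x + pm_scale (-1) (T n (std_diff x)))"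
    if T: "gmap G (tuple_mod G (n + j)) (tuple_mod G (Suc n)) (T n)" for n
    using gmap_plus[OF grp.gmod_tuple_mod \<xi>' gmap_scale[OF grp.gmod_tuple_mod gmap_comp[OF gmap_std_diff T], of "-1"]]
    by simp
  have T: "gmap G (tuple_mod G (n + j)) (tuple_mod G (Suc n)) (T n) \<and>
      (\<forall>x. Poly_Mapping.keys x \<subseteq> tuples G (Suc (n + j)) \<longrightarrow>
        std_diff (T n (std_diff x)) = std_diff (\<xi> n x))" (is "?T n") for n
  proof (induction n)
    case 0
    show ?case using T0 by (simp add: T_def)
  next
    case (Suc n)
    then have IH: "gmap G (tuple_mod G (n + j)) (tuple_mod G (Suc n)) (T n)"
      "\<And>x. Poly_Mapping.keys x \<subseteq> tuples G (Suc (n + j)) \<Longrightarrow>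
        std_diff (T n (std_diff x)) = std_diff (\<xi> n x)"
      by auto
    have "T n 0 = 0" using gmap_smult[OF IH(1), of 0 0] by simp
    then have "std_diff (T (Suc n) (std_diff x)) = std_diff (\<xi> (Suc n) x)"
      if "Poly_Mapping.keys x \<subseteq> tuples G (Suc (Suc n + j))" for x
      using std_diff_prism[OF \<phi>[OF IH(1)] _ d[of x "Suc (n + j)"]] IH(2) that chain[of x n]
      by (simp add: T_Suc std_res_eq pm_scale_minus_one)
    with gmap_prism[OF \<phi>[OF IH(1)]] show ?case by (simp add: T_Suc)
  qed
  have split: "\<xi> i x = std_diff (T (Suc i) x) + T i (std_diff x)"
    if "Poly_Mapping.keys x \<subseteq> tuples G (Suc (i + j))" for x
    using std_diff_prism[OF \<phi>[OF conjunct1[OF T]] _ that] T[of i]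
    by (simp add: T_Suc pm_scale_minus_one)
  have fc: "f \<in> carrier (cochains G M i)" and fd: "\<And>x. x \<in> carrier (std_res G (Suc i)) \<Longrightarrow> f (std_diff x) = \<zero>\<^bsub>M\<^esub>"
    and gf: "gmap G (std_res G i) M f"
    using f by (auto simp: cocycles_def cochain_iff)
  have val: "f (\<xi> i x) = f (T i (std_diff x))" if "x \<in> carrier (std_res G (i + j))" for x
  proof -
    have x: "Poly_Mapping.keys x \<subseteq> tuples G (Suc (i + j))" using that by (simp add: std_res_eq)
    have TS: "T (Suc i) x \<in> carrier (std_res G (Suc i))"
      using gmap_closed[OF conjunct1[OF T[of "Suc i"]], of x] x by (simp add: std_res_eq)
    have Td: "T i (std_diff x) \<in> carrier (std_res G i)"
      using gmap_closed[OF conjunct1[OF T[of i]], of "std_diff x"] d[OF x] by (simp add: std_res_eq)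
    show ?thesis
      using gmap_add[OF gf std_diff_closed[OF TS] Td] split[OF x] fd[OF TS] cochain_closed[OF fc Td]
      by (simp add: std_res_eq)
  qed
  show ?thesis
  proof (cases "i + j")
    case 0
    then have "T i = (\<lambda>x. 0)" using T0(3) by (simp add: T_def)
    then show ?thesis
      using val cochain_zero[OF fc] 0 by (auto simp: cochains_simps intro!: restrict_ext)
  next
    case (Suc p)
    have "gmap G (std_res G p) M (\<lambda>x. f (T i x))"
      using gmap_comp[OF conjunct1[OF T[of i]], of M f] gf by (simp add: std_res_eq Suc)
    then show ?thesis
      unfolding Suc by (rule coboundary_SucI) (use val Suc in auto)
  qed
qed

lemma lift_comp_cocycle:
  assumes f: "f \<in> cocycles G M i" and \<psi>: "is_lift G j h \<psi>"
  shows "compose (carrier (std_res G (i + j))) f (\<psi> i) \<in> cocycles G M (i + j)"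
proof -
  have gf: "gmap G (std_res G i) M f" using f by (auto simp: cocycles_def cochain_iff)
  have "f (\<psi> i (std_diff x)) = \<zero>\<^bsub>M\<^esub>" if "x \<in> carrier (std_res G (Suc i + j))" for x
  proof -
    have "\<psi> (Suc i) x \<in> carrier (std_res G (Suc i))"
      using gmap_closed[OF is_liftD(1)[OF \<psi>] that] .
    then show ?thesis
      using is_liftD(2)[OF \<psi> that] f by (auto simp: cocycles_def)
  qed
  then show ?thesis
    using restrict_cochain[OF gmap_comp[OF is_liftD(1)[OF \<psi>, of i] gf]] std_diff_closed[of _ "i + j"]
    by (auto simp: cocycles_def compose_def)
qed

lemma coboundary_comp_lift:
  assumes f: "f \<in> coboundaries G M i" and \<psi>: "is_lift G j h \<psi>"
  shows "compose (carrier (std_res G (i + j))) f (\<psi> i) \<in> coboundaries G M (i + j)"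
proof (cases i)
  case 0
  interpret C: vspace "cochains G M j" by (rule vspace_cochains)
  have "compose (carrier (std_res G j)) f (\<psi> 0) = \<zero>\<^bsub>cochains G M j\<^esub>"
    using f 0 gmap_closed[OF is_liftD(1)[OF \<psi>, of 0]]
    by (auto simp: cochains_simps compose_def intro!: restrict_ext)
  then show ?thesis using subsp_coboundaries[of j] by (simp add: 0 subsp_def)
next
  case (Suc p)
  with f obtain e where e: "e \<in> carrier (cochains G M p)"
    "f = (\<lambda>x\<in>carrier (std_res G i). e (std_diff x))"
    using coboundary_SucE by metis
  have "gmap G (std_res G (p + j)) M (\<lambda>x. e (\<psi> p x))"
    using gmap_comp[OF is_liftD(1)[OF \<psi>, of p], of M e] e by (simp add: cochain_iff)
  then have "compose (carrier (std_res G (i + j))) f (\<psi> i) \<in> coboundaries G M (Suc (p + j))"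
    by (rule coboundary_SucI)
      (use e is_liftD(2)[OF \<psi>, of _ p] gmap_closed[OF is_liftD(1)[OF \<psi>, of i]] Suc
       in \<open>auto simp: compose_def\<close>)
  then show ?thesis by (simp add: Suc)
qed

text \<open>
  Two lifts of cohomologous cocycles differ by a lift of a coboundary, and changing \<open>f\<close> by a
  coboundary changes the composite by one because a lift commutes with the differential. Hence
  any choice of representatives and of a lift computes the product.
\<close>

lemma yoneda_eq:
  assumes f: "f \<in> cocycles G M i" and h: "h \<in> cocycles G (triv_mod TYPE('k)) j"
    and \<psi>: "is_lift G j h \<psi>"
  shows "yoneda G M i j (ext_class G M i f) (ext_class G (triv_mod TYPE('k)) j h)
    = ext_class G M (i + j) (compose (carrier (std_res G (i + j))) f (\<psi> i))"
  unfolding yoneda_def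
proof (rule the_equality)
  interpret K: coeff G "triv_mod TYPE('k)" by (rule grp.coeff_triv)
  let ?K = "triv_mod TYPE('k) :: ('k, 'k, 'g) gmodule" and ?R = "carrier (std_res G (i + j))"
  show "\<exists>f'\<in>ext_class G M i f. \<exists>h'\<in>ext_class G ?K j h. \<exists>\<psi>'. is_lift G j h' \<psi>' \<and>
      ext_class G M (i + j) (compose ?R f (\<psi> i)) = ext_class G M (i + j) (compose ?R f' (\<psi>' i))"
    using f h \<psi> ext_class_self K.ext_class_self by blast
  fix Z
  assume "\<exists>f'\<in>ext_class G M i f. \<exists>h'\<in>ext_class G ?K j h. \<exists>\<psi>'. is_lift G j h' \<psi>' \<and>
      Z = ext_class G M (i + j) (compose ?R f' (\<psi>' i))"
  then obtain f' h' \<psi>' where f': "f' \<in> ext_class G M i f" and h': "h' \<in> ext_class G ?K j h"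
    and \<psi>': "is_lift G j h' \<psi>'" and Z: "Z = ext_class G M (i + j) (compose ?R f' (\<psi>' i))"
    by blast
  obtain b where b: "b \<in> coboundaries G M i" "f' = (\<lambda>x\<in>carrier (std_res G i). b x \<oplus>\<^bsub>M\<^esub> f x)"
    and f'c: "f' \<in> cocycles G M i"
    using cochain_coset_memD[OF f' f] .
  obtain c where c: "c \<in> coboundaries G ?K j" "h' = (\<lambda>x\<in>carrier (std_res G j). c x + h x)"
    and h'c: "h' \<in> cocycles G ?K j"
    using K.cochain_coset_memD[OF h' h] by auto
  note \<psi>c = gmap_closed[OF is_liftD(1)[OF \<psi>]] and \<psi>'c = gmap_closed[OF is_liftD(1)[OF \<psi>']]
  have 1: "ext_class G M (i + j) (compose ?R f' (\<psi>' i)) = ext_class G M (i + j) (compose ?R f (\<psi>' i))"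
    by (rule ext_class_eqI[OF lift_comp_cocycle[OF f'c \<psi>'] lift_comp_cocycle[OF f \<psi>']
          coboundary_comp_lift[OF b(1) \<psi>']])
      (use \<psi>'c in \<open>auto simp: b compose_def\<close>)
  define \<xi> where "\<xi> n x = \<psi>' n x + pm_scale (-1) (\<psi> n x)" for n x
  have g\<xi>: "gmap G (std_res G (n + j)) (std_res G n) (\<xi> n)" for n
    using gmap_plus[OF grp.gmod_std_res is_liftD(1)[OF \<psi>']
      gmap_scale[OF grp.gmod_std_res is_liftD(1)[OF \<psi>], where c = "-1"]]
    unfolding \<xi>_def by (simp add: std_res_eq)
  have cob: "(\<lambda>x\<in>?R. f (\<xi> i x)) \<in> coboundaries G M (i + j)"
  proof (rule lift_of_coboundary[OF _ _ _ c(1) f])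
    fix n
    show "gmap G (std_res G (n + j)) (std_res G n) (\<xi> n)" by (rule g\<xi>)
    show "std_diff (\<xi> (Suc n) x) = \<xi> n (std_diff x)"
      if "x \<in> carrier (std_res G (Suc n + j))" for x
      using is_liftD(2)[OF \<psi> that] is_liftD(2)[OF \<psi>' that] by (simp add: \<xi>_def)
  next
    fix x :: "'g list \<Rightarrow>\<^sub>0 'k"
    assume "x \<in> carrier (std_res G j)"
    then show "std_aug (\<xi> 0 x) = c x"
      using is_liftD(3)[OF \<psi>, of x] is_liftD(3)[OF \<psi>', of x] c(2) by (simp add: \<xi>_def)
  qed
  have "f (\<psi>' i x) = f (\<xi> i x) \<oplus>\<^bsub>M\<^esub> f (\<psi> i x)" if x: "x \<in> ?R" for x
  proof -
    have gf: "gmap G (std_res G i) M f" using f by (auto simp: cocycles_def cochain_iff)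
    note gmap_closed[OF g\<xi> x]
    from gmap_add[OF gf this \<psi>c[OF x]] show ?thesis
      by (simp add: \<xi>_def std_res_eq pm_scale_minus_one)
  qed
  then have 2: "ext_class G M (i + j) (compose ?R f (\<psi>' i)) = ext_class G M (i + j) (compose ?R f (\<psi> i))"
    by (intro ext_class_eqI[OF lift_comp_cocycle[OF f \<psi>'] lift_comp_cocycle[OF f \<psi>] cob])
      (simp add: compose_def)
  show "Z = ext_class G M (i + j) (compose ?R f (\<psi> i))"
    using Z 1 2 by simp
qed

end

context coeff
begin

lemma ext_class_add:
  "\<lbrakk>f \<in> cocycles G M m; f' \<in> cocycles G M m\<rbrakk> \<Longrightarrow>
    ext_class G M m f \<oplus>\<^bsub>Ext G M m\<^esub> ext_class G M m f' = ext_class G M m (\<lambda>x\<in>carrier (std_res G m). f x \<oplus>\<^bsub>M\<^esub> f' x)"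
  using vlin_add[OF ext_class_lin, of f m f'] by (simp add: cochains_simps)

lemma ext_class_smult:
  "f \<in> cocycles G M m \<Longrightarrow>
    c \<odot>\<^bsub>Ext G M m\<^esub> ext_class G M m f = ext_class G M m (\<lambda>x\<in>carrier (std_res G m). c \<odot>\<^bsub>M\<^esub> f x)"
  using vlin_smult[OF ext_class_lin, of f m c] by (simp add: cochains_simps)

lemma cocycle_add:
  "\<lbrakk>f \<in> cocycles G M m; f' \<in> cocycles G M m\<rbrakk> \<Longrightarrow> (\<lambda>x\<in>carrier (std_res G m). f x \<oplus>\<^bsub>M\<^esub> f' x) \<in> cocycles G M m"
  using subsp_cocycles[of m] by (auto simp: subsp_def cochains_simps)

lemma cocycle_smult:
  "f \<in> cocycles G M m \<Longrightarrow> (\<lambda>x\<in>carrier (std_res G m). c \<odot>\<^bsub>M\<^esub> f x) \<in> cocycles G M m"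
  using subsp_cocycles[of m] by (auto simp: subsp_def cochains_simps)

lemma cocycle_gmap: "f \<in> cocycles G M m \<Longrightarrow> gmap G (std_res G m) M f"
  by (simp add: cocycles_def cochain_iff)

lemma yoneda_closed:
  assumes "X \<in> carrier (Ext G M i)" "Y \<in> carrier (Ext G (triv_mod TYPE('k)) j)"
  shows "yoneda G M i j X Y \<in> carrier (Ext G M (i + j))"
proof -
  interpret K: coeff G "triv_mod TYPE('k)" by (rule grp.coeff_triv)
  obtain f where f: "f \<in> cocycles G M i" "X = ext_class G M i f" using ExtE[OF assms(1)] .
  obtain h where h: "h \<in> cocycles G (triv_mod TYPE('k)) j" "Y = ext_class G (triv_mod TYPE('k)) j h"
    using K.ExtE[OF assms(2)] .
  obtain \<psi> where \<psi>: "is_lift G j h \<psi>" using lift_exists[OF grp.group_axioms h(1)] .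
  show ?thesis
    using yoneda_eq[OF f(1) h(1) \<psi>] f h ext_class_closed lift_comp_cocycle[OF f(1) \<psi>] by simp
qed

lemma yoneda_linear_left:
  assumes "Y \<in> carrier (Ext G (triv_mod TYPE('k)) j)"
  shows "vlin (Ext G M i) (Ext G M (i + j)) (\<lambda>X. yoneda G M i j X Y)"
proof (rule vlinI)
  interpret K: coeff G "triv_mod TYPE('k)" by (rule grp.coeff_triv)
  obtain h where h: "h \<in> cocycles G (triv_mod TYPE('k)) j" "Y = ext_class G (triv_mod TYPE('k)) j h"
    using K.ExtE[OF assms] .
  obtain \<psi> where \<psi>: "is_lift G j h \<psi>" using lift_exists[OF grp.group_axioms h(1)] .
  let ?R = "carrier (std_res G (i + j))"
  note y = yoneda_eq[OF _ h(1) \<psi>, folded h(2)] and l = lift_comp_cocycle[OF _ \<psi>]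
  have \<psi>c: "\<psi> i x \<in> carrier (std_res G i)" if "x \<in> ?R" for x
    using gmap_closed[OF is_liftD(1)[OF \<psi>] that] .
  show "yoneda G M i j X Y \<in> carrier (Ext G M (i + j))" if "X \<in> carrier (Ext G M i)" for X
    using yoneda_closed[OF that assms] .
  fix X assume "X \<in> carrier (Ext G M i)"
  then obtain f where f: "f \<in> cocycles G M i" "X = ext_class G M i f" by (rule ExtE)
  { fix X' assume "X' \<in> carrier (Ext G M i)"
    then obtain f' where f': "f' \<in> cocycles G M i" "X' = ext_class G M i f'" by (rule ExtE)
    have "compose ?R (\<lambda>x\<in>carrier (std_res G i). f x \<oplus>\<^bsub>M\<^esub> f' x) (\<psi> i)
        = (\<lambda>x\<in>?R. compose ?R f (\<psi> i) x \<oplus>\<^bsub>M\<^esub> compose ?R f' (\<psi> i) x)"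
      using \<psi>c by (auto simp: compose_def intro!: restrict_ext)
    then show "yoneda G M i j (X \<oplus>\<^bsub>Ext G M i\<^esub> X') Y
        = yoneda G M i j X Y \<oplus>\<^bsub>Ext G M (i + j)\<^esub> yoneda G M i j X' Y"
      using f f' by (simp add: ext_class_add y cocycle_add l) }
  fix c
  have "compose ?R (\<lambda>x\<in>carrier (std_res G i). c \<odot>\<^bsub>M\<^esub> f x) (\<psi> i)
      = (\<lambda>x\<in>?R. c \<odot>\<^bsub>M\<^esub> compose ?R f (\<psi> i) x)"
    using \<psi>c by (auto simp: compose_def intro!: restrict_ext)
  then show "yoneda G M i j (c \<odot>\<^bsub>Ext G M i\<^esub> X) Y = c \<odot>\<^bsub>Ext G M (i + j)\<^esub> yoneda G M i j X Y"
    using f by (simp add: ext_class_smult y cocycle_smult l)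
qed

lemma yoneda_linear_right:
  assumes "X \<in> carrier (Ext G M i)"
  shows "vlin (Ext G (triv_mod TYPE('k)) j) (Ext G M (i + j)) (yoneda G M i j X)"
proof (rule vlinI)
  interpret K: coeff G "triv_mod TYPE('k)" by (rule grp.coeff_triv)
  let ?K = "triv_mod TYPE('k) :: ('k, 'k, 'g) gmodule"
  let ?R = "carrier (std_res G (i + j))"
  obtain f where f: "f \<in> cocycles G M i" "X = ext_class G M i f" using ExtE[OF assms] .
  note gf = cocycle_gmap[OF f(1)]
  show "yoneda G M i j X Y \<in> carrier (Ext G M (i + j))" if "Y \<in> carrier (Ext G ?K j)" for Y
    using yoneda_closed[OF assms that] .
  fix Y assume "Y \<in> carrier (Ext G ?K j)"
  then obtain h where h: "h \<in> cocycles G ?K j" "Y = ext_class G ?K j h" by (rule K.ExtE)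
  obtain \<psi> where \<psi>: "is_lift G j h \<psi>" using lift_exists[OF grp.group_axioms h(1)] .
  have \<psi>c: "\<psi> n x \<in> carrier (std_res G n)" if "x \<in> carrier (std_res G (n + j))" for n x
    using gmap_closed[OF is_liftD(1)[OF \<psi>] that] .
  { fix Y' assume "Y' \<in> carrier (Ext G ?K j)"
    then obtain h' where h': "h' \<in> cocycles G ?K j" "Y' = ext_class G ?K j h'" by (rule K.ExtE)
    obtain \<psi>' where \<psi>': "is_lift G j h' \<psi>'" using lift_exists[OF grp.group_axioms h'(1)] .
    have \<psi>'c: "\<psi>' n x \<in> carrier (std_res G n)" if "x \<in> carrier (std_res G (n + j))" for n x
      using gmap_closed[OF is_liftD(1)[OF \<psi>'] that] .
    have sum: "is_lift G j (\<lambda>x\<in>carrier (std_res G j). h x \<oplus>\<^bsub>?K\<^esub> h' x)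
        (\<lambda>n. \<lambda>x\<in>carrier (std_res G (n + j)). \<psi> n x \<oplus>\<^bsub>std_res G n\<^esub> \<psi>' n x)"
      by (rule is_liftI[OF grp.group_axioms gmap_plus[OF grp.gmod_std_res is_liftD(1)[OF \<psi>] is_liftD(1)[OF \<psi>']]])
        (use is_liftD(2,3)[OF \<psi>] is_liftD(2,3)[OF \<psi>'] in \<open>simp_all add: std_res_eq\<close>)
    have "compose ?R f (\<lambda>x\<in>?R. \<psi> i x \<oplus>\<^bsub>std_res G i\<^esub> \<psi>' i x)
        = (\<lambda>x\<in>?R. compose ?R f (\<psi> i) x \<oplus>\<^bsub>M\<^esub> compose ?R f (\<psi>' i) x)"
      using gmap_add[OF gf \<psi>c \<psi>'c] by (auto simp: compose_def intro!: restrict_ext)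
    then show "yoneda G M i j X (Y \<oplus>\<^bsub>Ext G ?K j\<^esub> Y')
        = yoneda G M i j X Y \<oplus>\<^bsub>Ext G M (i + j)\<^esub> yoneda G M i j X Y'"
      using yoneda_eq[OF f(1) K.cocycle_add[OF h(1) h'(1)] sum] yoneda_eq[OF f(1) h(1) \<psi>]
        yoneda_eq[OF f(1) h'(1) \<psi>'] lift_comp_cocycle[OF f(1) \<psi>] lift_comp_cocycle[OF f(1) \<psi>'] f h h'
      by (simp only: K.ext_class_add ext_class_add) }
  fix c
  have sc: "is_lift G j (\<lambda>x\<in>carrier (std_res G j). c \<odot>\<^bsub>?K\<^esub> h x)
      (\<lambda>n. \<lambda>x\<in>carrier (std_res G (n + j)). c \<odot>\<^bsub>std_res G n\<^esub> \<psi> n x)"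
    by (rule is_liftI[OF grp.group_axioms gmap_scale[OF grp.gmod_std_res is_liftD(1)[OF \<psi>]]])
      (use is_liftD(2,3)[OF \<psi>] in \<open>simp_all add: std_res_eq\<close>)
  have "compose ?R f (\<lambda>x\<in>?R. c \<odot>\<^bsub>std_res G i\<^esub> \<psi> i x) = (\<lambda>x\<in>?R. c \<odot>\<^bsub>M\<^esub> compose ?R f (\<psi> i) x)"
    using gmap_smult[OF gf \<psi>c] by (auto simp: compose_def intro!: restrict_ext)
  then show "yoneda G M i j X (c \<odot>\<^bsub>Ext G ?K j\<^esub> Y) = c \<odot>\<^bsub>Ext G M (i + j)\<^esub> yoneda G M i j X Y"
    using yoneda_eq[OF f(1) K.cocycle_smult[OF h(1)] sc] yoneda_eq[OF f(1) h(1) \<psi>]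
      lift_comp_cocycle[OF f(1) \<psi>] f h
    by (simp only: K.ext_class_smult ext_class_smult)
qed

end

section \<open>Functoriality in the coefficients\<close>

definition ext_push ::
  "('g, 'z) monoid_scheme \<Rightarrow> ('k::field, 'v, 'g) gmodule \<Rightarrow> ('k, 'w, 'g) gmodule \<Rightarrow> nat \<Rightarrow> ('v \<Rightarrow> 'w)
    \<Rightarrow> (('g list \<Rightarrow>\<^sub>0 'k) \<Rightarrow> 'v) set \<Rightarrow> (('g list \<Rightarrow>\<^sub>0 'k) \<Rightarrow> 'w) set" where
  "ext_push G M N m \<theta> X =
     coboundaries G N m <+>\<^bsub>cochains G N m\<^esub> ((\<lambda>f. compose (carrier (std_res G m)) \<theta> f) ` X)"

lemma ext_map_eq_push: "ext_map G M m \<theta> = ext_push G M M m \<theta>"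
  by (simp add: ext_map_def[abs_def] ext_push_def[abs_def])

locale coeff_map = M: coeff G M + N: coeff G N
  for G :: "('g, 'z) monoid_scheme" and M :: "('k::field, 'v, 'g) gmodule"
    and N :: "('k, 'w, 'g) gmodule" +
  fixes \<theta> :: "'v \<Rightarrow> 'w"
  assumes gmap: "gmap G M N \<theta>"
begin

lemma push_cochain:
  "f \<in> carrier (cochains G M m) \<Longrightarrow> compose (carrier (std_res G m)) \<theta> f \<in> carrier (cochains G N m)"
  unfolding compose_def
  by (rule N.restrict_cochain) (use gmap_comp[OF _ gmap] in \<open>auto simp: M.cochain_iff\<close>)

lemma push_cocycle:
  assumes "f \<in> cocycles G M m"
  shows "compose (carrier (std_res G m)) \<theta> f \<in> cocycles G N m"
  using assms push_cochain gmap_zero[OF gmap M.vspace_axioms N.vspace_axioms]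
  by (auto simp: cocycles_def compose_def M.std_diff_closed)

lemma push_coboundary:
  assumes "f \<in> coboundaries G M m"
  shows "compose (carrier (std_res G m)) \<theta> f \<in> coboundaries G N m"
proof (cases m)
  case 0
  then show ?thesis
    using assms gmap_zero[OF gmap M.vspace_axioms N.vspace_axioms]
    by (auto simp: M.cochains_simps N.cochains_simps compose_def intro!: restrict_ext)
next
  case (Suc p)
  with assms obtain e where e: "e \<in> carrier (cochains G M p)"
    "f = (\<lambda>x\<in>carrier (std_res G m). e (std_diff x))"
    using M.coboundary_SucE by metis
  have "gmap G (std_res G p) N (\<lambda>x. \<theta> (e x))"
    using gmap_comp[OF _ gmap] e(1) by (auto simp: M.cochain_iff)
  then show ?thesis
    unfolding Suc by (rule N.coboundary_SucI) (auto simp: e Suc compose_def)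
qed

lemma push_class:
  assumes "f \<in> cocycles G M m"
  shows "ext_push G M N m \<theta> (ext_class G M m f) = ext_class G N m (compose (carrier (std_res G m)) \<theta> f)"
proof -
  have "vlin (M.Z m) (N.Z m) (\<lambda>f. compose (carrier (std_res G m)) \<theta> f)"
    using push_cocycle gmap
    by (intro vlinI)
      (auto simp: M.cochains_simps N.cochains_simps compose_def cocycles_def M.cochain_closed gmap_add gmap_smult
        intro!: restrict_ext)
  from set_add_image_coset[OF M.quotient_Z N.quotient_Z this _, of f] push_coboundary assms
  show ?thesis
    by (auto simp: ext_push_def M.ext_class_eq N.ext_class_eq set_add_def' )
qed

lemma push_closed:
  assumes "X \<in> carrier (Ext G M m)" shows "ext_push G M N m \<theta> X \<in> carrier (Ext G N m)"
  using assms push_class push_cocycle N.ext_class_closed by (metis M.ExtE)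

lemma push_linear: "vlin (Ext G M m) (Ext G N m) (ext_push G M N m \<theta>)"
proof (rule vlinI)
  let ?R = "carrier (std_res G m)"
  fix X assume "X \<in> carrier (Ext G M m)"
  then obtain f where f: "f \<in> cocycles G M m" "X = ext_class G M m f" by (rule M.ExtE)
  have fc: "f x \<in> carrier M" if "x \<in> ?R" for x
    using f(1) that M.cochain_closed by (auto simp: cocycles_def)
  { fix X' assume "X' \<in> carrier (Ext G M m)"
    then obtain f' where f': "f' \<in> cocycles G M m" "X' = ext_class G M m f'" by (rule M.ExtE)
    have f'c: "f' x \<in> carrier M" if "x \<in> ?R" for x
      using f'(1) that M.cochain_closed by (auto simp: cocycles_def)
    have "compose ?R \<theta> (\<lambda>x\<in>?R. f x \<oplus>\<^bsub>M\<^esub> f' x) = (\<lambda>x\<in>?R. compose ?R \<theta> f x \<oplus>\<^bsub>N\<^esub> compose ?R \<theta> f' x)"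
      using gmap_add[OF gmap fc f'c] by (auto simp: compose_def intro!: restrict_ext)
    then show "ext_push G M N m \<theta> (X \<oplus>\<^bsub>Ext G M m\<^esub> X')
        = ext_push G M N m \<theta> X \<oplus>\<^bsub>Ext G N m\<^esub> ext_push G M N m \<theta> X'"
      using f f' by (simp add: M.ext_class_add push_class M.cocycle_add N.ext_class_add push_cocycle) }
  fix c
  have "compose ?R \<theta> (\<lambda>x\<in>?R. c \<odot>\<^bsub>M\<^esub> f x) = (\<lambda>x\<in>?R. c \<odot>\<^bsub>N\<^esub> compose ?R \<theta> f x)"
    using gmap_smult[OF gmap fc] by (auto simp: compose_def intro!: restrict_ext)
  then show "ext_push G M N m \<theta> (c \<odot>\<^bsub>Ext G M m\<^esub> X) = c \<odot>\<^bsub>Ext G N m\<^esub> ext_push G M N m \<theta> X"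
    using f by (simp add: M.ext_class_smult push_class M.cocycle_smult N.ext_class_smult push_cocycle)
qed (rule push_closed)

lemma push_yoneda:
  assumes "X \<in> carrier (Ext G M i)" "Y \<in> carrier (Ext G (triv_mod TYPE('k)) j)"
  shows "ext_push G M N (i + j) \<theta> (yoneda G M i j X Y) = yoneda G N i j (ext_push G M N i \<theta> X) Y"
proof -
  interpret K: coeff G "triv_mod TYPE('k)" by (rule M.grp.coeff_triv)
  obtain f where f: "f \<in> cocycles G M i" "X = ext_class G M i f" using M.ExtE[OF assms(1)] .
  obtain h where h: "h \<in> cocycles G (triv_mod TYPE('k)) j" "Y = ext_class G (triv_mod TYPE('k)) j h"
    using K.ExtE[OF assms(2)] .
  obtain \<psi> where \<psi>: "is_lift G j h \<psi>" using lift_exists[OF M.grp.group_axioms h(1)] .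
  have "compose (carrier (std_res G (i + j))) \<theta> (compose (carrier (std_res G (i + j))) f (\<psi> i))
      = compose (carrier (std_res G (i + j))) (compose (carrier (std_res G i)) \<theta> f) (\<psi> i)"
    using gmap_closed[OF is_liftD(1)[OF \<psi>, of i]] by (auto simp: compose_def intro!: restrict_ext)
  then show ?thesis
    using f h
    by (simp add: M.yoneda_eq[OF _ _ \<psi>] N.yoneda_eq[OF _ _ \<psi>] push_class push_cocycle
        M.lift_comp_cocycle[OF _ \<psi>])
qed

end

lemma push_comp:
  assumes "coeff_map G L M \<eta>" "coeff_map G M N \<theta>" "X \<in> carrier (Ext G L m)"
  shows "ext_push G M N m \<theta> (ext_push G L M m \<eta> X) = ext_push G L N m (\<lambda>v. \<theta> (\<eta> v)) X"
proof -
  interpret \<eta>: coeff_map G L M \<eta> by fact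
  interpret \<theta>: coeff_map G M N \<theta> by fact
  interpret \<theta>\<eta>: coeff_map G L N "\<lambda>v. \<theta> (\<eta> v)"
    by unfold_locales (rule gmap_comp[OF \<eta>.gmap \<theta>.gmap])
  obtain f where f: "f \<in> cocycles G L m" "X = ext_class G L m f" using \<eta>.M.ExtE[OF assms(3)] .
  have "compose (carrier (std_res G m)) \<theta> (compose (carrier (std_res G m)) \<eta> f)
      = compose (carrier (std_res G m)) (\<lambda>v. \<theta> (\<eta> v)) f"
    by (auto simp: compose_def intro!: restrict_ext)
  then show ?thesis
    using f by (simp add: \<eta>.push_class \<theta>.push_class \<theta>\<eta>.push_class \<eta>.push_cocycle)
qed

lemma push_cong:
  assumes "coeff_map G M N \<theta>" "\<And>v. v \<in> carrier M \<Longrightarrow> \<eta> v = \<theta> v" "X \<in> carrier (Ext G M m)"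
  shows "ext_push G M N m \<eta> X = ext_push G M N m \<theta> X"
proof -
  interpret \<theta>: coeff_map G M N \<theta> by fact
  interpret \<eta>: coeff_map G M N \<eta>
    by unfold_locales (rule gmap_cong[OF \<theta>.gmap assms(2) \<theta>.M.gmod_axioms])
  obtain f where f: "f \<in> cocycles G M m" "X = ext_class G M m f" using \<theta>.M.ExtE[OF assms(3)] .
  have "compose (carrier (std_res G m)) \<theta> f = compose (carrier (std_res G m)) \<eta> f"
    using f(1) assms(2) by (auto simp: compose_def cocycles_def \<theta>.M.cochain_closed intro!: restrict_ext)
  then show ?thesis using f by (simp add: \<theta>.push_class \<eta>.push_class)
qed

lemma (in coeff) coeff_map_ident: "coeff_map G M M (\<lambda>v. v)"
  by unfold_locales (auto simp: gmap_def equivariant_def intro: vlinI)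

lemma (in coeff) push_ident:
  assumes "X \<in> carrier (Ext G M m)" shows "ext_push G M M m (\<lambda>v. v) X = X"
proof -
  interpret coeff_map G M M "\<lambda>v. v" by (rule coeff_map_ident)
  obtain f where f: "f \<in> cocycles G M m" "X = ext_class G M m f" using ExtE[OF assms] .
  have "compose (carrier (std_res G m)) (\<lambda>v. v) f = f"
    using f(1) by (auto simp: compose_def cocycles_def cochain_iff intro: extensional_restrict)
  then show ?thesis using f push_class by simp
qed

lemma coeff_map_plus:
  assumes "coeff_map G M N \<theta>" "coeff_map G M N \<eta>"
  shows "coeff_map G M N (\<lambda>v. \<theta> v \<oplus>\<^bsub>N\<^esub> \<eta> v)"
proof -
  interpret \<theta>: coeff_map G M N \<theta> by fact
  interpret \<eta>: coeff_map G M N \<eta> by fact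
  show ?thesis by unfold_locales (rule gmap_plus[OF \<theta>.N.gmod_axioms \<theta>.gmap \<eta>.gmap])
qed

lemma coeff_map_scale:
  assumes "coeff_map G M N \<theta>"
  shows "coeff_map G M N (\<lambda>v. c \<odot>\<^bsub>N\<^esub> \<theta> v)"
proof -
  interpret \<theta>: coeff_map G M N \<theta> by fact
  show ?thesis by unfold_locales (rule gmap_scale[OF \<theta>.N.gmod_axioms \<theta>.gmap])
qed

lemma push_plus:
  assumes "coeff_map G M N \<theta>" "coeff_map G M N \<eta>" "X \<in> carrier (Ext G M m)"
  shows "ext_push G M N m (\<lambda>v. \<theta> v \<oplus>\<^bsub>N\<^esub> \<eta> v) X
    = ext_push G M N m \<theta> X \<oplus>\<^bsub>Ext G N m\<^esub> ext_push G M N m \<eta> X"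
proof -
  interpret \<theta>: coeff_map G M N \<theta> by fact
  interpret \<eta>: coeff_map G M N \<eta> by fact
  interpret s: coeff_map G M N "\<lambda>v. \<theta> v \<oplus>\<^bsub>N\<^esub> \<eta> v" by (rule coeff_map_plus) fact+
  let ?R = "carrier (std_res G m)"
  obtain f where f: "f \<in> cocycles G M m" "X = ext_class G M m f" using \<theta>.M.ExtE[OF assms(3)] .
  have "compose ?R (\<lambda>v. \<theta> v \<oplus>\<^bsub>N\<^esub> \<eta> v) f = (\<lambda>x\<in>?R. compose ?R \<theta> f x \<oplus>\<^bsub>N\<^esub> compose ?R \<eta> f x)"
    by (auto simp: compose_def intro!: restrict_ext)
  then show ?thesis
    using f by (simp add: s.push_class \<theta>.push_class \<eta>.push_class \<theta>.push_cocycle \<eta>.push_cocycle \<theta>.N.ext_class_add)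
qed

lemma push_scale:
  assumes "coeff_map G M N \<theta>" "X \<in> carrier (Ext G M m)"
  shows "ext_push G M N m (\<lambda>v. c \<odot>\<^bsub>N\<^esub> \<theta> v) X = c \<odot>\<^bsub>Ext G N m\<^esub> ext_push G M N m \<theta> X"
proof -
  interpret \<theta>: coeff_map G M N \<theta> by fact
  interpret s: coeff_map G M N "\<lambda>v. c \<odot>\<^bsub>N\<^esub> \<theta> v" by (rule coeff_map_scale) fact
  let ?R = "carrier (std_res G m)"
  obtain f where f: "f \<in> cocycles G M m" "X = ext_class G M m f" using \<theta>.M.ExtE[OF assms(2)] .
  have "compose ?R (\<lambda>v. c \<odot>\<^bsub>N\<^esub> \<theta> v) f = (\<lambda>x\<in>?R. c \<odot>\<^bsub>N\<^esub> compose ?R \<theta> f x)"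
    by (auto simp: compose_def intro!: restrict_ext)
  then show ?thesis
    using f by (simp add: s.push_class \<theta>.push_class \<theta>.push_cocycle \<theta>.N.ext_class_smult)
qed

section \<open>Total cohomology\<close>

lemma total_ext_simps [simp]:
  "carrier (total_ext G \<Phi> M) = total_ext_carrier G M"
  "\<zero>\<^bsub>total_ext G \<Phi> M\<^esub> = (\<lambda>m. \<zero>\<^bsub>Ext G M m\<^esub>)"
  "x \<oplus>\<^bsub>total_ext G \<Phi> M\<^esub> y = (\<lambda>m. x m \<oplus>\<^bsub>Ext G M m\<^esub> y m)"
  "c \<odot>\<^bsub>total_ext G \<Phi> M\<^esub> x = (\<lambda>m. c \<odot>\<^bsub>Ext G M m\<^esub> x m)"
  "gact (total_ext G \<Phi> M) h x = (\<lambda>m. ext_map G M m (\<Phi> h) (x m))"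
  "ract (total_ext G \<Phi> M) x b = (\<lambda>n. \<Oplus>\<^bsub>Ext G M n\<^esub>i\<in>{..n}. yoneda G M i (n - i) (x i) (b (n - i)))"
  "hcomp (total_ext G \<Phi> M) n = {x \<in> total_ext_carrier G M. \<forall>m. m \<noteq> n \<longrightarrow> x m = \<zero>\<^bsub>Ext G M m\<^esub>}"
  by (simp_all add: total_ext_def)

lemma total_ext_carrierI:
  assumes "\<And>m. x m \<in> carrier (Ext G M m)" "\<And>m. m \<ge> N \<Longrightarrow> x m = \<zero>\<^bsub>Ext G M m\<^esub>"
  shows "x \<in> total_ext_carrier G M"
proof -
  have "{m. x m \<noteq> \<zero>\<^bsub>Ext G M m\<^esub>} \<subseteq> {..<N}" using assms(2) by (auto simp: not_le[symmetric])
  then show ?thesis using assms(1) by (auto simp: total_ext_carrier_def intro: finite_subset)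
qed

lemma total_ext_carrierE:
  assumes "x \<in> total_ext_carrier G M"
  obtains N where "\<And>m. x m \<in> carrier (Ext G M m)" "\<And>m. m \<ge> N \<Longrightarrow> x m = \<zero>\<^bsub>Ext G M m\<^esub>"
proof -
  have "finite {m. x m \<noteq> \<zero>\<^bsub>Ext G M m\<^esub>}" using assms by (simp add: total_ext_carrier_def)
  then obtain N where "{m. x m \<noteq> \<zero>\<^bsub>Ext G M m\<^esub>} \<subseteq> {..<N}"
    by (auto simp: finite_nat_iff_bounded)
  then have "x m = \<zero>\<^bsub>Ext G M m\<^esub>" if "m \<ge> N" for m using that by auto
  then show thesis using assms that by (auto simp: total_ext_carrier_def)
qed

lemma total_ext_comp: "x \<in> total_ext_carrier G M \<Longrightarrow> x m \<in> carrier (Ext G M m)"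
  by (simp add: total_ext_carrier_def)

context coeff
begin

lemma vspace_total: "vspace (total_ext G \<Phi> M)"
proof -
  interpret E: vspace "Ext G M m" for m by (rule vspace_Ext)
  show ?thesis
  proof (rule vspaceI, goal_cases)
    case (1 x y)
    obtain N where N: "\<And>m. x m \<in> carrier (Ext G M m)" "\<And>m. m \<ge> N \<Longrightarrow> x m = \<zero>\<^bsub>Ext G M m\<^esub>"
      using 1 total_ext_carrierE[of x G M] by auto
    obtain N' where N': "\<And>m. y m \<in> carrier (Ext G M m)" "\<And>m. m \<ge> N' \<Longrightarrow> y m = \<zero>\<^bsub>Ext G M m\<^esub>"
      using 1 total_ext_carrierE[of y G M] by auto
    show ?case using N N' by (auto intro!: total_ext_carrierI[where N = "max N N'"])
  next
    case 2
    show ?case by (auto intro!: total_ext_carrierI[where N = 0])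
  next
    case (7 c x)
    obtain N where N: "\<And>m. x m \<in> carrier (Ext G M m)" "\<And>m. m \<ge> N \<Longrightarrow> x m = \<zero>\<^bsub>Ext G M m\<^esub>"
      using 7 total_ext_carrierE[of x G M] by auto
    show ?case using N by (auto intro!: total_ext_carrierI[where N = N])
  qed (auto simp: total_ext_comp E.a_ac E.smult_r_distr E.smult_l_distr E.smult_assoc fun_eq_iff)
qed

lemma yoneda_zero_left:
  "Y \<in> carrier (Ext G (triv_mod TYPE('k)) j) \<Longrightarrow> yoneda G M i j \<zero>\<^bsub>Ext G M i\<^esub> Y = \<zero>\<^bsub>Ext G M (i + j)\<^esub>"
  using vlin_zero[OF vspace_Ext vspace_Ext yoneda_linear_left] .

lemma yoneda_zero_right:
  "X \<in> carrier (Ext G M i) \<Longrightarrow> yoneda G M i j X \<zero>\<^bsub>Ext G (triv_mod TYPE('k)) j\<^esub> = \<zero>\<^bsub>Ext G M (i + j)\<^esub>"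
  using vlin_zero[OF coeff.vspace_Ext[OF grp.coeff_triv] vspace_Ext yoneda_linear_right] .

lemma yoneda_summand:
  assumes "x \<in> total_ext_carrier G M" "b \<in> total_ext_carrier G (triv_mod TYPE('k))" "i \<le> n"
  shows "yoneda G M i (n - i) (x i) (b (n - i)) \<in> carrier (Ext G M n)"
  using yoneda_closed[OF total_ext_comp[OF assms(1), of i] total_ext_comp[OF assms(2), of "n - i"]] assms(3)
  by simp

lemma ract_closed:
  assumes x: "x \<in> total_ext_carrier G M" and b: "b \<in> total_ext_carrier G (triv_mod TYPE('k))"
  shows "ract (total_ext G \<Phi> M) x b \<in> total_ext_carrier G M"
proof -
  interpret E: vspace "Ext G M m" for m by (rule vspace_Ext)
  obtain N where N: "\<And>m. m \<ge> N \<Longrightarrow> x m = \<zero>\<^bsub>Ext G M m\<^esub>" by (rule total_ext_carrierE[OF x]) blast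
  obtain N' where N': "\<And>m. m \<ge> N' \<Longrightarrow> b m = \<zero>\<^bsub>Ext G (triv_mod TYPE('k)) m\<^esub>" by (rule total_ext_carrierE[OF b]) blast
  show ?thesis
  proof (rule total_ext_carrierI[where N = "N + N'"])
    show "ract (total_ext G \<Phi> M) x b m \<in> carrier (Ext G M m)" for m
      using yoneda_summand[OF x b] by (auto intro!: E.finsum_closed)
    fix n assume n: "N + N' \<le> n"
    have "yoneda G M i (n - i) (x i) (b (n - i)) = \<zero>\<^bsub>Ext G M n\<^esub>" if "i \<le> n" for i
    proof (cases "i \<ge> N")
      case True
      then show ?thesis
        using N[of i] yoneda_zero_left[OF total_ext_comp[OF b], of i "n - i"] that by simp
    next
      case False
      then show ?thesis
        using N'[of "n - i"] yoneda_zero_right[OF total_ext_comp[OF x], of i "n - i"] that n by simp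
    qed
    then have "(\<Oplus>\<^bsub>Ext G M n\<^esub>i\<in>{..n}. yoneda G M i (n - i) (x i) (b (n - i))) = (\<Oplus>\<^bsub>Ext G M n\<^esub>i\<in>{..n}. \<zero>\<^bsub>Ext G M n\<^esub>)"
      by (intro E.finsum_cong') auto
    then show "ract (total_ext G \<Phi> M) x b n = \<zero>\<^bsub>Ext G M n\<^esub>" by simp
  qed
qed

lemma ract_linear_left:
  assumes b: "b \<in> total_ext_carrier G (triv_mod TYPE('k))"
  shows "vlin (total_ext G \<Phi> M) (total_ext G \<Phi>' M) (\<lambda>x. ract (total_ext G \<Psi> M) x b)"
proof -
  interpret E: vspace "Ext G M m" for m by (rule vspace_Ext)
  note lin = yoneda_linear_left[OF total_ext_comp[OF b]]
  show ?thesis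
  proof (rule vlinI)
    fix x assume "x \<in> carrier (total_ext G \<Phi> M)"
    then have x: "x \<in> total_ext_carrier G M" by simp
    show "ract (total_ext G \<Psi> M) x b \<in> carrier (total_ext G \<Phi>' M)"
      using ract_closed[OF x b] by simp
    { fix y assume "y \<in> carrier (total_ext G \<Phi> M)"
      then have y: "y \<in> total_ext_carrier G M" by simp
      have "(\<Oplus>\<^bsub>Ext G M n\<^esub>i\<in>{..n}. yoneda G M i (n - i) (x i \<oplus>\<^bsub>Ext G M i\<^esub> y i) (b (n - i)))
        = (\<Oplus>\<^bsub>Ext G M n\<^esub>i\<in>{..n}. yoneda G M i (n - i) (x i) (b (n - i)) \<oplus>\<^bsub>Ext G M n\<^esub>
            yoneda G M i (n - i) (y i) (b (n - i)))" for n
        using vlin_add[OF lin total_ext_comp[OF x] total_ext_comp[OF y]] yoneda_summand[OF x b] yoneda_summand[OF y b]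
        by (intro E.finsum_cong') auto
      then show "ract (total_ext G \<Psi> M) (x \<oplus>\<^bsub>total_ext G \<Phi> M\<^esub> y) b
          = ract (total_ext G \<Psi> M) x b \<oplus>\<^bsub>total_ext G \<Phi>' M\<^esub> ract (total_ext G \<Psi> M) y b"
        using yoneda_summand[OF x b] yoneda_summand[OF y b] by (simp add: E.finsum_addf Pi_def) }
    fix c
    have sum: "c \<odot>\<^bsub>Ext G M n\<^esub> (\<Oplus>\<^bsub>Ext G M n\<^esub>i\<in>{..n}. yoneda G M i (n - i) (x i) (b (n - i)))
      = (\<Oplus>\<^bsub>Ext G M n\<^esub>i\<in>{..n}. c \<odot>\<^bsub>Ext G M n\<^esub> yoneda G M i (n - i) (x i) (b (n - i)))" for n
      using yoneda_summand[OF x b] by (intro vlin_finsum[OF vspace_Ext vspace_Ext E.scale_lin]) auto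
    have "(\<Oplus>\<^bsub>Ext G M n\<^esub>i\<in>{..n}. yoneda G M i (n - i) (c \<odot>\<^bsub>Ext G M i\<^esub> x i) (b (n - i)))
      = (\<Oplus>\<^bsub>Ext G M n\<^esub>i\<in>{..n}. c \<odot>\<^bsub>Ext G M n\<^esub> yoneda G M i (n - i) (x i) (b (n - i)))" for n
      using vlin_smult[OF lin total_ext_comp[OF x]] yoneda_summand[OF x b]
      by (intro E.finsum_cong') auto
    then show "ract (total_ext G \<Psi> M) (c \<odot>\<^bsub>total_ext G \<Phi> M\<^esub> x) b
        = c \<odot>\<^bsub>total_ext G \<Phi>' M\<^esub> ract (total_ext G \<Psi> M) x b"
      by (simp add: sum)
  qed
qed

lemma ract_linear_right:
  assumes x: "x \<in> total_ext_carrier G M"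
  shows "vlin (total_ext G \<Phi> (triv_mod TYPE('k))) (total_ext G \<Phi>' M) (ract (total_ext G \<Psi> M) x)"
proof -
  interpret E: vspace "Ext G M m" for m by (rule vspace_Ext)
  let ?K = "triv_mod TYPE('k) :: ('k, 'k, 'g) gmodule"
  note lin = yoneda_linear_right[OF total_ext_comp[OF x]]
  show ?thesis
  proof (rule vlinI)
    fix b assume "b \<in> carrier (total_ext G \<Phi> ?K)"
    then have b: "b \<in> total_ext_carrier G ?K" by simp
    show "ract (total_ext G \<Psi> M) x b \<in> carrier (total_ext G \<Phi>' M)"
      using ract_closed[OF x b] by simp
    { fix y assume "y \<in> carrier (total_ext G \<Phi> ?K)"
      then have y: "y \<in> total_ext_carrier G ?K" by simp
      have "(\<Oplus>\<^bsub>Ext G M n\<^esub>i\<in>{..n}. yoneda G M i (n - i) (x i) (b (n - i) \<oplus>\<^bsub>Ext G ?K (n - i)\<^esub> y (n - i)))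
        = (\<Oplus>\<^bsub>Ext G M n\<^esub>i\<in>{..n}. yoneda G M i (n - i) (x i) (b (n - i)) \<oplus>\<^bsub>Ext G M n\<^esub>
            yoneda G M i (n - i) (x i) (y (n - i)))" for n
        using vlin_add[OF lin total_ext_comp[OF b] total_ext_comp[OF y]] yoneda_summand[OF x b] yoneda_summand[OF x y]
        by (intro E.finsum_cong') auto
      then show "ract (total_ext G \<Psi> M) x (b \<oplus>\<^bsub>total_ext G \<Phi> ?K\<^esub> y)
          = ract (total_ext G \<Psi> M) x b \<oplus>\<^bsub>total_ext G \<Phi>' M\<^esub> ract (total_ext G \<Psi> M) x y"
        using yoneda_summand[OF x b] yoneda_summand[OF x y] by (simp add: E.finsum_addf Pi_def) }
    fix c
    have sum: "c \<odot>\<^bsub>Ext G M n\<^esub> (\<Oplus>\<^bsub>Ext G M n\<^esub>i\<in>{..n}. yoneda G M i (n - i) (x i) (b (n - i)))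
      = (\<Oplus>\<^bsub>Ext G M n\<^esub>i\<in>{..n}. c \<odot>\<^bsub>Ext G M n\<^esub> yoneda G M i (n - i) (x i) (b (n - i)))" for n
      using yoneda_summand[OF x b] by (intro vlin_finsum[OF vspace_Ext vspace_Ext E.scale_lin]) auto
    have "(\<Oplus>\<^bsub>Ext G M n\<^esub>i\<in>{..n}. yoneda G M i (n - i) (x i) (c \<odot>\<^bsub>Ext G ?K (n - i)\<^esub> b (n - i)))
      = (\<Oplus>\<^bsub>Ext G M n\<^esub>i\<in>{..n}. c \<odot>\<^bsub>Ext G M n\<^esub> yoneda G M i (n - i) (x i) (b (n - i)))" for n
      using vlin_smult[OF lin total_ext_comp[OF b]] yoneda_summand[OF x b]
      by (intro E.finsum_cong') auto
    then show "ract (total_ext G \<Psi> M) x (c \<odot>\<^bsub>total_ext G \<Phi> ?K\<^esub> b)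
        = c \<odot>\<^bsub>total_ext G \<Phi>' M\<^esub> ract (total_ext G \<Psi> M) x b"
      by (simp add: sum)
  qed
qed

end

definition total_push ::
  "('g, 'z) monoid_scheme \<Rightarrow> ('k::field, 'v, 'g) gmodule \<Rightarrow> ('k, 'w, 'g) gmodule \<Rightarrow> ('v \<Rightarrow> 'w)
    \<Rightarrow> (nat \<Rightarrow> (('g list \<Rightarrow>\<^sub>0 'k) \<Rightarrow> 'v) set) \<Rightarrow> (nat \<Rightarrow> (('g list \<Rightarrow>\<^sub>0 'k) \<Rightarrow> 'w) set)" where
  "total_push G M N \<theta> x = (\<lambda>m. ext_push G M N m \<theta> (x m))"

lemma total_ext_gact: "gact (total_ext G \<Phi> M) h x = total_push G M M (\<Phi> h) x"
  by (simp add: total_push_def ext_map_eq_push)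

context coeff_map
begin

lemma push_zero: "ext_push G M N m \<theta> \<zero>\<^bsub>Ext G M m\<^esub> = \<zero>\<^bsub>Ext G N m\<^esub>"
  by (rule vlin_zero[OF M.vspace_Ext N.vspace_Ext push_linear])

lemma total_push_closed:
  assumes "x \<in> total_ext_carrier G M" shows "total_push G M N \<theta> x \<in> total_ext_carrier G N"
proof -
  obtain n where "\<And>m. x m \<in> carrier (Ext G M m)" "\<And>m. m \<ge> n \<Longrightarrow> x m = \<zero>\<^bsub>Ext G M m\<^esub>"
    by (rule total_ext_carrierE[OF assms]) blast
  then show ?thesis
    by (intro total_ext_carrierI[where N = n]) (auto simp: total_push_def push_closed push_zero)
qed

lemma total_push_linear: "vlin (total_ext G \<Phi> M) (total_ext G \<Phi>' N) (total_push G M N \<theta>)"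
  using total_push_closed vlin_add[OF push_linear total_ext_comp total_ext_comp]
    vlin_smult[OF push_linear total_ext_comp]
  by (intro vlinI) (auto simp: total_push_def fun_eq_iff)

text \<open>
  The product is composition on the right with a lift, whereas \<open>\<theta>\<close> is composed on the left.
\<close>

lemma total_push_ract:
  assumes x: "x \<in> total_ext_carrier G M" and b: "b \<in> total_ext_carrier G (triv_mod TYPE('k))"
  shows "total_push G M N \<theta> (ract (total_ext G \<Phi> M) x b)
    = ract (total_ext G \<Phi>' N) (total_push G M N \<theta> x) b"
proof
  fix n
  interpret EN: vspace "Ext G N n" by (rule N.vspace_Ext)
  have "ext_push G M N n \<theta> (\<Oplus>\<^bsub>Ext G M n\<^esub>i\<in>{..n}. yoneda G M i (n - i) (x i) (b (n - i)))
    = (\<Oplus>\<^bsub>Ext G N n\<^esub>i\<in>{..n}. ext_push G M N n \<theta> (yoneda G M i (n - i) (x i) (b (n - i))))"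
    using M.yoneda_summand[OF x b] by (intro vlin_finsum[OF M.vspace_Ext N.vspace_Ext push_linear]) auto
  also have "\<dots> = (\<Oplus>\<^bsub>Ext G N n\<^esub>i\<in>{..n}. yoneda G N i (n - i) (ext_push G M N i \<theta> (x i)) (b (n - i)))"
  proof (rule EN.finsum_cong')
    fix i assume "i \<in> {..n}"
    then show "ext_push G M N n \<theta> (yoneda G M i (n - i) (x i) (b (n - i)))
        = yoneda G N i (n - i) (ext_push G M N i \<theta> (x i)) (b (n - i))"
      using push_yoneda[OF total_ext_comp[OF x] total_ext_comp[OF b], of i "n - i"] by simp
  qed (use N.yoneda_summand[OF total_push_closed[OF x] b] in \<open>auto simp: total_push_def\<close>)
  finally show "total_push G M N \<theta> (ract (total_ext G \<Phi> M) x b) n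
      = ract (total_ext G \<Phi>' N) (total_push G M N \<theta> x) b n"
    by (simp add: total_push_def)
qed

lemma total_push_hcomp:
  "x \<in> hcomp (total_ext G \<Phi> M) n \<Longrightarrow> total_push G M N \<theta> x \<in> hcomp (total_ext G \<Phi>' N) n"
  using total_push_closed[of x] push_zero by (simp add: total_push_def)

end

lemma total_push_comp:
  assumes "coeff_map G L M \<eta>" "coeff_map G M N \<theta>" "x \<in> total_ext_carrier G L"
  shows "total_push G M N \<theta> (total_push G L M \<eta> x) = total_push G L N (\<lambda>v. \<theta> (\<eta> v)) x"
  using push_comp[OF assms(1,2) total_ext_comp[OF assms(3)]] by (simp add: total_push_def)

lemma total_push_cong:
  assumes "coeff_map G M N \<theta>" "\<And>v. v \<in> carrier M \<Longrightarrow> \<eta> v = \<theta> v" "x \<in> total_ext_carrier G M"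
  shows "total_push G M N \<eta> x = total_push G M N \<theta> x"
  using push_cong[OF assms(1,2) total_ext_comp[OF assms(3)]] by (simp add: total_push_def)

lemma (in coeff) total_push_ident:
  assumes "\<And>v. v \<in> carrier M \<Longrightarrow> \<theta> v = v" "x \<in> total_ext_carrier G M"
  shows "total_push G M M \<theta> x = x"
  using total_push_cong[OF coeff_map_ident assms] push_ident[OF total_ext_comp[OF assms(2)]]
  by (simp add: total_push_def)

lemma total_push_plus:
  assumes "coeff_map G M N \<theta>" "coeff_map G M N \<eta>" "x \<in> total_ext_carrier G M"
  shows "total_push G M N (\<lambda>v. \<theta> v \<oplus>\<^bsub>N\<^esub> \<eta> v) x
    = total_push G M N \<theta> x \<oplus>\<^bsub>total_ext G \<Phi> N\<^esub> total_push G M N \<eta> x"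
  using push_plus[OF assms(1,2) total_ext_comp[OF assms(3)]] by (simp add: total_push_def)

lemma total_push_scale:
  assumes "coeff_map G M N \<theta>" "x \<in> total_ext_carrier G M"
  shows "total_push G M N (\<lambda>v. c \<odot>\<^bsub>N\<^esub> \<theta> v) x = c \<odot>\<^bsub>total_ext G \<Phi> N\<^esub> total_push G M N \<theta> x"
  using push_scale[OF assms(1) total_ext_comp[OF assms(2)]] by (simp add: total_push_def)

lemma coeff_map_const_zero: "\<lbrakk>coeff G M; coeff G N\<rbrakk> \<Longrightarrow> coeff_map G M N (\<lambda>v. \<zero>\<^bsub>N\<^esub>)"
  by (simp add: coeff_map_def coeff_map_axioms_def coeff_def gmap_const_zero)

lemma total_push_const_zero:
  assumes "coeff G M" "coeff G N" "x \<in> total_ext_carrier G M"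
  shows "total_push G M N (\<lambda>v. \<zero>\<^bsub>N\<^esub>) x = \<zero>\<^bsub>total_ext G \<Phi> N\<^esub>"
proof -
  interpret N: coeff G N by fact
  interpret E: vspace "Ext G N m" for m by (rule N.vspace_Ext)
  interpret z: coeff_map G M N "\<lambda>v. \<zero>\<^bsub>N\<^esub>" by (rule coeff_map_const_zero) fact+
  have "total_push G M N (\<lambda>v. 0 \<odot>\<^bsub>N\<^esub> \<zero>\<^bsub>N\<^esub>) x = 0 \<odot>\<^bsub>total_ext G \<Phi> N\<^esub> total_push G M N (\<lambda>v. \<zero>\<^bsub>N\<^esub>) x"
    by (rule total_push_scale) (fact z.coeff_map_axioms assms(3))+
  then show ?thesis
    using total_ext_comp[OF z.total_push_closed[OF assms(3)]] by simp
qed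

subsection \<open>Decomposition along a finite direct sum\<close>

locale coeff_decomposition = M: coeff G M
  for G :: "('g, 'z) monoid_scheme" and M :: "('k::field, 'v, 'g) gmodule" +
  fixes I :: "'i set" and N :: "'i \<Rightarrow> ('k, 'w, 'g) gmodule"
    and incl :: "'i \<Rightarrow> 'w \<Rightarrow> 'v" and proj :: "'i \<Rightarrow> 'v \<Rightarrow> 'w"
  assumes finite: "finite I"
    and incl: "\<And>i. i \<in> I \<Longrightarrow> coeff_map G (N i) M (incl i)"
    and proj: "\<And>i. i \<in> I \<Longrightarrow> coeff_map G M (N i) (proj i)"
    and proj_incl: "\<And>i j w. \<lbrakk>i \<in> I; j \<in> I; w \<in> carrier (N j)\<rbrakk> \<Longrightarrow>
      proj i (incl j w) = (if i = j then w else \<zero>\<^bsub>N i\<^esub>)"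
    and incl_proj: "\<And>v. v \<in> carrier M \<Longrightarrow> (\<Oplus>\<^bsub>M\<^esub>i\<in>I. incl i (proj i v)) = v"
begin

lemma total_push_sum:
  assumes x: "x \<in> total_ext_carrier G M" and J: "J \<subseteq> I"
  shows "coeff_map G M M (\<lambda>v. \<Oplus>\<^bsub>M\<^esub>i\<in>J. incl i (proj i v)) \<and>
    total_push G M M (\<lambda>v. \<Oplus>\<^bsub>M\<^esub>i\<in>J. incl i (proj i v)) x
    = (\<Oplus>\<^bsub>total_ext G \<Phi> M\<^esub>i\<in>J. total_push G (N i) M (incl i) (total_push G M (N i) (proj i) x))"
proof -
  interpret T: vspace "total_ext G \<Phi> M" by (rule M.vspace_total)
  have comp: "coeff_map G M M (\<lambda>v. incl i (proj i v))" if "i \<in> I" for i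
    using incl[OF that] proj[OF that] gmap_comp[of G M "N i" "proj i" M "incl i"]
    by (simp add: coeff_map_def coeff_map_axioms_def)
  have "finite J" using J finite by (rule finite_subset)
  then show ?thesis using J
  proof (induction J rule: finite_induct)
    case empty
    then show ?case
      using coeff_map_const_zero[OF M.coeff_axioms M.coeff_axioms]
        total_push_const_zero[OF M.coeff_axioms M.coeff_axioms x, where \<Phi> = \<Phi>] by simp
  next
    case (insert j J)
    have cl: "incl i (proj i v) \<in> carrier M" if "v \<in> carrier M" "i \<in> I" for i v
      using gmap_closed[OF coeff_map.gmap[OF comp[OF that(2)]] that(1)] .
    have eq: "(\<Oplus>\<^bsub>M\<^esub>i\<in>insert j J. incl i (proj i v)) = incl j (proj j v) \<oplus>\<^bsub>M\<^esub> (\<Oplus>\<^bsub>M\<^esub>i\<in>J. incl i (proj i v))"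
      if "v \<in> carrier M" for v
      using insert cl[OF that] by (intro M.finsum_insert) auto
    from insert have j: "j \<in> I" and IH: "coeff_map G M M (\<lambda>v. \<Oplus>\<^bsub>M\<^esub>i\<in>J. incl i (proj i v))"
      "total_push G M M (\<lambda>v. \<Oplus>\<^bsub>M\<^esub>i\<in>J. incl i (proj i v)) x
        = (\<Oplus>\<^bsub>total_ext G \<Phi> M\<^esub>i\<in>J. total_push G (N i) M (incl i) (total_push G M (N i) (proj i) x))"
      by auto
    note pl = coeff_map_plus[OF comp[OF j] IH(1)]
    have cm: "coeff_map G M M (\<lambda>v. \<Oplus>\<^bsub>M\<^esub>i\<in>insert j J. incl i (proj i v))"
      using gmap_cong[OF coeff_map.gmap[OF pl] eq M.gmod_axioms] M.coeff_axioms
      by (simp add: coeff_map_def coeff_map_axioms_def)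
    have "total_push G M M (\<lambda>v. \<Oplus>\<^bsub>M\<^esub>i\<in>insert j J. incl i (proj i v)) x
      = total_push G M M (\<lambda>v. incl j (proj j v)) x \<oplus>\<^bsub>total_ext G \<Phi> M\<^esub>
        total_push G M M (\<lambda>v. \<Oplus>\<^bsub>M\<^esub>i\<in>J. incl i (proj i v)) x"
      using total_push_cong[OF pl eq x] total_push_plus[OF comp[OF j] IH(1) x, where \<Phi> = \<Phi>] by simp
    also have "\<dots> = (\<Oplus>\<^bsub>total_ext G \<Phi> M\<^esub>i\<in>insert j J. total_push G (N i) M (incl i) (total_push G M (N i) (proj i) x))"
      unfolding IH(2) total_push_comp[OF proj[OF j] incl[OF j] x, symmetric]
      using insert coeff_map.total_push_closed[OF incl] coeff_map.total_push_closed[OF proj] x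
      by (intro T.finsum_insert[symmetric]) auto
    finally show ?case using cm by blast
  qed
qed

lemma total_push_incl_proj:
  assumes "x \<in> total_ext_carrier G M"
  shows "(\<Oplus>\<^bsub>total_ext G \<Phi> M\<^esub>i\<in>I. total_push G (N i) M (incl i) (total_push G M (N i) (proj i) x)) = x"
  using total_push_sum[OF assms subset_refl, of \<Phi>] M.total_push_ident[OF incl_proj assms] by simp

lemma total_push_proj_incl:
  assumes "i \<in> I" "j \<in> I" "y \<in> total_ext_carrier G (N j)"
  shows "total_push G M (N i) (proj i) (total_push G (N j) M (incl j) y)
    = (if i = j then y else \<zero>\<^bsub>total_ext G \<Phi> (N i)\<^esub>)"
proof -
  interpret i: coeff_map G M "N i" "proj i" by (rule proj) fact
  interpret j: coeff_map G "N j" M "incl j" by (rule incl) fact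
  have "total_push G M (N i) (proj i) (total_push G (N j) M (incl j) y)
      = total_push G (N j) (N i) (\<lambda>w. proj i (incl j w)) y"
    by (rule total_push_comp) (fact i.coeff_map_axioms j.coeff_map_axioms assms(3))+
  also have "\<dots> = (if i = j then y else \<zero>\<^bsub>total_ext G \<Phi> (N i)\<^esub>)"
  proof (cases "i = j")
    case True
    then show ?thesis
      using j.M.total_push_ident[of "\<lambda>w. proj j (incl j w)" y] proj_incl[OF assms(1,2)] assms(3) by simp
  next
    case False
    then show ?thesis
      using total_push_cong[OF coeff_map_const_zero[OF j.M.coeff_axioms i.N.coeff_axioms] _ assms(3), of "\<lambda>w. proj i (incl j w)"]
        total_push_const_zero[OF j.M.coeff_axioms i.N.coeff_axioms assms(3), where \<Phi> = \<Phi>] proj_incl[OF assms(1,2)]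
      by simp
  qed
  finally show ?thesis .
qed

lemma total_push_proj_sum:
  assumes y: "\<And>j. j \<in> I \<Longrightarrow> y j \<in> total_ext_carrier G (N j)" and i: "i \<in> I"
  shows "total_push G M (N i) (proj i) (\<Oplus>\<^bsub>total_ext G \<Phi> M\<^esub>j\<in>I. total_push G (N j) M (incl j) (y j)) = y i"
proof -
  let ?T = "total_ext G \<Phi> M" and ?Ti = "total_ext G (\<lambda>_::unit. id) (N i)"
  interpret i: coeff_map G M "N i" "proj i" by (rule proj) fact
  interpret Ti: vspace ?Ti by (rule i.N.vspace_total)
  have yi: "y i \<in> carrier ?Ti" using y i by auto
  have "total_push G M (N i) (proj i) (\<Oplus>\<^bsub>?T\<^esub>j\<in>I. total_push G (N j) M (incl j) (y j))
    = (\<Oplus>\<^bsub>?Ti\<^esub>j\<in>I. total_push G M (N i) (proj i) (total_push G (N j) M (incl j) (y j)))"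
    using coeff_map.total_push_closed[OF incl y]
    by (intro vlin_finsum[OF M.vspace_total i.N.vspace_total i.total_push_linear finite]) auto
  also have "\<dots> = (\<Oplus>\<^bsub>?Ti\<^esub>j\<in>I. if i = j then y i else \<zero>\<^bsub>?Ti\<^esub>)"
  proof (rule Ti.finsum_cong')
    show "total_push G M (N i) (proj i) (total_push G (N j) M (incl j) (y j)) = (if i = j then y i else \<zero>\<^bsub>?Ti\<^esub>)"
      if "j \<in> I" for j
      using total_push_proj_incl[OF i that y[OF that], where \<Phi> = "\<lambda>_::unit. id"] by simp
  qed (use yi Ti.zero_closed in auto)
  also have "\<dots> = y i"
    using Ti.finsum_singleton[OF i finite, of "\<lambda>_. y i"] yi by simp
  finally show ?thesis .
qed

lemma total_push_bij:
  "bij_betw (\<lambda>x. \<lambda>i\<in>I. total_push G M (N i) (proj i) x)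
     (total_ext_carrier G M) (PiE I (\<lambda>i. total_ext_carrier G (N i)))"
proof (rule bij_betw_byWitness[where f' = "\<lambda>y. \<Oplus>\<^bsub>total_ext G (\<lambda>_::unit. id) M\<^esub>i\<in>I. total_push G (N i) M (incl i) (y i)"])
  let ?T = "total_ext G (\<lambda>_::unit. id) M"
  interpret T: vspace ?T by (rule M.vspace_total)
  have ic: "total_push G (N i) M (incl i) (y i) \<in> carrier ?T"
    if "i \<in> I" "y \<in> PiE I (\<lambda>i. total_ext_carrier G (N i))" for i y
    using coeff_map.total_push_closed[OF incl[OF that(1)], of "y i"] that by auto
  have pc: "total_push G M (N i) (proj i) x \<in> total_ext_carrier G (N i)"
    if "i \<in> I" "x \<in> total_ext_carrier G M" for i x
    using coeff_map.total_push_closed[OF proj[OF that(1)] that(2)] .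
  show "\<forall>x\<in>total_ext_carrier G M. (\<Oplus>\<^bsub>?T\<^esub>i\<in>I. total_push G (N i) M (incl i)
      ((\<lambda>i\<in>I. total_push G M (N i) (proj i) x) i)) = x"
  proof
    fix x assume x: "x \<in> total_ext_carrier G M"
    have "(\<Oplus>\<^bsub>?T\<^esub>i\<in>I. total_push G (N i) M (incl i) ((\<lambda>i\<in>I. total_push G M (N i) (proj i) x) i))
       = (\<Oplus>\<^bsub>?T\<^esub>i\<in>I. total_push G (N i) M (incl i) (total_push G M (N i) (proj i) x))"
      using coeff_map.total_push_closed[OF incl] pc x by (intro T.finsum_cong') auto
    then show "(\<Oplus>\<^bsub>?T\<^esub>i\<in>I. total_push G (N i) M (incl i) ((\<lambda>i\<in>I. total_push G M (N i) (proj i) x) i)) = x"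
      using total_push_incl_proj[OF x, of "\<lambda>_::unit. id"] by simp
  qed
  show "\<forall>y\<in>PiE I (\<lambda>i. total_ext_carrier G (N i)).
      (\<lambda>i\<in>I. total_push G M (N i) (proj i) (\<Oplus>\<^bsub>?T\<^esub>i\<in>I. total_push G (N i) M (incl i) (y i))) = y"
  proof
    fix y assume y: "y \<in> PiE I (\<lambda>i. total_ext_carrier G (N i))"
    have "total_push G M (N i) (proj i) (\<Oplus>\<^bsub>?T\<^esub>j\<in>I. total_push G (N j) M (incl j) (y j)) = y i"
      if i: "i \<in> I" for i
      by (rule total_push_proj_sum[OF PiE_mem[OF y] i])
    then show "(\<lambda>i\<in>I. total_push G M (N i) (proj i) (\<Oplus>\<^bsub>?T\<^esub>i\<in>I. total_push G (N i) M (incl i) (y i))) = y"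
      using y by (auto intro!: extensionalityI[of _ I] simp: PiE_def)
  qed
  show "(\<lambda>x. \<lambda>i\<in>I. total_push G M (N i) (proj i) x) ` total_ext_carrier G M
      \<subseteq> PiE I (\<lambda>i. total_ext_carrier G (N i))"
    using pc by auto
  show "(\<lambda>y. \<Oplus>\<^bsub>?T\<^esub>i\<in>I. total_push G (N i) M (incl i) (y i)) ` PiE I (\<lambda>i. total_ext_carrier G (N i))
      \<subseteq> total_ext_carrier G M"
  proof (rule image_subsetI)
    fix y assume y: "y \<in> PiE I (\<lambda>i. total_ext_carrier G (N i))"
    show "(\<Oplus>\<^bsub>?T\<^esub>i\<in>I. total_push G (N i) M (incl i) (y i)) \<in> total_ext_carrier G M"
      using T.finsum_closed[of "\<lambda>i. total_push G (N i) M (incl i) (y i)" I] ic[OF _ y] by (simp add: Pi_def)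
  qed
qed

end

section \<open>Tensor products\<close>

definition vext :: "('k::field, 'u, 'x) module_scheme \<Rightarrow> ('a \<Rightarrow> 'u) \<Rightarrow> ('a \<Rightarrow>\<^sub>0 'k) \<Rightarrow> 'u" where
  "vext U \<beta> t = (\<Oplus>\<^bsub>U\<^esub>p\<in>Poly_Mapping.keys t. Poly_Mapping.lookup t p \<odot>\<^bsub>U\<^esub> \<beta> p)"

context vspace
begin

lemma vext_superset:
  assumes "finite S" "Poly_Mapping.keys t \<subseteq> S" "\<And>p. p \<in> S \<Longrightarrow> \<beta> p \<in> carrier V"
  shows "vext V \<beta> t = (\<Oplus>p\<in>S. Poly_Mapping.lookup t p \<odot> \<beta> p)"
  unfolding vext_def using assms
  by (intro add.finprod_mono_neutral_cong_left) (auto simp: in_keys_iff)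

lemma vext_linear:
  assumes "\<And>p. p \<in> X \<Longrightarrow> \<beta> p \<in> carrier V"
  shows "vlin (free_mod (X :: 'a set)) V (vext V \<beta>)"
proof (rule vlinI)
  fix u :: "'a \<Rightarrow>\<^sub>0 'k" assume "u \<in> carrier (free_mod X)"
  then have u: "Poly_Mapping.keys u \<subseteq> X" by simp
  then show "vext V \<beta> u \<in> carrier V" using assms by (auto simp: vext_def intro!: finsum_closed)
  { fix v :: "'a \<Rightarrow>\<^sub>0 'k" assume "v \<in> carrier (free_mod X)"
    then have v: "Poly_Mapping.keys v \<subseteq> X" by simp
    let ?S = "Poly_Mapping.keys u \<union> Poly_Mapping.keys v"
    have S: "\<beta> p \<in> carrier V" if "p \<in> ?S" for p using u v assms that by auto
    have e: "vext V \<beta> u = (\<Oplus>p\<in>?S. Poly_Mapping.lookup u p \<odot> \<beta> p)"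
        "vext V \<beta> v = (\<Oplus>p\<in>?S. Poly_Mapping.lookup v p \<odot> \<beta> p)"
        "vext V \<beta> (u + v) = (\<Oplus>p\<in>?S. Poly_Mapping.lookup (u + v) p \<odot> \<beta> p)"
      using S keys_add[of u v] by (auto intro!: vext_superset)
    have "(\<Oplus>p\<in>?S. Poly_Mapping.lookup (u + v) p \<odot> \<beta> p)
        = (\<Oplus>p\<in>?S. Poly_Mapping.lookup u p \<odot> \<beta> p \<oplus> Poly_Mapping.lookup v p \<odot> \<beta> p)"
      using S by (intro finsum_cong') (auto simp: lookup_add smult_l_distr)
    then show "vext V \<beta> (u \<oplus>\<^bsub>free_mod X\<^esub> v) = vext V \<beta> u \<oplus> vext V \<beta> v"
      using S by (simp add: e finsum_addf Pi_def) }
  fix c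
  have S: "\<beta> p \<in> carrier V" if "p \<in> Poly_Mapping.keys u" for p using u assms that by auto
  have "vext V \<beta> (pm_scale c u) = (\<Oplus>p\<in>Poly_Mapping.keys u. Poly_Mapping.lookup (pm_scale c u) p \<odot> \<beta> p)"
    using S keys_pm_scale[of c u] by (intro vext_superset) auto
  also have "\<dots> = (\<Oplus>p\<in>Poly_Mapping.keys u. c \<odot> (Poly_Mapping.lookup u p \<odot> \<beta> p))"
    using S by (intro finsum_cong') (auto simp: smult_assoc)
  also have "\<dots> = c \<odot> vext V \<beta> u"
    unfolding vext_def using S
    by (intro vlin_finsum[OF vspace_axioms vspace_axioms scale_lin, symmetric]) auto
  finally show "vext V \<beta> (c \<odot>\<^bsub>free_mod X\<^esub> u) = c \<odot> vext V \<beta> u" by simp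
qed

lemma vext_single: "\<beta> p \<in> carrier V \<Longrightarrow> vext V \<beta> (Poly_Mapping.single p 1) = \<beta> p"
  using vext_superset[of "{p}" "Poly_Mapping.single p 1" \<beta>] by simp

end

lemma (in quotient_space) quotient_lift:
  assumes U: "vspace U" and f: "vlin V U f" and zero: "\<And>b. b \<in> B \<Longrightarrow> f b = \<zero>\<^bsub>U\<^esub>"
  obtains F where "vlin (quot_mod V B) U F" "\<And>v. v \<in> carrier V \<Longrightarrow> F (B +> v) = f v"
proof -
  interpret U: vspace U by fact
  define F where "F X = f (SOME v. v \<in> carrier V \<and> X = B +> v)" for X
  have F: "F (B +> v) = f v" if v: "v \<in> carrier V" for v
  proof -
    define w where "w = (SOME w. w \<in> carrier V \<and> B +> v = B +> w)"
    have w: "w \<in> carrier V" "B +> v = B +> w"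
      using someI[of "\<lambda>w. w \<in> carrier V \<and> B +> v = B +> w" v] v by (auto simp: w_def)
    then have "v \<in> B +> w" using a_rcos_self[OF v] by simp
    then obtain b where b: "b \<in> B" "v = b \<oplus> w" by (auto simp: a_r_coset_def')
    then have "f v = f b \<oplus>\<^bsub>U\<^esub> f w" using w vlin_add[OF f, of b w] by simp
    then show ?thesis using zero[OF b(1)] vlin_closed[OF f w(1)] by (simp add: F_def flip: w_def)
  qed
  have "vlin (quot_mod V B) U F"
    using vlin_closed[OF f] vlin_add[OF f] vlin_smult[OF f]
    by (intro vlinI) (auto simp: quot_mod_simps(1) quot_add quot_smult F)
  with F that show thesis by blast
qed

locale tensor_product = V: vspace V + W: vspace W
  for V :: "('k::field, 'v, 'x) module_scheme" and W :: "('k, 'w, 'y) module_scheme"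
begin

abbreviation "F \<equiv> free_mod (carrier V \<times> carrier W) :: ('k, 'v \<times> 'w \<Rightarrow>\<^sub>0 'k) module"

lemma tensor_rel_minimal:
  assumes "\<And>v v' w. \<lbrakk>v \<in> carrier V; v' \<in> carrier V; w \<in> carrier W\<rbrakk> \<Longrightarrow>
      P (Poly_Mapping.single (v \<oplus>\<^bsub>V\<^esub> v', w) 1 - Poly_Mapping.single (v, w) 1 - Poly_Mapping.single (v', w) 1)"
    and "\<And>v w w'. \<lbrakk>v \<in> carrier V; w \<in> carrier W; w' \<in> carrier W\<rbrakk> \<Longrightarrow>
      P (Poly_Mapping.single (v, w \<oplus>\<^bsub>W\<^esub> w') 1 - Poly_Mapping.single (v, w) 1 - Poly_Mapping.single (v, w') 1)"
    and "\<And>c v w. \<lbrakk>v \<in> carrier V; w \<in> carrier W\<rbrakk> \<Longrightarrow>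
      P (Poly_Mapping.single (c \<odot>\<^bsub>V\<^esub> v, w) 1 - Poly_Mapping.single (v, w) c)"
    and "\<And>c v w. \<lbrakk>v \<in> carrier V; w \<in> carrier W\<rbrakk> \<Longrightarrow>
      P (Poly_Mapping.single (v, c \<odot>\<^bsub>W\<^esub> w) 1 - Poly_Mapping.single (v, w) c)"
    and "P 0" "\<And>s t. \<lbrakk>P s; P t\<rbrakk> \<Longrightarrow> P (s + t)" "\<And>c t. P t \<Longrightarrow> P (pm_scale c t)"
    and t: "t \<in> tensor_rel V W"
  shows "P t"
proof -
  interpret pm: Modules.module "pm_scale :: 'k \<Rightarrow> ('v \<times> 'w \<Rightarrow>\<^sub>0 'k) \<Rightarrow> _" by (rule pm_module)
  have "pm.subspace {t. P t}" using assms(5-7) by (auto simp: pm.subspace_def)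
  then have "tensor_rel V W \<subseteq> {t. P t}"
    unfolding tensor_rel_def by (intro pm.span_minimal) (auto intro: assms(1-4))
  with t show ?thesis by auto
qed

lemma tensor_rel_gens:
  "\<lbrakk>v \<in> carrier V; v' \<in> carrier V; w \<in> carrier W\<rbrakk> \<Longrightarrow>
    Poly_Mapping.single (v \<oplus>\<^bsub>V\<^esub> v', w) 1 - Poly_Mapping.single (v, w) 1 - Poly_Mapping.single (v', w) 1 \<in> tensor_rel V W"
  "\<lbrakk>v \<in> carrier V; w \<in> carrier W; w' \<in> carrier W\<rbrakk> \<Longrightarrow>
    Poly_Mapping.single (v, w \<oplus>\<^bsub>W\<^esub> w') 1 - Poly_Mapping.single (v, w) 1 - Poly_Mapping.single (v, w') 1 \<in> tensor_rel V W"
  "\<lbrakk>v \<in> carrier V; w \<in> carrier W\<rbrakk> \<Longrightarrow>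
    Poly_Mapping.single (c \<odot>\<^bsub>V\<^esub> v, w) 1 - Poly_Mapping.single (v, w) c \<in> tensor_rel V W"
  "\<lbrakk>v \<in> carrier V; w \<in> carrier W\<rbrakk> \<Longrightarrow>
    Poly_Mapping.single (v, c \<odot>\<^bsub>W\<^esub> w) 1 - Poly_Mapping.single (v, w) c \<in> tensor_rel V W"
  unfolding tensor_rel_def by (rule module.span_base[OF pm_module]; blast)+

lemma tensor_rel_subspace:
  "0 \<in> tensor_rel V W" "\<lbrakk>s \<in> tensor_rel V W; t \<in> tensor_rel V W\<rbrakk> \<Longrightarrow> s + t \<in> tensor_rel V W"
  "t \<in> tensor_rel V W \<Longrightarrow> pm_scale c t \<in> tensor_rel V W"
  unfolding tensor_rel_def
  by (rule module.span_zero[OF pm_module] module.span_add[OF pm_module] module.span_scale[OF pm_module]; assumption?)+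

lemma keys_diff: "Poly_Mapping.keys (s - t) \<subseteq> Poly_Mapping.keys s \<union> Poly_Mapping.keys (t :: 'a \<Rightarrow>\<^sub>0 'k)"
  by (auto simp: in_keys_iff lookup_minus)

lemma tensor_rel_keys: "t \<in> tensor_rel V W \<Longrightarrow> Poly_Mapping.keys t \<subseteq> carrier V \<times> carrier W"
proof (rule tensor_rel_minimal[where P = "\<lambda>t. Poly_Mapping.keys t \<subseteq> carrier V \<times> carrier W"], goal_cases)
  case (6 s t) then show ?case using keys_add[of s t] by blast
next
  case (7 c t) then show ?case using keys_pm_scale[of c t] by blast
qed (fastforce dest!: subsetD[OF keys_diff] split: if_splits)+

sublocale Q: quotient_space F "tensor_rel V W"
  by (intro quotient_space.intro quotient_space_axioms.intro vspace_free_mod)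
    (auto simp: subsp_def tensor_rel_subspace dest: subsetD[OF tensor_rel_keys])

lemma tensor_eq: "tensor V W = quot_mod F (tensor_rel V W)"
  by (simp add: tensor_def)

lemma vspace_tensor: "vspace (tensor V W)"
  unfolding tensor_eq by (rule Q.vspace_quot)

lemma coset_linear: "vlin F (tensor V W) (\<lambda>t. tensor_rel V W +>\<^bsub>F\<^esub> t)"
  unfolding tensor_eq by (rule Q.vlin_coset)

lemma tensorE:
  assumes "T \<in> carrier (tensor V W)"
  obtains t where "Poly_Mapping.keys t \<subseteq> carrier V \<times> carrier W" "T = tensor_rel V W +>\<^bsub>F\<^esub> t"
  using assms by (auto simp: tensor_eq Q.quot_mod_simps)

lemma elem_tensor_closed:
  "\<lbrakk>v \<in> carrier V; w \<in> carrier W\<rbrakk> \<Longrightarrow> elem_tensor V W v w \<in> carrier (tensor V W)"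
  by (simp add: elem_tensor_def tensor_eq Q.quot_mod_simps)

lemma coset_eq_of_diff:
  assumes "s - t \<in> tensor_rel V W" "Poly_Mapping.keys s \<subseteq> carrier V \<times> carrier W"
    "Poly_Mapping.keys t \<subseteq> carrier V \<times> carrier W"
  shows "tensor_rel V W +>\<^bsub>F\<^esub> s = tensor_rel V W +>\<^bsub>F\<^esub> t"
  using assms by (intro Q.coset_eqI[of _ _ "s - t"]) auto

lemma elem_tensor_linear_left:
  assumes w: "w \<in> carrier W" shows "vlin V (tensor V W) (\<lambda>v. elem_tensor V W v w)"
proof (rule vlinI)
  fix v assume v: "v \<in> carrier V"
  then show "elem_tensor V W v w \<in> carrier (tensor V W)" using w by (rule elem_tensor_closed)
  { fix v' assume v': "v' \<in> carrier V"
    have "tensor_rel V W +>\<^bsub>F\<^esub> Poly_Mapping.single (v \<oplus>\<^bsub>V\<^esub> v', w) 1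
        = tensor_rel V W +>\<^bsub>F\<^esub> (Poly_Mapping.single (v, w) 1 + Poly_Mapping.single (v', w) 1)"
      using tensor_rel_gens(1)[OF v v' w] v v' w
      by (intro coset_eq_of_diff) (auto simp: diff_diff_eq dest!: subsetD[OF keys_add])
    then show "elem_tensor V W (v \<oplus>\<^bsub>V\<^esub> v') w = elem_tensor V W v w \<oplus>\<^bsub>tensor V W\<^esub> elem_tensor V W v' w"
      using vlin_add[OF coset_linear, of "Poly_Mapping.single (v, w) 1" "Poly_Mapping.single (v', w) 1"] v v' w
      by (simp add: elem_tensor_def) }
  fix c
  have "tensor_rel V W +>\<^bsub>F\<^esub> Poly_Mapping.single (c \<odot>\<^bsub>V\<^esub> v, w) 1
      = tensor_rel V W +>\<^bsub>F\<^esub> (Poly_Mapping.single (v, w) c)"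
    using tensor_rel_gens(3)[OF v w] v w by (intro coset_eq_of_diff) auto
  then show "elem_tensor V W (c \<odot>\<^bsub>V\<^esub> v) w = c \<odot>\<^bsub>tensor V W\<^esub> elem_tensor V W v w"
    using vlin_smult[OF coset_linear, of "Poly_Mapping.single (v, w) 1" c] v w
    by (simp add: elem_tensor_def)
qed

lemma elem_tensor_linear_right:
  assumes v: "v \<in> carrier V" shows "vlin W (tensor V W) (elem_tensor V W v)"
proof (rule vlinI)
  fix w assume w: "w \<in> carrier W"
  with v show "elem_tensor V W v w \<in> carrier (tensor V W)" by (rule elem_tensor_closed)
  { fix w' assume w': "w' \<in> carrier W"
    have "tensor_rel V W +>\<^bsub>F\<^esub> Poly_Mapping.single (v, w \<oplus>\<^bsub>W\<^esub> w') 1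
        = tensor_rel V W +>\<^bsub>F\<^esub> (Poly_Mapping.single (v, w) 1 + Poly_Mapping.single (v, w') 1)"
      using tensor_rel_gens(2)[OF v w w'] v w w'
      by (intro coset_eq_of_diff) (auto simp: diff_diff_eq dest!: subsetD[OF keys_add])
    then show "elem_tensor V W v (w \<oplus>\<^bsub>W\<^esub> w') = elem_tensor V W v w \<oplus>\<^bsub>tensor V W\<^esub> elem_tensor V W v w'"
      using vlin_add[OF coset_linear, of "Poly_Mapping.single (v, w) 1" "Poly_Mapping.single (v, w') 1"] v w w'
      by (simp add: elem_tensor_def) }
  fix c
  have "tensor_rel V W +>\<^bsub>F\<^esub> Poly_Mapping.single (v, c \<odot>\<^bsub>W\<^esub> w) 1
      = tensor_rel V W +>\<^bsub>F\<^esub> (Poly_Mapping.single (v, w) c)"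
    using tensor_rel_gens(4)[OF v w] v w by (intro coset_eq_of_diff) auto
  then show "elem_tensor V W v (c \<odot>\<^bsub>W\<^esub> w) = c \<odot>\<^bsub>tensor V W\<^esub> elem_tensor V W v w"
    using vlin_smult[OF coset_linear, of "Poly_Mapping.single (v, w) 1" c] v w
    by (simp add: elem_tensor_def)
qed

lemma tensor_induct:
  assumes T: "T \<in> carrier (tensor V W)"
    and zero: "P \<zero>\<^bsub>tensor V W\<^esub>"
    and step: "\<And>v w T. \<lbrakk>v \<in> carrier V; w \<in> carrier W; T \<in> carrier (tensor V W); P T\<rbrakk> \<Longrightarrow>
      P (elem_tensor V W v w \<oplus>\<^bsub>tensor V W\<^esub> T)"
  shows "P T"
proof -
  obtain t where t: "Poly_Mapping.keys t \<subseteq> carrier V \<times> carrier W" "T = tensor_rel V W +>\<^bsub>F\<^esub> t"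
    using tensorE[OF T] .
  from t(1) have "P (tensor_rel V W +>\<^bsub>F\<^esub> t)"
  proof (induction t rule: free_induct)
    case zero
    then show ?case using assms(2) vlin_zero[OF vspace_free_mod vspace_tensor coset_linear] by simp
  next
    case (step p c t)
    obtain v w where p: "p = (v, w)" by (cases p)
    with step have vw: "v \<in> carrier V" "w \<in> carrier W" by auto
    have "tensor_rel V W +>\<^bsub>F\<^esub> Poly_Mapping.single (v, w) c = elem_tensor V W (c \<odot>\<^bsub>V\<^esub> v) w"
      using tensor_rel_gens(3)[OF vw, of c] vw
      unfolding elem_tensor_def by (intro coset_eq_of_diff[symmetric]) auto
    then show ?case
      using assms(3)[of "c \<odot>\<^bsub>V\<^esub> v" w "tensor_rel V W +>\<^bsub>F\<^esub> t"] step vw p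
        vlin_add[OF coset_linear, of "Poly_Mapping.single (v, w) c" t] vlin_closed[OF coset_linear, of t]
      by simp
  qed
  then show ?thesis by (simp add: t)
qed

lemma tensor_linear_eq:
  assumes U: "vspace U" and f: "vlin (tensor V W) U f" and h: "vlin (tensor V W) U h"
    and eq: "\<And>v w. \<lbrakk>v \<in> carrier V; w \<in> carrier W\<rbrakk> \<Longrightarrow> f (elem_tensor V W v w) = h (elem_tensor V W v w)"
    and T: "T \<in> carrier (tensor V W)"
  shows "f T = h T"
  by (rule tensor_induct[OF T])
    (simp_all add: vlin_zero[OF vspace_tensor U f] vlin_zero[OF vspace_tensor U h]
      vlin_add[OF f] vlin_add[OF h] eq elem_tensor_closed)

lemma tensor_universal:
  assumes U: "vspace U"
    and left: "\<And>w. w \<in> carrier W \<Longrightarrow> vlin V U (\<lambda>v. \<beta> v w)"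
    and right: "\<And>v. v \<in> carrier V \<Longrightarrow> vlin W U (\<beta> v)"
  obtains f where "vlin (tensor V W) U f"
    "\<And>v w. \<lbrakk>v \<in> carrier V; w \<in> carrier W\<rbrakk> \<Longrightarrow> f (elem_tensor V W v w) = \<beta> v w"
    "\<And>t. Poly_Mapping.keys t \<subseteq> carrier V \<times> carrier W \<Longrightarrow>
       f (tensor_rel V W +>\<^bsub>F\<^esub> t) = vext U (\<lambda>(v, w). \<beta> v w) t"
proof -
  interpret U: vspace U by fact
  let ?b = "vext U (\<lambda>(v, w). \<beta> v w)"
  have cl: "\<beta> v w \<in> carrier U" if "v \<in> carrier V" "w \<in> carrier W" for v w
    using vlin_closed[OF right] that by blast
  have lin: "vlin F U ?b"
    by (rule U.vext_linear) (auto simp: cl)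
  have s: "?b (Poly_Mapping.single (v, w) 1) = \<beta> v w" if "v \<in> carrier V" "w \<in> carrier W" for v w
    using U.vext_single[of "\<lambda>(v, w). \<beta> v w" "(v, w)"] cl[OF that] by simp
  have sc: "?b (Poly_Mapping.single (v, w) c) = c \<odot>\<^bsub>U\<^esub> \<beta> v w" if "v \<in> carrier V" "w \<in> carrier W" for v w c
    using vlin_smult[OF lin, of "Poly_Mapping.single (v, w) 1" c] s[OF that] that by simp
  have diff: "?b (x - y) = ?b x \<ominus>\<^bsub>U\<^esub> ?b y"
    if "Poly_Mapping.keys x \<subseteq> carrier V \<times> carrier W" "Poly_Mapping.keys y \<subseteq> carrier V \<times> carrier W" for x y
  proof -
    show ?thesis
      using vlin_minus[OF vspace_free_mod U lin, of x y] that
      by (simp add: Q.minus_eq_smult pm_scale_minus_one)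
  qed
  have kd: "Poly_Mapping.keys (Poly_Mapping.single p c - Poly_Mapping.single q d :: 'v \<times> 'w \<Rightarrow>\<^sub>0 'k) \<subseteq> carrier V \<times> carrier W"
    if "p \<in> carrier V \<times> carrier W" "q \<in> carrier V \<times> carrier W" for p q c d
    using that keys_diff[of "Poly_Mapping.single p c" "Poly_Mapping.single q d"] by (auto split: if_splits)
  have "t \<in> tensor_rel V W \<Longrightarrow> Poly_Mapping.keys t \<subseteq> carrier V \<times> carrier W \<and> ?b t = \<zero>\<^bsub>U\<^esub>" for t
  proof (rule tensor_rel_minimal[where P = "\<lambda>t. Poly_Mapping.keys t \<subseteq> carrier V \<times> carrier W \<and> ?b t = \<zero>\<^bsub>U\<^esub>"], goal_cases)
    case (1 v v' w)
    then have k: "Poly_Mapping.single (v \<oplus>\<^bsub>V\<^esub> v', w) 1 - Poly_Mapping.single (v, w) 1 - Poly_Mapping.single (v', w) 1 \<in> tensor_rel V W"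
      by (intro tensor_rel_gens)
    have "\<beta> (v \<oplus>\<^bsub>V\<^esub> v') w = \<beta> v w \<oplus>\<^bsub>U\<^esub> \<beta> v' w" using vlin_add[OF left] 1 by blast
    with 1 cl show ?case
      using tensor_rel_keys[OF k] by (simp add: diff kd s) (simp add: U.minus_eq U.a_ac U.r_neg U.r_neg2)
  next
    case (2 v w w')
    then have k: "Poly_Mapping.single (v, w \<oplus>\<^bsub>W\<^esub> w') 1 - Poly_Mapping.single (v, w) 1 - Poly_Mapping.single (v, w') 1 \<in> tensor_rel V W"
      by (intro tensor_rel_gens)
    have "\<beta> v (w \<oplus>\<^bsub>W\<^esub> w') = \<beta> v w \<oplus>\<^bsub>U\<^esub> \<beta> v w'" using vlin_add[OF right] 2 by blast
    with 2 cl show ?case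
      using tensor_rel_keys[OF k] by (simp add: diff kd s) (simp add: U.minus_eq U.a_ac U.r_neg U.r_neg2)
  next
    case (3 c v w)
    have "\<beta> (c \<odot>\<^bsub>V\<^esub> v) w = c \<odot>\<^bsub>U\<^esub> \<beta> v w" using vlin_smult[OF left] 3 by blast
    with 3 cl show ?case by (simp add: diff kd s sc U.minus_eq U.r_neg)
  next
    case (4 c v w)
    have "\<beta> v (c \<odot>\<^bsub>W\<^esub> w) = c \<odot>\<^bsub>U\<^esub> \<beta> v w" using vlin_smult[OF right] 4 by blast
    with 4 cl show ?case by (simp add: diff kd s sc U.minus_eq U.r_neg)
  next
    case 5
    then show ?case using vlin_zero[OF vspace_free_mod U lin] by simp
  next
    case (6 s t)
    then show ?case using vlin_add[OF lin, of s t] keys_add[of s t] by (simp; blast)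
  next
    case (7 c t)
    then show ?case using vlin_smult[OF lin, of t c] keys_pm_scale[of c t] by (simp; blast)
  qed
  note kernel = this
  have "\<exists>f. vlin (quot_mod F (tensor_rel V W)) U f \<and>
      (\<forall>t\<in>carrier F. f (tensor_rel V W +>\<^bsub>F\<^esub> t) = ?b t)"
    by (rule Q.quotient_lift[OF U lin conjunct2[OF kernel]]) auto
  then obtain f where f: "vlin (tensor V W) U f"
    "\<And>t. t \<in> carrier F \<Longrightarrow> f (tensor_rel V W +>\<^bsub>F\<^esub> t) = ?b t"
    unfolding tensor_eq by blast
  have "f (elem_tensor V W v w) = \<beta> v w" if "v \<in> carrier V" "w \<in> carrier W" for v w
    using f(2)[of "Poly_Mapping.single (v, w) 1"] s[OF that] that by (simp add: elem_tensor_def)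
  then show thesis using that[of f] f by simp
qed

context
  fixes f h
  assumes f: "vlin V V f" and h: "vlin W W h"
begin

lemma basis_map_tensor_rel: "t \<in> tensor_rel V W \<Longrightarrow> basis_map (map_prod f h) t \<in> tensor_rel V W"
  by (rule tensor_rel_minimal[where P = "\<lambda>t. basis_map (map_prod f h) t \<in> tensor_rel V W"])
    (use vlin_closed[OF f] vlin_closed[OF h] in
      \<open>auto simp: vlin_add[OF f] vlin_add[OF h] vlin_smult[OF f] vlin_smult[OF h]
        tensor_rel_gens tensor_rel_subspace\<close>)

lemma tensor_map_coset:
  assumes "Poly_Mapping.keys t \<subseteq> carrier V \<times> carrier W"
  shows "tensor_map V W f h (tensor_rel V W +>\<^bsub>F\<^esub> t) = tensor_rel V W +>\<^bsub>F\<^esub> basis_map (map_prod f h) t"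
    and "Poly_Mapping.keys (basis_map (map_prod f h) t) \<subseteq> carrier V \<times> carrier W"
proof -
  have keys: "Poly_Mapping.keys (basis_map (map_prod f h) t) \<subseteq> carrier V \<times> carrier W"
    if "Poly_Mapping.keys t \<subseteq> carrier V \<times> carrier W" for t :: "'v \<times> 'w \<Rightarrow>\<^sub>0 'k"
    using vlin_closed[OF f] vlin_closed[OF h] by (intro basis_map_keys[OF that]) auto
  have "vlin F F (basis_map (map_prod f h))"
    by (rule vlinI) (simp_all add: keys)
  from set_add_image_coset[OF Q.quotient_space_axioms Q.quotient_space_axioms this] assms
  show "tensor_map V W f h (tensor_rel V W +>\<^bsub>F\<^esub> t) = tensor_rel V W +>\<^bsub>F\<^esub> basis_map (map_prod f h) t"
    using basis_map_tensor_rel unfolding tensor_map_def by auto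
qed (use vlin_closed[OF f] vlin_closed[OF h] in \<open>intro basis_map_keys[OF assms]; auto\<close>)

lemma tensor_map_elem:
  "\<lbrakk>v \<in> carrier V; w \<in> carrier W\<rbrakk> \<Longrightarrow>
    tensor_map V W f h (elem_tensor V W v w) = elem_tensor V W (f v) (h w)"
  using tensor_map_coset(1)[of "Poly_Mapping.single (v, w) 1"] by (simp add: elem_tensor_def)

lemma tensor_map_linear: "vlin (tensor V W) (tensor V W) (tensor_map V W f h)"
proof -
  have k: "Poly_Mapping.keys (s + t) \<subseteq> carrier V \<times> carrier W" "Poly_Mapping.keys (pm_scale c t) \<subseteq> carrier V \<times> carrier W"
    if "Poly_Mapping.keys s \<subseteq> carrier V \<times> carrier W" "Poly_Mapping.keys t \<subseteq> carrier V \<times> carrier W"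
    for s t :: "'v \<times> 'w \<Rightarrow>\<^sub>0 'k" and c
    using that keys_add[of s t] keys_pm_scale[of c t] by blast+
  show ?thesis
    by (rule vlinI; elim tensorE)
      (simp_all add: tensor_map_coset vlin_closed[OF coset_linear] k
        flip: vlin_add[OF coset_linear, simplified] vlin_smult[OF coset_linear, simplified])
qed

end

text \<open>
  Elementary tensors have this form by expanding the second factor, and the form is closed under
  addition. The coefficients in \<open>V\<close> are in general not unique; a map out of the tensor product
  that determines them is automatically injective.
\<close>

lemma tensor_normal_form:
  assumes I: "finite I" "\<And>i. i \<in> I \<Longrightarrow> w i \<in> carrier W"
    and span: "\<And>y. y \<in> carrier W \<Longrightarrow> \<exists>a. y = (\<Oplus>\<^bsub>W\<^esub>i\<in>I. a i \<odot>\<^bsub>W\<^esub> w i)"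
    and T: "T \<in> carrier (tensor V W)"
  obtains x where "x \<in> I \<rightarrow>\<^sub>E carrier V" "T = (\<Oplus>\<^bsub>tensor V W\<^esub>i\<in>I. elem_tensor V W (x i) (w i))"
proof -
  interpret T: vspace "tensor V W" by (rule vspace_tensor)
  have "\<exists>x \<in> I \<rightarrow> carrier V. T = (\<Oplus>\<^bsub>tensor V W\<^esub>i\<in>I. elem_tensor V W (x i) (w i))"
  proof (rule tensor_induct[OF T])
    have z: "elem_tensor V W \<zero>\<^bsub>V\<^esub> (w i) = \<zero>\<^bsub>tensor V W\<^esub>" if "i \<in> I" for i
      using vlin_zero[OF V.vspace_axioms vspace_tensor elem_tensor_linear_left[OF I(2)[OF that]]] .
    have "(\<Oplus>\<^bsub>tensor V W\<^esub>i\<in>I. elem_tensor V W \<zero>\<^bsub>V\<^esub> (w i)) = (\<Oplus>\<^bsub>tensor V W\<^esub>i\<in>I. \<zero>\<^bsub>tensor V W\<^esub>)"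
      by (rule T.finsum_cong') (simp_all add: z)
    then show "\<exists>x \<in> I \<rightarrow> carrier V. \<zero>\<^bsub>tensor V W\<^esub> = (\<Oplus>\<^bsub>tensor V W\<^esub>i\<in>I. elem_tensor V W (x i) (w i))"
      by (intro bexI[of _ "\<lambda>_. \<zero>\<^bsub>V\<^esub>"]) auto
  next
    fix v y T
    assume v: "v \<in> carrier V" and y: "y \<in> carrier W"
      and "\<exists>x \<in> I \<rightarrow> carrier V. T = (\<Oplus>\<^bsub>tensor V W\<^esub>i\<in>I. elem_tensor V W (x i) (w i))"
    then obtain x where x: "x \<in> I \<rightarrow> carrier V" and Tx: "T = (\<Oplus>\<^bsub>tensor V W\<^esub>i\<in>I. elem_tensor V W (x i) (w i))"
      by blast
    obtain a where a: "y = (\<Oplus>\<^bsub>W\<^esub>i\<in>I. a i \<odot>\<^bsub>W\<^esub> w i)" using span[OF y] by blast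
    have el: "elem_tensor V W v' (w i) \<in> carrier (tensor V W)" if "i \<in> I" "v' \<in> carrier V" for i v'
      using elem_tensor_closed[OF that(2) I(2)[OF that(1)]] .
    have "elem_tensor V W v y = (\<Oplus>\<^bsub>tensor V W\<^esub>i\<in>I. elem_tensor V W v (a i \<odot>\<^bsub>W\<^esub> w i))"
      unfolding a using I by (intro vlin_finsum[OF W.vspace_axioms vspace_tensor elem_tensor_linear_right[OF v]]) auto
    also have "\<dots> = (\<Oplus>\<^bsub>tensor V W\<^esub>i\<in>I. elem_tensor V W (a i \<odot>\<^bsub>V\<^esub> v) (w i))"
      using I v el by (intro T.finsum_cong')
        (auto simp: vlin_smult[OF elem_tensor_linear_right] vlin_smult[OF elem_tensor_linear_left])
    finally have "elem_tensor V W v y \<oplus>\<^bsub>tensor V W\<^esub> T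
        = (\<Oplus>\<^bsub>tensor V W\<^esub>i\<in>I. elem_tensor V W (a i \<odot>\<^bsub>V\<^esub> v) (w i) \<oplus>\<^bsub>tensor V W\<^esub> elem_tensor V W (x i) (w i))"
      using x v el by (simp add: Tx T.finsum_addf Pi_def)
    also have "\<dots> = (\<Oplus>\<^bsub>tensor V W\<^esub>i\<in>I. elem_tensor V W (a i \<odot>\<^bsub>V\<^esub> v \<oplus>\<^bsub>V\<^esub> x i) (w i))"
      using x v I el by (intro T.finsum_cong') (auto simp: vlin_add[OF elem_tensor_linear_left] Pi_def)
    finally show "\<exists>x \<in> I \<rightarrow> carrier V. elem_tensor V W v y \<oplus>\<^bsub>tensor V W\<^esub> T
        = (\<Oplus>\<^bsub>tensor V W\<^esub>i\<in>I. elem_tensor V W (x i) (w i))"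
      using x v by (intro bexI[of _ "\<lambda>i. a i \<odot>\<^bsub>V\<^esub> v \<oplus>\<^bsub>V\<^esub> x i"]) auto
  qed
  then obtain x where x: "x \<in> I \<rightarrow> carrier V" "T = (\<Oplus>\<^bsub>tensor V W\<^esub>i\<in>I. elem_tensor V W (x i) (w i))" by blast
  have "(\<Oplus>\<^bsub>tensor V W\<^esub>i\<in>I. elem_tensor V W (x i) (w i)) = (\<Oplus>\<^bsub>tensor V W\<^esub>i\<in>I. elem_tensor V W (restrict x I i) (w i))"
    using elem_tensor_closed[OF Pi_mem[OF x(1)] I(2)] by (intro T.finsum_cong') auto
  with x show thesis using that[of "restrict x I"] by auto
qed

end

section \<open>Tensor products mapping to cohomology\<close>

lemma tensor_snd_simps [simp]:
  "carrier (tensor_snd V W) = carrier (tensor V W)"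
  "zero (tensor_snd V W) = zero (tensor V W)"
  "add (tensor_snd V W) = add (tensor V W)"
  "smult (tensor_snd V W) = smult (tensor V W)"
  "gact (tensor_snd V W) = (\<lambda>g. tensor_map V W id (gact W g))"
  "ract (tensor_snd V W) = (\<lambda>T b. tensor_map V W (\<lambda>v. ract V v b) id T)"
  "hcomp (tensor_snd V W) = (\<lambda>n. {T \<in> carrier (tensor V W).
     \<exists>t\<in>T. Poly_Mapping.keys t \<subseteq> hcomp V n \<times> carrier W})"
  by (simp_all add: tensor_snd_def add_gact_def gmodule.defs hmodule.defs module.defs)

lemma vlin_tensor_snd: "vlin (tensor_snd V W) U f \<longleftrightarrow> vlin (tensor V W) U f"
  by (simp add: vlin_def)

lemma vlin_id: "vlin V V id" by (simp add: vlin_def)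

lemma (in coeff) subsp_hcomp: "subsp (total_ext G \<Phi> M) (hcomp (total_ext G \<Phi> M) n)"
proof -
  interpret T: vspace "total_ext G \<Phi> M" by (rule vspace_total)
  interpret E: vspace "Ext G M m" for m by (rule vspace_Ext)
  show ?thesis
    using T.zero_closed T.a_closed T.smult_closed by (auto simp: subsp_def)
qed

lemma (in vspace) vext_subsp:
  assumes B: "subsp V B" and \<beta>: "\<And>p. p \<in> X \<Longrightarrow> \<beta> p \<in> B" and t: "Poly_Mapping.keys t \<subseteq> X"
  shows "vext V \<beta> t \<in> B"
proof -
  have lin: "vlin (free_mod X) V (vext V \<beta>)"
    by (rule vext_linear) (use \<beta> B in \<open>auto simp: subsp_def\<close>)
  show ?thesis using t
  proof (induction t rule: free_induct)
    case zero
    then show ?case using vlin_zero[OF vspace_free_mod vspace_axioms lin] B by (simp add: subsp_def)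
  next
    case (step p c t)
    have "vext V \<beta> (Poly_Mapping.single p 1) = \<beta> p"
      using \<beta>[OF step(1)] B by (intro vext_single) (auto simp: subsp_def)
    then have "vext V \<beta> (Poly_Mapping.single p c) = c \<odot> \<beta> p"
      using vlin_smult[OF lin, of "Poly_Mapping.single p 1" c] step(1) by simp
    then show ?case
      using vlin_add[OF lin, of "Poly_Mapping.single p c" t] step \<beta>[OF step(1)] B by (simp add: subsp_def)
  qed
qed

context
  fixes G :: "('g, 'z) monoid_scheme" and N :: "('k::field, 'w, 'g) gmodule" and M :: "('k, 'v, 'g) gmodule"
    and W :: "('k, 'u, 'h) gmodule" and \<theta> :: "'u \<Rightarrow> 'w \<Rightarrow> 'v" and \<Phi>' :: "'h \<Rightarrow> 'v \<Rightarrow> 'v" and S :: "'h set"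
  assumes N: "coeff G N" and M: "coeff G M" and W: "vspace W"
    and \<theta>: "\<And>w. w \<in> carrier W \<Longrightarrow> coeff_map G N M (\<theta> w)"
    and \<theta>_add: "\<And>w w' v. \<lbrakk>w \<in> carrier W; w' \<in> carrier W; v \<in> carrier N\<rbrakk> \<Longrightarrow>
      \<theta> (w \<oplus>\<^bsub>W\<^esub> w') v = \<theta> w v \<oplus>\<^bsub>M\<^esub> \<theta> w' v"
    and \<theta>_smult: "\<And>c w v. \<lbrakk>w \<in> carrier W; v \<in> carrier N\<rbrakk> \<Longrightarrow> \<theta> (c \<odot>\<^bsub>W\<^esub> w) v = c \<odot>\<^bsub>M\<^esub> \<theta> w v"
    and gact: "\<And>g. g \<in> S \<Longrightarrow> vlin W W (gact W g)"
    and \<Phi>': "\<And>g. g \<in> S \<Longrightarrow> coeff_map G M M (\<Phi>' g)"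
    and \<theta>_gact: "\<And>g w v. \<lbrakk>g \<in> S; w \<in> carrier W; v \<in> carrier N\<rbrakk> \<Longrightarrow> \<Phi>' g (\<theta> w v) = \<theta> (gact W g w) v"
begin

text \<open>
  The assignment \<open>(x, w) \<mapsto> total_push (\<theta> w) x\<close> is bilinear. The cohomology ring acts on \<open>x\<close> and
  commutes with change of coefficients, while \<open>S\<close> acts on \<open>w\<close> and is carried to the action on
  \<open>M\<close> by the last assumption.
\<close>

lemma tensor_to_cohomology:
  obtains f where "vlin (tensor (total_ext G \<Phi> N) W) (total_ext G \<Phi>' M) f"
    "\<And>x w. \<lbrakk>x \<in> total_ext_carrier G N; w \<in> carrier W\<rbrakk> \<Longrightarrow>
      f (elem_tensor (total_ext G \<Phi> N) W x w) = total_push G N M (\<theta> w) x"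
    "\<And>b T. \<lbrakk>b \<in> total_ext_carrier G (triv_mod TYPE('k)); T \<in> carrier (tensor (total_ext G \<Phi> N) W)\<rbrakk> \<Longrightarrow>
      f (ract (tensor_snd (total_ext G \<Phi> N) W) T b) = ract (total_ext G \<Phi>' M) (f T) b"
    "\<And>g T. \<lbrakk>g \<in> S; T \<in> carrier (tensor (total_ext G \<Phi> N) W)\<rbrakk> \<Longrightarrow>
      f (gact (tensor_snd (total_ext G \<Phi> N) W) g T) = gact (total_ext G \<Phi>' M) g (f T)"
    "\<And>n T. T \<in> hcomp (tensor_snd (total_ext G \<Phi> N) W) n \<Longrightarrow> f T \<in> hcomp (total_ext G \<Phi>' M) n"
proof -
  interpret N: coeff G N by (rule N)
  interpret M: coeff G M by (rule M)
  interpret W: vspace W by (rule W)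
  let ?V = "total_ext G \<Phi> N" and ?U = "total_ext G \<Phi>' M"
  interpret V: vspace ?V by (rule N.vspace_total)
  interpret U: vspace ?U by (rule M.vspace_total)
  interpret T: tensor_product ?V W ..
  have left: "vlin ?V ?U (\<lambda>x. total_push G N M (\<theta> w) x)" if "w \<in> carrier W" for w
    by (rule coeff_map.total_push_linear[OF \<theta>[OF that]])
  have right: "vlin W ?U (\<lambda>w. total_push G N M (\<theta> w) x)" if "x \<in> carrier ?V" for x
  proof (rule vlinI)
    have x: "x \<in> total_ext_carrier G N" using that by simp
    fix w assume w: "w \<in> carrier W"
    show "total_push G N M (\<theta> w) x \<in> carrier ?U"
      using coeff_map.total_push_closed[OF \<theta>[OF w] x] by simp
    { fix w' assume w': "w' \<in> carrier W"
      show "total_push G N M (\<theta> (w \<oplus>\<^bsub>W\<^esub> w')) x = total_push G N M (\<theta> w) x \<oplus>\<^bsub>?U\<^esub> total_push G N M (\<theta> w') x"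
        using total_push_cong[OF coeff_map_plus[OF \<theta>[OF w] \<theta>[OF w']] \<theta>_add[OF w w'] x]
          total_push_plus[OF \<theta>[OF w] \<theta>[OF w'] x, where \<Phi> = \<Phi>'] by simp }
    fix c
    show "total_push G N M (\<theta> (c \<odot>\<^bsub>W\<^esub> w)) x = c \<odot>\<^bsub>?U\<^esub> total_push G N M (\<theta> w) x"
      using total_push_cong[OF coeff_map_scale[OF \<theta>[OF w]] \<theta>_smult[OF w] x]
        total_push_scale[OF \<theta>[OF w] x, where \<Phi> = \<Phi>'] by simp
  qed
  obtain f where f: "vlin (tensor ?V W) ?U f"
    "\<And>x w. \<lbrakk>x \<in> carrier ?V; w \<in> carrier W\<rbrakk> \<Longrightarrow> f (elem_tensor ?V W x w) = total_push G N M (\<theta> w) x"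
    "\<And>t. Poly_Mapping.keys t \<subseteq> carrier ?V \<times> carrier W \<Longrightarrow>
       f (tensor_rel ?V W +>\<^bsub>T.F\<^esub> t) = vext ?U (\<lambda>(x, w). total_push G N M (\<theta> w) x) t"
    using T.tensor_universal[OF U.vspace_axioms left right] by metis
  show thesis
  proof (rule that[OF f(1)])
    show "f (elem_tensor ?V W x w) = total_push G N M (\<theta> w) x"
      if "x \<in> total_ext_carrier G N" "w \<in> carrier W" for x w
      using f(2) that by simp
    show "f (ract (tensor_snd ?V W) T b) = ract ?U (f T) b"
      if b: "b \<in> total_ext_carrier G (triv_mod TYPE('k))" and T: "T \<in> carrier (tensor ?V W)" for b T
    proof -
      have r: "vlin ?V ?V (\<lambda>x. ract ?V x b)" by (rule N.ract_linear_left[OF b])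
      note tm = T.tensor_map_linear[OF r vlin_id] and te = T.tensor_map_elem[OF r vlin_id]
      show ?thesis
        unfolding tensor_snd_simps
      proof (rule T.tensor_linear_eq[OF U.vspace_axioms vlin_compose[OF tm f(1)]
            vlin_compose[OF f(1) M.ract_linear_left[OF b]] _ T])
        fix x w assume x: "x \<in> carrier ?V" and w: "w \<in> carrier W"
        show "f (tensor_map ?V W (\<lambda>x. ract ?V x b) id (elem_tensor ?V W x w)) = ract ?U (f (elem_tensor ?V W x w)) b"
          using te[OF x w] f(2)[OF vlin_closed[OF r x] w] f(2)[OF x w] x
            coeff_map.total_push_ract[OF \<theta>[OF w] _ b, of x \<Phi> \<Phi>'] by simp
      qed
    qed
    show "f (gact (tensor_snd ?V W) g T) = gact ?U g (f T)"
      if g: "g \<in> S" and T: "T \<in> carrier (tensor ?V W)" for g T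
    proof -
      note tm = T.tensor_map_linear[OF vlin_id gact[OF g]] and te = T.tensor_map_elem[OF vlin_id gact[OF g]]
      show ?thesis
        unfolding tensor_snd_simps total_ext_gact
      proof (rule T.tensor_linear_eq[OF U.vspace_axioms vlin_compose[OF tm f(1)]
            vlin_compose[OF f(1) coeff_map.total_push_linear[OF \<Phi>'[OF g]]] _ T])
        fix x w assume x: "x \<in> carrier ?V" and w: "w \<in> carrier W"
        have x': "x \<in> total_ext_carrier G N" using x by simp
        note gw = vlin_closed[OF gact[OF g] w]
        have "total_push G N M (\<theta> (gact W g w)) x = total_push G M M (\<Phi>' g) (total_push G N M (\<theta> w) x)"
          using total_push_comp[OF \<theta>[OF w] \<Phi>'[OF g] x'] total_push_cong[OF \<theta>[OF gw] \<theta>_gact[OF g w] x'] by simp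
        then show "f (tensor_map ?V W id (gact W g) (elem_tensor ?V W x w))
            = total_push G M M (\<Phi>' g) (f (elem_tensor ?V W x w))"
          using te[OF x w] f(2)[OF x gw] f(2)[OF x w] by simp
      qed
    qed
    show "f T \<in> hcomp ?U n" if hT: "T \<in> hcomp (tensor_snd ?V W) n" for n T
    proof -
      obtain t where T: "T \<in> carrier (tensor ?V W)" and t: "t \<in> T" "Poly_Mapping.keys t \<subseteq> hcomp ?V n \<times> carrier W"
        using hT unfolding tensor_snd_simps by blast
      have t': "Poly_Mapping.keys t \<subseteq> carrier ?V \<times> carrier W" using t(2) by auto
      have "T = tensor_rel ?V W +>\<^bsub>T.F\<^esub> t"
        using T t(1) T.Q.a_repr_independence'[of t] by (auto elim!: T.tensorE)
      then have "f T = vext ?U (\<lambda>(x, w). total_push G N M (\<theta> w) x) t" using f(3)[OF t'] by simp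
      also have "\<dots> \<in> hcomp ?U n"
      proof (rule U.vext_subsp[OF M.subsp_hcomp _ t(2)])
        show "(case p of (x, w) \<Rightarrow> total_push G N M (\<theta> w) x) \<in> hcomp ?U n"
          if "p \<in> hcomp ?V n \<times> carrier W" for p
          using that coeff_map.total_push_hcomp[OF \<theta>, of "snd p" "fst p" \<Phi> n \<Phi>']
          by (cases p) auto
      qed
      finally show ?thesis .
    qed
  qed
qed

end

lemma (in tensor_product) tensor_sum_support:
  assumes "finite I" "\<And>i. i \<in> I \<Longrightarrow> x i \<in> A" "\<And>i. i \<in> I \<Longrightarrow> w i \<in> carrier W" "A \<subseteq> carrier V"
  shows "\<exists>t\<in>(\<Oplus>\<^bsub>tensor V W\<^esub>i\<in>I. elem_tensor V W (x i) (w i)). Poly_Mapping.keys t \<subseteq> A \<times> carrier W"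
proof -
  interpret T: vspace "tensor V W" by (rule vspace_tensor)
  from assms have "\<exists>t. (\<Oplus>\<^bsub>tensor V W\<^esub>i\<in>I. elem_tensor V W (x i) (w i)) = tensor_rel V W +>\<^bsub>F\<^esub> t
      \<and> Poly_Mapping.keys t \<subseteq> A \<times> carrier W"
  proof (induction I rule: finite_induct)
    case empty
    have "\<zero>\<^bsub>tensor V W\<^esub> = tensor_rel V W +>\<^bsub>F\<^esub> 0"
      using vlin_zero[OF vspace_free_mod vspace_tensor coset_linear] by simp
    then show ?case by (intro exI[of _ 0]) simp
  next
    case (insert i I)
    then obtain t where t: "(\<Oplus>\<^bsub>tensor V W\<^esub>i\<in>I. elem_tensor V W (x i) (w i)) = tensor_rel V W +>\<^bsub>F\<^esub> t"
      "Poly_Mapping.keys t \<subseteq> A \<times> carrier W" by auto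
    have xw: "x i \<in> carrier V" "w i \<in> carrier W" "x i \<in> A" using insert by auto
    have el: "elem_tensor V W (x j) (w j) \<in> carrier (tensor V W)" if "j \<in> insert i I" for j
      using elem_tensor_closed[of "x j" "w j"] insert.prems that by blast
    have "(\<Oplus>\<^bsub>tensor V W\<^esub>i\<in>insert i I. elem_tensor V W (x i) (w i))
        = elem_tensor V W (x i) (w i) \<oplus>\<^bsub>tensor V W\<^esub> (tensor_rel V W +>\<^bsub>F\<^esub> t)"
      using insert(1,2) el by (subst T.finsum_insert) (auto simp: t(1))
    also have "\<dots> = tensor_rel V W +>\<^bsub>F\<^esub> (Poly_Mapping.single (x i, w i) 1 + t)"
      using vlin_add[OF coset_linear, of "Poly_Mapping.single (x i, w i) 1" t] t(2) xw insert.prems(3)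
      by (auto simp: elem_tensor_def)
    finally show ?case
      using t(2) xw keys_add[of "Poly_Mapping.single (x i, w i) 1" t]
      by (intro exI[of _ "Poly_Mapping.single (x i, w i) 1 + t"]) (auto split: if_splits)
  qed
  then obtain t where t: "(\<Oplus>\<^bsub>tensor V W\<^esub>i\<in>I. elem_tensor V W (x i) (w i)) = tensor_rel V W +>\<^bsub>F\<^esub> t"
    "Poly_Mapping.keys t \<subseteq> A \<times> carrier W" by blast
  have "t \<in> tensor_rel V W +>\<^bsub>F\<^esub> t" using t(2) assms(4) by (intro Q.a_rcos_self) auto
  with t show ?thesis by auto
qed

lemma dir_sum_simps [simp]:
  "carrier (dir_sum V W) = carrier V \<times> carrier W"
  "add (dir_sum V W) = (\<lambda>x y. (fst x \<oplus>\<^bsub>V\<^esub> fst y, snd x \<oplus>\<^bsub>W\<^esub> snd y))"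
  "smult (dir_sum V W) = (\<lambda>c. map_prod (\<lambda>v. c \<odot>\<^bsub>V\<^esub> v) (\<lambda>w. c \<odot>\<^bsub>W\<^esub> w))"
  "zero (dir_sum V W) = (\<zero>\<^bsub>V\<^esub>, \<zero>\<^bsub>W\<^esub>)"
  "gact (dir_sum V W) = (\<lambda>g. map_prod (gact V g) (gact W g))"
  "ract (dir_sum V W) = (\<lambda>x b. (ract V (fst x) b, ract W (snd x) b))"
  "hcomp (dir_sum V W) = (\<lambda>n. hcomp V n \<times> hcomp W n)"
  by (simp_all add: dir_sum_def)

lemma dpower_simps [simp]:
  "carrier (dpower V k) = {..<k} \<rightarrow>\<^sub>E carrier V"
  "add (dpower V k) = (\<lambda>x y. \<lambda>i\<in>{..<k}. x i \<oplus>\<^bsub>V\<^esub> y i)"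
  "smult (dpower V k) = (\<lambda>c x. \<lambda>i\<in>{..<k}. c \<odot>\<^bsub>V\<^esub> x i)"
  "ract (dpower V k) = (\<lambda>x b. \<lambda>i\<in>{..<k}. ract V (x i) b)"
  by (simp_all add: dpower_def)

lemma vspace_dir_sum: "\<lbrakk>vspace V; vspace W\<rbrakk> \<Longrightarrow> vspace (dir_sum V W)"
proof -
  assume "vspace V" "vspace W"
  then interpret V: vspace V + W: vspace W .
  show ?thesis
    by (rule vspaceI)
      (auto simp: V.a_ac W.a_ac V.smult_l_distr W.smult_l_distr V.smult_r_distr W.smult_r_distr
        V.smult_assoc W.smult_assoc)
qed

lemma (in abelian_monoid) finsum_Plus:
  assumes "finite A" "finite B" "\<And>x. x \<in> Sum_Type.Plus A B \<Longrightarrow> f x \<in> carrier G"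
  shows "(\<Oplus>x\<in>Sum_Type.Plus A B. f x) = (\<Oplus>x\<in>A. f (Inl x)) \<oplus> (\<Oplus>x\<in>B. f (Inr x))"
proof -
  have "(\<Oplus>x\<in>Sum_Type.Plus A B. f x) = (\<Oplus>x\<in>Inl ` A. f x) \<oplus> (\<Oplus>x\<in>Inr ` B. f x)"
    unfolding Sum_Type.Plus_def using assms by (intro finsum_Un_disjoint) auto
  then show ?thesis
    using assms(3) by (subst (asm) (1 2) finsum_reindex) (auto simp: inj_on_def)
qed

section \<open>Degree zero and the unit of the cohomology ring\<close>

definition invariants :: "('g, 'z) monoid_scheme \<Rightarrow> ('k, 'v, 'g, 'x) gmodule_scheme \<Rightarrow> 'v set" where
  "invariants G M = {v \<in> carrier M. \<forall>g\<in>carrier G. gact M g v = v}"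

definition eval0 :: "('g, 'z) monoid_scheme \<Rightarrow> (('g list \<Rightarrow>\<^sub>0 'k::field) \<Rightarrow> 'v) set \<Rightarrow> 'v" where
  "eval0 G X = the_elem X (Poly_Mapping.single [\<one>\<^bsub>G\<^esub>] 1)"

context coeff
begin

definition const_cocycle :: "'v \<Rightarrow> ('g list \<Rightarrow>\<^sub>0 'k) \<Rightarrow> 'v" where
  "const_cocycle v = (\<lambda>x\<in>carrier (std_res G 0). std_aug x \<odot>\<^bsub>M\<^esub> v)"

lemma single_tuple1: "g \<in> carrier G \<Longrightarrow> Poly_Mapping.single [g] (1::'k) \<in> carrier (std_res G 0)"
  by (simp add: std_res_eq tuples_def)

lemma std_aug_gact:
  "std_aug (basis_map \<sigma> x) = std_aug (x :: 'g list \<Rightarrow>\<^sub>0 'k)" for \<sigma> :: "'g list \<Rightarrow> 'g list"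
proof -
  have "Poly_Mapping.keys x \<subseteq> UNIV" by simp
  then show ?thesis by (induction x rule: free_induct) auto
qed

lemma std_aug_std_diff:
  assumes "x \<in> carrier (std_res G 1)" shows "std_aug (std_diff x) = (0 :: 'k)"
  using std_diff_eq_std_aug[of "std_diff x" G] std_diff_closed[of x 0] assms
  by (simp add: std_res_eq) (metis lookup_single_eq lookup_zero)

lemma const_cocycle:
  assumes v: "v \<in> invariants G M" shows "const_cocycle v \<in> cocycles G M 0"
proof -
  have vc: "v \<in> carrier M" using v by (simp add: invariants_def)
  have "gmap G (std_res G 0) M (\<lambda>x. std_aug x \<odot>\<^bsub>M\<^esub> v)"
    unfolding gmap_def equivariant_def
  proof (intro conjI ballI vlinI)
    fix g and x :: "'g list \<Rightarrow>\<^sub>0 'k" assume "g \<in> carrier G"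
    then show "std_aug (gact (std_res G 0) g x) \<odot>\<^bsub>M\<^esub> v = gact M g (std_aug x \<odot>\<^bsub>M\<^esub> v)"
      using v by (simp add: std_res_eq std_aug_gact gact_smult invariants_def)
  qed (use vc in \<open>auto simp: std_res_eq smult_l_distr smult_assoc\<close>)
  from restrict_cochain[OF this] show ?thesis
    using std_aug_std_diff vc std_diff_closed[of _ 0] by (auto simp: cocycles_def const_cocycle_def)
qed

lemma cocycle0:
  assumes f: "f \<in> cocycles G M 0"
  shows "f (Poly_Mapping.single [\<one>\<^bsub>G\<^esub>] 1) \<in> invariants G M"
    and "f = const_cocycle (f (Poly_Mapping.single [\<one>\<^bsub>G\<^esub>] 1))"
proof -
  note gf = cocycle_gmap[OF f]
  define v where "v = f (Poly_Mapping.single [\<one>\<^bsub>G\<^esub>] 1)"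
  have fc: "f \<in> carrier (cochains G M 0)" using f by (simp add: cocycles_def)
  have vc: "v \<in> carrier M"
    unfolding v_def by (rule cochain_closed[OF fc single_tuple1]) simp
  have g: "f (Poly_Mapping.single [g] 1) = v" if "g \<in> carrier G" for g
  proof -
    let ?x = "Poly_Mapping.single [\<one>\<^bsub>G\<^esub>, g] (1 :: 'k)"
    have "?x \<in> carrier (std_res G (Suc 0))" using that by (simp add: std_res_eq tuples_def)
    then have "f (std_diff ?x) = \<zero>\<^bsub>M\<^esub>" using f by (simp add: cocycles_def)
    moreover have "std_diff ?x = Poly_Mapping.single [g] 1 - Poly_Mapping.single [\<one>\<^bsub>G\<^esub>] 1"
      by (simp add: std_diff_single_Cons)
    moreover have "f (Poly_Mapping.single [g] 1 - Poly_Mapping.single [\<one>\<^bsub>G\<^esub>] 1)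
        = f (Poly_Mapping.single [g] 1) \<ominus>\<^bsub>M\<^esub> v"
      using vlin_minus[OF gmod.axioms(1)[OF grp.gmod_std_res] vspace_axioms, of 0 f "Poly_Mapping.single [g] 1" "Poly_Mapping.single [\<one>\<^bsub>G\<^esub>] 1"]
        gf that gmod.axioms(1)[OF grp.gmod_std_res, THEN vspace.minus_eq_smult, of "Poly_Mapping.single [g] (1 :: 'k)" 0 "Poly_Mapping.single [\<one>\<^bsub>G\<^esub>] 1"]
      by (simp add: gmap_def v_def std_res_eq tuples_def pm_scale_minus_one single_uminus)
    ultimately show ?thesis
      using vc cochain_closed[OF fc single_tuple1[OF that]]
        minus_equality[of "f (Poly_Mapping.single [g] 1)" "\<ominus>\<^bsub>M\<^esub> v"] by (simp add: minus_eq)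
  qed
  have "gact M h v = v" if "h \<in> carrier G" for h
    using gmap_gact[OF gf that single_tuple1[of "\<one>\<^bsub>G\<^esub>"]] g[of h] that
    by (simp add: std_res_eq v_def)
  then show inv: "f (Poly_Mapping.single [\<one>\<^bsub>G\<^esub>] 1) \<in> invariants G M"
    using vc by (simp add: invariants_def v_def)
  show "f = const_cocycle (f (Poly_Mapping.single [\<one>\<^bsub>G\<^esub>] 1))"
    unfolding v_def[symmetric]
  proof (rule cochain_eqI[OF fc])
    show "const_cocycle v \<in> carrier (cochains G M 0)"
      using const_cocycle[OF inv] by (simp add: cocycles_def v_def)
    fix x :: "'g list \<Rightarrow>\<^sub>0 'k" assume "x \<in> carrier (std_res G 0)"
    then have x: "Poly_Mapping.keys x \<subseteq> tuples G 1" by (simp add: std_res_eq)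
    then have "f x = std_aug x \<odot>\<^bsub>M\<^esub> v"
    proof (induction x rule: free_induct)
      case zero
      then show ?case using cochain_zero[OF fc] vc by simp
    next
      case (step xs c x)
      then obtain h where h: "xs = [h]" "h \<in> carrier G" by (auto simp: tuples_def length_Suc_conv)
      have "f (Poly_Mapping.single xs c) = c \<odot>\<^bsub>M\<^esub> v"
        using gmap_smult[OF gf single_tuple1[OF h(2)], of c] g[OF h(2)] h by (simp add: std_res_eq)
      then show ?case
        using gmap_add[OF gf, of "Poly_Mapping.single xs c" x] step vc by (simp add: std_res_eq smult_l_distr)
    qed
    then show "f x = const_cocycle v x" using x by (simp add: const_cocycle_def std_res_eq)
  qed
qed

lemma ext_class0: "f \<in> cocycles G M 0 \<Longrightarrow> ext_class G M 0 f = {f}"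
proof -
  assume f: "f \<in> cocycles G M 0"
  interpret C: vspace "cochains G M 0" by (rule vspace_cochains)
  have "f \<in> carrier (cochains G M 0)" using f by (simp add: cocycles_def)
  then show ?thesis by (simp add: ext_class_def a_r_coset_def')
qed

lemma eval0_class: "f \<in> cocycles G M 0 \<Longrightarrow> eval0 G (ext_class G M 0 f) = f (Poly_Mapping.single [\<one>\<^bsub>G\<^esub>] 1)"
  by (simp add: eval0_def ext_class0)

lemma eval0_const:
  "v \<in> invariants G M \<Longrightarrow> eval0 G (ext_class G M 0 (const_cocycle v)) = v"
  using eval0_class[OF const_cocycle] single_tuple1[of "\<one>\<^bsub>G\<^esub>"] by (simp add: const_cocycle_def invariants_def)

lemma Ext0_cases:
  assumes "X \<in> carrier (Ext G M 0)"
  obtains v where "v \<in> invariants G M" "X = ext_class G M 0 (const_cocycle v)" "eval0 G X = v"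
  using assms cocycle0 eval0_const by (metis ExtE)

lemma eval0_bij: "bij_betw (eval0 G) (carrier (Ext G M 0)) (invariants G M)"
proof (rule bij_betw_byWitness[where f' = "\<lambda>v. ext_class G M 0 (const_cocycle v)"])
  show "\<forall>X\<in>carrier (Ext G M 0). ext_class G M 0 (const_cocycle (eval0 G X)) = X"
    by (metis Ext0_cases)
  show "eval0 G ` carrier (Ext G M 0) \<subseteq> invariants G M"
    by (metis Ext0_cases image_subsetI)
  show "(\<lambda>v. ext_class G M 0 (const_cocycle v)) ` invariants G M \<subseteq> carrier (Ext G M 0)"
    using ext_class_closed[OF const_cocycle] by auto
qed (simp add: eval0_const)

lemma eval0_linear: "vlin (Ext G M 0) M (eval0 G)"
proof (rule vlinI)
  note o = single_tuple1[OF grp.one_closed]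
  fix X assume "X \<in> carrier (Ext G M 0)"
  then obtain f where f: "f \<in> cocycles G M 0" "X = ext_class G M 0 f" by (rule ExtE)
  show "eval0 G X \<in> carrier M"
    using cocycle0(1)[OF f(1)] f by (simp add: eval0_class invariants_def)
  { fix Y assume "Y \<in> carrier (Ext G M 0)"
    then obtain h where h: "h \<in> cocycles G M 0" "Y = ext_class G M 0 h" by (rule ExtE)
    show "eval0 G (X \<oplus>\<^bsub>Ext G M 0\<^esub> Y) = eval0 G X \<oplus>\<^bsub>M\<^esub> eval0 G Y"
      using f h o by (simp add: ext_class_add eval0_class cocycle_add) }
  fix c
  show "eval0 G (c \<odot>\<^bsub>Ext G M 0\<^esub> X) = c \<odot>\<^bsub>M\<^esub> eval0 G X"
    using f o by (simp add: ext_class_smult eval0_class cocycle_smult)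
qed

end

lemma (in coeff_map) eval0_push:
  assumes "X \<in> carrier (Ext G M 0)"
  shows "eval0 G (ext_push G M N 0 \<theta> X) = \<theta> (eval0 G X)"
proof -
  obtain f where f: "f \<in> cocycles G M 0" "X = ext_class G M 0 f" using M.ExtE[OF assms] .
  then show ?thesis
    using M.single_tuple1[OF M.grp.one_closed]
    by (simp add: push_class M.eval0_class N.eval0_class push_cocycle) (simp add: compose_def)
qed

lemma (in group) identity_lift:
  "is_lift G 0 (\<lambda>x\<in>carrier (std_res G 0). std_aug x)
     (\<lambda>n. \<lambda>x\<in>carrier (std_res G (n + 0)). x :: 'a list \<Rightarrow>\<^sub>0 'k::field)"
  by (rule is_liftI[OF group_axioms]) (auto simp: gmap_def equivariant_def intro!: vlinI)

context coeff
begin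

abbreviation "unit_class \<equiv> ext_class G (triv_mod TYPE('k)) 0 (\<lambda>x\<in>carrier (std_res G 0). std_aug x)"

lemma aug_const_cocycle:
  "(\<lambda>x\<in>carrier (std_res G 0). std_aug x) = coeff.const_cocycle G (triv_mod TYPE('k)) 1"
  by (simp add: coeff.const_cocycle_def[OF grp.coeff_triv])

lemma aug_cocycle: "(\<lambda>x\<in>carrier (std_res G 0). std_aug x) \<in> cocycles G (triv_mod TYPE('k)) 0"
  unfolding aug_const_cocycle
  by (rule coeff.const_cocycle[OF grp.coeff_triv]) (simp add: invariants_def)

lemma yoneda_unit_right:
  assumes "X \<in> carrier (Ext G M i)" shows "yoneda G M i 0 X unit_class = X"
proof -
  obtain f where f: "f \<in> cocycles G M i" "X = ext_class G M i f" using ExtE[OF assms] .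
  have "f \<in> extensional (carrier (std_res G i))"
    using f(1) by (simp add: cocycles_def cochain_iff)
  then have "compose (carrier (std_res G (i + 0))) f (\<lambda>x\<in>carrier (std_res G (i + 0)). x) = f"
    by (auto simp: compose_def fun_eq_iff extensional_def)
  then show ?thesis using yoneda_eq[OF f(1) aug_cocycle grp.identity_lift] f(2) by simp
qed

lemma yoneda_unit_left:
  assumes "Y \<in> carrier (Ext G (triv_mod TYPE('k)) j)"
  shows "yoneda G (triv_mod TYPE('k)) 0 j unit_class Y = Y"
proof -
  interpret K: coeff G "triv_mod TYPE('k)" by (rule grp.coeff_triv)
  obtain h where h: "h \<in> cocycles G (triv_mod TYPE('k)) j" "Y = ext_class G (triv_mod TYPE('k)) j h"
    using K.ExtE[OF assms] .
  obtain \<psi> where \<psi>: "is_lift G j h \<psi>" using lift_exists[OF grp.group_axioms h(1)] .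
  have "h \<in> extensional (carrier (std_res G j))"
    using h(1) by (simp add: cocycles_def K.cochain_iff)
  then have "compose (carrier (std_res G (0 + j))) (\<lambda>x\<in>carrier (std_res G 0). std_aug x) (\<psi> 0) = h"
    using is_liftD(3)[OF \<psi>] gmap_closed[OF is_liftD(1)[OF \<psi>, of 0]]
    by (auto simp: compose_def fun_eq_iff extensional_def)
  then show ?thesis using K.yoneda_eq[OF aug_cocycle h(1) \<psi>] h(2) by simp
qed

lemma Ext0_triv:
  assumes "Y \<in> carrier (Ext G (triv_mod TYPE('k)) 0)"
  shows "\<exists>c. Y = c \<odot>\<^bsub>Ext G (triv_mod TYPE('k)) 0\<^esub> unit_class"
proof -
  interpret K: coeff G "triv_mod TYPE('k)" by (rule grp.coeff_triv)
  obtain c where c: "Y = ext_class G (triv_mod TYPE('k)) 0 (K.const_cocycle c)"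
    using K.Ext0_cases[OF assms] .
  have "c \<odot>\<^bsub>Ext G (triv_mod TYPE('k)) 0\<^esub> unit_class
     = ext_class G (triv_mod TYPE('k)) 0 (\<lambda>x\<in>carrier (std_res G 0). c * (\<lambda>x\<in>carrier (std_res G 0). std_aug x) x)"
    using K.ext_class_smult[OF aug_cocycle, of c] by simp
  also have "(\<lambda>x\<in>carrier (std_res G 0). c * (\<lambda>x\<in>carrier (std_res G 0). std_aug x) x) = K.const_cocycle c"
    by (auto simp: K.const_cocycle_def mult.commute intro!: restrict_ext)
  finally show ?thesis using c by metis
qed

lemma coh_augmentation:
  assumes "b \<in> total_ext_carrier G (triv_mod TYPE('k))"
  shows "b 0 = coh_augmentation G b \<odot>\<^bsub>Ext G (triv_mod TYPE('k)) 0\<^esub> unit_class"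
proof -
  interpret K: coeff G "triv_mod TYPE('k)" by (rule grp.coeff_triv)
  obtain c where c: "b 0 = c \<odot>\<^bsub>Ext G (triv_mod TYPE('k)) 0\<^esub> unit_class"
    using Ext0_triv[OF total_ext_comp[OF assms]] by blast
  have ev: "eval0 G (d \<odot>\<^bsub>Ext G (triv_mod TYPE('k)) 0\<^esub> unit_class) = d" for d
    using vlin_smult[OF K.eval0_linear K.ext_class_closed[OF aug_cocycle], of d]
      K.eval0_const[of 1] aug_const_cocycle by (simp add: invariants_def)
  have "coh_augmentation G b = c"
    unfolding coh_augmentation_def
    by (rule the_equality, rule c) (metis ev c)
  with c show ?thesis by simp
qed

lemma ract_unit:
  assumes b: "b \<in> total_ext_carrier G (triv_mod TYPE('k))"
  shows "ract (total_ext G \<Phi> (triv_mod TYPE('k))) (in_degree G (triv_mod TYPE('k)) 0 unit_class) b = b"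
proof
  let ?K = "triv_mod TYPE('k) :: ('k, 'k, 'g) gmodule"
  interpret K: coeff G ?K by (rule grp.coeff_triv)
  fix n
  interpret E: vspace "Ext G ?K n" by (rule K.vspace_Ext)
  have "(\<Oplus>\<^bsub>Ext G ?K n\<^esub>i\<in>{..n}. yoneda G ?K i (n - i) (in_degree G ?K 0 unit_class i) (b (n - i)))
    = (\<Oplus>\<^bsub>Ext G ?K n\<^esub>i\<in>{..n}. if 0 = i then b n else \<zero>\<^bsub>Ext G ?K n\<^esub>)"
  proof (rule E.finsum_cong')
    fix i assume i: "i \<in> {..n}"
    show "yoneda G ?K i (n - i) (in_degree G ?K 0 unit_class i) (b (n - i))
        = (if 0 = i then b n else \<zero>\<^bsub>Ext G ?K n\<^esub>)"
      using yoneda_unit_left[OF total_ext_comp[OF b]] K.yoneda_zero_left[OF total_ext_comp[OF b], of i "n - i"] i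
      by (auto simp: in_degree_def)
  qed (use total_ext_comp[OF b] in auto)
  also have "\<dots> = b n"
    using E.finsum_singleton[of 0 "{..n}" "\<lambda>_. b n"] total_ext_comp[OF b] by simp
  finally show "ract (total_ext G \<Phi> ?K) (in_degree G ?K 0 unit_class) b n = b n" by simp
qed

text \<open>
  A class of positive degree moves degree \<open>0\<close> into a group that vanishes, so only the
  degree \<open>0\<close> part of a class, a scalar multiple of the unit, can act.
\<close>

lemma trivial_module_of_vanishing:
  assumes vanish: "\<And>m. carrier (Ext G M (Suc m)) \<subseteq> {\<zero>\<^bsub>Ext G M (Suc m)\<^esub>}"
  shows "carrier (total_ext G \<Phi> M) = hcomp (total_ext G \<Phi> M) 0"
    and "trivial_coh_module G (total_ext G \<Phi> M)"
proof -
  interpret E: vspace "Ext G M m" for m by (rule vspace_Ext)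
  let ?K = "triv_mod TYPE('k) :: ('k, 'k, 'g) gmodule"
  have zero: "X = \<zero>\<^bsub>Ext G M m\<^esub>" if "X \<in> carrier (Ext G M m)" "m \<noteq> 0" for X m
    using vanish[of "m - 1"] that by (cases m) auto
  then show "carrier (total_ext G \<Phi> M) = hcomp (total_ext G \<Phi> M) 0"
    by (auto dest: total_ext_comp)
  show "trivial_coh_module G (total_ext G \<Phi> M)"
    unfolding trivial_coh_module_def
  proof (intro ballI ext)
    fix b x n
    assume b: "b \<in> total_ext_carrier G ?K" and "x \<in> carrier (total_ext G \<Phi> M)"
    then have x: "x \<in> total_ext_carrier G M" by simp
    show "ract (total_ext G \<Phi> M) x b n = (coh_augmentation G b \<odot>\<^bsub>total_ext G \<Phi> M\<^esub> x) n"
    proof (cases "n = 0")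
      case True
      have u: "unit_class \<in> carrier (Ext G ?K 0)"
        by (rule coeff.ext_class_closed[OF grp.coeff_triv aug_cocycle])
      have "yoneda G M 0 0 (x 0) (b 0) = coh_augmentation G b \<odot>\<^bsub>Ext G M 0\<^esub> x 0"
        using vlin_smult[OF yoneda_linear_right[OF total_ext_comp[OF x, of 0]] u, of "coh_augmentation G b"]
          yoneda_unit_right[OF total_ext_comp[OF x, of 0]] coh_augmentation[OF b] by simp
      then show ?thesis using True total_ext_comp[OF x] by simp
    next
      case False
      have "ract (total_ext G \<Phi> M) x b n = \<zero>\<^bsub>Ext G M n\<^esub>"
        using zero[OF total_ext_comp[OF ract_closed[OF x b]] False] .
      then show ?thesis using zero[OF total_ext_comp[OF x] False] by simp
    qed
  qed
qed

end

section \<open>Vanishing for permutation modules with invertible stabilisers\<close>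

lemma sum_single: "(\<Sum>g\<in>A. Poly_Mapping.single x (c g)) = Poly_Mapping.single x (\<Sum>g\<in>A. c g)"
  by (induction A rule: infinite_finite_induct) (simp_all add: single_add)

text \<open>
  \<open>T x\<close> is an equivariant choice of finite subsets of the group, in practice cosets of stabilisers. The
  coefficient of \<open>x\<close> in the new cochain at \<open>xs\<close> is the average over \<open>g \<in> T x\<close> of the coefficient of \<open>x\<close>
  in \<open>f (g # xs)\<close>. For a single \<open>g\<close>, prepending would already bound the cocycle \<open>f\<close>;
  letting \<open>g\<close> run through \<open>T x\<close> makes the result equivariant, and dividing by the size
  of \<open>T x\<close> makes it bound \<open>f\<close> itself.
\<close>

lemma (in group) permutation_module_vanishing:
  fixes \<alpha> :: "'a \<Rightarrow> 'p \<Rightarrow> 'p" and X :: "'p set"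
  defines "M \<equiv> perm_mod X \<alpha> :: ('k::field, 'p \<Rightarrow>\<^sub>0 'k, 'a) gmodule"
  assumes fin: "finite (carrier G)"
    and closed: "\<And>g x. \<lbrakk>g \<in> carrier G; x \<in> X\<rbrakk> \<Longrightarrow> \<alpha> g x \<in> X"
    and one: "\<And>x. x \<in> X \<Longrightarrow> \<alpha> \<one> x = x"
    and mult: "\<And>g h x. \<lbrakk>g \<in> carrier G; h \<in> carrier G; x \<in> X\<rbrakk> \<Longrightarrow> \<alpha> (g \<otimes> h) x = \<alpha> g (\<alpha> h x)"
    and T: "\<And>x. x \<in> X \<Longrightarrow> T x \<subseteq> carrier G"
    and T_act: "\<And>g x. \<lbrakk>g \<in> carrier G; x \<in> X\<rbrakk> \<Longrightarrow> T (\<alpha> g x) = (\<lambda>h. g \<otimes> h) ` T x"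
    and T_card: "\<And>x. x \<in> X \<Longrightarrow> of_nat (card (T x)) \<noteq> (0::'k)"
  shows "carrier (Ext G M (Suc m)) \<subseteq> {\<zero>\<^bsub>Ext G M (Suc m)\<^esub>}"
proof
  have "gmod G M" unfolding M_def by (rule gmod_perm_mod[OF group_axioms closed one mult])
  then interpret coeff G M by (simp add: coeff_def)
  define p :: "'a \<Rightarrow> 'p \<Rightarrow> ('p \<Rightarrow>\<^sub>0 'k)" where
    "p g x = (if g \<in> T x then Poly_Mapping.single x (inverse (of_nat (card (T x)))) else 0)" for g x
  have p_keys: "Poly_Mapping.keys (p g x) \<subseteq> X" if "x \<in> X" for g x
    using that by (simp add: p_def)
  have p_sum: "(\<Sum>g\<in>carrier G. p g x) = Poly_Mapping.single x 1" if "x \<in> X" for x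
  proof -
    have "(\<Sum>g\<in>carrier G. p g x) = (\<Sum>g\<in>T x. Poly_Mapping.single x (inverse (of_nat (card (T x)))))"
      using T[OF that] fin by (intro sum.mono_neutral_cong_right) (auto simp: p_def)
    also have "\<dots> = Poly_Mapping.single x (\<Sum>g\<in>T x. inverse (of_nat (card (T x))))"
      by (rule sum_single)
    also have "\<dots> = Poly_Mapping.single x 1" using T_card[OF that] by simp
    finally show ?thesis .
  qed
  have p_act: "p (g \<otimes> h) (\<alpha> g x) = basis_map (\<alpha> g) (p h x)"
    if "g \<in> carrier G" "h \<in> carrier G" "x \<in> X" for g h x
  proof -
    have inj: "inj_on (\<lambda>h. g \<otimes> h) (T x)" using T[OF that(3)] that(1) by (intro inj_onI) (metis Units_eq Units_l_cancel subsetD)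
    have "g \<otimes> h \<in> (\<lambda>h. g \<otimes> h) ` T x \<longleftrightarrow> h \<in> T x" using T[OF that(3)] that by auto
    then show ?thesis using T_act[OF that(1,3)] card_image[OF inj] by (simp add: p_def)
  qed
  fix X' assume "X' \<in> carrier (Ext G M (Suc m))"
  then obtain f where f: "f \<in> cocycles G M (Suc m)" "X' = ext_class G M (Suc m) f" by (rule ExtE)
  note gf = cocycle_gmap[OF f(1)]
  have fX: "Poly_Mapping.keys (f x) \<subseteq> X" if "Poly_Mapping.keys x \<subseteq> tuples G (Suc (Suc m))" for x
    using gmap_closed[OF gf, of x] that by (simp add: std_res_eq M_def)
  define e :: "('a list \<Rightarrow>\<^sub>0 'k) \<Rightarrow> ('p \<Rightarrow>\<^sub>0 'k)" where
    "e = lin_ext (\<lambda>xs. \<Sum>g\<in>carrier G. lin_ext (p g) (f (Poly_Mapping.single (g # xs) 1)))"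
  have cons: "Poly_Mapping.keys (basis_map (Cons g) y) \<subseteq> tuples G (Suc n)"
    if "g \<in> carrier G" "Poly_Mapping.keys y \<subseteq> tuples G n" for g n and y :: "'a list \<Rightarrow>\<^sub>0 'k"
    using that by (intro basis_map_keys) (auto simp: tuples_def)
  have cons1: "Poly_Mapping.single (g # xs) (1::'k) \<in> carrier (std_res G (Suc m))"
    if "g \<in> carrier G" "xs \<in> tuples G (Suc m)" for g xs
    using that by (auto simp: std_res_eq tuples_def)
  have f0: "f 0 = 0" using cochain_zero[of f "Suc m"] f(1) by (simp add: cocycles_def M_def)
  have e: "e y = (\<Sum>g\<in>carrier G. lin_ext (p g) (f (basis_map (Cons g) y)))"
    if "Poly_Mapping.keys y \<subseteq> tuples G (Suc m)" for y
    using that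
  proof (induction y rule: free_induct)
    case zero
    then show ?case by (simp add: e_def f0)
  next
    case (step xs c y)
    have "f (basis_map (Cons g) (Poly_Mapping.single xs c + y))
        = pm_scale c (f (Poly_Mapping.single (g # xs) 1)) + f (basis_map (Cons g) y)"
      if "g \<in> carrier G" for g
      using gmap_add[OF gf, of "Poly_Mapping.single (g # xs) c" "basis_map (Cons g) y"]
        gmap_smult[OF gf cons1[OF that step(1)], of c] cons1[OF that step(1)] cons[OF that step(2)]
      by (simp add: std_res_eq M_def)
    then have "(\<Sum>g\<in>carrier G. lin_ext (p g) (f (basis_map (Cons g) (Poly_Mapping.single xs c + y))))
        = (\<Sum>g\<in>carrier G. pm_scale c (lin_ext (p g) (f (Poly_Mapping.single (g # xs) 1))) + lin_ext (p g) (f (basis_map (Cons g) y)))"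
      by (intro sum.cong) auto
    then show ?case
      using step by (simp add: e_def sum.distrib pm_scale_sum)
  qed
  have lin_ext_pg: "basis_map (\<alpha> h) (lin_ext (p g) v) = lin_ext (p (h \<otimes> g)) (basis_map (\<alpha> h) v)"
    if "h \<in> carrier G" "g \<in> carrier G" "Poly_Mapping.keys v \<subseteq> X" for g h v
    using that(3) by (induction v rule: free_induct) (simp_all add: p_act that)
  have ge: "gmap G (std_res G m) M e"
    unfolding e_def M_def std_res_eq tuple_mod_def
  proof (rule gmap_lin_ext)
    fix xs assume xs: "xs \<in> tuples G (Suc m)"
    have k: "Poly_Mapping.keys (f (Poly_Mapping.single (g # xs) 1)) \<subseteq> X" if "g \<in> carrier G" for g
      using gmap_closed[OF gf cons1[OF that xs]] by (simp add: M_def)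
    have "Poly_Mapping.keys (lin_ext (p g) (f (Poly_Mapping.single (g # xs) 1))) \<subseteq> X" if "g \<in> carrier G" for g
      using lin_ext_keys[OF k[OF that] p_keys] .
    then show "Poly_Mapping.keys (\<Sum>g\<in>carrier G. lin_ext (p g) (f (Poly_Mapping.single (g # xs) 1))) \<subseteq> X"
      using keys_sum[of "\<lambda>g. lin_ext (p g) (f (Poly_Mapping.single (g # xs) 1))" "carrier G"] by blast
    fix h assume h: "h \<in> carrier G"
    have "bij_betw (\<lambda>g. h \<otimes> g) (carrier G) (carrier G)"
      by (rule bij_betw_byWitness[where f' = "\<lambda>g. inv h \<otimes> g"]) (use h in \<open>auto simp: inv_solve_left' m_assoc[symmetric]\<close>)
    then have "(\<Sum>g\<in>carrier G. lin_ext (p g) (f (Poly_Mapping.single (g # map ((\<otimes>) h) xs) 1)))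
        = (\<Sum>g\<in>carrier G. lin_ext (p (h \<otimes> g)) (f (Poly_Mapping.single ((h \<otimes> g) # map ((\<otimes>) h) xs) 1)))"
      by (rule sum.reindex_bij_betw[symmetric])
    also have "\<dots> = (\<Sum>g\<in>carrier G. basis_map (\<alpha> h) (lin_ext (p g) (f (Poly_Mapping.single (g # xs) 1))))"
    proof (rule sum.cong)
      fix g assume g: "g \<in> carrier G"
      show "lin_ext (p (h \<otimes> g)) (f (Poly_Mapping.single ((h \<otimes> g) # map ((\<otimes>) h) xs) 1))
          = basis_map (\<alpha> h) (lin_ext (p g) (f (Poly_Mapping.single (g # xs) 1)))"
        using gmap_gact[OF gf h cons1[OF g xs]] lin_ext_pg[OF h g k[OF g]] by (simp add: std_res_eq M_def)
    qed simp
    finally show "(\<Sum>g\<in>carrier G. lin_ext (p g) (f (Poly_Mapping.single (g # map ((\<otimes>) h) xs) 1)))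
        = basis_map (\<alpha> h) (\<Sum>g\<in>carrier G. lin_ext (p g) (f (Poly_Mapping.single (g # xs) 1)))"
      by (simp add: basis_map_sum)
  qed
  have "f x = e (std_diff x)" if x: "x \<in> carrier (std_res G (Suc m))" for x
  proof -
    have kx: "Poly_Mapping.keys x \<subseteq> tuples G (Suc (Suc m))" using x by (simp add: std_res_eq)
    have kd: "Poly_Mapping.keys (std_diff x) \<subseteq> tuples G (Suc m)"
      using std_diff_closed[OF x] by (simp add: std_res_eq)
    have "f (basis_map (Cons g) (std_diff x)) = f x" if g: "g \<in> carrier G" for g
    proof -
      let ?y = "basis_map (Cons g) x"
      have y: "?y \<in> carrier (std_res G (Suc (Suc m)))" using cons[OF g kx] by (simp add: std_res_eq)
      have "x = std_diff ?y + basis_map (Cons g) (std_diff x)" by (simp add: std_diff_Cons)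
      then have "f x = f (std_diff ?y + basis_map (Cons g) (std_diff x))" by simp
      also have "\<dots> = f (std_diff ?y) + f (basis_map (Cons g) (std_diff x))"
        using gmap_add[OF gf std_diff_closed[OF y], of "basis_map (Cons g) (std_diff x)"] cons[OF g kd]
        by (simp add: std_res_eq M_def)
      also have "f (std_diff ?y) = 0" using f(1) y by (simp add: cocycles_def M_def)
      finally show ?thesis by simp
    qed
    then have "e (std_diff x) = (\<Sum>g\<in>carrier G. lin_ext (p g) (f x))"
      using e[OF kd] by simp
    also have "\<dots> = f x"
    proof -
      have "(\<Sum>g\<in>carrier G. lin_ext (p g) v) = v" if "Poly_Mapping.keys v \<subseteq> X" for v
        using that
      proof (induction v rule: free_induct)
        case (step y c v)
        then show ?case using p_sum[OF step(1)] by (simp add: sum.distrib flip: pm_scale_sum)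
      qed simp
      then show ?thesis using fX[OF kx] by blast
    qed
    finally show ?thesis by simp
  qed
  then have "f \<in> coboundaries G M (Suc m)"
    using f(1) by (intro coboundary_SucI[OF ge]) (auto simp: cocycles_def cochain_iff)
  then show "X' \<in> {\<zero>\<^bsub>Ext G M (Suc m)\<^esub>}"
    using ext_class_eq_zero_iff[OF f(1)] f(2) by simp
qed

section \<open>The group \<open>S\<^sub>3\<close>\<close>

lemma z3_cases: obtains "x = (0::3)" | "x = 1" | "x = 2"
  using exhaust_3[of x] by auto

lemma z2_cases: obtains "x = (0::2)" | "x = 1"
  using exhaust_2[of x] by auto

definition rot :: "3 \<Rightarrow> perm3" where
  "rot x = (if x = 0 then id else if x = 1 then Transposition.transpose 1 2 \<circ> Transposition.transpose 2 3
     else Transposition.transpose 2 3 \<circ> Transposition.transpose 1 2)"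

text \<open>
  Signed residues modulo \<open>3\<close> are coordinates on \<open>S\<^sub>3\<close> as a dihedral group, so that commutation and
  conjugation become arithmetic in \<open>\<int>\<^sub>3\<close>.
\<close>

definition dih :: "bool \<Rightarrow> 3 \<Rightarrow> perm3" where
  "dih b x = (if b then rot x \<circ> Transposition.transpose 1 2 else rot x)"

lemma dih_closed: "dih b x \<in> carrier S3"
proof -
  have "Transposition.transpose 1 2 permutes {1..3::nat}" "Transposition.transpose 2 3 permutes {1..3::nat}"
    by (rule permutes_swap_id; simp)+
  then show ?thesis
    by (auto simp: sym_group_carrier dih_def rot_def intro!: permutes_compose permutes_id)
qed

lemma fun_eq_on_123:
  fixes f g :: "nat \<Rightarrow> nat"
  assumes "f 1 = g 1" "f 2 = g 2" "f 3 = g 3" "\<And>n. \<lbrakk>n \<noteq> 1; n \<noteq> 2; n \<noteq> 3\<rbrakk> \<Longrightarrow> f n = g n"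
  shows "f = g"
  using assms by (metis ext)

lemma rot_values:
  "rot x 1 = (if x = 0 then 1 else if x = 1 then 2 else 3)"
  "rot x 2 = (if x = 0 then 2 else if x = 1 then 3 else 1)"
  "rot x 3 = (if x = 0 then 3 else if x = 1 then 1 else 2)"
  "\<lbrakk>n \<noteq> 1; n \<noteq> 2; n \<noteq> 3\<rbrakk> \<Longrightarrow> rot x n = n"
  by (simp_all add: rot_def Transposition.transpose_def)

lemma swap_values:
  "Transposition.transpose 1 2 1 = (2::nat)" "Transposition.transpose 1 2 2 = (1::nat)"
  "Transposition.transpose 1 2 3 = (3::nat)"
  "\<lbrakk>n \<noteq> 1; n \<noteq> 2; n \<noteq> (3::nat)\<rbrakk> \<Longrightarrow> Transposition.transpose 1 2 n = n"
  by (simp_all add: Transposition.transpose_def)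

lemma rot_comp: "rot x \<circ> rot y = rot (x + y)"
  by (rule fun_eq_on_123; cases x rule: z3_cases; cases y rule: z3_cases; simp add: rot_values del: One_nat_def)

lemma swap_rot: "Transposition.transpose 1 2 \<circ> rot y = rot (- y) \<circ> Transposition.transpose 1 2"
  by (rule fun_eq_on_123; cases y rule: z3_cases; simp add: rot_values swap_values del: One_nat_def)

lemma dih_mult: "dih a x \<otimes>\<^bsub>S3\<^esub> dih b y = dih (a \<noteq> b) (x + (if a then - y else y))"
proof -
  let ?s = "Transposition.transpose 1 2 :: perm3"
  have "rot x \<circ> ?s \<circ> rot y = rot x \<circ> (rot (- y) \<circ> ?s)"
    by (simp only: comp_assoc swap_rot)
  also have "\<dots> = rot (x - y) \<circ> ?s"
    using rot_comp[of x "- y"] by (simp only: comp_assoc[symmetric] diff_conv_add_uminus)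
  finally have 1: "rot x \<circ> ?s \<circ> rot y = rot (x - y) \<circ> ?s" .
  have 2: "rot x \<circ> ?s \<circ> (rot y \<circ> ?s) = rot (x - y)"
    by (simp only: comp_assoc[symmetric] 1) (simp add: comp_assoc)
  have 3: "rot x \<circ> (rot y \<circ> ?s) = rot (x + y) \<circ> ?s"
    by (simp only: comp_assoc[symmetric] rot_comp)
  show ?thesis
    using 1 2 3 rot_comp[of x y] by (cases a; cases b) (simp_all add: sym_group_mult dih_def)
qed

lemma dih_values:
  "dih b x 1 = (if b then rot x 2 else rot x 1)" "dih b x 2 = (if b then rot x 1 else rot x 2)"
  by (simp_all add: dih_def swap_values del: One_nat_def)

lemma dih_eq_iff: "dih a x = dih b y \<longleftrightarrow> a = b \<and> x = y"
proof
  assume "dih a x = dih b y"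
  then have "dih a x 1 = dih b y 1" "dih a x 2 = dih b y 2" by simp_all
  then show "a = b \<and> x = y"
    by (cases a; cases b; cases x rule: z3_cases; cases y rule: z3_cases;
        simp add: dih_values rot_values del: One_nat_def)
qed simp

lemma S3_carrier: "carrier S3 = range (\<lambda>(b, x). dih b x)"
proof -
  have inj: "inj (\<lambda>(b, x). dih b x)" by (auto simp: inj_def dih_eq_iff)
  have "card (range (\<lambda>(b, x). dih b x)) = CARD(bool \<times> 3)"
    by (rule card_image[OF inj])
  then have "card (range (\<lambda>(b, x). dih b x)) = card (carrier S3)"
    by (simp add: sym_group_card_carrier fact_numeral)
  moreover have "finite (carrier S3)"
    by (rule card_ge_0_finite) (simp add: sym_group_card_carrier)
  ultimately show ?thesis
    using card_subset_eq[of "carrier S3" "range (\<lambda>(b, x). dih b x)"] dih_closed by fastforce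
qed

lemma finite_S3: "finite (carrier S3)"
  unfolding S3_carrier by simp

lemma S3_cases:
  assumes "g \<in> carrier S3" obtains b x where "g = dih b x"
  using assms by (auto simp: S3_carrier)

interpretation S3: group S3 by (rule sym_group_is_group)

lemma dih_one: "\<one>\<^bsub>S3\<^esub> = dih False 0"
  by (simp add: sym_group_one dih_def rot_def)

lemma dih_inv: "inv\<^bsub>S3\<^esub> dih b x = dih b (if b then x else - x)"
  by (rule S3.inv_equality) (auto simp: dih_mult dih_one dih_closed)

lemma sign_dih: "sign (dih b x) = (if b then -1 else 1)"
proof -
  have t: "permutation (Transposition.transpose i j)" for i j :: nat by (simp add: permutation_swap_id)
  show ?thesis
    by (cases x rule: z3_cases; cases b)
      (simp_all add: dih_def rot_def sign_compose sign_swap_id t permutation_compose)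
qed

lemma A3_carrier: "carrier (alt_group 3) = range (dih False)"
proof -
  have "p \<in> carrier (alt_group 3) \<longleftrightarrow> p \<in> carrier S3 \<and> sign p = 1" for p
    by (auto simp: alt_group_carrier sym_group_carrier sign_def)
  moreover have "p \<in> carrier S3 \<and> sign p = 1 \<longleftrightarrow> p \<in> range (dih False)" for p
  proof
    assume p: "p \<in> carrier S3 \<and> sign p = 1"
    then obtain b x where "p = dih b x" using S3_cases by blast
    with p show "p \<in> range (dih False)" by (cases b) (simp_all add: sign_dih)
  next
    assume "p \<in> range (dih False)"
    then show "p \<in> carrier S3 \<and> sign p = 1" by (elim rangeE) (simp add: sign_dih dih_closed)
  qed
  ultimately show ?thesis by blast
qed

text \<open>\<open>tpow z\<close> is the homomorphism from \<open>\<int>\<^sub>2\<close> whose image is generated by a transposition.\<close>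

definition tpow :: "3 \<Rightarrow> 2 \<Rightarrow> perm3" where
  "tpow z e = (if e = 0 then dih False 0 else dih True z)"

lemma tpow_closed: "tpow z e \<in> carrier S3"
  by (simp add: tpow_def dih_closed)

lemma tpow_add: "tpow z (e + e') = tpow z e \<otimes>\<^bsub>S3\<^esub> tpow z e'"
  by (cases e rule: z2_cases; cases e' rule: z2_cases) (simp_all add: tpow_def dih_mult)

lemma rot_closed: "dih False x \<in> carrier S3" by (rule dih_closed)

lemma rot_add: "dih False (x + y) = dih False x \<otimes>\<^bsub>S3\<^esub> dih False y"
  by (simp add: dih_mult)

definition coord :: "('r::comm_ring_1 \<Rightarrow> perm3) \<Rightarrow> 'r ^ 2 \<Rightarrow> perm3 \<times> perm3" where
  "coord e u = (e (u $ 2), e (- (u $ 1)))"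

lemma additive_int_pow:
  fixes e :: "'r::comm_ring_1 \<Rightarrow> perm3"
  assumes cl: "\<And>x. e x \<in> carrier S3" and add: "\<And>x y. e (x + y) = e x \<otimes>\<^bsub>S3\<^esub> e y"
  shows "e (of_int k * x) = e x [^]\<^bsub>S3\<^esub> (k :: int)"
proof -
  have zero: "e 0 = \<one>\<^bsub>S3\<^esub>"
    using add[of 0 0] S3.l_cancel_one'[OF cl cl, of 0 0] by simp
  have nat: "e (of_nat n * x) = e x [^]\<^bsub>S3\<^esub> (n :: nat)" for n
  proof (induction n)
    case (Suc n)
    have "e (of_nat (Suc n) * x) = e (of_nat n * x + x)" by (simp add: algebra_simps)
    then show ?case using add Suc by simp
  qed (simp add: zero)
  have neg: "e (- y) = inv\<^bsub>S3\<^esub> e y" for y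
    using add[of "- y" y] zero by (intro S3.inv_equality[symmetric]) (auto simp: cl)
  show ?thesis
  proof (cases k rule: int_cases2)
    case (nonneg n)
    then show ?thesis using nat[of n] by (simp add: int_pow_int)
  next
    case (nonpos n)
    then show ?thesis using nat[of n] neg[of "of_nat n * x"] cl
      by (simp add: S3.int_pow_neg int_pow_int)
  qed
qed

lemma SL2Z_inverse_transpose:
  assumes "A \<in> SL2Z"
  shows "matrix_inv (transpose A) $ 1 $ 1 = A $ 2 $ 2" "matrix_inv (transpose A) $ 1 $ 2 = - A $ 2 $ 1"
    "matrix_inv (transpose A) $ 2 $ 1 = - A $ 1 $ 2" "matrix_inv (transpose A) $ 2 $ 2 = A $ 1 $ 1"
proof -
  have det: "A $ 1 $ 1 * A $ 2 $ 2 - A $ 1 $ 2 * A $ 2 $ 1 = 1"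
    using assms by (simp add: SL2Z_def det_2)
  define B :: "int^2^2" where
    "B = (\<chi> i j. if i = 1 then (if j = 1 then A $ 2 $ 2 else - A $ 2 $ 1) else (if j = 1 then - A $ 1 $ 2 else A $ 1 $ 1))"
  have AB: "transpose A ** B = mat 1" "B ** transpose A = mat 1"
    using det by (simp_all add: vec_eq_iff forall_2 matrix_matrix_mult_def sum_2 B_def transpose_def mat_def algebra_simps)
  define C where "C = matrix_inv (transpose A)"
  have "transpose A ** C = mat 1 \<and> C ** transpose A = mat 1"
    unfolding C_def matrix_inv_def by (rule someI[of _ B]) (simp add: AB)
  then have "C = C ** (transpose A ** B)" "(C ** transpose A) ** B = B"
    using AB by (simp_all add: matrix_mul_rid matrix_mul_lid)
  then have "C = B" by (simp add: matrix_mul_assoc)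
  then show "matrix_inv (transpose A) $ 1 $ 1 = A $ 2 $ 2" "matrix_inv (transpose A) $ 1 $ 2 = - A $ 2 $ 1"
    "matrix_inv (transpose A) $ 2 $ 1 = - A $ 1 $ 2" "matrix_inv (transpose A) $ 2 $ 2 = A $ 1 $ 1"
    by (simp_all add: C_def[symmetric] B_def)
qed

text \<open>
  For \<open>A\<close> with rows \<open>(p, q)\<close> and \<open>(r, s)\<close>, the inverse transpose has rows \<open>(s, - r)\<close> and \<open>(- q, p)\<close>.
  The coordinates of a pair are chosen such that this becomes multiplication by \<open>A\<close>.
\<close>

lemma mat_act_coord:
  fixes e :: "'r::comm_ring_1 \<Rightarrow> perm3"
  assumes cl: "\<And>x. e x \<in> carrier S3" and add: "\<And>x y. e (x + y) = e x \<otimes>\<^bsub>S3\<^esub> e y" and A: "A \<in> SL2Z"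
  shows "mat_act (matrix_inv (transpose A)) (coord e u) = coord e (vec_act A u)"
proof -
  note pow = additive_int_pow[of e, OF cl add, symmetric]
  show ?thesis
    by (simp add: mat_act_def coord_def SL2Z_inverse_transpose[OF A] pow add[symmetric] vec_act_def
        matrix_vector_mult_def sum_2 map_matrix_def algebra_simps)
qed

abbreviation conj_pair :: "perm3 \<Rightarrow> perm3 \<times> perm3 \<Rightarrow> perm3 \<times> perm3" where
  "conj_pair \<equiv> \<lambda>c (a, b). (c \<otimes>\<^bsub>S3\<^esub> a \<otimes>\<^bsub>S3\<^esub> inv\<^bsub>S3\<^esub> c, c \<otimes>\<^bsub>S3\<^esub> b \<otimes>\<^bsub>S3\<^esub> inv\<^bsub>S3\<^esub> c)"

lemma conj_rot: "dih b z \<otimes>\<^bsub>S3\<^esub> dih False x \<otimes>\<^bsub>S3\<^esub> inv\<^bsub>S3\<^esub> dih b z = dih False (if b then - x else x)"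
  by (simp add: dih_mult dih_inv)

lemma conj_tpow:
  "dih b z \<otimes>\<^bsub>S3\<^esub> tpow y e \<otimes>\<^bsub>S3\<^esub> inv\<^bsub>S3\<^esub> dih b z = tpow (z + z + (if b then - y else y)) e"
  by (simp add: tpow_def dih_mult dih_inv algebra_simps)

lemma conj_coord_rot:
  "conj_pair (dih b z) (coord (dih False) u) = coord (dih False) (if b then - u else u)"
  by (auto simp: coord_def conj_rot)

lemma conj_coord_tpow:
  "conj_pair (dih b z) (coord (tpow y) u) = coord (tpow (z + z + (if b then - y else y))) u"
  by (simp add: coord_def conj_tpow)

subsection \<open>The orbits of commuting pairs\<close>

lemma generate_rot:
  assumes "x \<noteq> 0 \<or> y \<noteq> 0"
  shows "generate S3 {dih False x, dih False y} = range (dih False)"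
proof
  let ?H = "generate S3 {dih False x, dih False y}"
  have "subgroup (range (dih False)) S3"
  proof (rule S3.subgroupI)
    show "range (dih False) \<subseteq> carrier S3" using dih_closed by blast
  next
    fix a assume "a \<in> range (dih False)"
    then show "inv\<^bsub>S3\<^esub> a \<in> range (dih False)" by (elim rangeE) (simp add: dih_inv)
  next
    fix a b assume "a \<in> range (dih False)" "b \<in> range (dih False)"
    then show "a \<otimes>\<^bsub>S3\<^esub> b \<in> range (dih False)" by (elim rangeE) (simp add: dih_mult)
  qed simp
  then show "?H \<subseteq> range (dih False)"
    by (rule S3.generate_subgroup_incl[rotated]) simp
  obtain z where z: "z \<noteq> 0" "dih False z \<in> ?H"
    using assms generate.incl[of "dih False x" "{dih False x, dih False y}" S3]
      generate.incl[of "dih False y" "{dih False x, dih False y}" S3] by blast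
  have g: "dih False (a + b) \<in> ?H" if "dih False a \<in> ?H" "dih False b \<in> ?H" for a b
    using generate.eng[OF that] by (simp add: dih_mult)
  have multiples: "w = z \<or> w = z + z \<or> w = z + z + z" for w
    using z(1) by (cases w rule: z3_cases; cases z rule: z3_cases; simp)
  have "dih False w \<in> ?H" for w
    using multiples[of w] z(2) g[OF z(2) z(2)] g[OF g[OF z(2) z(2)] z(2)] by (elim disjE) (simp_all only:)
  then show "range (dih False) \<subseteq> ?H" by blast
qed

lemma generate_tpow:
  assumes "x \<noteq> 0 \<or> y \<noteq> 0"
  shows "generate S3 {tpow z x, tpow z y} = {\<one>\<^bsub>S3\<^esub>, dih True z}"
  unfolding dih_one
proof
  have "subgroup {dih False 0, dih True z} S3"
  proof (rule S3.subgroupI)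
    show "{dih False 0, dih True z} \<subseteq> carrier S3" by (simp add: dih_closed)
  next
    fix a assume "a \<in> {dih False 0, dih True z}"
    then show "inv\<^bsub>S3\<^esub> a \<in> {dih False 0, dih True z}" by (elim insertE) (simp_all add: dih_inv)
  next
    fix a b assume "a \<in> {dih False 0, dih True z}" "b \<in> {dih False 0, dih True z}"
    then show "a \<otimes>\<^bsub>S3\<^esub> b \<in> {dih False 0, dih True z}"
      by (elim insertE emptyE) (simp_all add: dih_mult)
  qed simp
  then show "generate S3 {tpow z x, tpow z y} \<subseteq> {dih False 0, dih True z}"
    by (rule S3.generate_subgroup_incl[rotated]) (simp add: tpow_def)
  have "dih True z \<in> generate S3 {tpow z x, tpow z y}"
    using assms generate.incl[of "dih True z" "{tpow z x, tpow z y}" S3]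
    by (simp add: tpow_def split: if_splits)
  then show "{dih False 0, dih True z} \<subseteq> generate S3 {tpow z x, tpow z y}"
    using generate.one[of S3 "{tpow z x, tpow z y}"] by (simp add: dih_one)
qed

lemma vec2_nonzero_iff: "(u :: 'r::zero ^ 2) \<noteq> 0 \<longleftrightarrow> u $ 1 \<noteq> 0 \<or> u $ 2 \<noteq> 0"
  by (auto simp: vec_eq_iff forall_2)

lemma vec2_ex: "\<exists>u :: 'r ^ 2. u $ 1 = a \<and> u $ 2 = b"
  by (rule exI[of _ "\<chi> i. if i = 1 then a else b"]) simp

text \<open>
  A rotation commutes with a reflection only if it is trivial, and two reflections commute only if
  they are equal: both reduce to \<open>2 x = 0\<close> in \<open>\<int>\<^sub>3\<close>.
\<close>

lemma commuting_pair_cases: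
  assumes "(a, b) \<in> Omega1"
  obtains "(a, b) = (\<one>\<^bsub>S3\<^esub>, \<one>\<^bsub>S3\<^esub>)"
  | u where "u \<noteq> 0" "(a, b) = coord (dih False) u"
  | z u where "u \<noteq> 0" "(a, b) = coord (tpow z) u"
proof -
  have "a \<in> carrier S3" "b \<in> carrier S3" and comm: "a \<otimes>\<^bsub>S3\<^esub> b = b \<otimes>\<^bsub>S3\<^esub> a"
    using assms by (simp_all add: Omega1_def)
  then obtain p x q y where ab: "a = dih p x" "b = dih q y"
    using S3_cases by metis
  obtain u :: "3^2" where u: "u $ 1 = - y" "u $ 2 = x" using vec2_ex[of "- y" "x"] by auto
  have double: "z = 0" if "z + z = 0" for z :: 3
    using that by (cases z rule: z3_cases) simp_all
  have eq: "(p \<noteq> q) = (q \<noteq> p)" "x + (if p then - y else y) = y + (if q then - x else x)"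
    using comm by (simp_all add: ab dih_mult dih_eq_iff)
  consider "\<not> p" "\<not> q" | "\<not> p" "q" | "p" "\<not> q" | "p" "q" by blast
  then show thesis
  proof cases
    case 1
    then have "(a, b) = coord (dih False) u" by (simp add: ab coord_def u)
    then show thesis
      using that(1) that(2)[of u] by (cases "u = 0") (simp_all add: coord_def dih_one)
  next
    case 2
    obtain w :: "2^2" where w: "w $ 1 = 1" "w $ 2 = 0" using vec2_ex[of "1" "0"] by auto
    have "x = 0" using eq(2) 2 double[of x] by (simp add: algebra_simps)
    show thesis
      by (rule that(3)[of w y]) (simp_all add: ab coord_def tpow_def vec2_nonzero_iff w 2 \<open>x = 0\<close>)
  next
    case 3
    obtain w :: "2^2" where w: "w $ 1 = 0" "w $ 2 = 1" using vec2_ex[of "0" "1"] by auto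
    have "y = 0" using eq(2) 3 double[of y] by (simp add: algebra_simps)
    show thesis
      by (rule that(3)[of w x]) (simp_all add: ab coord_def tpow_def vec2_nonzero_iff w 3 \<open>y = 0\<close>)
  next
    case 4
    obtain w :: "2^2" where w: "w $ 1 = 1" "w $ 2 = 1" using vec2_ex[of "1" "1"] by auto
    have "x = y" using eq(2) 4 double[of "x - y"] by (simp add: algebra_simps)
    show thesis
      by (rule that(3)[of w x]) (simp_all add: ab coord_def tpow_def vec2_nonzero_iff w 4 \<open>x = y\<close>)
  qed
qed

lemma coord_in_Omega1:
  assumes "\<And>x. e x \<in> carrier S3" "\<And>x y. e (x + y) = e x \<otimes>\<^bsub>S3\<^esub> e y"
  shows "coord e u \<in> Omega1"
  using assms(1) assms(2)[symmetric] by (simp add: Omega1_def coord_def add.commute)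

lemma generate_one: "generate S3 {\<one>\<^bsub>S3\<^esub>} = {\<one>\<^bsub>S3\<^esub>}"
  using S3.generate_subgroup_incl[of "{\<one>\<^bsub>S3\<^esub>}" "{\<one>\<^bsub>S3\<^esub>}"] S3.triv_subgroup by (auto intro: generate.one)

lemma card_range_rot: "card (range (dih False)) = 3"
  by (subst card_image) (auto simp: inj_def dih_eq_iff)

lemma coord_generate:
  "u \<noteq> 0 \<Longrightarrow> coord (dih False) u = (a, b) \<Longrightarrow> generate S3 {a, b} = range (dih False)"
  "w \<noteq> 0 \<Longrightarrow> coord (tpow z) w = (a, b) \<Longrightarrow> generate S3 {a, b} = {\<one>\<^bsub>S3\<^esub>, dih True z}"
  using generate_rot[of "u $ 2" "- (u $ 1)"] generate_tpow[of "w $ 2" "- (w $ 1)" z]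
  by (auto simp: coord_def vec2_nonzero_iff)

lemma card_C2: "card {\<one>\<^bsub>S3\<^esub>, dih True z} = 2"
  by (simp add: dih_one dih_eq_iff)

lemma card_A3_neq: "range (dih False) \<noteq> {\<one>\<^bsub>S3\<^esub>}" "range (dih False) \<noteq> {\<one>\<^bsub>S3\<^esub>, dih True z}"
proof -
  show "range (dih False) \<noteq> {\<one>\<^bsub>S3\<^esub>, dih True z}" using card_range_rot card_C2[of z] by auto
  show "range (dih False) \<noteq> {\<one>\<^bsub>S3\<^esub>}" using card_range_rot by auto
qed

lemma O1_eq: "O1 = {(\<one>\<^bsub>S3\<^esub>, \<one>\<^bsub>S3\<^esub>)}"
proof -
  have "\<one>\<^bsub>S3\<^esub> \<in> carrier S3" by (rule S3.one_closed)
  then have "(\<one>\<^bsub>S3\<^esub>, \<one>\<^bsub>S3\<^esub>) \<in> O1"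
    unfolding O1_def Omega1_def by (simp only: mem_Collect_eq prod.case insert_absorb2 generate_one simp_thms)
  moreover have "p = (\<one>\<^bsub>S3\<^esub>, \<one>\<^bsub>S3\<^esub>)" if "p \<in> O1" for p
  proof (cases p)
    case (Pair a b)
    then have "generate S3 {a, b} = {\<one>\<^bsub>S3\<^esub>}" using that unfolding O1_def by simp
    then have "a \<in> {\<one>\<^bsub>S3\<^esub>}" "b \<in> {\<one>\<^bsub>S3\<^esub>}"
      using generate.incl[of a "{a, b}" S3] generate.incl[of b "{a, b}" S3] by simp_all
    then show ?thesis using Pair by simp
  qed
  ultimately show ?thesis by blast
qed

lemma O2_eq: "O2 = {coord (tpow z) u | z u. u \<noteq> 0}"
proof -
  have "p \<in> O2" if "p = coord (tpow z) u" "u \<noteq> 0" for p z u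
  proof (cases p)
    case (Pair a b)
    then show ?thesis
      using coord_generate(2)[OF that(2), of z a b] coord_in_Omega1[of "tpow z" u, OF tpow_closed tpow_add] that(1) card_C2
      by (simp add: O2_def)
  qed
  moreover have "\<exists>z u. u \<noteq> 0 \<and> p = coord (tpow z) u" if p: "p \<in> O2" for p
  proof (cases p)
    case (Pair a b)
    then have "(a, b) \<in> Omega1" and c: "card (generate S3 {a, b}) = 2" using p by (auto simp: O2_def)
    from this(1) show ?thesis
    proof (cases rule: commuting_pair_cases)
      case 1
      then show ?thesis using c by (simp add: generate_one)
    next
      case (2 u)
      then show ?thesis using coord_generate(1)[OF 2(1), of a b] c card_range_rot by simp
    qed (use Pair in auto)
  qed
  ultimately show ?thesis by blast
qed

lemma O3_eq: "O3 = coord (dih False) ` (UNIV - {0})"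
proof -
  have "p \<in> O3" if "p = coord (dih False) u" "u \<noteq> 0" for p u
  proof (cases p)
    case (Pair a b)
    then show ?thesis
      using coord_generate(1)[OF that(2), of a b] coord_in_Omega1[of "dih False" u, OF rot_closed rot_add] that(1)
      by (simp add: O3_def A3_carrier)
  qed
  moreover have "\<exists>u. u \<noteq> 0 \<and> p = coord (dih False) u" if p: "p \<in> O3" for p
  proof (cases p)
    case (Pair a b)
    then have "(a, b) \<in> Omega1" and c: "generate S3 {a, b} = range (dih False)"
      using p by (auto simp: O3_def A3_carrier)
    from this(1) show ?thesis
    proof (cases rule: commuting_pair_cases)
      case 1
      then show ?thesis using c card_A3_neq(1) by (simp add: generate_one)
    next
      case (3 z u)
      then show ?thesis using coord_generate(2)[OF 3(1), of z a b] c card_A3_neq(2) by simp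
    qed (use Pair in auto)
  qed
  ultimately show ?thesis by blast
qed

lemma Omega1_partition:
  "Omega1 = O1 \<union> O2 \<union> O3" "O1 \<inter> O2 = {}" "O1 \<inter> O3 = {}" "O2 \<inter> O3 = {}"
proof -
  have "Omega1 \<subseteq> O1 \<union> O2 \<union> O3"
  proof
    fix p assume "p \<in> Omega1"
    moreover obtain a b where "p = (a, b)" by (cases p)
    ultimately have "(a, b) \<in> Omega1" and p: "p = (a, b)" by simp_all
    from this(1) show "p \<in> O1 \<union> O2 \<union> O3"
      by (cases rule: commuting_pair_cases) (use p in \<open>auto simp: O1_eq O2_eq O3_eq\<close>)
  qed
  then show "Omega1 = O1 \<union> O2 \<union> O3" by (auto simp: O1_def O2_def O3_def)
  show "O1 \<inter> O2 = {}" by (auto simp: O1_def O2_def)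
  show "O1 \<inter> O3 = {}" using card_A3_neq(1) by (auto simp: O1_def O3_def A3_carrier)
  show "O2 \<inter> O3 = {}" using card_range_rot by (auto simp: O2_def O3_def A3_carrier)
qed

lemma sum_decomposition:
  fixes X Y Z :: "'a set"
  assumes "W = X \<union> Y \<union> Z" "X \<inter> Y = {}" "X \<inter> Z = {}" "Y \<inter> Z = {}"
  shows "bij_betw (\<lambda>(u, v, w). u + v + (w :: 'a \<Rightarrow>\<^sub>0 'k::field))
    ({u. Poly_Mapping.keys u \<subseteq> X} \<times> {v. Poly_Mapping.keys v \<subseteq> Y} \<times> {w. Poly_Mapping.keys w \<subseteq> Z})
    {t. Poly_Mapping.keys t \<subseteq> W}"
proof -
  define part :: "'a set \<Rightarrow> ('a \<Rightarrow>\<^sub>0 'k) \<Rightarrow> ('a \<Rightarrow>\<^sub>0 'k)" where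
    "part S = lin_ext (\<lambda>x. if x \<in> S then Poly_Mapping.single x 1 else 0)" for S
  have part_id: "part S t = t" if "Poly_Mapping.keys t \<subseteq> S" for S t
  proof -
    have "part S t = lin_ext (\<lambda>x. Poly_Mapping.single x 1) t"
      unfolding part_def using that by (intro lin_ext_cong) auto
    then show ?thesis by simp
  qed
  have part_zero: "part S t = 0" if "Poly_Mapping.keys t \<inter> S = {}" for S t
  proof -
    have "part S t = lin_ext (\<lambda>x. 0) t"
      unfolding part_def using that by (intro lin_ext_cong) auto
    then show ?thesis by (simp add: lin_ext_def)
  qed
  have part_add: "part S (s + t) = part S s + part S t" for S s t by (simp add: part_def)
  have part_keys: "Poly_Mapping.keys (part S t) \<subseteq> S" for S t
    unfolding part_def by (rule lin_ext_keys[of t UNIV]) auto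
  have part_sum: "part X t + part Y t + part Z t = t" if "Poly_Mapping.keys t \<subseteq> W" for t
    using that
  proof (induction t rule: free_induct)
    case (step x c t)
    then have "part X (Poly_Mapping.single x c) + part Y (Poly_Mapping.single x c) + part Z (Poly_Mapping.single x c)
        = Poly_Mapping.single x c"
      using assms by (auto simp: part_def)
    moreover have "part X (r + t) + part Y (r + t) + part Z (r + t)
        = (part X r + part Y r + part Z r) + (part X t + part Y t + part Z t)" for r
      by (simp add: part_add add_ac)
    ultimately show ?case using step by simp
  qed (simp add: part_def)
  show ?thesis
  proof (rule bij_betw_byWitness[where f' = "\<lambda>t. (part X t, part Y t, part Z t)"])
    show "\<forall>a\<in>{u. Poly_Mapping.keys u \<subseteq> X} \<times> {v. Poly_Mapping.keys v \<subseteq> Y} \<times> {w. Poly_Mapping.keys w \<subseteq> Z}.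
       (part X (case a of (u, v, w) \<Rightarrow> u + v + w), part Y (case a of (u, v, w) \<Rightarrow> u + v + w),
        part Z (case a of (u, v, w) \<Rightarrow> u + v + w)) = a"
    proof
      fix a assume a: "a \<in> {u :: 'a \<Rightarrow>\<^sub>0 'k. Poly_Mapping.keys u \<subseteq> X} \<times> {v :: 'a \<Rightarrow>\<^sub>0 'k. Poly_Mapping.keys v \<subseteq> Y} \<times> {w :: 'a \<Rightarrow>\<^sub>0 'k. Poly_Mapping.keys w \<subseteq> Z}"
      obtain u v w where uvw: "a = (u, v, w)" by (cases a)
      with a have k: "Poly_Mapping.keys u \<subseteq> X" "Poly_Mapping.keys v \<subseteq> Y" "Poly_Mapping.keys w \<subseteq> Z"
        by simp_all
      then have "part X v = 0" "part X w = 0" "part Y u = 0" "part Y w = 0" "part Z u = 0" "part Z v = 0"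
        using assms by (auto intro!: part_zero)
      then show "(part X (case a of (u, v, w) \<Rightarrow> u + v + w), part Y (case a of (u, v, w) \<Rightarrow> u + v + w),
          part Z (case a of (u, v, w) \<Rightarrow> u + v + w)) = a"
        using k by (simp add: uvw part_add part_id)
    qed
    show "(\<lambda>(u, v, w). u + v + (w :: 'a \<Rightarrow>\<^sub>0 'k)) ` ({u. Poly_Mapping.keys u \<subseteq> X} \<times> {v. Poly_Mapping.keys v \<subseteq> Y} \<times> {w. Poly_Mapping.keys w \<subseteq> Z})
        \<subseteq> {t. Poly_Mapping.keys t \<subseteq> W}"
      using assms(1) by (auto dest!: subsetD[OF keys_add])
  qed (use part_sum part_keys in auto)
qed

section \<open>Cohomology of a decomposed coefficient module\<close>

lemma vspace_same:
  assumes "vspace V" "carrier W = carrier V" "add W = add V" "zero W = zero V" "smult W = smult V"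
  shows "vspace W"
proof -
  interpret V: vspace V by fact
  show ?thesis
    using assms(2-5) by (intro vspaceI) (simp_all add: V.a_ac V.smult_r_distr V.smult_l_distr V.smult_assoc)
qed

lemma mem_Plus_simps [simp]:
  "Inl i \<in> Sum_Type.Plus A B \<longleftrightarrow> i \<in> A" "Inr j \<in> Sum_Type.Plus A B \<longleftrightarrow> j \<in> B"
  by auto

lemma two_type_decomposition_iso:
  fixes N1 N2 :: "('k::field, 'w, 'g) gmodule" and k1 k2 :: nat
  assumes dec: "coeff_decomposition G M (Sum_Type.Plus {..<k1} {..<k2}) (case_sum (\<lambda>_. N1) (\<lambda>_. N2)) incl proj"
  defines "\<phi> \<equiv> \<lambda>x. (\<lambda>i\<in>{..<k1}. total_push G M N1 (proj (Inl i)) x, \<lambda>i\<in>{..<k2}. total_push G M N2 (proj (Inr i)) x)"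
  shows "lin_iso (total_ext G \<Phi> M) (dir_sum (dpower (total_ext G \<Phi>1 N1) k1) (dpower (total_ext G \<Phi>2 N2) k2)) \<phi>"
    and "right_linear (total_ext_carrier G (triv_mod TYPE('k))) (total_ext G \<Phi> M)
      (dir_sum (dpower (total_ext G \<Phi>1 N1) k1) (dpower (total_ext G \<Phi>2 N2) k2)) \<phi>"
proof -
  let ?I = "Sum_Type.Plus {..<k1} {..<k2}" and ?N = "case_sum (\<lambda>_::nat. N1) (\<lambda>_::nat. N2)"
  interpret D: coeff_decomposition G M ?I ?N incl proj by (rule dec)
  have p1: "coeff_map G M N1 (proj (Inl i))" if "i < k1" for i using D.proj[of "Inl i"] that by simp
  have p2: "coeff_map G M N2 (proj (Inr i))" if "i < k2" for i using D.proj[of "Inr i"] that by simp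
  let ?T = "total_ext G \<Phi> M" and ?D = "dir_sum (dpower (total_ext G \<Phi>1 N1) k1) (dpower (total_ext G \<Phi>2 N2) k2)"
  have lin: "vlin ?T ?D \<phi>"
  proof (rule vlinI)
    fix x assume x: "x \<in> carrier ?T"
    then show "\<phi> x \<in> carrier ?D"
      using coeff_map.total_push_closed[OF p1, of _ x] coeff_map.total_push_closed[OF p2, of _ x]
      by (auto simp: \<phi>_def)
    { fix y assume y: "y \<in> carrier ?T"
      show "\<phi> (x \<oplus>\<^bsub>?T\<^esub> y) = \<phi> x \<oplus>\<^bsub>?D\<^esub> \<phi> y"
        using vlin_add[OF coeff_map.total_push_linear[OF p1] x y] vlin_add[OF coeff_map.total_push_linear[OF p2] x y]
        by (auto simp: \<phi>_def intro!: restrict_ext) }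
    show "\<phi> (c \<odot>\<^bsub>?T\<^esub> x) = c \<odot>\<^bsub>?D\<^esub> \<phi> x" for c
      using vlin_smult[OF coeff_map.total_push_linear[OF p1] x] vlin_smult[OF coeff_map.total_push_linear[OF p2] x]
      by (auto simp: \<phi>_def intro!: restrict_ext)
  qed
  have bij: "bij_betw \<phi> (carrier ?T) (carrier ?D)"
    unfolding bij_betw_def
  proof
    show "inj_on \<phi> (carrier ?T)"
    proof (rule inj_onI)
      fix x y assume xy: "x \<in> carrier ?T" "y \<in> carrier ?T" "\<phi> x = \<phi> y"
      have "total_push G M N1 (proj (Inl i)) x = total_push G M N1 (proj (Inl i)) y" if "i < k1" for i
        using fun_cong[OF arg_cong[OF xy(3), of fst], of i] that by (simp add: \<phi>_def)
      moreover have "total_push G M N2 (proj (Inr i)) x = total_push G M N2 (proj (Inr i)) y" if "i < k2" for i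
        using fun_cong[OF arg_cong[OF xy(3), of snd], of i] that by (simp add: \<phi>_def)
      ultimately have "(\<lambda>i\<in>?I. total_push G M (?N i) (proj i) x) = (\<lambda>i\<in>?I. total_push G M (?N i) (proj i) y)"
        by (intro restrict_ext) auto
      then show "x = y"
        using bij_betw_imp_inj_on[OF D.total_push_bij] xy(1,2) by (simp add: inj_on_def)
    qed
    show "\<phi> ` carrier ?T = carrier ?D"
    proof
      show "\<phi> ` carrier ?T \<subseteq> carrier ?D" using vlin_closed[OF lin] by blast
      show "carrier ?D \<subseteq> \<phi> ` carrier ?T"
      proof
        fix y assume y: "y \<in> carrier ?D"
        then have yc: "fst y \<in> {..<k1} \<rightarrow>\<^sub>E total_ext_carrier G N1" "snd y \<in> {..<k2} \<rightarrow>\<^sub>E total_ext_carrier G N2"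
          by (auto simp: mem_Times_iff)
        let ?z = "\<lambda>i\<in>?I. case_sum (fst y) (snd y) i"
        have "?z \<in> PiE ?I (\<lambda>i. total_ext_carrier G (?N i))" using yc by auto
        then have "?z \<in> (\<lambda>x. \<lambda>i\<in>?I. total_push G M (?N i) (proj i) x) ` total_ext_carrier G M"
          by (simp only: bij_betw_imp_surj_on[OF D.total_push_bij])
        then obtain x where x': "?z = (\<lambda>i\<in>?I. total_push G M (?N i) (proj i) x)" "x \<in> total_ext_carrier G M"
          by (rule imageE)
        note x = x'(2) x'(1)[symmetric]
        have "total_push G M N1 (proj (Inl i)) x = fst y i" if "i < k1" for i
          using fun_cong[OF x(2), of "Inl i"] that by simp
        moreover have "total_push G M N2 (proj (Inr i)) x = snd y i" if "i < k2" for i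
          using fun_cong[OF x(2), of "Inr i"] that by simp
        ultimately have "fst (\<phi> x) = fst y" "snd (\<phi> x) = snd y"
          using yc by (auto simp: \<phi>_def fun_eq_iff PiE_def extensional_def)
        then show "y \<in> \<phi> ` carrier ?T" using x(1) by (auto simp: prod_eq_iff intro!: image_eqI[of _ _ x])
      qed
    qed
  qed
  show "lin_iso ?T ?D \<phi>" using lin bij by (simp add: lin_iso_alt)
  show "right_linear (total_ext_carrier G (triv_mod TYPE('k))) ?T ?D \<phi>"
    using coeff_map.total_push_ract[OF p1, where \<Phi> = \<Phi> and \<Phi>' = \<Phi>1] coeff_map.total_push_ract[OF p2, where \<Phi> = \<Phi> and \<Phi>' = \<Phi>2]
    by (auto simp: right_linear_def \<phi>_def simp del: total_ext_simps(6) intro!: restrict_ext)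
qed

text \<open>
  Here the summands of \<open>M\<close> are copies of \<open>N1\<close> and \<open>N2\<close> whose inclusions depend linearly on vectors of \<open>W1\<close>
  and \<open>W2\<close>. The families \<open>w1\<close> and \<open>w2\<close> serve only to prove bijectivity, so the resulting isomorphism
  respects actions that do not preserve them.
\<close>

locale two_tensor_decomposition =
  coeff_decomposition G M "Sum_Type.Plus {..<k1} {..<k2}" "case_sum (\<lambda>_::nat. N1) (\<lambda>_::nat. N2)"
    "case_sum (\<lambda>i. \<theta>1 (w1 i)) (\<lambda>i. \<theta>2 (w2 i))" proj +
  W1: vspace W1 + W2: vspace W2
  for G :: "('g, 'z) monoid_scheme" and M :: "('k::field, 'v, 'g) gmodule"
    and N1 N2 :: "('k, 'w, 'g) gmodule" and k1 k2 :: nat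
    and W1 :: "('k, 'u1, 'h) gmodule" and W2 :: "('k, 'u2, 'h) gmodule"
    and \<theta>1 :: "'u1 \<Rightarrow> 'w \<Rightarrow> 'v" and \<theta>2 :: "'u2 \<Rightarrow> 'w \<Rightarrow> 'v" and w1 w2 proj +
  fixes \<Phi>' :: "'h \<Rightarrow> 'v \<Rightarrow> 'v" and S :: "'h set"
  assumes N: "coeff G N1" "coeff G N2"
    and \<theta>1: "\<And>w. w \<in> carrier W1 \<Longrightarrow> coeff_map G N1 M (\<theta>1 w)"
      "\<And>w w' v. \<lbrakk>w \<in> carrier W1; w' \<in> carrier W1; v \<in> carrier N1\<rbrakk> \<Longrightarrow> \<theta>1 (w \<oplus>\<^bsub>W1\<^esub> w') v = \<theta>1 w v \<oplus>\<^bsub>M\<^esub> \<theta>1 w' v"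
      "\<And>c w v. \<lbrakk>w \<in> carrier W1; v \<in> carrier N1\<rbrakk> \<Longrightarrow> \<theta>1 (c \<odot>\<^bsub>W1\<^esub> w) v = c \<odot>\<^bsub>M\<^esub> \<theta>1 w v"
    and \<theta>2: "\<And>w. w \<in> carrier W2 \<Longrightarrow> coeff_map G N2 M (\<theta>2 w)"
      "\<And>w w' v. \<lbrakk>w \<in> carrier W2; w' \<in> carrier W2; v \<in> carrier N2\<rbrakk> \<Longrightarrow> \<theta>2 (w \<oplus>\<^bsub>W2\<^esub> w') v = \<theta>2 w v \<oplus>\<^bsub>M\<^esub> \<theta>2 w' v"
      "\<And>c w v. \<lbrakk>w \<in> carrier W2; v \<in> carrier N2\<rbrakk> \<Longrightarrow> \<theta>2 (c \<odot>\<^bsub>W2\<^esub> w) v = c \<odot>\<^bsub>M\<^esub> \<theta>2 w v"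
    and gact: "\<And>g. g \<in> S \<Longrightarrow> vlin W1 W1 (gact W1 g)" "\<And>g. g \<in> S \<Longrightarrow> vlin W2 W2 (gact W2 g)"
    and \<Phi>': "\<And>g. g \<in> S \<Longrightarrow> coeff_map G M M (\<Phi>' g)"
    and \<theta>1_gact: "\<And>g w v. \<lbrakk>g \<in> S; w \<in> carrier W1; v \<in> carrier N1\<rbrakk> \<Longrightarrow> \<Phi>' g (\<theta>1 w v) = \<theta>1 (gact W1 g w) v"
    and \<theta>2_gact: "\<And>g w v. \<lbrakk>g \<in> S; w \<in> carrier W2; v \<in> carrier N2\<rbrakk> \<Longrightarrow> \<Phi>' g (\<theta>2 w v) = \<theta>2 (gact W2 g w) v"
    and w: "\<And>i. i < k1 \<Longrightarrow> w1 i \<in> carrier W1" "\<And>i. i < k2 \<Longrightarrow> w2 i \<in> carrier W2"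
    and span1: "\<And>y. y \<in> carrier W1 \<Longrightarrow> \<exists>a. y = (\<Oplus>\<^bsub>W1\<^esub>i\<in>{..<k1}. a i \<odot>\<^bsub>W1\<^esub> w1 i)"
    and span2: "\<And>y. y \<in> carrier W2 \<Longrightarrow> \<exists>a. y = (\<Oplus>\<^bsub>W2\<^esub>i\<in>{..<k2}. a i \<odot>\<^bsub>W2\<^esub> w2 i)"
begin

text \<open>
  Write a pair of tensors in normal form with respect to \<open>w1\<close> and \<open>w2\<close>. The map to cohomology sends it to
  the sum of the images of its coefficients under the inclusions, which is the decomposition of
  cohomology induced by the decomposition of \<open>M\<close>. So it is surjective, and the image determines
  the coefficients. The isomorphism wanted is its inverse.
\<close>

lemma tensor_iso:
  fixes \<Phi>1 \<Phi>2 :: "'h \<Rightarrow> 'w \<Rightarrow> 'w"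
  defines "H \<equiv> total_ext G \<Phi>' M"
    and "D \<equiv> dir_sum (tensor_snd (total_ext G \<Phi>1 N1) W1) (tensor_snd (total_ext G \<Phi>2 N2) W2)"
  shows "\<exists>\<phi>. lin_iso H D \<phi> \<and> right_linear (total_ext_carrier G (triv_mod TYPE('k))) H D \<phi> \<and>
    equivariant S H D \<phi> \<and> degree_preserving H D \<phi>"
proof -
  let ?I = "Sum_Type.Plus {..<k1} {..<k2}"
  let ?N = "case_sum (\<lambda>_::nat. N1) (\<lambda>_::nat. N2)"
  let ?incl = "case_sum (\<lambda>i. \<theta>1 (w1 i)) (\<lambda>i. \<theta>2 (w2 i))"
  let ?V1 = "total_ext G \<Phi>1 N1" and ?V2 = "total_ext G \<Phi>2 N2"
  let ?K = "total_ext_carrier G (triv_mod TYPE('k))"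
  interpret N1: coeff G N1 by (rule N)
  interpret N2: coeff G N2 by (rule N)
  interpret H: vspace H unfolding H_def by (rule M.vspace_total)
  interpret T1: tensor_product ?V1 W1
    by (intro tensor_product.intro N1.vspace_total W1.vspace_axioms)
  interpret T2: tensor_product ?V2 W2
    by (intro tensor_product.intro N2.vspace_total W2.vspace_axioms)
  interpret V1: vspace "tensor ?V1 W1" by (rule T1.vspace_tensor)
  interpret V2: vspace "tensor ?V2 W2" by (rule T2.vspace_tensor)
  obtain F1 where F1: "vlin (tensor ?V1 W1) H F1"
    "\<And>x w. \<lbrakk>x \<in> total_ext_carrier G N1; w \<in> carrier W1\<rbrakk> \<Longrightarrow> F1 (elem_tensor ?V1 W1 x w) = total_push G N1 M (\<theta>1 w) x"
    "\<And>b T. \<lbrakk>b \<in> ?K; T \<in> carrier (tensor ?V1 W1)\<rbrakk> \<Longrightarrow> F1 (ract (tensor_snd ?V1 W1) T b) = ract H (F1 T) b"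
    "\<And>g T. \<lbrakk>g \<in> S; T \<in> carrier (tensor ?V1 W1)\<rbrakk> \<Longrightarrow> F1 (gact (tensor_snd ?V1 W1) g T) = gact H g (F1 T)"
    "\<And>n T. T \<in> hcomp (tensor_snd ?V1 W1) n \<Longrightarrow> F1 T \<in> hcomp H n"
    unfolding H_def
    by (rule tensor_to_cohomology[OF N(1) M.coeff_axioms W1.vspace_axioms \<theta>1 gact(1) \<Phi>' \<theta>1_gact]; (assumption | blast)?)
  obtain F2 where F2: "vlin (tensor ?V2 W2) H F2"
    "\<And>x w. \<lbrakk>x \<in> total_ext_carrier G N2; w \<in> carrier W2\<rbrakk> \<Longrightarrow> F2 (elem_tensor ?V2 W2 x w) = total_push G N2 M (\<theta>2 w) x"
    "\<And>b T. \<lbrakk>b \<in> ?K; T \<in> carrier (tensor ?V2 W2)\<rbrakk> \<Longrightarrow> F2 (ract (tensor_snd ?V2 W2) T b) = ract H (F2 T) b"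
    "\<And>g T. \<lbrakk>g \<in> S; T \<in> carrier (tensor ?V2 W2)\<rbrakk> \<Longrightarrow> F2 (gact (tensor_snd ?V2 W2) g T) = gact H g (F2 T)"
    "\<And>n T. T \<in> hcomp (tensor_snd ?V2 W2) n \<Longrightarrow> F2 T \<in> hcomp H n"
    unfolding H_def
    by (rule tensor_to_cohomology[OF N(2) M.coeff_axioms W2.vspace_axioms \<theta>2 gact(2) \<Phi>' \<theta>2_gact]; (assumption | blast)?)
  define \<Psi> where "\<Psi> T = F1 (fst T) \<oplus>\<^bsub>H\<^esub> F2 (snd T)" for T
  have Fc: "F1 T1 \<in> carrier H" "F2 T2 \<in> carrier H"
    if "T1 \<in> carrier (tensor ?V1 W1)" "T2 \<in> carrier (tensor ?V2 W2)" for T1 T2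
    using vlin_closed[OF F1(1) that(1)] vlin_closed[OF F2(1) that(2)] .
  have cD: "carrier D = carrier (tensor ?V1 W1) \<times> carrier (tensor ?V2 W2)" by (simp add: D_def)
  have lin: "vlin D H \<Psi>"
  proof (rule vlinI)
    fix x assume x: "x \<in> carrier D"
    then show "\<Psi> x \<in> carrier H" using Fc by (auto simp: cD \<Psi>_def)
    { fix y assume "y \<in> carrier D"
      with x show "\<Psi> (x \<oplus>\<^bsub>D\<^esub> y) = \<Psi> x \<oplus>\<^bsub>H\<^esub> \<Psi> y"
        using Fc by (auto simp: cD \<Psi>_def D_def vlin_add[OF F1(1)] vlin_add[OF F2(1)] H.a_ac) }
    show "\<Psi> (c \<odot>\<^bsub>D\<^esub> x) = c \<odot>\<^bsub>H\<^esub> \<Psi> x" for c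
      using x Fc by (auto simp: cD \<Psi>_def D_def vlin_smult[OF F1(1)] vlin_smult[OF F2(1)] H.smult_r_distr)
  qed
  define \<sigma> where "\<sigma> x1 x2 = ((\<Oplus>\<^bsub>tensor ?V1 W1\<^esub>i\<in>{..<k1}. elem_tensor ?V1 W1 (x1 i) (w1 i)),
      (\<Oplus>\<^bsub>tensor ?V2 W2\<^esub>i\<in>{..<k2}. elem_tensor ?V2 W2 (x2 i) (w2 i)))" for x1 x2
  have ic: "\<lbrakk>i < k1; x \<in> total_ext_carrier G N1\<rbrakk> \<Longrightarrow> total_push G N1 M (\<theta>1 (w1 i)) x \<in> carrier H"
    "\<lbrakk>i < k2; x \<in> total_ext_carrier G N2\<rbrakk> \<Longrightarrow> total_push G N2 M (\<theta>2 (w2 i)) x \<in> carrier H" for i x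
    using coeff_map.total_push_closed[OF \<theta>1(1)[OF w(1)]] coeff_map.total_push_closed[OF \<theta>2(1)[OF w(2)]]
    by (simp_all add: H_def)
  have \<Psi>\<sigma>: "\<Psi> (\<sigma> x1 x2) = (\<Oplus>\<^bsub>H\<^esub>j\<in>?I. total_push G (?N j) M (?incl j) (case_sum x1 x2 j))"
    if x: "\<And>i. i < k1 \<Longrightarrow> x1 i \<in> total_ext_carrier G N1" "\<And>i. i < k2 \<Longrightarrow> x2 i \<in> total_ext_carrier G N2" for x1 x2
  proof -
    have "F1 (\<Oplus>\<^bsub>tensor ?V1 W1\<^esub>i\<in>{..<k1}. elem_tensor ?V1 W1 (x1 i) (w1 i))
        = (\<Oplus>\<^bsub>H\<^esub>i\<in>{..<k1}. F1 (elem_tensor ?V1 W1 (x1 i) (w1 i)))"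
      using x w by (intro vlin_finsum[OF T1.vspace_tensor H.vspace_axioms F1(1)] T1.elem_tensor_closed) auto
    also have "\<dots> = (\<Oplus>\<^bsub>H\<^esub>i\<in>{..<k1}. total_push G N1 M (\<theta>1 (w1 i)) (x1 i))"
      using F1(2)[OF x(1) w(1)] coeff_map.total_push_closed[OF \<theta>1(1)[OF w(1)] x(1)]
      by (intro H.finsum_cong') (auto simp: H_def)
    finally have 1: "F1 (\<Oplus>\<^bsub>tensor ?V1 W1\<^esub>i\<in>{..<k1}. elem_tensor ?V1 W1 (x1 i) (w1 i))
        = (\<Oplus>\<^bsub>H\<^esub>i\<in>{..<k1}. total_push G N1 M (\<theta>1 (w1 i)) (x1 i))" .
    have "F2 (\<Oplus>\<^bsub>tensor ?V2 W2\<^esub>i\<in>{..<k2}. elem_tensor ?V2 W2 (x2 i) (w2 i))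
        = (\<Oplus>\<^bsub>H\<^esub>i\<in>{..<k2}. F2 (elem_tensor ?V2 W2 (x2 i) (w2 i)))"
      using x w by (intro vlin_finsum[OF T2.vspace_tensor H.vspace_axioms F2(1)] T2.elem_tensor_closed) auto
    also have "\<dots> = (\<Oplus>\<^bsub>H\<^esub>i\<in>{..<k2}. total_push G N2 M (\<theta>2 (w2 i)) (x2 i))"
      using F2(2)[OF x(2) w(2)] coeff_map.total_push_closed[OF \<theta>2(1)[OF w(2)] x(2)]
      by (intro H.finsum_cong') (auto simp: H_def)
    finally have 2: "F2 (\<Oplus>\<^bsub>tensor ?V2 W2\<^esub>i\<in>{..<k2}. elem_tensor ?V2 W2 (x2 i) (w2 i))
        = (\<Oplus>\<^bsub>H\<^esub>i\<in>{..<k2}. total_push G N2 M (\<theta>2 (w2 i)) (x2 i))" .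
    have "(\<Oplus>\<^bsub>H\<^esub>j\<in>?I. total_push G (?N j) M (?incl j) (case_sum x1 x2 j))
        = (\<Oplus>\<^bsub>H\<^esub>i\<in>{..<k1}. total_push G N1 M (\<theta>1 (w1 i)) (x1 i)) \<oplus>\<^bsub>H\<^esub>
          (\<Oplus>\<^bsub>H\<^esub>i\<in>{..<k2}. total_push G N2 M (\<theta>2 (w2 i)) (x2 i))"
      by (subst H.finsum_Plus) (use ic x in \<open>auto split: sum.split\<close>)
    then show ?thesis by (simp add: \<Psi>_def \<sigma>_def 1 2)
  qed
  have proj_\<Psi>: "total_push G M (?N j) (proj j) (\<Psi> (\<sigma> x1 x2)) = case_sum x1 x2 j"
    if x: "\<And>i. i < k1 \<Longrightarrow> x1 i \<in> total_ext_carrier G N1" "\<And>i. i < k2 \<Longrightarrow> x2 i \<in> total_ext_carrier G N2"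
      and j: "j \<in> ?I" for x1 x2 j
  proof -
    have "total_push G M (?N j) (proj j) (\<Oplus>\<^bsub>H\<^esub>j\<in>?I. total_push G (?N j) M (?incl j) (case_sum x1 x2 j)) = case_sum x1 x2 j"
      unfolding H_def by (rule total_push_proj_sum[OF _ j]) (use x in \<open>auto split: sum.split\<close>)
    moreover have "\<Psi> (\<sigma> x1 x2) = (\<Oplus>\<^bsub>H\<^esub>j\<in>?I. total_push G (?N j) M (?incl j) (case_sum x1 x2 j))"
      by (rule \<Psi>\<sigma>) (use x in auto)
    ultimately show ?thesis by simp
  qed
  have norm: "\<exists>x1 x2. x1 \<in> {..<k1} \<rightarrow>\<^sub>E total_ext_carrier G N1 \<and> x2 \<in> {..<k2} \<rightarrow>\<^sub>E total_ext_carrier G N2 \<and> T = \<sigma> x1 x2"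
    if T: "T \<in> carrier D" for T
  proof -
    have "fst T \<in> carrier (tensor ?V1 W1)" "snd T \<in> carrier (tensor ?V2 W2)"
      using T by (auto simp: cD)
    moreover obtain x1 where "x1 \<in> {..<k1} \<rightarrow>\<^sub>E carrier ?V1"
      "fst T = (\<Oplus>\<^bsub>tensor ?V1 W1\<^esub>i\<in>{..<k1}. elem_tensor ?V1 W1 (x1 i) (w1 i))"
      using T1.tensor_normal_form[OF _ _ span1 calculation(1)] w(1) by blast
    moreover obtain x2 where "x2 \<in> {..<k2} \<rightarrow>\<^sub>E carrier ?V2"
      "snd T = (\<Oplus>\<^bsub>tensor ?V2 W2\<^esub>i\<in>{..<k2}. elem_tensor ?V2 W2 (x2 i) (w2 i))"
      using T2.tensor_normal_form[OF _ _ span2 calculation(2)] w(2) by blast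
    ultimately show ?thesis
      by (intro exI[of _ x1] exI[of _ x2]) (simp add: \<sigma>_def prod_eq_iff)
  qed
  have inj: "inj_on \<Psi> (carrier D)"
  proof (rule inj_onI)
    fix T T' assume TT: "T \<in> carrier D" "T' \<in> carrier D" "\<Psi> T = \<Psi> T'"
    obtain x1 x2 where x: "x1 \<in> {..<k1} \<rightarrow>\<^sub>E total_ext_carrier G N1" "x2 \<in> {..<k2} \<rightarrow>\<^sub>E total_ext_carrier G N2" "T = \<sigma> x1 x2"
      using norm[OF TT(1)] by blast
    obtain y1 y2 where y: "y1 \<in> {..<k1} \<rightarrow>\<^sub>E total_ext_carrier G N1" "y2 \<in> {..<k2} \<rightarrow>\<^sub>E total_ext_carrier G N2" "T' = \<sigma> y1 y2"
      using norm[OF TT(2)] by blast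
    have xc: "x1 i \<in> total_ext_carrier G N1" "y1 i \<in> total_ext_carrier G N1" if "i < k1" for i
      using x(1) y(1) that by auto
    have yc: "x2 i \<in> total_ext_carrier G N2" "y2 i \<in> total_ext_carrier G N2" if "i < k2" for i
      using x(2) y(2) that by auto
    have e: "case_sum x1 x2 j = case_sum y1 y2 j" if "j \<in> ?I" for j
      using proj_\<Psi>[of x1 x2 j, OF xc(1) yc(1) that] proj_\<Psi>[of y1 y2 j, OF xc(2) yc(2) that] TT(3) x(3) y(3) by simp
    have "x1 i = y1 i" if "i < k1" for i using e[of "Inl i"] that by simp
    then have "x1 = y1" using x(1) y(1) by (intro PiE_ext[of x1 "{..<k1}"]) auto
    moreover have "x2 i = y2 i" if "i < k2" for i using e[of "Inr i"] that by simp
    then have "x2 = y2" using x(2) y(2) by (intro PiE_ext[of x2 "{..<k2}"]) auto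
    ultimately show "T = T'" using x(3) y(3) by simp
  qed
  have pre: "\<exists>x1 x2. y = \<Psi> (\<sigma> x1 x2) \<and> (\<forall>i<k1. x1 i = total_push G M N1 (proj (Inl i)) y) \<and>
      (\<forall>i<k2. x2 i = total_push G M N2 (proj (Inr i)) y)"
    if y: "y \<in> total_ext_carrier G M" for y
  proof -
    define x1 where "x1 i = total_push G M N1 (proj (Inl i)) y" for i
    define x2 where "x2 i = total_push G M N2 (proj (Inr i)) y" for i
    have x: "x1 i \<in> total_ext_carrier G N1" if "i < k1" for i
      using coeff_map.total_push_closed[OF proj[of "Inl i"] y] that by (simp add: x1_def)
    have x': "x2 i \<in> total_ext_carrier G N2" if "i < k2" for i
      using coeff_map.total_push_closed[OF proj[of "Inr i"] y] that by (simp add: x2_def)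
    have "y = (\<Oplus>\<^bsub>H\<^esub>j\<in>?I. total_push G (?N j) M (?incl j) (total_push G M (?N j) (proj j) y))"
      unfolding H_def by (rule total_push_incl_proj[OF y, symmetric])
    also have "\<dots> = (\<Oplus>\<^bsub>H\<^esub>j\<in>?I. total_push G (?N j) M (?incl j) (case_sum x1 x2 j))"
    proof (rule H.finsum_cong')
      show "total_push G (?N j) M (?incl j) (total_push G M (?N j) (proj j) y) = total_push G (?N j) M (?incl j) (case_sum x1 x2 j)" for j
        by (cases j) (simp_all add: x1_def x2_def)
    qed (use ic x x' in \<open>auto split: sum.split\<close>)
    also have "\<dots> = \<Psi> (\<sigma> x1 x2)" by (rule \<Psi>\<sigma>[symmetric]) (use x x' in auto)
    finally show ?thesis by (intro exI[of _ x1] exI[of _ x2]) (simp add: x1_def x2_def)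
  qed
  have \<sigma>c: "\<sigma> x1 x2 \<in> carrier D"
    if "\<And>i. i < k1 \<Longrightarrow> x1 i \<in> total_ext_carrier G N1" "\<And>i. i < k2 \<Longrightarrow> x2 i \<in> total_ext_carrier G N2" for x1 x2
    using that w by (auto simp: cD \<sigma>_def intro!: V1.finsum_closed V2.finsum_closed T1.elem_tensor_closed T2.elem_tensor_closed)
  have hc: "\<Psi> ` hcomp D n = hcomp H n" for n
  proof (intro equalityI subsetI)
    fix y assume "y \<in> \<Psi> ` hcomp D n"
    then obtain T where T: "fst T \<in> hcomp (tensor_snd ?V1 W1) n" "snd T \<in> hcomp (tensor_snd ?V2 W2) n" "y = \<Psi> T"
      by (auto simp: D_def simp del: tensor_snd_simps)
    show "y \<in> hcomp H n"
      using F1(5)[OF T(1)] F2(5)[OF T(2)] M.subsp_hcomp[of \<Phi>' n] T(3)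
      by (simp add: \<Psi>_def subsp_def H_def del: total_ext_simps)
  next
    fix y assume y: "y \<in> hcomp H n"
    then have "y \<in> total_ext_carrier G M" by (simp add: H_def)
    from pre[OF this] obtain x1 x2 where x: "y = \<Psi> (\<sigma> x1 x2)"
      "\<And>i. i < k1 \<Longrightarrow> x1 i = total_push G M N1 (proj (Inl i)) y"
      "\<And>i. i < k2 \<Longrightarrow> x2 i = total_push G M N2 (proj (Inr i)) y" by blast
    have x1: "x1 i \<in> hcomp ?V1 n" if "i < k1" for i
      using coeff_map.total_push_hcomp[OF proj[of "Inl i"], of y \<Phi>' n \<Phi>1] y that x(2) by (simp add: H_def del: total_ext_simps)
    have x2: "x2 i \<in> hcomp ?V2 n" if "i < k2" for i
      using coeff_map.total_push_hcomp[OF proj[of "Inr i"], of y \<Phi>' n \<Phi>2] y that x(3) by (simp add: H_def del: total_ext_simps)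
    have c: "\<sigma> x1 x2 \<in> carrier D" using x1 x2 by (intro \<sigma>c) auto
    have "\<exists>t\<in>fst (\<sigma> x1 x2). Poly_Mapping.keys t \<subseteq> hcomp ?V1 n \<times> carrier W1"
      unfolding \<sigma>_def fst_conv using x1 w by (intro T1.tensor_sum_support) auto
    moreover have "\<exists>t\<in>snd (\<sigma> x1 x2). Poly_Mapping.keys t \<subseteq> hcomp ?V2 n \<times> carrier W2"
      unfolding \<sigma>_def snd_conv using x2 w by (intro T2.tensor_sum_support) auto
    ultimately have "\<sigma> x1 x2 \<in> hcomp D n"
      using c by (simp add: D_def mem_Times_iff del: total_ext_simps)
    then show "y \<in> \<Psi> ` hcomp D n" using x(1) by blast
  qed
  have bij: "bij_betw \<Psi> (carrier D) (carrier H)"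
    unfolding bij_betw_def
  proof
    show "\<Psi> ` carrier D = carrier H"
    proof
      show "\<Psi> ` carrier D \<subseteq> carrier H" using vlin_closed[OF lin] by blast
      show "carrier H \<subseteq> \<Psi> ` carrier D"
      proof
        fix y assume "y \<in> carrier H"
        then have y: "y \<in> total_ext_carrier G M" by (simp add: H_def)
        from pre[OF y] obtain x1 x2 where x: "y = \<Psi> (\<sigma> x1 x2)"
          "\<And>i. i < k1 \<Longrightarrow> x1 i = total_push G M N1 (proj (Inl i)) y"
          "\<And>i. i < k2 \<Longrightarrow> x2 i = total_push G M N2 (proj (Inr i)) y" by blast
        have "\<sigma> x1 x2 \<in> carrier D"
          using x(2,3) coeff_map.total_push_closed[OF proj y] by (intro \<sigma>c) (force simp: InlI InrI)+
        then show "y \<in> \<Psi> ` carrier D" using x(1) by blast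
      qed
    qed
  qed (rule inj)
  have vD: "vspace D"
    unfolding D_def
    by (rule vspace_dir_sum) (use T1.vspace_tensor T2.vspace_tensor in \<open>auto intro: vspace_same\<close>)
  let ?\<phi> = "inv_into (carrier D) \<Psi>"
  have "lin_iso H D ?\<phi>"
    using lin_iso_inv[OF vD, of H \<Psi>] lin bij by (simp add: lin_iso_alt)
  moreover have "right_linear ?K H D ?\<phi>"
    unfolding right_linear_def
  proof (intro ballI)
    fix b y assume b: "b \<in> ?K" and y: "y \<in> carrier H"
    have r: "vlin ?V1 ?V1 (\<lambda>x. ract ?V1 x b)" "vlin ?V2 ?V2 (\<lambda>x. ract ?V2 x b)"
      by (rule N1.ract_linear_left[OF b] N2.ract_linear_left[OF b])+
    have cl: "ract D T b \<in> carrier D" if "T \<in> carrier D" for T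
      using that vlin_closed[OF T1.tensor_map_linear[OF r(1) vlin_id]]
        vlin_closed[OF T2.tensor_map_linear[OF r(2) vlin_id]]
      by (simp add: cD mem_Times_iff del: total_ext_simps) (simp add: D_def del: total_ext_simps)
    have eq: "\<Psi> (ract D T b) = ract H (\<Psi> T) b" if "T \<in> carrier D" for T
    proof -
      have T: "fst T \<in> carrier (tensor ?V1 W1)" "snd T \<in> carrier (tensor ?V2 W2)" using that by (auto simp: cD)
      have "ract H (\<Psi> T) b = ract H (F1 (fst T)) b \<oplus>\<^bsub>H\<^esub> ract H (F2 (snd T)) b"
        unfolding \<Psi>_def H_def using Fc[OF T] by (intro vlin_add[OF M.ract_linear_left[OF b]]) (simp_all add: H_def)
      then show ?thesis
        using F1(3)[OF b T(1)] F2(3)[OF b T(2)] by (simp add: \<Psi>_def D_def del: total_ext_simps tensor_snd_simps)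
    qed
    show "?\<phi> (ract H y b) = ract D (?\<phi> y) b"
      by (rule inverse_intertwines[where p = "\<lambda>T. ract D T b" and q = "\<lambda>y. ract H y b", OF bij cl eq y])
  qed
  moreover have "equivariant S H D ?\<phi>"
    unfolding equivariant_def
  proof (intro ballI)
    fix g y assume g: "g \<in> S" and y: "y \<in> carrier H"
    have cl: "gact D g T \<in> carrier D" if "T \<in> carrier D" for T
      using that vlin_closed[OF T1.tensor_map_linear[OF vlin_id gact(1)[OF g]]]
        vlin_closed[OF T2.tensor_map_linear[OF vlin_id gact(2)[OF g]]]
      by (simp add: cD mem_Times_iff del: total_ext_simps) (simp add: D_def del: total_ext_simps)
    have eq: "\<Psi> (gact D g T) = gact H g (\<Psi> T)" if "T \<in> carrier D" for T
    proof -
      have T: "fst T \<in> carrier (tensor ?V1 W1)" "snd T \<in> carrier (tensor ?V2 W2)" using that by (auto simp: cD)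
      have "gact H g (\<Psi> T) = gact H g (F1 (fst T)) \<oplus>\<^bsub>H\<^esub> gact H g (F2 (snd T))"
        unfolding \<Psi>_def H_def total_ext_gact using Fc[OF T]
        by (intro vlin_add[OF coeff_map.total_push_linear[OF \<Phi>'[OF g]]]) (simp_all add: H_def)
      then show ?thesis
        using F1(4)[OF g T(1)] F2(4)[OF g T(2)] by (simp add: \<Psi>_def D_def del: total_ext_simps tensor_snd_simps)
    qed
    show "?\<phi> (gact H g y) = gact D g (?\<phi> y)"
      by (rule inverse_intertwines[where p = "gact D g" and q = "gact H g", OF bij cl eq y])
  qed
  moreover have "degree_preserving H D ?\<phi>"
    unfolding degree_preserving_def
  proof
    fix n
    have "hcomp D n \<subseteq> carrier D" by (auto simp: D_def)
    then show "?\<phi> ` hcomp H n = hcomp D n"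
      unfolding hc[symmetric] by (rule inv_into_image_cancel[OF inj])
  qed
  ultimately show ?thesis by blast
qed

end

section \<open>Rank one\<close>

lemma tensor_fst_simps [simp]:
  "carrier (tensor_fst V W) = carrier (tensor V W)"
  "zero (tensor_fst V W) = zero (tensor V W)"
  "add (tensor_fst V W) = add (tensor V W)"
  "smult (tensor_fst V W) = smult (tensor V W)"
  "gact (tensor_fst V W) = (\<lambda>g. tensor_map V W (gact V g) id)"
  by (simp_all add: tensor_fst_def add_gact_def gmodule.defs module.defs)

lemma ext_gmod_simps [simp]:
  "carrier (ext_gmod G \<Phi> M m) = carrier (Ext G M m)"
  "zero (ext_gmod G \<Phi> M m) = zero (Ext G M m)"
  "add (ext_gmod G \<Phi> M m) = add (Ext G M m)"
  "smult (ext_gmod G \<Phi> M m) = smult (Ext G M m)"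
  "gact (ext_gmod G \<Phi> M m) = (\<lambda>h. ext_map G M m (\<Phi> h))"
  by (simp_all add: ext_gmod_def add_gact_def gmodule.defs module.defs)

context coeff
begin

lemma in_degree_linear: "vlin (ext_gmod G \<Phi> M n) (total_ext G \<Phi>' M) (in_degree G M n)"
proof -
  interpret E: vspace "Ext G M m" for m by (rule vspace_Ext)
  show ?thesis
    by (rule vlinI) (auto simp: in_degree_def fun_eq_iff intro!: total_ext_carrierI[where N = "Suc n"])
qed

lemma in_degree_closed: "X \<in> carrier (Ext G M n) \<Longrightarrow> in_degree G M n X \<in> total_ext_carrier G M"
  using vlin_closed[OF in_degree_linear[of "\<lambda>_::unit. id" n "\<lambda>_::unit. id"]] by simp

end

lemma (in coeff_map) total_push_in_degree:
  "total_push G M N \<theta> (in_degree G M n X) = in_degree G N n (ext_push G M N n \<theta> X)"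
  by (rule ext) (simp add: total_push_def in_degree_def push_zero)

context
  fixes G :: "('g, 'z) monoid_scheme" and M :: "('k::field, 'v, 'g) gmodule"
    and \<theta> :: "'k \<Rightarrow> 'v" and \<pi> :: "'v \<Rightarrow> 'k"
  assumes \<theta>: "coeff_map G (triv_mod TYPE('k)) M \<theta>" and \<pi>: "coeff_map G M (triv_mod TYPE('k)) \<pi>"
    and \<pi>\<theta>: "\<And>c. \<pi> (\<theta> c) = c" and \<theta>\<pi>: "\<And>v. v \<in> carrier M \<Longrightarrow> \<theta> (\<pi> v) = v"
begin

lemma total_push_iso:
  "lin_iso (total_ext G \<Phi> (triv_mod TYPE('k))) (total_ext G \<Phi>' M) (total_push G (triv_mod TYPE('k)) M \<theta>)"
proof -
  interpret \<theta>: coeff_map G "triv_mod TYPE('k)" M \<theta> by (rule \<theta>)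
  interpret \<pi>: coeff_map G M "triv_mod TYPE('k)" \<pi> by (rule \<pi>)
  have "bij_betw (total_push G (triv_mod TYPE('k)) M \<theta>) (total_ext_carrier G (triv_mod TYPE('k))) (total_ext_carrier G M)"
  proof (rule bij_betw_byWitness[where f' = "total_push G M (triv_mod TYPE('k)) \<pi>"])
    show "\<forall>x\<in>total_ext_carrier G (triv_mod TYPE('k)). total_push G M (triv_mod TYPE('k)) \<pi> (total_push G (triv_mod TYPE('k)) M \<theta> x) = x"
      using total_push_comp[OF \<theta> \<pi>] \<theta>.M.total_push_ident[of "\<lambda>v. \<pi> (\<theta> v)"] by (simp add: \<pi>\<theta>)
    show "\<forall>y\<in>total_ext_carrier G M. total_push G (triv_mod TYPE('k)) M \<theta> (total_push G M (triv_mod TYPE('k)) \<pi> y) = y"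
      using total_push_comp[OF \<pi> \<theta>] \<theta>.N.total_push_ident[of "\<lambda>v. \<theta> (\<pi> v)"] by (simp add: \<theta>\<pi>)
  qed (use \<theta>.total_push_closed \<pi>.total_push_closed in auto)
  then show ?thesis
    using \<theta>.total_push_linear by (simp add: lin_iso_alt)
qed

lemma free_of_rank_one:
  "free_of_rank (total_ext G \<Phi> (triv_mod TYPE('k))) 1 (total_ext G \<Phi>' M)"
proof -
  interpret \<theta>: coeff_map G "triv_mod TYPE('k)" M \<theta> by (rule \<theta>)
  let ?K = "total_ext G \<Phi> (triv_mod TYPE('k))" and ?H = "total_ext G \<Phi>' M"
  let ?\<phi> = "\<lambda>x. total_push G (triv_mod TYPE('k)) M \<theta> (x (0::nat))"
  have one: "{..<1::nat} = {0}" by auto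
  have iso: "vlin ?K ?H (total_push G (triv_mod TYPE('k)) M \<theta>)"
    "bij_betw (total_push G (triv_mod TYPE('k)) M \<theta>) (carrier ?K) (carrier ?H)"
    using total_push_iso[of \<Phi> \<Phi>'] by (simp_all only: lin_iso_alt)
  have "bij_betw (\<lambda>x. x (0::nat)) ({..<1} \<rightarrow>\<^sub>E carrier ?K) (carrier ?K)"
    unfolding one
    by (rule bij_betw_byWitness[where f' = "\<lambda>y. \<lambda>i\<in>{0}. y"])
      (auto simp: PiE_def extensional_def fun_eq_iff)
  from bij_betw_trans[OF this iso(2)] have "bij_betw ?\<phi> (carrier (dpower ?K 1)) (carrier ?H)"
    by (simp add: comp_def)
  moreover have "vlin (dpower ?K 1) ?H ?\<phi>"
  proof (rule vlinI)
    fix x assume x: "x \<in> carrier (dpower ?K 1)"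
    then have x0: "x 0 \<in> carrier ?K" by auto
    show "?\<phi> x \<in> carrier ?H" using vlin_closed[OF iso(1) x0] .
    show "?\<phi> (c \<odot>\<^bsub>dpower ?K 1\<^esub> x) = c \<odot>\<^bsub>?H\<^esub> ?\<phi> x" for c
      using vlin_smult[OF iso(1) x0, of c] by simp
    fix y assume "y \<in> carrier (dpower ?K 1)"
    then have y0: "y 0 \<in> carrier ?K" by auto
    show "?\<phi> (x \<oplus>\<^bsub>dpower ?K 1\<^esub> y) = ?\<phi> x \<oplus>\<^bsub>?H\<^esub> ?\<phi> y"
      using vlin_add[OF iso(1) x0 y0] by simp
  qed
  moreover have "right_linear (carrier ?K) (dpower ?K 1) ?H ?\<phi>"
    unfolding right_linear_def
  proof (intro ballI)
    fix b x assume b: "b \<in> carrier ?K" and "x \<in> carrier (dpower ?K 1)"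
    then have x0: "x 0 \<in> total_ext_carrier G (triv_mod TYPE('k))" by auto
    show "?\<phi> (ract (dpower ?K 1) x b) = ract ?H (?\<phi> x) b"
      using \<theta>.total_push_ract[OF x0, of b \<Phi> \<Phi>'] b by (simp del: total_ext_simps(6))
  qed
  ultimately show ?thesis unfolding free_of_rank_def lin_iso_alt by blast
qed

lemma rank_one_tensor_iso:
  fixes \<Phi> :: "'h \<Rightarrow> 'k \<Rightarrow> 'k" and \<Phi>' :: "'h \<Rightarrow> 'v \<Rightarrow> 'v"
  assumes \<Phi>': "\<And>g. g \<in> S \<Longrightarrow> coeff_map G M M (\<Phi>' g)"
  defines "E0 \<equiv> ext_gmod G \<Phi>' M 0" and "K \<equiv> total_ext G \<Phi> (triv_mod TYPE('k))" and "H \<equiv> total_ext G \<Phi>' M"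
  shows "\<exists>\<phi>. lin_iso (tensor_fst E0 K) H \<phi> \<and> equivariant S (tensor_fst E0 K) H \<phi> \<and>
    (\<forall>v\<in>carrier E0. \<forall>b\<in>carrier K. \<phi> (elem_tensor E0 K v b) = ract H (in_degree G M 0 v) b)"
proof -
  let ?k = "triv_mod TYPE('k) :: ('k, 'k, 'g) gmodule"
  interpret \<theta>: coeff_map G ?k M \<theta> by (rule \<theta>)
  interpret \<pi>: coeff_map G M ?k \<pi> by (rule \<pi>)
  interpret H: vspace H unfolding H_def by (rule \<theta>.N.vspace_total)
  interpret K: vspace K unfolding K_def by (rule \<theta>.M.vspace_total)
  interpret E: vspace E0
    unfolding E0_def by (rule vspace_same[OF \<theta>.N.vspace_Ext[of 0]]) simp_all
  interpret T: tensor_product E0 K ..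
  have Kc: "carrier K = total_ext_carrier G ?k" and Ec: "carrier E0 = carrier (Ext G M 0)"
    by (simp_all add: K_def E0_def)
  have d: "in_degree G M 0 v \<in> total_ext_carrier G M" if "v \<in> carrier E0" for v
    using that \<theta>.N.in_degree_closed by (simp add: E0_def)
  have dl: "vlin E0 H (in_degree G M 0)" unfolding E0_def H_def by (rule \<theta>.N.in_degree_linear)
  have left: "vlin E0 H (\<lambda>v. ract H (in_degree G M 0 v) b)" if "b \<in> carrier K" for b
    by (rule vlin_compose[OF dl], unfold H_def, rule \<theta>.N.ract_linear_left) (use that Kc in simp)
  have right: "vlin K H (\<lambda>b. ract H (in_degree G M 0 v) b)" if "v \<in> carrier E0" for v
    unfolding K_def H_def by (rule \<theta>.N.ract_linear_right[OF d[OF that]])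
  have "\<exists>f. vlin (tensor E0 K) H f \<and>
      (\<forall>v\<in>carrier E0. \<forall>b\<in>carrier K. f (elem_tensor E0 K v b) = ract H (in_degree G M 0 v) b)"
    by (rule T.tensor_universal[where \<beta> = "\<lambda>v b. ract H (in_degree G M 0 v) b", OF H.vspace_axioms left right]) auto
  then obtain f where f: "vlin (tensor E0 K) H f"
    "\<And>v b. \<lbrakk>v \<in> carrier E0; b \<in> carrier K\<rbrakk> \<Longrightarrow> f (elem_tensor E0 K v b) = ract H (in_degree G M 0 v) b"
    by blast
  define u where "u = ext_class G ?k 0 (\<lambda>x\<in>carrier (std_res G 0). std_aug x)"
  have u: "u \<in> carrier (Ext G ?k 0)"
    unfolding u_def by (rule \<theta>.M.ext_class_closed[OF \<theta>.M.aug_cocycle])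
  define v0 where "v0 = ext_push G ?k M 0 \<theta> u"
  have v0: "v0 \<in> carrier E0" using \<theta>.push_closed[OF u] by (simp add: v0_def E0_def)
  \<comment> \<open>The generator corresponds to the unit of the cohomology ring.\<close>
  have fv0: "f (elem_tensor E0 K v0 b) = total_push G ?k M \<theta> b" if "b \<in> carrier K" for b
  proof -
    have b: "b \<in> total_ext_carrier G ?k" using that Kc by simp
    have "total_push G ?k M \<theta> (ract K (in_degree G ?k 0 u) b) = ract H (total_push G ?k M \<theta> (in_degree G ?k 0 u)) b"
      unfolding K_def H_def by (rule \<theta>.total_push_ract[OF \<theta>.M.in_degree_closed[OF u] b])
    moreover have "ract K (in_degree G ?k 0 u) b = b"
      unfolding K_def u_def by (rule \<theta>.M.ract_unit[OF b])
    ultimately show ?thesis using f(2)[OF v0 that] \<theta>.total_push_in_degree[of 0 u] by (simp add: v0_def)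
  qed
  have gen: "\<exists>c. v = c \<odot>\<^bsub>E0\<^esub> v0" if "v \<in> carrier E0" for v
  proof -
    have v: "v \<in> carrier (Ext G M 0)" using that Ec by simp
    obtain c where c: "ext_push G M ?k 0 \<pi> v = c \<odot>\<^bsub>Ext G ?k 0\<^esub> u"
      using \<theta>.M.Ext0_triv[OF \<pi>.push_closed[OF v]] unfolding u_def by blast
    have "v = ext_push G ?k M 0 \<theta> (ext_push G M ?k 0 \<pi> v)"
      using push_comp[OF \<pi> \<theta> v] push_cong[OF \<theta>.N.coeff_map_ident \<theta>\<pi> v] \<theta>.N.push_ident[OF v] by simp
    also have "\<dots> = c \<odot>\<^bsub>Ext G M 0\<^esub> v0"
      unfolding c v0_def by (rule vlin_smult[OF \<theta>.push_linear u])
    finally show ?thesis by (auto simp: E0_def)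
  qed
  have norm: "\<exists>b\<in>carrier K. T = elem_tensor E0 K v0 b" if T: "T \<in> carrier (tensor E0 K)" for T
  proof (rule T.tensor_induct[OF T])
    show "\<exists>b\<in>carrier K. \<zero>\<^bsub>tensor E0 K\<^esub> = elem_tensor E0 K v0 b"
      using vlin_zero[OF K.vspace_axioms T.vspace_tensor T.elem_tensor_linear_right[OF v0]] by (metis K.zero_closed)
    fix v b T assume v: "v \<in> carrier E0" and b: "b \<in> carrier K" and "\<exists>b\<in>carrier K. T = elem_tensor E0 K v0 b"
    then obtain b' where b': "b' \<in> carrier K" "T = elem_tensor E0 K v0 b'" by blast
    obtain c where c: "v = c \<odot>\<^bsub>E0\<^esub> v0" using gen[OF v] by blast
    have "elem_tensor E0 K v b = elem_tensor E0 K v0 (c \<odot>\<^bsub>K\<^esub> b)"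
      using vlin_smult[OF T.elem_tensor_linear_left[OF b] v0, of c] vlin_smult[OF T.elem_tensor_linear_right[OF v0] b, of c] c by simp
    then have "elem_tensor E0 K v b \<oplus>\<^bsub>tensor E0 K\<^esub> T = elem_tensor E0 K v0 (c \<odot>\<^bsub>K\<^esub> b \<oplus>\<^bsub>K\<^esub> b')"
      using vlin_add[OF T.elem_tensor_linear_right[OF v0] K.smult_closed[OF b] b'(1)] b'(2) by simp
    then show "\<exists>y\<in>carrier K. elem_tensor E0 K v b \<oplus>\<^bsub>tensor E0 K\<^esub> T = elem_tensor E0 K v0 y"
      using b b'(1) by blast
  qed
  have bij\<theta>: "bij_betw (total_push G ?k M \<theta>) (carrier K) (carrier H)"
    using total_push_iso[of \<Phi> \<Phi>'] by (simp add: lin_iso_alt K_def H_def)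
  have "bij_betw f (carrier (tensor E0 K)) (carrier H)"
    unfolding bij_betw_def
  proof
    show "inj_on f (carrier (tensor E0 K))"
    proof (rule inj_onI)
      fix T T' assume TT: "T \<in> carrier (tensor E0 K)" "T' \<in> carrier (tensor E0 K)" "f T = f T'"
      obtain b where b: "b \<in> carrier K" "T = elem_tensor E0 K v0 b" using norm[OF TT(1)] by blast
      obtain b' where b': "b' \<in> carrier K" "T' = elem_tensor E0 K v0 b'" using norm[OF TT(2)] by blast
      have "b = b'"
        using inj_onD[OF bij_betw_imp_inj_on[OF bij\<theta>] _ b(1) b'(1)] fv0[OF b(1)] fv0[OF b'(1)] TT(3) b b' by simp
      then show "T = T'" using b b' by simp
    qed
    show "f ` carrier (tensor E0 K) = carrier H"
    proof
      show "f ` carrier (tensor E0 K) \<subseteq> carrier H" using vlin_closed[OF f(1)] by blast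
      show "carrier H \<subseteq> f ` carrier (tensor E0 K)"
      proof
        fix y assume "y \<in> carrier H"
        then have "y \<in> total_push G ?k M \<theta> ` carrier K" using bij_betw_imp_surj_on[OF bij\<theta>] by simp
        then obtain b where "b \<in> carrier K" "y = total_push G ?k M \<theta> b" by blast
        then show "y \<in> f ` carrier (tensor E0 K)"
          using fv0[of b] T.elem_tensor_closed[OF v0, of b] by (intro image_eqI[of _ _ "elem_tensor E0 K v0 b"]) simp_all
      qed
    qed
  qed
  then have "lin_iso (tensor_fst E0 K) H f" using f(1) by (simp add: lin_iso_alt vlin_def)
  moreover have "equivariant S (tensor_fst E0 K) H f"
    unfolding equivariant_def
  proof (intro ballI)
    fix g T assume g: "g \<in> S" and "T \<in> carrier (tensor_fst E0 K)"
    then have T: "T \<in> carrier (tensor E0 K)" by simp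
    interpret g: coeff_map G M M "\<Phi>' g" by (rule \<Phi>'[OF g])
    have pl: "vlin E0 E0 (gact E0 g)"
      using g.push_linear[of 0] by (simp add: E0_def vlin_def ext_map_eq_push)
    have "f (tensor_map E0 K (gact E0 g) id T) = total_push G M M (\<Phi>' g) (f T)"
    proof (rule T.tensor_linear_eq[OF H.vspace_axioms vlin_compose[OF T.tensor_map_linear[OF pl vlin_id] f(1)]
        vlin_compose[OF f(1)] _ T])
      show "vlin H H (total_push G M M (\<Phi>' g))" unfolding H_def by (rule g.total_push_linear)
      fix v b assume v: "v \<in> carrier E0" and b: "b \<in> carrier K"
      have b': "b \<in> total_ext_carrier G ?k" using b Kc by simp
      have "total_push G M M (\<Phi>' g) (ract H (in_degree G M 0 v) b) = ract H (in_degree G M 0 (gact E0 g v)) b"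
        unfolding H_def g.total_push_ract[OF d[OF v] b', of \<Phi>' \<Phi>'] g.total_push_in_degree
        by (simp add: E0_def ext_map_eq_push)
      then show "f (tensor_map E0 K (gact E0 g) id (elem_tensor E0 K v b)) = total_push G M M (\<Phi>' g) (f (elem_tensor E0 K v b))"
        using T.tensor_map_elem[OF pl vlin_id v b] f(2)[OF v b] f(2)[OF vlin_closed[OF pl v] b] by simp
    qed
    then show "f (gact (tensor_fst E0 K) g T) = gact H g (f T)"
      unfolding H_def total_ext_gact by simp
  qed
  ultimately show ?thesis using f(2) by blast
qed

end

section \<open>The permutation modules of commuting pairs\<close>

declare sym_group_inv_equality [simp del]

lemma lookup_basis_map:
  assumes "inj_on \<sigma> X" "x \<in> X" "Poly_Mapping.keys v \<subseteq> X"
  shows "Poly_Mapping.lookup (basis_map \<sigma> v) (\<sigma> x) = Poly_Mapping.lookup v x"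
  using assms(3)
proof (induction v rule: free_induct)
  case (step y c v)
  then have "\<sigma> y = \<sigma> x \<longleftrightarrow> y = x" using assms(1,2) by (auto dest: inj_onD)
  then show ?case using step by (simp add: lookup_add lookup_single when_def)
qed simp

lemma M1_eq: "M1 T X = perm_mod X conj_pair"
  by (simp add: M1_def)

lemma conj_pair_mult:
  assumes "g \<in> carrier S3" "h \<in> carrier S3" "p \<in> carrier S3 \<times> carrier S3"
  shows "conj_pair (g \<otimes>\<^bsub>S3\<^esub> h) p = conj_pair g (conj_pair h p)"
  using assms by (cases p) (simp add: S3.m_assoc S3.inv_mult_group)

lemma conj_pair_one: "p \<in> carrier S3 \<times> carrier S3 \<Longrightarrow> conj_pair \<one>\<^bsub>S3\<^esub> p = p"
  by (cases p) (simp)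

locale conj_stable =
  fixes X :: "(perm3 \<times> perm3) set"
  assumes sub: "X \<subseteq> carrier S3 \<times> carrier S3"
    and conj: "\<And>b z p. p \<in> X \<Longrightarrow> conj_pair (dih b z) p \<in> X"
begin

lemma conj_closed: "\<lbrakk>g \<in> carrier S3; p \<in> X\<rbrakk> \<Longrightarrow> conj_pair g p \<in> X"
  using conj by (metis S3_cases)

lemma gmod_M1: "gmod S3 (M1 TYPE('k::field) X)"
  unfolding M1_eq
proof (rule gmod_perm_mod[OF S3.group_axioms])
  show "conj_pair g p \<in> X" if "g \<in> carrier S3" "p \<in> X" for g p using that by (rule conj_closed)
  show "conj_pair \<one>\<^bsub>S3\<^esub> p = p" if "p \<in> X" for p using that sub by (intro conj_pair_one) auto
  show "conj_pair (g \<otimes>\<^bsub>S3\<^esub> h) p = conj_pair g (conj_pair h p)"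
    if "g \<in> carrier S3" "h \<in> carrier S3" "p \<in> X" for g h p
    using that sub by (intro conj_pair_mult) auto
qed

lemma coeff_M1: "coeff S3 (M1 TYPE('k::field) X)"
  by (simp add: coeff_def gmod_M1)

lemma inj_conj: "g \<in> carrier S3 \<Longrightarrow> inj_on (conj_pair g) X"
proof (rule inj_on_inverseI[where g = "conj_pair (inv\<^bsub>S3\<^esub> g)"])
  fix p assume g: "g \<in> carrier S3" and "p \<in> X"
  then have p: "p \<in> carrier S3 \<times> carrier S3" using sub by auto
  show "conj_pair (inv\<^bsub>S3\<^esub> g) (conj_pair g p) = p"
    using conj_pair_mult[OF S3.inv_closed[OF g] g p] conj_pair_one[OF p] S3.l_inv[OF g] by simp
qed

lemma coeff_map_basis:
  assumes "\<And>p. p \<in> X \<Longrightarrow> \<tau> p \<in> X"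
    and "\<And>b z p. p \<in> X \<Longrightarrow> \<tau> (conj_pair (dih b z) p) = conj_pair (dih b z) (\<tau> p)"
  shows "coeff_map S3 (M1 TYPE('k::field) X) (M1 TYPE('k) X) (basis_map \<tau>)"
proof -
  have c: "\<tau> (conj_pair g p) = conj_pair g (\<tau> p)" if "g \<in> carrier S3" "p \<in> X" for g p
    using assms(2)[OF that(2)] that(1) by (metis S3_cases)
  have "gmap S3 (M1 TYPE('k) X) (M1 TYPE('k) X) (basis_map \<tau>)"
    unfolding M1_eq basis_map_def
    by (rule gmap_lin_ext) (simp_all add: assms(1) c basis_map_def[symmetric])
  then show ?thesis using coeff_M1 by (simp add: coeff_map_def coeff_map_axioms_def)
qed

end

lemma O1_stable: "conj_stable O1"
  by standard (auto simp: O1_eq dih_one dih_mult dih_inv dih_closed)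

lemma O2_stable: "conj_stable O2"
proof
  show "O2 \<subseteq> carrier S3 \<times> carrier S3" by (auto simp: O2_def Omega1_def)
  show "conj_pair (dih b z) p \<in> O2" if p: "p \<in> O2" for b z p
  proof -
    obtain y u where "u \<noteq> 0" "p = coord (tpow y) u" using p unfolding O2_eq by blast
    then show ?thesis unfolding O2_eq using conj_coord_tpow[of b z y u] by blast
  qed
qed

lemma O3_stable: "conj_stable O3"
proof
  show "O3 \<subseteq> carrier S3 \<times> carrier S3" by (auto simp: O3_def Omega1_def)
  show "conj_pair (dih b z) p \<in> O3" if p: "p \<in> O3" for b z p
  proof -
    obtain u where u: "u \<noteq> 0" "p = coord (dih False) u" using p unfolding O3_eq by blast
    then have "(if b then - u else u) \<in> UNIV - {0}" by simp
    then show ?thesis unfolding O3_eq u conj_coord_rot by (rule imageI)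
  qed
qed

interpretation O1: conj_stable O1 by (rule O1_stable)
interpretation O2: conj_stable O2 by (rule O2_stable)
interpretation O3: conj_stable O3 by (rule O3_stable)

lemma vec_act_components:
  fixes u :: "'r::comm_ring_1 ^ 2"
  shows "vec_act A u $ 1 = of_int (A $ 1 $ 1) * u $ 1 + of_int (A $ 1 $ 2) * u $ 2"
    "vec_act A u $ 2 = of_int (A $ 2 $ 1) * u $ 1 + of_int (A $ 2 $ 2) * u $ 2"
  by (simp_all add: vec_act_def matrix_vector_mult_def sum_2 map_matrix_def)

lemma vec_act_scale: "vec_act A (c *s u) = c *s vec_act A u"
  by (simp add: vec_eq_iff forall_2 vec_act_components algebra_simps)

lemma vec_act_minus: "vec_act A (- u) = - vec_act A (u :: 'r::comm_ring_1 ^ 2)"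
  by (simp add: vec_eq_iff forall_2 vec_act_components algebra_simps)

lemma vec_act_nonzero:
  fixes u :: "'r::comm_ring_1 ^ 2"
  assumes A: "A \<in> SL2Z" and u: "u \<noteq> 0" shows "vec_act A u \<noteq> 0"
proof
  assume z: "vec_act A u = 0"
  have "A $ 1 $ 1 * A $ 2 $ 2 - A $ 1 $ 2 * A $ 2 $ 1 = 1" using A by (simp add: SL2Z_def det_2)
  then have det: "of_int (A $ 1 $ 1) * of_int (A $ 2 $ 2) - of_int (A $ 1 $ 2) * of_int (A $ 2 $ 1) = (1::'r)"
    using arg_cong[of _ _ "of_int :: int \<Rightarrow> 'r"] by (simp flip: of_int_mult of_int_diff)
  have "of_int (A $ 2 $ 2) * vec_act A u $ 1 - of_int (A $ 1 $ 2) * vec_act A u $ 2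
      = (of_int (A $ 1 $ 1) * of_int (A $ 2 $ 2) - of_int (A $ 1 $ 2) * of_int (A $ 2 $ 1)) * u $ 1"
    "of_int (A $ 1 $ 1) * vec_act A u $ 2 - of_int (A $ 2 $ 1) * vec_act A u $ 1
      = (of_int (A $ 1 $ 1) * of_int (A $ 2 $ 2) - of_int (A $ 1 $ 2) * of_int (A $ 2 $ 1)) * u $ 2"
    by (simp_all add: vec_act_components algebra_simps)
  then have "u $ 1 = 0" "u $ 2 = 0" unfolding det z by simp_all
  with u show False by (simp add: vec2_nonzero_iff)
qed

lemma sl_act_O1: "coeff_map S3 (M1 TYPE('k::field) O1) (M1 TYPE('k) O1) (sl_act A)"
  unfolding sl_act_def
proof (rule O1.coeff_map_basis)
  have one: "mat_act B (\<one>\<^bsub>S3\<^esub>, \<one>\<^bsub>S3\<^esub>) = (\<one>\<^bsub>S3\<^esub>, \<one>\<^bsub>S3\<^esub>)" for B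
    by (simp add: mat_act_def)
  show "mat_act B p \<in> O1" if "p \<in> O1" for B p using that by (simp add: O1_eq one)
  show "mat_act B (conj_pair (dih b z) p) = conj_pair (dih b z) (mat_act B p)" if "p \<in> O1" for B b z p
  proof -
    have "conj_pair (dih b z) p = p" using O1.conj[OF that, of b z] that by (simp add: O1_eq)
    moreover have "mat_act B p = p" using that one by (simp add: O1_eq)
    ultimately show ?thesis by simp
  qed
qed

lemma mat_act_rot:
  "A \<in> SL2Z \<Longrightarrow> mat_act (matrix_inv (transpose A)) (coord (dih False) u) = coord (dih False) (vec_act A u)"
  by (rule mat_act_coord[OF rot_closed rot_add])

lemma mat_act_tpow:
  "A \<in> SL2Z \<Longrightarrow> mat_act (matrix_inv (transpose A)) (coord (tpow z) u) = coord (tpow z) (vec_act A u)"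
  by (rule mat_act_coord[OF tpow_closed tpow_add])

lemma sl_act_O3:
  assumes "A \<in> SL2Z" shows "coeff_map S3 (M1 TYPE('k::field) O3) (M1 TYPE('k) O3) (sl_act A)"
  unfolding sl_act_def
proof (rule O3.coeff_map_basis)
  fix p assume "p \<in> O3"
  then obtain u where u: "u \<noteq> 0" "p = coord (dih False) u" unfolding O3_eq by blast
  show "mat_act (matrix_inv (transpose A)) p \<in> O3"
    unfolding u(2) mat_act_rot[OF assms] O3_eq using vec_act_nonzero[OF assms u(1)] by simp
  show "mat_act (matrix_inv (transpose A)) (conj_pair (dih b z) p)
      = conj_pair (dih b z) (mat_act (matrix_inv (transpose A)) p)" for b z
    unfolding u(2) mat_act_rot[OF assms] conj_coord_rot by (simp add: vec_act_minus)
qed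

lemma coord_rot_inj: "coord (dih False) u = coord (dih False) w \<longleftrightarrow> u = w"
  by (auto simp: coord_def dih_eq_iff vec_eq_iff forall_2)

lemma coord_tpow_inj:
  assumes "u \<noteq> 0" "w \<noteq> 0"
  shows "coord (tpow y) u = coord (tpow z) w \<longleftrightarrow> y = z \<and> u = w"
proof
  have m: "- e = e" for e :: 2 by (cases e rule: z2_cases) simp_all
  have t: "tpow y e = tpow z f \<longleftrightarrow> e = f \<and> (e \<noteq> 0 \<longrightarrow> y = z)" for e f
    by (cases e rule: z2_cases; cases f rule: z2_cases) (simp_all add: tpow_def dih_eq_iff)
  assume "coord (tpow y) u = coord (tpow z) w"
  then have "u $ 2 = w $ 2" "u $ 2 \<noteq> 0 \<longrightarrow> y = z" "u $ 1 = w $ 1" "u $ 1 \<noteq> 0 \<longrightarrow> y = z"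
    unfolding coord_def by (simp_all add: t m)
  with assms(1) show "y = z \<and> u = w" by (auto simp: vec2_nonzero_iff vec_eq_iff forall_2)
qed simp

section \<open>Pairs generating a subgroup of order two\<close>

text \<open>
  The entries of such a pair are the identity and a single transposition \<open>t\<close>. The elements
  that conjugate \<open>dih True 0\<close> into \<open>t\<close> form a coset of the centraliser of \<open>dih True 0\<close>, which has order \<open>2\<close>.
\<close>

lemma Ext_O2_vanishes:
  assumes "(2::'k::field) \<noteq> 0"
  shows "carrier (Ext S3 (M1 TYPE('k) O2) (Suc m)) \<subseteq> {\<zero>\<^bsub>Ext S3 (M1 TYPE('k) O2) (Suc m)\<^esub>}"
  unfolding M1_eq
proof (rule S3.permutation_module_vanishing[where T = "\<lambda>p. {g \<in> carrier S3.
    g \<otimes>\<^bsub>S3\<^esub> dih True 0 \<otimes>\<^bsub>S3\<^esub> inv\<^bsub>S3\<^esub> g \<in> {fst p, snd p}}"])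
  let ?t = "dih True 0"
  let ?T = "\<lambda>p. {g \<in> carrier S3. g \<otimes>\<^bsub>S3\<^esub> ?t \<otimes>\<^bsub>S3\<^esub> inv\<^bsub>S3\<^esub> g \<in> {fst p, snd p}}"
  show "finite (carrier S3)" by (rule finite_S3)
  show "conj_pair g p \<in> O2" if "g \<in> carrier S3" "p \<in> O2" for g p using O2.conj_closed[OF that] .
  show "conj_pair \<one>\<^bsub>S3\<^esub> p = p" if "p \<in> O2" for p using that O2.sub by (intro conj_pair_one) auto
  show "conj_pair (g \<otimes>\<^bsub>S3\<^esub> h) p = conj_pair g (conj_pair h p)"
    if "g \<in> carrier S3" "h \<in> carrier S3" "p \<in> O2" for g h p
    using that O2.sub by (intro conj_pair_mult) auto
  show "?T p \<subseteq> carrier S3" for p by blast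
  show "?T (conj_pair g p) = (\<lambda>h. g \<otimes>\<^bsub>S3\<^esub> h) ` ?T p" if g: "g \<in> carrier S3" and p: "p \<in> O2" for g p
  proof -
    obtain a b where ab: "p = (a, b)" "a \<in> carrier S3" "b \<in> carrier S3" using p O2.sub by (cases p) auto
    have c: "(g \<otimes>\<^bsub>S3\<^esub> h) \<otimes>\<^bsub>S3\<^esub> ?t \<otimes>\<^bsub>S3\<^esub> inv\<^bsub>S3\<^esub> (g \<otimes>\<^bsub>S3\<^esub> h) = g \<otimes>\<^bsub>S3\<^esub> x \<otimes>\<^bsub>S3\<^esub> inv\<^bsub>S3\<^esub> g
        \<longleftrightarrow> h \<otimes>\<^bsub>S3\<^esub> ?t \<otimes>\<^bsub>S3\<^esub> inv\<^bsub>S3\<^esub> h = x" if h: "h \<in> carrier S3" and x: "x \<in> carrier S3" for h x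
    proof -
      have i: "inv\<^bsub>S3\<^esub> g \<in> carrier S3" "inv\<^bsub>S3\<^esub> h \<in> carrier S3" using g h by (simp_all only: S3.inv_closed)
      have "(g \<otimes>\<^bsub>S3\<^esub> h) \<otimes>\<^bsub>S3\<^esub> ?t \<otimes>\<^bsub>S3\<^esub> inv\<^bsub>S3\<^esub> (g \<otimes>\<^bsub>S3\<^esub> h) = g \<otimes>\<^bsub>S3\<^esub> (h \<otimes>\<^bsub>S3\<^esub> ?t \<otimes>\<^bsub>S3\<^esub> inv\<^bsub>S3\<^esub> h) \<otimes>\<^bsub>S3\<^esub> inv\<^bsub>S3\<^esub> g"
        using g h i dih_closed by (simp only: S3.inv_mult_group S3.m_assoc S3.m_closed)
      then show ?thesis
        using g h i x dih_closed
        by (simp only: S3.right_cancel S3.m_closed S3.Units_eq S3.Units_l_cancel)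
    qed
    have "k \<in> ?T (conj_pair g p) \<longleftrightarrow> k \<in> (\<lambda>h. g \<otimes>\<^bsub>S3\<^esub> h) ` ?T p" for k
    proof
      assume k: "k \<in> ?T (conj_pair g p)"
      define h where "h = inv\<^bsub>S3\<^esub> g \<otimes>\<^bsub>S3\<^esub> k"
      have kc: "k \<in> carrier S3" using k by blast
      have h: "h \<in> carrier S3" unfolding h_def using g kc by (intro S3.m_closed S3.inv_closed)
      have gh: "g \<otimes>\<^bsub>S3\<^esub> h = k"
        unfolding h_def using g kc S3.inv_closed[OF g] by (simp only: S3.m_assoc[symmetric] S3.r_inv S3.l_one)
      have "h \<otimes>\<^bsub>S3\<^esub> ?t \<otimes>\<^bsub>S3\<^esub> inv\<^bsub>S3\<^esub> h = a \<or> h \<otimes>\<^bsub>S3\<^esub> ?t \<otimes>\<^bsub>S3\<^esub> inv\<^bsub>S3\<^esub> h = b"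
        using k c[OF h ab(2)] c[OF h ab(3)] unfolding gh ab(1) by simp
      then show "k \<in> (\<lambda>h. g \<otimes>\<^bsub>S3\<^esub> h) ` ?T p"
        using h unfolding gh[symmetric] by (intro imageI) (simp add: ab(1))
    next
      assume "k \<in> (\<lambda>h. g \<otimes>\<^bsub>S3\<^esub> h) ` ?T p"
      then obtain h where h: "h \<in> carrier S3" "k = g \<otimes>\<^bsub>S3\<^esub> h" "h \<otimes>\<^bsub>S3\<^esub> ?t \<otimes>\<^bsub>S3\<^esub> inv\<^bsub>S3\<^esub> h \<in> {a, b}"
        by (auto simp: ab(1))
      have "k \<otimes>\<^bsub>S3\<^esub> ?t \<otimes>\<^bsub>S3\<^esub> inv\<^bsub>S3\<^esub> k \<in> {fst (conj_pair g p), snd (conj_pair g p)}"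
        using c[OF h(1) ab(2)] c[OF h(1) ab(3)] h(3) unfolding h(2) ab(1) by simp
      then show "k \<in> ?T (conj_pair g p)" using S3.m_closed[OF g h(1)] h(2) by simp
    qed
    then show ?thesis by blast
  qed
  show "of_nat (card (?T p)) \<noteq> (0::'k)" if p: "p \<in> O2" for p
  proof -
    obtain z u where u: "u \<noteq> 0" "p = coord (tpow z) u" using p unfolding O2_eq by blast
    have double: "y + y = z \<longleftrightarrow> y = - z" for y :: 3
      by (cases y rule: z3_cases; cases z rule: z3_cases) simp_all
    have "dih b y \<otimes>\<^bsub>S3\<^esub> ?t \<otimes>\<^bsub>S3\<^esub> inv\<^bsub>S3\<^esub> dih b y = dih True (y + y)" for b y
      by (simp add: dih_mult dih_inv)
    moreover have "dih True y \<in> {fst p, snd p} \<longleftrightarrow> y = z" for y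
      using u(1) by (auto simp: u(2) coord_def tpow_def dih_eq_iff vec2_nonzero_iff)
    ultimately have "g \<in> ?T p \<longleftrightarrow> g \<in> {dih False (- z), dih True (- z)}" for g
    proof -
      assume c: "\<And>b y. dih b y \<otimes>\<^bsub>S3\<^esub> ?t \<otimes>\<^bsub>S3\<^esub> inv\<^bsub>S3\<^esub> dih b y = dih True (y + y)"
        and d: "\<And>y. dih True y \<in> {fst p, snd p} \<longleftrightarrow> y = z"
      have m: "dih b y \<in> ?T p \<longleftrightarrow> y = - z" for b y
        using d[of "y + y"] double[of y] dih_closed[of b y] c[of b y] by simp
      show ?thesis
      proof
        assume g: "g \<in> ?T p"
        then obtain b y where by': "g = dih b y" using S3_cases by blast
        with g m[of b y] show "g \<in> {dih False (- z), dih True (- z)}" by (cases b) simp_all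
      next
        assume "g \<in> {dih False (- z), dih True (- z)}"
        then show "g \<in> ?T p" using m[of False "- z"] m[of True "- z"] by (elim insertE emptyE) (simp_all only:)
      qed
    qed
    then have "?T p = {dih False (- z), dih True (- z)}" by blast
    then have "card (?T p) = 2" by (simp only:) (simp add: dih_eq_iff)
    then show ?thesis using assms by (simp only: of_nat_numeral) simp
  qed
qed

abbreviation line :: "2^2 \<Rightarrow> (2^2) set" where
  "line u \<equiv> range (\<lambda>c. c *s u)"

lemma line_eq: "line u = {0, u}"
proof -
  have "c \<in> {0, 1}" for c :: 2 by (cases c rule: z2_cases) simp_all
  then have U: "(UNIV :: 2 set) = {0, 1}" by blast
  show ?thesis unfolding U by simp
qed

lemma line_inj: "\<lbrakk>u \<noteq> 0; w \<noteq> 0\<rbrakk> \<Longrightarrow> line u = line w \<longleftrightarrow> u = w"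
  unfolding line_eq by (auto simp: doubleton_eq_iff)

lemma line_image: "vec_act A ` line u = line (vec_act A u)"
  by (auto simp: vec_act_scale image_image)

lemma proj_line_eq: "proj_line = line ` (UNIV - {0})"
  by (auto simp: proj_line_def)

text \<open>
  Every orbit on \<open>O2\<close> has exactly one pair with entries in the subgroup generated by
  \<open>dih True 0\<close>, so an invariant is determined by its coefficients at these three pairs.
\<close>

definition line_map :: "(perm3 \<times> perm3 \<Rightarrow>\<^sub>0 'k::field) \<Rightarrow> ((2^2) set \<Rightarrow>\<^sub>0 'k)" where
  "line_map = lin_ext (\<lambda>p. if \<exists>u. u \<noteq> 0 \<and> p = coord (tpow 0) u
     then Poly_Mapping.single (line (THE u. u \<noteq> 0 \<and> p = coord (tpow 0) u)) 1 else 0)"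

lemma line_map_single:
  assumes "u \<noteq> 0"
  shows "line_map (Poly_Mapping.single (coord (tpow z) u) c)
    = (if z = 0 then Poly_Mapping.single (line u) c else 0)"
proof (cases "z = 0")
  case True
  have "(THE w. w \<noteq> 0 \<and> coord (tpow 0) u = coord (tpow 0) w) = u"
    using assms coord_tpow_inj by (intro the_equality) auto
  moreover have "\<exists>w. w \<noteq> 0 \<and> coord (tpow 0) u = coord (tpow 0) w" using assms by blast
  ultimately show ?thesis unfolding line_map_def lin_ext_single True by simp
next
  case False
  then have "\<not> (\<exists>w. w \<noteq> 0 \<and> coord (tpow z) u = coord (tpow 0) w)"
    using coord_tpow_inj[OF assms] by blast
  then show ?thesis unfolding line_map_def lin_ext_single using False by (simp only: if_False pm_scale_simps)
qed

lemma line_map_lookup: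
  assumes u: "u \<noteq> 0" and v: "Poly_Mapping.keys v \<subseteq> O2"
  shows "Poly_Mapping.lookup (line_map v) (line u) = Poly_Mapping.lookup v (coord (tpow 0) u)"
  using v
proof (induction v rule: free_induct)
  case zero
  then show ?case by (simp add: line_map_def)
next
  case (step p c v)
  obtain z w where w: "w \<noteq> 0" "p = coord (tpow z) w" using step(1) unfolding O2_eq by blast
  have "line_map (Poly_Mapping.single p c + v) = line_map (Poly_Mapping.single p c) + line_map v"
    by (simp add: line_map_def)
  then show ?case
    using step(3) line_inj[OF w(1) u] coord_tpow_inj[OF w(1) u, of z 0] line_map_single[OF w(1), of z c]
    by (simp add: w(2) lookup_add lookup_single when_def)
qed

lemma conj_O2_base: "conj_pair (dih False (- z)) (coord (tpow 0) u) = coord (tpow z) u"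
proof -
  have e: "- z + - z = (z::3)" by (cases z rule: z3_cases) simp_all
  show ?thesis using conj_coord_tpow[of False "- z" 0 u] by (simp only: if_False add_0_right e)
qed

lemma invariant_O2_lookup:
  fixes v :: "perm3 \<times> perm3 \<Rightarrow>\<^sub>0 'k::field"
  assumes v: "v \<in> invariants S3 (M1 TYPE('k) O2)" and u: "u \<noteq> 0"
  shows "Poly_Mapping.lookup v (coord (tpow z) u) = Poly_Mapping.lookup v (coord (tpow 0) u)"
proof -
  have p: "coord (tpow 0) u \<in> O2" unfolding O2_eq using u by blast
  have "basis_map (conj_pair (dih False (- z))) v = v" "Poly_Mapping.keys v \<subseteq> O2"
    using v dih_closed by (auto simp: invariants_def M1_eq)
  then show ?thesis
    using lookup_basis_map[OF O2.inj_conj[OF dih_closed] p, of v False "- z"] conj_O2_base by simp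
qed

lemma line_map_iso:
  "bij_betw line_map (invariants S3 (M1 TYPE('k::field) O2)) (carrier K_P1_2)"
  unfolding bij_betw_def
proof
  let ?I = "invariants S3 (M1 TYPE('k) O2)"
  have keys: "Poly_Mapping.keys v \<subseteq> O2" if "v \<in> ?I" for v using that by (simp add: invariants_def M1_eq)
  show "inj_on line_map ?I"
  proof (rule inj_onI)
    fix v w assume vw: "v \<in> ?I" "w \<in> ?I" "line_map v = line_map w"
    show "v = w"
    proof (rule poly_mapping_eqI)
      fix p show "Poly_Mapping.lookup v p = Poly_Mapping.lookup w p"
      proof (cases "p \<in> O2")
        case True
        then obtain z u where "u \<noteq> 0" "p = coord (tpow z) u" unfolding O2_eq by blast
        then show ?thesis
          using invariant_O2_lookup[OF vw(1)] invariant_O2_lookup[OF vw(2)]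
            line_map_lookup[OF _ keys[OF vw(1)]] line_map_lookup[OF _ keys[OF vw(2)]] vw(3) by metis
      next
        case False
        then have "p \<notin> Poly_Mapping.keys v" "p \<notin> Poly_Mapping.keys w" using keys vw(1,2) by blast+
        then show ?thesis by (simp add: in_keys_iff)
      qed
    qed
  qed
  show "line_map ` ?I = carrier K_P1_2"
  proof
    show "line_map ` ?I \<subseteq> carrier K_P1_2"
    proof
      fix q assume "q \<in> line_map ` ?I"
      then obtain v where v: "v \<in> ?I" "q = line_map v" by blast
      have "Poly_Mapping.keys (line_map v) \<subseteq> proj_line"
        unfolding line_map_def
      proof (rule lin_ext_keys[OF keys[OF v(1)]])
        fix p assume "p \<in> O2"
        then obtain z u where u: "u \<noteq> 0" "p = coord (tpow z) u" unfolding O2_eq by blast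
        have "Poly_Mapping.keys (line_map (Poly_Mapping.single p (1::'k))) \<subseteq> proj_line"
          unfolding u(2) line_map_single[OF u(1)] proj_line_eq using u(1) by auto
        then show "Poly_Mapping.keys (if \<exists>u. u \<noteq> 0 \<and> p = coord (tpow 0) u
            then Poly_Mapping.single (line (THE u. u \<noteq> 0 \<and> p = coord (tpow 0) u)) (1::'k) else 0) \<subseteq> proj_line"
          unfolding line_map_def lin_ext_single pm_scale_simps .
      qed
      then show "q \<in> carrier K_P1_2" by (simp add: v(2) K_P1_2_def)
    qed
    show "carrier K_P1_2 \<subseteq> line_map ` ?I"
    proof
      fix q :: "(2^2) set \<Rightarrow>\<^sub>0 'k" assume "q \<in> carrier K_P1_2"
      then have q: "Poly_Mapping.keys q \<subseteq> proj_line" by (simp add: K_P1_2_def)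
      define orb :: "2^2 \<Rightarrow> (perm3 \<times> perm3 \<Rightarrow>\<^sub>0 'k)" where
        "orb u = (\<Sum>z\<in>UNIV. Poly_Mapping.single (coord (tpow z) u) 1)" for u
      define pt where "pt l = (THE u. u \<noteq> 0 \<and> l = line u)" for l
      have pt: "pt (line u) = u" if "u \<noteq> 0" for u
        unfolding pt_def using that line_inj by (intro the_equality) auto
      define v where "v = lin_ext (\<lambda>l. orb (pt l)) q"
      have orb_keys: "Poly_Mapping.keys (orb u) \<subseteq> O2" if "u \<noteq> 0" for u
      proof -
        have "Poly_Mapping.keys (Poly_Mapping.single (coord (tpow z) u) (1::'k)) \<subseteq> O2" for z
          unfolding O2_eq using that by auto
        then show ?thesis
          unfolding orb_def using keys_sum[of "\<lambda>z. Poly_Mapping.single (coord (tpow z) u) (1::'k)" UNIV] by blast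
      qed
      have pl: "\<exists>u. u \<noteq> 0 \<and> l = line u" if "l \<in> proj_line" for l using that unfolding proj_line_eq by blast
      have vk: "Poly_Mapping.keys v \<subseteq> O2"
        unfolding v_def
      proof (rule lin_ext_keys[OF q])
        fix l :: "(2^2) set" assume "l \<in> proj_line"
        then show "Poly_Mapping.keys (orb (pt l)) \<subseteq> O2" using pl pt orb_keys by metis
      qed
      have orb_conj: "basis_map (conj_pair (dih b y)) (orb u) = orb u" for b y u
      proof -
        have "bij (\<lambda>z. y + y + (if b then - z else z))"
          by (rule o_bij[where g = "\<lambda>z. if b then y + y - z else z - y - y"]) (auto simp: fun_eq_iff)
        then have "(\<Sum>z\<in>UNIV. Poly_Mapping.single (coord (tpow (y + y + (if b then - z else z))) u) (1::'k))
            = (\<Sum>z\<in>UNIV. Poly_Mapping.single (coord (tpow z) u) 1)"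
          by (rule sum.reindex_bij_betw)
        then show ?thesis unfolding orb_def basis_map_sum basis_map_simps conj_coord_tpow .
      qed
      have "basis_map (conj_pair (dih b y)) v = v" for b y
        unfolding v_def basis_map_def[of "conj_pair (dih b y)"] lin_ext_lin_ext
        by (rule lin_ext_cong) (simp add: basis_map_def[symmetric] orb_conj)
      then have inv: "v \<in> ?I"
        using vk by (auto simp: invariants_def M1_eq elim!: S3_cases)
      have "line_map (orb u) = Poly_Mapping.single (line u) 1" if "u \<noteq> 0" for u
      proof -
        have "line_map (orb u) = (\<Sum>z\<in>UNIV. line_map (Poly_Mapping.single (coord (tpow z) u) 1))"
          by (simp add: line_map_def orb_def lin_ext_sum)
        also have "\<dots> = (\<Sum>z\<in>(UNIV :: 3 set). if z = 0 then Poly_Mapping.single (line u) 1 else 0)"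
          by (simp add: line_map_single[OF that])
        finally show ?thesis by simp
      qed
      then have "line_map (orb (pt l)) = Poly_Mapping.single l 1" if "l \<in> proj_line" for l
        using pl[OF that] pt by metis
      then have "line_map v = lin_ext (\<lambda>l. Poly_Mapping.single l 1) q"
        unfolding v_def line_map_def lin_ext_lin_ext using q by (intro lin_ext_cong) (auto simp: line_map_def)
      then have "line_map v = q" by simp
      then show "q \<in> line_map ` ?I" using inv by blast
    qed
  qed
qed

lemma line_map_sl_act:
  assumes A: "A \<in> SL2Z" and v: "Poly_Mapping.keys v \<subseteq> O2"
  shows "line_map (sl_act A v) = basis_map (image (vec_act A)) (line_map v)"
  using v
proof (induction v rule: free_induct)
  case zero
  then show ?case by (simp add: line_map_def sl_act_def)
next
  case (step p c v)
  obtain z u where u: "u \<noteq> 0" "p = coord (tpow z) u" using step(1) unfolding O2_eq by blast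
  have "line_map (sl_act A (Poly_Mapping.single p c)) = basis_map (image (vec_act A)) (line_map (Poly_Mapping.single p c))"
    unfolding u(2) sl_act_def basis_map_simps mat_act_tpow[OF A] line_map_single[OF u(1)]
      line_map_single[OF vec_act_nonzero[OF A u(1)]]
    using line_image[of A u] by simp
  moreover have "line_map (x + y) = line_map x + line_map y" for x y :: "perm3 \<times> perm3 \<Rightarrow>\<^sub>0 'a"
    by (simp add: line_map_def)
  moreover have "sl_act A (x + y) = sl_act A x + sl_act A y" for x y :: "perm3 \<times> perm3 \<Rightarrow>\<^sub>0 'a"
    by (simp add: sl_act_def)
  ultimately show ?case using step(3) by simp
qed

lemma sl_act_O2:
  assumes "A \<in> SL2Z" shows "coeff_map S3 (M1 TYPE('k::field) O2) (M1 TYPE('k) O2) (sl_act A)"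
  unfolding sl_act_def
proof (rule O2.coeff_map_basis)
  fix p assume "p \<in> O2"
  then obtain y u where u: "u \<noteq> 0" "p = coord (tpow y) u" unfolding O2_eq by blast
  show "mat_act (matrix_inv (transpose A)) p \<in> O2"
    unfolding u(2) mat_act_tpow[OF assms] O2_eq using vec_act_nonzero[OF assms u(1)] by blast
  show "mat_act (matrix_inv (transpose A)) (conj_pair (dih b z) p)
      = conj_pair (dih b z) (mat_act (matrix_inv (transpose A)) p)" for b z
    unfolding u(2) mat_act_tpow[OF assms] conj_coord_tpow ..
qed

lemma H0_O2_iso:
  "\<exists>\<phi>. lin_iso (H0_M1 TYPE('k::field) O2) K_P1_2 \<phi> \<and> equivariant SL2Z (H0_M1 TYPE('k) O2) K_P1_2 \<phi>"
proof -
  interpret coeff S3 "M1 TYPE('k) O2" by (rule O2.coeff_M1)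
  let ?\<phi> = "\<lambda>X. line_map (eval0 S3 X) :: (2^2) set \<Rightarrow>\<^sub>0 'k"
  have "bij_betw ?\<phi> (carrier (Ext S3 (M1 TYPE('k) O2) 0)) (carrier K_P1_2)"
    using bij_betw_trans[OF eval0_bij line_map_iso] by (simp add: comp_def)
  moreover have "vlin (H0_M1 TYPE('k) O2) K_P1_2 ?\<phi>"
  proof (rule vlinI)
    fix X assume X: "X \<in> carrier (H0_M1 TYPE('k) O2)"
    then have X': "X \<in> carrier (Ext S3 (M1 TYPE('k) O2) 0)" by (simp add: H0_M1_def)
    show "?\<phi> X \<in> carrier K_P1_2" using calculation X' by (auto simp: bij_betw_def)
    show "?\<phi> (c \<odot>\<^bsub>H0_M1 TYPE('k) O2\<^esub> X) = c \<odot>\<^bsub>K_P1_2\<^esub> ?\<phi> X" for c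
      using vlin_smult[OF eval0_linear X', of c] by (simp add: H0_M1_def K_P1_2_def M1_eq line_map_def)
    fix Y assume Y: "Y \<in> carrier (H0_M1 TYPE('k) O2)"
    then have Y': "Y \<in> carrier (Ext S3 (M1 TYPE('k) O2) 0)" by (simp add: H0_M1_def)
    show "?\<phi> (X \<oplus>\<^bsub>H0_M1 TYPE('k) O2\<^esub> Y) = ?\<phi> X \<oplus>\<^bsub>K_P1_2\<^esub> ?\<phi> Y"
      using vlin_add[OF eval0_linear X' Y'] by (simp add: H0_M1_def K_P1_2_def M1_eq line_map_def)
  qed
  moreover have "equivariant SL2Z (H0_M1 TYPE('k) O2) K_P1_2 ?\<phi>"
    unfolding equivariant_def
  proof (intro ballI)
    fix A X assume A: "A \<in> SL2Z" and "X \<in> carrier (H0_M1 TYPE('k) O2)"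
    then have X: "X \<in> carrier (Ext S3 (M1 TYPE('k) O2) 0)" by (simp add: H0_M1_def)
    have "Poly_Mapping.keys (eval0 S3 X) \<subseteq> O2" using vlin_closed[OF eval0_linear X] by (simp add: M1_eq)
    then show "?\<phi> (gact (H0_M1 TYPE('k) O2) A X) = gact K_P1_2 A (?\<phi> X)"
      using coeff_map.eval0_push[OF sl_act_O2[OF A] X] line_map_sl_act[OF A]
      by (simp add: H0_M1_def K_P1_2_def ext_map_eq_push)
  qed
  ultimately show ?thesis by (auto simp: lin_iso_alt H0_M1_def)
qed

section \<open>Pairs generating the alternating group\<close>

lemma finsum_eq_sum:
  fixes V :: "('k::field, 'u::ab_group_add, 'x) module_scheme"
  assumes V: "vspace V" "add V = (+)" "zero V = 0"
    and f: "\<And>i. i \<in> I \<Longrightarrow> f i \<in> carrier V" and I: "finite I"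
  shows "(\<Oplus>\<^bsub>V\<^esub>i\<in>I. f i) = (\<Sum>i\<in>I. f i)"
proof -
  interpret V: vspace V by fact
  from I f show ?thesis
  proof (induction I rule: finite_induct)
    case (insert i I)
    then show ?case using V(2) by (subst V.finsum_insert) auto
  qed (simp add: V(3))
qed

text \<open>Representatives of the nonzero vectors of \<open>\<int>\<^sub>3\<^sup>2\<close> up to sign.\<close>

definition rep :: "nat \<Rightarrow> 3^2" where
  "rep i = (\<chi> j. if j = 1 then (if i = 1 then 0 else 1) else (if i = 0 then 0 else if i = 3 then 2 else 1))"

lemma rep_components:
  "rep i $ 1 = (if i = 1 then 0 else 1)"
  "rep i $ 2 = (if i = 0 then 0 else if i = 3 then 2 else 1)"
  by (simp_all add: rep_def)

lemma less_4_cases: assumes "i < (4::nat)" obtains "i = 0" | "i = 1" | "i = 2" | "i = 3"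
  using assms by linarith

lemma rep_nonzero: "rep i \<noteq> 0" "- rep i \<noteq> 0"
  by (simp_all add: vec2_nonzero_iff rep_components)

lemma rep_eq_iff: "\<lbrakk>i < 4; j < 4\<rbrakk> \<Longrightarrow> rep i = rep j \<longleftrightarrow> i = j"
  by (elim less_4_cases) (simp_all add: vec_eq_iff forall_2 rep_components)

lemma rep_neq_minus: "\<lbrakk>i < 4; j < 4\<rbrakk> \<Longrightarrow> rep i \<noteq> - rep j"
  by (elim less_4_cases) (simp_all add: vec_eq_iff forall_2 rep_components)

lemma rep_exists:
  assumes "u \<noteq> 0" shows "\<exists>i<4. u = rep i \<or> u = - rep i"
proof -
  have "\<exists>i\<in>{0,1,2,3}. u = rep i \<or> u = - rep i"
    using assms
    by (cases "u $ 1" rule: z3_cases; cases "u $ 2" rule: z3_cases)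
      (simp_all add: vec_eq_iff forall_2 rep_components)
  then show ?thesis by force
qed

lemma rep_sum:
  fixes \<eta> :: "3^2 \<Rightarrow> 'a" and v :: "'a \<Rightarrow>\<^sub>0 'k::field"
  assumes inj: "inj \<eta>" and v: "Poly_Mapping.keys v \<subseteq> \<eta> ` (UNIV - {0})"
  shows "(\<Sum>i<4. Poly_Mapping.single (\<eta> (rep i)) (Poly_Mapping.lookup v (\<eta> (rep i)))
      + Poly_Mapping.single (\<eta> (- rep i)) (Poly_Mapping.lookup v (\<eta> (- rep i)))) = v" (is "?S = v")
proof (rule poly_mapping_eqI)
  fix p
  have L: "Poly_Mapping.lookup ?S p = (\<Sum>i<4. (if \<eta> (rep i) = p then Poly_Mapping.lookup v p else 0)
      + (if \<eta> (- rep i) = p then Poly_Mapping.lookup v p else 0))"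
    unfolding lookup_sum lookup_add by (intro sum.cong) (auto simp: lookup_single when_def)
  show "Poly_Mapping.lookup ?S p = Poly_Mapping.lookup v p"
  proof (cases "p \<in> \<eta> ` (UNIV - {0})")
    case False
    have "\<eta> (rep i) \<noteq> p" "\<eta> (- rep i) \<noteq> p" for i using False rep_nonzero[of i] by blast+
    then show ?thesis using False v unfolding L by (auto simp: in_keys_iff)
  next
    case True
    then obtain u where u: "u \<noteq> 0" "p = \<eta> u" by blast
    obtain j where j: "j < 4" "u = rep j \<or> u = - rep j" using rep_exists[OF u(1)] by blast
    have e: "\<eta> x = p \<longleftrightarrow> x = u" for x using inj u(2) by (auto dest: injD)
    have "(if \<eta> (rep i) = p then Poly_Mapping.lookup v p else 0) + (if \<eta> (- rep i) = p then Poly_Mapping.lookup v p else 0)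
        = (if i = j then Poly_Mapping.lookup v p else 0)" if i: "i < 4" for i
      using j(2)
    proof
      assume "u = rep j"
      then show ?thesis using rep_eq_iff[OF i j(1)] rep_neq_minus[OF j(1) i] unfolding e by auto
    next
      assume "u = - rep j"
      then show ?thesis using rep_eq_iff[OF i j(1)] rep_neq_minus[OF i j(1)] unfolding e by auto
    qed
    then have "Poly_Mapping.lookup ?S p = (\<Sum>i<4. if i = j then Poly_Mapping.lookup v p else 0)"
      unfolding L by (intro sum.cong) auto
    also have "\<dots> = Poly_Mapping.lookup v p" using j(1) by simp
    finally show ?thesis .
  qed
qed

text \<open>
  The two characters of \<open>\<int>\<^sub>3\<^sup>\<times>\<close> are treated together: \<open>\<epsilon>\<close> is the value of the character
  at \<open>-1\<close>, and the corresponding one-dimensional representation of \<open>S\<^sub>3\<close> is the one on which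
  the odd permutations act as \<open>\<epsilon>\<close>.
\<close>

definition eps_vectors :: "'k::field \<Rightarrow> (3^2 \<Rightarrow>\<^sub>0 'k) set" where
  "eps_vectors \<epsilon> = {w. Poly_Mapping.keys w \<subseteq> UNIV - {0} \<and> basis_map uminus w = pm_scale \<epsilon> w}"

definition eps_basis :: "'k::field \<Rightarrow> nat \<Rightarrow> (3^2 \<Rightarrow>\<^sub>0 'k)" where
  "eps_basis \<epsilon> i = Poly_Mapping.single (rep i) 1 + Poly_Mapping.single (- rep i) \<epsilon>"

definition eps_incl :: "(3^2 \<Rightarrow>\<^sub>0 'k::field) \<Rightarrow> 'k \<Rightarrow> (perm3 \<times> perm3 \<Rightarrow>\<^sub>0 'k)" where
  "eps_incl w c = pm_scale c (basis_map (coord (dih False)) w)"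

definition eps_proj :: "'k::field \<Rightarrow> nat \<Rightarrow> (perm3 \<times> perm3 \<Rightarrow>\<^sub>0 'k) \<Rightarrow> 'k" where
  "eps_proj \<epsilon> i v = inverse 2 * (Poly_Mapping.lookup v (coord (dih False) (rep i))
     + \<epsilon> * Poly_Mapping.lookup v (coord (dih False) (- rep i)))"

lemma eps_vectors_minus:
  "w \<in> eps_vectors \<epsilon> \<Longrightarrow> Poly_Mapping.lookup w (- x) = \<epsilon> * Poly_Mapping.lookup w x"
  using lookup_basis_map[of uminus UNIV "- x" w] by (simp add: eps_vectors_def)

lemma K_chi_carrier:
  "carrier (K_chi chi1) = eps_vectors (1 :: 'k::field)" "carrier (K_chi chi2) = eps_vectors (-1 :: 'k)"
proof -
  have one: "basis_map (\<lambda>x. 1 *s x) w = w" for w :: "3^2 \<Rightarrow>\<^sub>0 'k" by (rule basis_map_ident) simp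
  have m: "(\<lambda>x::3^2. - 1 *s x) = uminus" by (auto simp: fun_eq_iff vec_eq_iff)
  have c: "chi1 1 = (1::'k)" "chi1 (- 1) = (1::'k)" "chi2 1 = (1::'k)" "chi2 (- 1) = (-1::'k)"
    by (simp_all add: chi1_def chi2_def)
  show "carrier (K_chi chi1) = eps_vectors (1 :: 'k::field)" "carrier (K_chi chi2) = eps_vectors (-1 :: 'k)"
    unfolding K_chi_def eps_vectors_def units3_def by (simp_all add: one m c)
qed

lemma K_chi_simps [simp]:
  "add (K_chi \<eta>) = (+)" "zero (K_chi \<eta>) = 0" "smult (K_chi \<eta>) = pm_scale"
  "gact (K_chi \<eta>) = (\<lambda>A. basis_map (vec_act A))"
  by (simp_all add: K_chi_def)

lemma eps_vectors_subspace:
  "0 \<in> eps_vectors \<epsilon>" "\<lbrakk>v \<in> eps_vectors \<epsilon>; w \<in> eps_vectors \<epsilon>\<rbrakk> \<Longrightarrow> v + w \<in> eps_vectors \<epsilon>"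
  "w \<in> eps_vectors \<epsilon> \<Longrightarrow> pm_scale c w \<in> eps_vectors \<epsilon>"
  using keys_add[of v w] keys_pm_scale[of c w]
  by (auto simp: eps_vectors_def mult.commute)

lemma vspace_K_chi:
  assumes "carrier (K_chi \<eta>) = eps_vectors (\<epsilon> :: 'k::field)" shows "vspace (K_chi \<eta> :: ('k, _, _) gmodule)"
  by (rule vspaceI) (simp_all add: assms eps_vectors_subspace pm_scale_add_left add_ac)

lemma eps_vectors_act:
  assumes A: "A \<in> SL2Z" and w: "w \<in> eps_vectors \<epsilon>"
  shows "basis_map (vec_act A) w \<in> eps_vectors \<epsilon>"
proof -
  have "Poly_Mapping.keys (basis_map (vec_act A) w) \<subseteq> UNIV - {0}"
    using w vec_act_nonzero[OF A] by (intro basis_map_keys[of w "UNIV - {0}"]) (auto simp: eps_vectors_def)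
  moreover have "basis_map uminus (basis_map (vec_act A) w) = basis_map (vec_act A) (basis_map uminus w)"
    by (simp add: basis_map_comp vec_act_minus)
  ultimately show ?thesis using w by (simp add: eps_vectors_def)
qed

lemma eps_basis_in: "\<epsilon> * \<epsilon> = 1 \<Longrightarrow> eps_basis \<epsilon> i \<in> eps_vectors \<epsilon>"
  using keys_add[of "Poly_Mapping.single (rep i) 1" "Poly_Mapping.single (- rep i) \<epsilon>"] rep_nonzero[of i]
  by (auto simp: eps_vectors_def eps_basis_def add.commute split: if_splits)

lemma eps_basis_span:
  fixes w :: "3^2 \<Rightarrow>\<^sub>0 'k::field"
  assumes "w \<in> eps_vectors \<epsilon>"
  shows "w = (\<Sum>i<4. pm_scale (Poly_Mapping.lookup w (rep i)) (eps_basis \<epsilon> i))"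
proof -
  have "Poly_Mapping.keys w \<subseteq> id ` (UNIV - {0})" using assms by (simp add: eps_vectors_def)
  from rep_sum[OF inj_on_id this] show ?thesis
    using eps_vectors_minus[OF assms] by (simp add: eps_basis_def mult.commute)
qed

locale eps_module = coeff S3 N for N :: "('k::field, 'k, perm3) gmodule" +
  fixes \<epsilon> :: 'k
  assumes N: "carrier N = UNIV" "add N = (+)" "zero N = 0" "smult N = (*)"
    and gact_dih: "\<And>b z c. gact N (dih b z) c = (if b then \<epsilon> * c else c)"
    and eps: "\<epsilon> * \<epsilon> = 1"
begin

lemma eps_incl_map:
  assumes w: "w \<in> eps_vectors \<epsilon>"
  shows "coeff_map S3 N (M1 TYPE('k) O3) (eps_incl w)"
proof -
  have k: "Poly_Mapping.keys (basis_map (coord (dih False)) w) \<subseteq> O3"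
    using w by (intro basis_map_keys[of w "UNIV - {0}"]) (auto simp: eps_vectors_def O3_eq)
  have "basis_map (conj_pair (dih b z)) (basis_map (coord (dih False)) w)
      = pm_scale (if b then \<epsilon> else 1) (basis_map (coord (dih False)) w)" for b z
  proof (cases b)
    case True
    have "basis_map (conj_pair (dih b z)) (basis_map (coord (dih False)) w)
        = basis_map (coord (dih False)) (basis_map uminus w)"
      unfolding basis_map_comp conj_coord_rot using True by simp
    then show ?thesis using w True by (simp add: eps_vectors_def)
  next
    case False
    then show ?thesis unfolding basis_map_comp conj_coord_rot by simp
  qed
  then have "eps_incl w (gact N (dih b z) c) = basis_map (conj_pair (dih b z)) (eps_incl w c)" for b z c
    unfolding eps_incl_def basis_map_simps gact_dih by (simp add: mult.commute)
  then have "equivariant (carrier S3) N (M1 TYPE('k) O3) (eps_incl w)"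
    unfolding equivariant_def M1_eq perm_mod_simps by (metis S3_cases)
  moreover have "vlin N (M1 TYPE('k) O3) (eps_incl w)"
    using k keys_pm_scale[of _ "basis_map (coord (dih False)) w"]
    by (intro vlinI) (auto simp: N M1_eq eps_incl_def pm_scale_add_left)
  ultimately show ?thesis
    using coeff_axioms O3.coeff_M1 by (simp add: coeff_map_def coeff_map_axioms_def gmap_def)
qed

lemma eps_proj_map: "coeff_map S3 (M1 TYPE('k) O3) N (eps_proj \<epsilon> i)"
proof -
  have l: "Poly_Mapping.lookup (basis_map (conj_pair (dih b z)) v) (coord (dih False) u)
      = Poly_Mapping.lookup v (coord (dih False) (if b then - u else u))"
    if v: "Poly_Mapping.keys v \<subseteq> O3" and u: "u \<noteq> 0" for b z u and v :: "perm3 \<times> perm3 \<Rightarrow>\<^sub>0 'k"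
  proof -
    have "coord (dih False) (if b then - u else u) \<in> O3" using u by (auto simp: O3_eq)
    from lookup_basis_map[OF O3.inj_conj[OF dih_closed] this v, of b z]
    show ?thesis unfolding conj_coord_rot by (cases b) simp_all
  qed
  have dih: "eps_proj \<epsilon> i (basis_map (conj_pair (dih b z)) v) = gact N (dih b z) (eps_proj \<epsilon> i v)"
    if v: "Poly_Mapping.keys v \<subseteq> O3" for b z v
  proof -
    let ?A = "Poly_Mapping.lookup v (coord (dih False) (rep i))"
      and ?B = "Poly_Mapping.lookup v (coord (dih False) (- rep i))"
    have "\<epsilon> * (\<epsilon> * y) = y" for y using eps by (simp only: mult.assoc[symmetric] mult_1_left)
    then have e: "inverse 2 * (?B + \<epsilon> * ?A) = \<epsilon> * (inverse 2 * (?A + \<epsilon> * ?B))"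
      by (simp only: mult.left_commute[of \<epsilon> "inverse 2"] distrib_left[of \<epsilon>] add.commute)
    show ?thesis
    proof (cases b)
      case True
      then show ?thesis
        unfolding eps_proj_def gact_dih l[OF v rep_nonzero(1)] l[OF v rep_nonzero(2)] using e by simp
    next
      case False
      then show ?thesis
        unfolding eps_proj_def gact_dih l[OF v rep_nonzero(1)] l[OF v rep_nonzero(2)] by simp
    qed
  qed
  have "equivariant (carrier S3) (M1 TYPE('k) O3) N (eps_proj \<epsilon> i)"
    unfolding equivariant_def M1_eq perm_mod_simps
  proof (intro ballI)
    fix g and v :: "perm3 \<times> perm3 \<Rightarrow>\<^sub>0 'k"
    assume g: "g \<in> carrier S3" and "v \<in> {v. Poly_Mapping.keys v \<subseteq> O3}"
    then have v: "Poly_Mapping.keys v \<subseteq> O3" by simp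
    obtain b z where "g = dih b z" using S3_cases[OF g] .
    then show "eps_proj \<epsilon> i (basis_map (conj_pair g) v) = gact N g (eps_proj \<epsilon> i v)"
      by (simp only: dih[OF v])
  qed
  moreover have "vlin (M1 TYPE('k) O3) N (eps_proj \<epsilon> i)"
    by (intro vlinI) (auto simp: N M1_eq eps_proj_def lookup_add algebra_simps)
  ultimately show ?thesis
    using coeff_axioms O3.coeff_M1 by (simp add: coeff_map_def coeff_map_axioms_def gmap_def)
qed

end

lemma lookup_eps_incl:
  "Poly_Mapping.lookup (eps_incl w c) (coord (dih False) x) = c * Poly_Mapping.lookup w x"
  using lookup_basis_map[of "coord (dih False)" UNIV x w] by (simp add: eps_incl_def inj_def coord_rot_inj)

lemma lookup_eps_basis:
  assumes "i < 4" "j < 4"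
  shows "Poly_Mapping.lookup (eps_basis \<delta> j) (rep i) = (if i = j then 1 else 0)"
    "Poly_Mapping.lookup (eps_basis \<delta> j) (- rep i) = (if i = j then \<delta> else 0)"
  using rep_eq_iff[OF assms] rep_eq_iff[OF assms(2,1)] rep_neq_minus[OF assms] rep_neq_minus[OF assms(2,1)]
  by (auto simp: eps_basis_def lookup_add lookup_single when_def)

lemma eps_proj_incl:
  assumes "i < 4" "j < 4"
  shows "eps_proj \<epsilon> i (eps_incl (eps_basis \<delta> j) c) = (if i = j then inverse 2 * (1 + \<epsilon> * \<delta>) * c else 0)"
  unfolding eps_proj_def lookup_eps_incl lookup_eps_basis[OF assms] by (simp add: algebra_simps)

text \<open>
  This is the splitting of a function on the nonzero vectors into its even and odd parts.
\<close>

lemma eps_incl_proj: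
  assumes "(2::'k::field) \<noteq> 0" and v: "Poly_Mapping.keys v \<subseteq> O3"
  shows "(\<Sum>i<4. eps_incl (eps_basis 1 i) (eps_proj 1 i v)) + (\<Sum>i<4. eps_incl (eps_basis (-1) i) (eps_proj (-1) i v))
    = (v :: perm3 \<times> perm3 \<Rightarrow>\<^sub>0 'k)"
proof -
  let ?e = "coord (dih False)"
  have half: "inverse 2 * (a + b) + inverse 2 * (a - b) = a" "inverse 2 * (a + b) - inverse 2 * (a - b) = b" for a b :: 'k
  proof -
    have h: "inverse 2 * (2 * c) = c" for c :: 'k using assms(1) by (simp flip: mult.assoc)
    have "(a + b) + (a - b) = 2 * a" "(a + b) - (a - b) = 2 * b" by simp_all
    then show "inverse 2 * (a + b) + inverse 2 * (a - b) = a" "inverse 2 * (a + b) - inverse 2 * (a - b) = b"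
      by (simp_all only: distrib_left[symmetric] right_diff_distrib[symmetric] h)
  qed
  have "eps_incl (eps_basis 1 i) (eps_proj 1 i v) + eps_incl (eps_basis (-1) i) (eps_proj (-1) i v)
      = Poly_Mapping.single (?e (rep i)) (Poly_Mapping.lookup v (?e (rep i)))
        + Poly_Mapping.single (?e (- rep i)) (Poly_Mapping.lookup v (?e (- rep i)))" for i
  proof -
    let ?a = "Poly_Mapping.lookup v (?e (rep i))" and ?b = "Poly_Mapping.lookup v (?e (- rep i))"
    have "eps_incl (eps_basis \<delta> i) c = Poly_Mapping.single (?e (rep i)) c + Poly_Mapping.single (?e (- rep i)) (\<delta> * c)" for \<delta> c :: 'k
      by (simp add: eps_incl_def eps_basis_def mult.commute)
    moreover have "(Poly_Mapping.single p c + Poly_Mapping.single q (1 * c)) + (Poly_Mapping.single p d + Poly_Mapping.single q (-1 * d))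
        = Poly_Mapping.single p (c + d) + Poly_Mapping.single q (c - d)"
      for p q :: "perm3 \<times> perm3" and c d :: 'k
      by (simp add: single_add single_diff single_uminus)
    moreover have "eps_proj 1 i v + eps_proj (-1) i v = ?a" "eps_proj 1 i v - eps_proj (-1) i v = ?b"
      unfolding eps_proj_def by (simp_all only: mult_1_left mult_minus1 add_uminus_conv_diff half)
    ultimately show ?thesis by (simp only:)
  qed
  then show ?thesis
    unfolding sum.distrib[symmetric] using rep_sum[of ?e v] v by (simp add: O3_eq inj_def coord_rot_inj)
qed

lemma eps_incl_sl_act:
  "A \<in> SL2Z \<Longrightarrow> sl_act A (eps_incl w c) = eps_incl (basis_map (vec_act A) w) c"
  by (simp add: sl_act_def eps_incl_def basis_map_comp mat_act_rot)

lemma sign_mod_simps [simp]: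
  "carrier (sign_mod T) = UNIV" "add (sign_mod T) = (+)" "zero (sign_mod T) = 0"
  "smult (sign_mod T) = (*)" "gact (sign_mod T) p v = of_int (sign p) * v"
  by (simp_all add: sign_mod_def)

lemma coeff_sign: "coeff S3 (sign_mod TYPE('k::field))"
proof -
  have "sign (\<one>\<^bsub>S3\<^esub>) = 1" by (simp add: dih_one sign_dih)
  moreover have "sign (g \<otimes>\<^bsub>S3\<^esub> h) = sign g * sign h" if gc: "g \<in> carrier S3" and hc: "h \<in> carrier S3" for g h
  proof -
    obtain a x where g: "g = dih a x" using S3_cases[OF gc] .
    obtain b y where h: "h = dih b y" using S3_cases[OF hc] .
    show ?thesis by (cases a; cases b) (simp_all add: g h dih_mult sign_dih)
  qed
  ultimately show ?thesis
    by (auto simp: coeff_def gmod_def gmod_axioms_def S3.group_axioms algebra_simps intro!: vspaceI)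
qed

lemma eps_module_triv: "eps_module (triv_mod TYPE('k::field)) 1"
  by (intro eps_module.intro S3.coeff_triv eps_module_axioms.intro) simp_all

lemma eps_module_sign: "eps_module (sign_mod TYPE('k::field)) (-1)"
  by (intro eps_module.intro coeff_sign eps_module_axioms.intro) (simp_all add: sign_dih)

lemma O3_tensor_decomposition:
  assumes two: "(2::'k::field) \<noteq> 0"
  shows "two_tensor_decomposition S3 (M1 TYPE('k) O3) (triv_mod TYPE('k)) (sign_mod TYPE('k)) 4 4
    (K_chi chi1) (K_chi chi2) eps_incl eps_incl (eps_basis 1) (eps_basis (-1))
    (case_sum (eps_proj 1) (eps_proj (-1))) sl_act SL2Z"
proof -
  interpret K: eps_module "triv_mod TYPE('k)" 1 by (rule eps_module_triv)
  interpret E: eps_module "sign_mod TYPE('k)" "-1" by (rule eps_module_sign)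
  interpret M: coeff S3 "M1 TYPE('k) O3" by (rule O3.coeff_M1)
  have W: "vspace (K_chi chi1 :: ('k, _, _) gmodule)" "vspace (K_chi chi2 :: ('k, _, _) gmodule)"
    using vspace_K_chi K_chi_carrier by blast+
  have b: "eps_basis 1 i \<in> eps_vectors (1::'k)" "eps_basis (-1) i \<in> eps_vectors (-1::'k)" for i
    by (rule eps_basis_in; simp)+
  have span1: "\<exists>a. y = (\<Oplus>\<^bsub>K_chi chi1\<^esub>i\<in>{..<4}. a i \<odot>\<^bsub>K_chi chi1\<^esub> eps_basis 1 i)"
    if y: "y \<in> carrier (K_chi chi1 :: ('k, _, _) gmodule)" for y
  proof -
    have "(\<Oplus>\<^bsub>K_chi chi1\<^esub>i\<in>{..<4}. Poly_Mapping.lookup y (rep i) \<odot>\<^bsub>K_chi chi1\<^esub> eps_basis 1 i)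
        = (\<Sum>i<4. pm_scale (Poly_Mapping.lookup y (rep i)) (eps_basis 1 i))"
      by (subst finsum_eq_sum[OF W(1)]) (simp_all add: K_chi_carrier eps_vectors_subspace b)
    moreover have "y \<in> eps_vectors 1" using y by (simp only: K_chi_carrier)
    ultimately show ?thesis using eps_basis_span[of y 1] by (intro exI[of _ "\<lambda>i. Poly_Mapping.lookup y (rep i)"]) (simp only:)
  qed
  have span2: "\<exists>a. y = (\<Oplus>\<^bsub>K_chi chi2\<^esub>i\<in>{..<4}. a i \<odot>\<^bsub>K_chi chi2\<^esub> eps_basis (-1) i)"
    if y: "y \<in> carrier (K_chi chi2 :: ('k, _, _) gmodule)" for y
  proof -
    have "(\<Oplus>\<^bsub>K_chi chi2\<^esub>i\<in>{..<4}. Poly_Mapping.lookup y (rep i) \<odot>\<^bsub>K_chi chi2\<^esub> eps_basis (-1) i)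
        = (\<Sum>i<4. pm_scale (Poly_Mapping.lookup y (rep i)) (eps_basis (-1) i))"
      by (subst finsum_eq_sum[OF W(2)]) (simp_all add: K_chi_carrier eps_vectors_subspace b)
    moreover have "y \<in> eps_vectors (-1)" using y by (simp only: K_chi_carrier)
    ultimately show ?thesis using eps_basis_span[of y "-1"] by (intro exI[of _ "\<lambda>i. Poly_Mapping.lookup y (rep i)"]) (simp only:)
  qed
  have dec: "coeff_decomposition S3 (M1 TYPE('k) O3) (Sum_Type.Plus {..<4} {..<4})
    (case_sum (\<lambda>_::nat. triv_mod TYPE('k)) (\<lambda>_::nat. sign_mod TYPE('k)))
    (case_sum (\<lambda>i. eps_incl (eps_basis 1 i)) (\<lambda>i. eps_incl (eps_basis (-1) i)))
    (case_sum (eps_proj 1) (eps_proj (-1)))"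
  proof (intro coeff_decomposition.intro coeff_decomposition_axioms.intro M.coeff_axioms)
    fix i :: "nat + nat" assume i: "i \<in> Sum_Type.Plus {..<4} {..<4}"
    show "coeff_map S3 (case_sum (\<lambda>_::nat. triv_mod TYPE('k)) (\<lambda>_::nat. sign_mod TYPE('k)) i) (M1 TYPE('k) O3)
        (case_sum (\<lambda>i. eps_incl (eps_basis 1 i)) (\<lambda>i. eps_incl (eps_basis (-1) i)) i)"
      using K.eps_incl_map[OF b(1)] E.eps_incl_map[OF b(2)] by (simp split: sum.split)
    show "coeff_map S3 (M1 TYPE('k) O3) (case_sum (\<lambda>_::nat. triv_mod TYPE('k)) (\<lambda>_::nat. sign_mod TYPE('k)) i)
        (case_sum (eps_proj 1) (eps_proj (-1)) i)"
      using K.eps_proj_map E.eps_proj_map by (simp split: sum.split)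
    fix j :: "nat + nat" and w :: 'k assume j: "j \<in> Sum_Type.Plus {..<4} {..<4}"
    show "case_sum (eps_proj 1) (eps_proj (-1)) i (case_sum (\<lambda>i. eps_incl (eps_basis 1 i)) (\<lambda>i. eps_incl (eps_basis (-1) i)) j w)
        = (if i = j then w else \<zero>\<^bsub>case_sum (\<lambda>_::nat. triv_mod TYPE('k)) (\<lambda>_::nat. sign_mod TYPE('k)) i\<^esub>)"
      using i j two by (cases i; cases j) (simp_all add: eps_proj_incl)
  next
    fix v assume "v \<in> carrier (M1 TYPE('k) O3)"
    then have v: "Poly_Mapping.keys v \<subseteq> O3" by (simp add: M1_eq)
    have c: "eps_incl (eps_basis 1 i) x \<in> carrier (M1 TYPE('k) O3)" "eps_incl (eps_basis (-1) i) x \<in> carrier (M1 TYPE('k) O3)" for i x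
      using gmap_closed[OF coeff_map.gmap[OF K.eps_incl_map[OF b(1)]]] gmap_closed[OF coeff_map.gmap[OF E.eps_incl_map[OF b(2)]]]
      by simp_all
    have am: "add (M1 TYPE('k) O3) = (+)" "zero (M1 TYPE('k) O3) = 0" by (simp_all add: M1_eq)
    have s: "(\<Oplus>\<^bsub>M1 TYPE('k) O3\<^esub>i\<in>{..<4}. eps_incl (eps_basis 1 i) (eps_proj 1 i v)) = (\<Sum>i<4. eps_incl (eps_basis 1 i) (eps_proj 1 i v))"
      "(\<Oplus>\<^bsub>M1 TYPE('k) O3\<^esub>i\<in>{..<4}. eps_incl (eps_basis (-1) i) (eps_proj (-1) i v)) = (\<Sum>i<4. eps_incl (eps_basis (-1) i) (eps_proj (-1) i v))"
      by (rule finsum_eq_sum[OF M.vspace_axioms am c(1)], simp, rule finsum_eq_sum[OF M.vspace_axioms am c(2)], simp)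
    have "(\<Oplus>\<^bsub>M1 TYPE('k) O3\<^esub>i\<in>Sum_Type.Plus {..<4} {..<4}. case_sum (\<lambda>i. eps_incl (eps_basis 1 i)) (\<lambda>i. eps_incl (eps_basis (-1) i)) i
          (case_sum (eps_proj 1) (eps_proj (-1)) i v))
        = (\<Sum>i<4. eps_incl (eps_basis 1 i) (eps_proj 1 i v)) + (\<Sum>i<4. eps_incl (eps_basis (-1) i) (eps_proj (-1) i v))"
      by (subst M.finsum_Plus) (use c in \<open>auto simp: s am(1) split: sum.split\<close>)
    then show "(\<Oplus>\<^bsub>M1 TYPE('k) O3\<^esub>i\<in>Sum_Type.Plus {..<4} {..<4}. case_sum (\<lambda>i. eps_incl (eps_basis 1 i)) (\<lambda>i. eps_incl (eps_basis (-1) i)) i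
          (case_sum (eps_proj 1) (eps_proj (-1)) i v)) = v"
      using eps_incl_proj[OF two v] by simp
  qed auto
  have act: "vlin (K_chi \<eta>) (K_chi \<eta>) (gact (K_chi \<eta>) g)"
    if "g \<in> SL2Z" "carrier (K_chi \<eta>) = eps_vectors (e :: 'k)" for g \<eta> e
    using eps_vectors_act[OF that(1)] by (intro vlinI) (simp_all add: that(2))
  show ?thesis
  proof (intro two_tensor_decomposition.intro two_tensor_decomposition_axioms.intro dec W)
    show "coeff S3 (triv_mod TYPE('k))" "coeff S3 (sign_mod TYPE('k))" by (rule S3.coeff_triv coeff_sign)+
    show "coeff_map S3 (triv_mod TYPE('k)) (M1 TYPE('k) O3) (eps_incl w)" if "w \<in> carrier (K_chi chi1)" for w
      using K.eps_incl_map that unfolding K_chi_carrier by blast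
    show "coeff_map S3 (sign_mod TYPE('k)) (M1 TYPE('k) O3) (eps_incl w)" if "w \<in> carrier (K_chi chi2)" for w
      using E.eps_incl_map that unfolding K_chi_carrier by blast
    show "vlin (K_chi chi1) (K_chi chi1) (gact (K_chi chi1 :: ('k, _, _) gmodule) g)" if "g \<in> SL2Z" for g
      by (rule act[OF that K_chi_carrier(1)])
    show "vlin (K_chi chi2) (K_chi chi2) (gact (K_chi chi2 :: ('k, _, _) gmodule) g)" if "g \<in> SL2Z" for g
      by (rule act[OF that K_chi_carrier(2)])
    show "coeff_map S3 (M1 TYPE('k) O3) (M1 TYPE('k) O3) (sl_act g)" if "g \<in> SL2Z" for g
      by (rule sl_act_O3[OF that])
    show "eps_basis 1 i \<in> carrier (K_chi chi1 :: ('k, _, _) gmodule)" "eps_basis (-1) i \<in> carrier (K_chi chi2 :: ('k, _, _) gmodule)" for i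
      unfolding K_chi_carrier by (rule b)+
  qed (use span1 span2 eps_incl_sl_act in \<open>simp_all add: eps_incl_def M1_eq pm_scale_add_left mult.commute\<close>)
qed

section \<open>The cohomology of the three summands\<close>

lemma O1_incl_map:
  "coeff_map S3 (triv_mod TYPE('k::field)) (M1 TYPE('k) O1) (Poly_Mapping.single (\<one>\<^bsub>S3\<^esub>, \<one>\<^bsub>S3\<^esub>))"
proof -
  have "conj_pair g (\<one>\<^bsub>S3\<^esub>, \<one>\<^bsub>S3\<^esub>) = (\<one>\<^bsub>S3\<^esub>, \<one>\<^bsub>S3\<^esub>)" if "g \<in> carrier S3" for g
    using O1.conj_closed[OF that, of "(\<one>\<^bsub>S3\<^esub>, \<one>\<^bsub>S3\<^esub>)"] by (simp add: O1_eq)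
  then have "gmap S3 (triv_mod TYPE('k)) (M1 TYPE('k) O1) (Poly_Mapping.single (\<one>\<^bsub>S3\<^esub>, \<one>\<^bsub>S3\<^esub>))"
    unfolding gmap_def equivariant_def M1_eq
    by (intro conjI vlinI ballI) (simp_all add: O1_eq single_add del: split_paired_Ex)
  then show ?thesis
    by (simp add: coeff_map_def coeff_map_axioms_def S3.coeff_triv O1.coeff_M1)
qed

lemma O1_proj_map:
  "coeff_map S3 (M1 TYPE('k::field) O1) (triv_mod TYPE('k)) (\<lambda>v. Poly_Mapping.lookup v (\<one>\<^bsub>S3\<^esub>, \<one>\<^bsub>S3\<^esub>))"
proof -
  let ?p = "(\<one>\<^bsub>S3\<^esub>, \<one>\<^bsub>S3\<^esub>)"
  have "basis_map (conj_pair g) v = v" if g: "g \<in> carrier S3" and v: "Poly_Mapping.keys v \<subseteq> O1"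
    for g and v :: "perm3 \<times> perm3 \<Rightarrow>\<^sub>0 'k"
  proof (rule basis_map_ident)
    fix p assume "p \<in> Poly_Mapping.keys v"
    then have "p \<in> O1" using v by blast
    then show "conj_pair g p = p" using O1.conj_closed[OF g, of p] by (simp only: O1_eq singleton_iff)
  qed
  then have "equivariant (carrier S3) (M1 TYPE('k) O1) (triv_mod TYPE('k)) (\<lambda>v. Poly_Mapping.lookup v ?p)"
    unfolding equivariant_def M1_eq perm_mod_simps triv_mod_simps by simp
  moreover have "vlin (M1 TYPE('k) O1) (triv_mod TYPE('k)) (\<lambda>v. Poly_Mapping.lookup v ?p)"
    unfolding M1_eq by (intro vlinI) (simp_all add: lookup_add)
  ultimately show ?thesis
    by (simp add: coeff_map_def coeff_map_axioms_def gmap_def S3.coeff_triv O1.coeff_M1)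
qed

lemma O1_incl_proj:
  assumes "v \<in> carrier (M1 TYPE('k::field) O1)"
  shows "Poly_Mapping.single (\<one>\<^bsub>S3\<^esub>, \<one>\<^bsub>S3\<^esub>) (Poly_Mapping.lookup v (\<one>\<^bsub>S3\<^esub>, \<one>\<^bsub>S3\<^esub>)) = v"
proof (rule poly_mapping_eqI)
  fix p
  have "Poly_Mapping.keys v \<subseteq> {(\<one>\<^bsub>S3\<^esub>, \<one>\<^bsub>S3\<^esub>)}" using assms unfolding M1_eq perm_mod_simps O1_eq by simp
  then show "Poly_Mapping.lookup (Poly_Mapping.single (\<one>\<^bsub>S3\<^esub>, \<one>\<^bsub>S3\<^esub>) (Poly_Mapping.lookup v (\<one>\<^bsub>S3\<^esub>, \<one>\<^bsub>S3\<^esub>))) p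
      = Poly_Mapping.lookup v p"
    by (cases "p = (\<one>\<^bsub>S3\<^esub>, \<one>\<^bsub>S3\<^esub>)") (auto simp: lookup_single when_def in_keys_iff)
qed

theorem theorem7p13:
  assumes "CHAR('k::alg_closed_field) = 3"
  shows
    "bij_betw (\<lambda>(u, v, w). u + v + w)
       (carrier (M1 TYPE('k) O1) \<times> carrier (M1 TYPE('k) O2) \<times> carrier (M1 TYPE('k) O3))
       (carrier (M1 TYPE('k) Omega1)) \<and>

     (free_of_rank (H_K TYPE('k)) 1 (H_M1 TYPE('k) O1) \<and>
      (\<exists>\<phi>. lin_iso (tensor_fst (H0_M1 TYPE('k) O1) (H_K TYPE('k))) (H_M1 TYPE('k) O1) \<phi> \<and>
         equivariant SL2Z
           (tensor_fst (H0_M1 TYPE('k) O1) (H_K TYPE('k))) (H_M1 TYPE('k) O1) \<phi> \<and>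
         (\<forall>v\<in>carrier (H0_M1 TYPE('k) O1). \<forall>b\<in>carrier (H_K TYPE('k)).
            \<phi> (elem_tensor (H0_M1 TYPE('k) O1) (H_K TYPE('k)) v b)
              = ract (H_M1 TYPE('k) O1) (in_degree S3 (M1 TYPE('k) O1) 0 v) b))) \<and>

     (carrier (H_M1 TYPE('k) O2) = hcomp (H_M1 TYPE('k) O2) 0 \<and>
      (\<exists>\<phi>. lin_iso (H0_M1 TYPE('k) O2) K_P1_2 \<phi> \<and>
         equivariant SL2Z (H0_M1 TYPE('k) O2) K_P1_2 \<phi>) \<and>
      trivial_coh_module S3 (H_M1 TYPE('k) O2)) \<and>

     ((\<exists>\<phi>. lin_iso (H_M1 TYPE('k) O3)
           (dir_sum (dpower (H_K TYPE('k)) 4) (dpower (H_sgn TYPE('k)) 4)) \<phi> \<and>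
         right_linear (carrier (H_K TYPE('k))) (H_M1 TYPE('k) O3)
           (dir_sum (dpower (H_K TYPE('k)) 4) (dpower (H_sgn TYPE('k)) 4)) \<phi>) \<and>
      (\<exists>\<phi>. lin_iso (H_M1 TYPE('k) O3)
           (dir_sum (tensor_snd (H_K TYPE('k)) (K_chi chi1))
                    (tensor_snd (H_sgn TYPE('k)) (K_chi chi2))) \<phi> \<and>
         right_linear (carrier (H_K TYPE('k))) (H_M1 TYPE('k) O3)
           (dir_sum (tensor_snd (H_K TYPE('k)) (K_chi chi1))
                    (tensor_snd (H_sgn TYPE('k)) (K_chi chi2))) \<phi> \<and>
         equivariant SL2Z (H_M1 TYPE('k) O3)
           (dir_sum (tensor_snd (H_K TYPE('k)) (K_chi chi1))
                    (tensor_snd (H_sgn TYPE('k)) (K_chi chi2))) \<phi> \<and>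
         degree_preserving (H_M1 TYPE('k) O3)
           (dir_sum (tensor_snd (H_K TYPE('k)) (K_chi chi1))
                    (tensor_snd (H_sgn TYPE('k)) (K_chi chi2))) \<phi>))"
proof -
  have "of_nat 2 \<noteq> (0::'k)" using assms by (subst of_nat_eq_0_iff_char_dvd) simp
  then have two: "(2::'k) \<noteq> 0" by (simp only: of_nat_numeral) simp
  have KE: "carrier (H_K TYPE('k)) = total_ext_carrier S3 (triv_mod TYPE('k))" by (simp add: H_K_def)
  interpret D: two_tensor_decomposition S3 "M1 TYPE('k) O3" "triv_mod TYPE('k)" "sign_mod TYPE('k)" 4 4
    "K_chi chi1" "K_chi chi2" eps_incl eps_incl "eps_basis 1" "eps_basis (-1)"
    "case_sum (eps_proj 1) (eps_proj (-1))" sl_act SL2Z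
    by (rule O3_tensor_decomposition[OF two])
  note O1_maps = O1_incl_map O1_proj_map lookup_single_eq O1_incl_proj
  have sum: "bij_betw (\<lambda>(u, v, w). u + v + w)
       (carrier (M1 TYPE('k) O1) \<times> carrier (M1 TYPE('k) O2) \<times> carrier (M1 TYPE('k) O3))
       (carrier (M1 TYPE('k) Omega1))"
    unfolding M1_eq perm_mod_simps by (rule sum_decomposition[OF Omega1_partition])
  have free: "free_of_rank (H_K TYPE('k)) 1 (H_M1 TYPE('k) O1)"
    unfolding H_K_def H_M1_def by (rule free_of_rank_one[OF O1_maps])
  have tensor1: "\<exists>\<phi>. lin_iso (tensor_fst (H0_M1 TYPE('k) O1) (H_K TYPE('k))) (H_M1 TYPE('k) O1) \<phi> \<and>
      equivariant SL2Z (tensor_fst (H0_M1 TYPE('k) O1) (H_K TYPE('k))) (H_M1 TYPE('k) O1) \<phi> \<and>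
      (\<forall>v\<in>carrier (H0_M1 TYPE('k) O1). \<forall>b\<in>carrier (H_K TYPE('k)).
         \<phi> (elem_tensor (H0_M1 TYPE('k) O1) (H_K TYPE('k)) v b)
           = ract (H_M1 TYPE('k) O1) (in_degree S3 (M1 TYPE('k) O1) 0 v) b)"
    unfolding H_K_def H_M1_def H0_M1_def by (rule rank_one_tensor_iso[OF O1_maps sl_act_O1])
  note O2 = coeff.trivial_module_of_vanishing[OF O2.coeff_M1 Ext_O2_vanishes[OF two]]
  have deg0: "carrier (H_M1 TYPE('k) O2) = hcomp (H_M1 TYPE('k) O2) 0"
    unfolding H_M1_def by (rule O2(1))
  have triv: "trivial_coh_module S3 (H_M1 TYPE('k) O2)"
    unfolding H_M1_def by (rule O2(2))
  have powers: "\<exists>\<phi>. lin_iso (H_M1 TYPE('k) O3) (dir_sum (dpower (H_K TYPE('k)) 4) (dpower (H_sgn TYPE('k)) 4)) \<phi> \<and>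
      right_linear (carrier (H_K TYPE('k))) (H_M1 TYPE('k) O3)
        (dir_sum (dpower (H_K TYPE('k)) 4) (dpower (H_sgn TYPE('k)) 4)) \<phi>"
    unfolding KE unfolding H_K_def H_M1_def H_sgn_def
    using two_type_decomposition_iso[OF D.coeff_decomposition_axioms] by blast
  have tensors: "\<exists>\<phi>. lin_iso (H_M1 TYPE('k) O3)
        (dir_sum (tensor_snd (H_K TYPE('k)) (K_chi chi1)) (tensor_snd (H_sgn TYPE('k)) (K_chi chi2))) \<phi> \<and>
      right_linear (carrier (H_K TYPE('k))) (H_M1 TYPE('k) O3)
        (dir_sum (tensor_snd (H_K TYPE('k)) (K_chi chi1)) (tensor_snd (H_sgn TYPE('k)) (K_chi chi2))) \<phi> \<and>
      equivariant SL2Z (H_M1 TYPE('k) O3)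
        (dir_sum (tensor_snd (H_K TYPE('k)) (K_chi chi1)) (tensor_snd (H_sgn TYPE('k)) (K_chi chi2))) \<phi> \<and>
      degree_preserving (H_M1 TYPE('k) O3)
        (dir_sum (tensor_snd (H_K TYPE('k)) (K_chi chi1)) (tensor_snd (H_sgn TYPE('k)) (K_chi chi2))) \<phi>"
    unfolding KE unfolding H_K_def H_M1_def H_sgn_def by (rule D.tensor_iso)
  show ?thesis
    by (intro conjI sum free tensor1 deg0 H0_O2_iso triv powers tensors)
qed

end
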